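(* Let $u\in\mathscr{M}(\mathbb{D}_1)\setminus\{0\}$, and suppose that $u$ is $2$-homogeneous. Then $u$ is of one of the following four types ($\mathrm{rot}$ denotes a rotation about the origin): (I) $u=s\,u^{\mathrm I}\circ\mathrm{rot}$, with $u^{\mathrm I}(x,y)=\frac{y_+^2}{2}$ and $s\in\{-1,+1\}$; (II) $u=s\,u^{\mathrm{II}}\circ\mathrm{rot}$, with $u^{\mathrm{II}}(re^{i\theta})=\frac{r^2}{4}\left(1-\cos(2\theta)-\frac{2}{t_1}\left(\theta-\frac{\sin(2\theta)}{2}\right)\right)\chi_{0\le\theta\le t_1}$ and $s\in\{-1,+1\}$; (III) $u=\lambda\,u^{\mathrm{III}}\circ\mathrm{rot}$, with $u^{\mathrm{III}}(x,y)=\frac{y^2}{2}$ and $|\lambda|\ge1$; (IV) $u(x,y)=a(x^2+y^2)+b(x^2-y^2)+2cxy$ for some $(a,b,c)\in\mathbb{R}^3$ such that $a^2\neq b^2+c^2$.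
   Context: $\mathbb{D}_1$ is the open unit disk of $\mathbb{R}^2$. $E(u;D)=\int_D(|\Delta u|^2+\chi_{u\neq0})$ for $u\in H^2(D)$, and $\mathscr{M}(D)$ is the set of $u\in H^2(D)$ such that $E(u;D)\le E(v;D)$ for every $v\in H^2(D)$ with $\{u\ne v\}$ compactly contained in $D$. $t_1\approx1.43\pi$ is the unique $t\in(\pi,2\pi)$ with $\tan t=t$; in (II), $\theta\in[0,2\pi)$. $u$ is $2$-homogeneous on $\mathbb{D}_1$ if $u(rx)=r^2u(x)$ for $x\in\mathbb{D}_1$, $r\in(0,1)$. *)

theory Defs
  imports "HOL-Analysis.Analysis"
begin

primrec Ck :: "nat \<Rightarrow> ('a::euclidean_space \<Rightarrow> real) \<Rightarrow> bool" where
  "Ck 0 f \<longleftrightarrow> continuous_on UNIV f"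
| "Ck (Suc k) f \<longleftrightarrow> (\<forall>x. f differentiable (at x)) \<and>
     (\<forall>b\<in>Basis. Ck k (\<lambda>x. frechet_derivative f (at x) b))"

definition test_functions :: "'a::euclidean_space set \<Rightarrow> ('a \<Rightarrow> real) set" where
  "test_functions D = {\<phi>. (\<forall>k. Ck k \<phi>) \<and> (\<exists>K. compact K \<and> K \<subseteq> D \<and> (\<forall>x. x \<notin> K \<longrightarrow> \<phi> x = 0))}"

definition locally_integrable :: "'a::euclidean_space set \<Rightarrow> ('a \<Rightarrow> real) \<Rightarrow> bool" where
  "locally_integrable D f \<longleftrightarrow> (\<forall>K. compact K \<and> K \<subseteq> D \<longrightarrow> f absolutely_integrable_on K)"

definition has_weak_pderiv ::
    "'a::euclidean_space set \<Rightarrow> 'a \<Rightarrow> ('a \<Rightarrow> real) \<Rightarrow> ('a \<Rightarrow> real) \<Rightarrow> bool" where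
  "has_weak_pderiv D b f g \<longleftrightarrow>
     locally_integrable D f \<and> locally_integrable D g \<and>
     (\<forall>\<phi>\<in>test_functions D.
        (LINT x:D|lebesgue. f x * frechet_derivative \<phi> (at x) b) = - (LINT x:D|lebesgue. g x * \<phi> x))"

text \<open>
  Elements of the Sobolev space are represented by functions, two of them being identified when
  they agree almost everywhere on the open set \<open>D\<close>; statements about them are accordingly read
  almost everywhere. In dimension two each class has a continuous representative, for which these
  readings agree with the pointwise ones. A weak derivative is determined only almost everywhere,
  hence the choice of a representative.
\<close>

definition weak_pderiv :: "'a::euclidean_space set \<Rightarrow> 'a \<Rightarrow> ('a \<Rightarrow> real) \<Rightarrow> 'a \<Rightarrow> real" where
  "weak_pderiv D b f = (SOME g. has_weak_pderiv D b f g)"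

definition weak_laplacian :: "'a::euclidean_space set \<Rightarrow> ('a \<Rightarrow> real) \<Rightarrow> 'a \<Rightarrow> real" where
  "weak_laplacian D f = (\<lambda>x. \<Sum>b\<in>Basis. weak_pderiv D b (weak_pderiv D b f) x)"

definition L2 :: "'a::euclidean_space set \<Rightarrow> ('a \<Rightarrow> real) set" where
  "L2 D = {f. f \<in> borel_measurable (lebesgue_on D) \<and> integrable (lebesgue_on D) (\<lambda>x. (f x)\<^sup>2)}"

definition H2 :: "'a::euclidean_space set \<Rightarrow> ('a \<Rightarrow> real) set" where
  "H2 D = {f \<in> L2 D. \<forall>b\<in>Basis. \<exists>g\<in>L2 D. has_weak_pderiv D b f g \<and>
             (\<forall>c\<in>Basis. \<exists>h\<in>L2 D. has_weak_pderiv D c g h)}"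

definition energy :: "('a::euclidean_space \<Rightarrow> real) \<Rightarrow> 'a set \<Rightarrow> ennreal" where
  "energy u D = (\<integral>\<^sup>+x\<in>D. ennreal ((weak_laplacian D u x)\<^sup>2 + indicator {x. u x \<noteq> 0} x) \<partial>lebesgue)"

definition minimizers :: "'a::euclidean_space set \<Rightarrow> ('a \<Rightarrow> real) set" where
  "minimizers D = {u \<in> H2 D. \<forall>v\<in>H2 D.
     (\<exists>K. compact K \<and> K \<subseteq> D \<and> (AE x in lebesgue_on D. u x \<noteq> v x \<longrightarrow> x \<in> K)) \<longrightarrow>
     energy u D \<le> energy v D}"

definition two_homogeneous :: "(real^2 \<Rightarrow> real) \<Rightarrow> bool" where
  "two_homogeneous u \<longleftrightarrow>
     (\<forall>r\<in>{0<..<1}. AE x in lebesgue_on (ball 0 1). u (r *\<^sub>R x) = r\<^sup>2 * u x)"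

definition t1 :: real where
  "t1 = (THE t. pi < t \<and> t < 2 * pi \<and> tan t = t)"

lemma t1_ex1: "\<exists>!t::real. pi < t \<and> t < 2 * pi \<and> tan t = t"
proof -
  define f :: "real \<Rightarrow> real" where "f t = sin t - t * cos t" for t
  have iff: "tan t = t \<longleftrightarrow> f t = 0" if "pi < t" for t
  proof (cases "cos t = 0")
    case True
    then have "sin t \<noteq> 0"
      using sin_cos_squared_add[of t] by auto
    moreover have "t \<noteq> 0"
      using that pi_gt_zero by linarith
    ultimately show ?thesis
      using True by (simp add: f_def tan_def)
  qed (auto simp: f_def tan_def field_simps)
  have der: "(f has_real_derivative t * sin t) (at t)" for t
    unfolding f_def by (auto intro!: derivative_eq_intros)
  have cont: "continuous_on {a..b} f" for a b
    unfolding f_def by (intro continuous_intros)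
  have decr: "f b < f a" if "pi < a" "a < b" "b < 2 * pi" for a b
  proof (rule DERIV_neg_imp_decreasing[OF \<open>a < b\<close>])
    fix x assume "a \<le> x" "x \<le> b"
    then have "sin x < 0" "0 < x"
      using that sin_lt_zero[of x] pi_gt_zero by auto
    then show "\<exists>y. (f has_real_derivative y) (at x) \<and> y < 0"
      using der mult_pos_neg by blast
  qed
  have "f pi = pi" "f (2 * pi) = - 2 * pi"
    by (auto simp: f_def)
  then obtain t where t: "pi \<le> t" "t \<le> 2 * pi" "f t = 0"
    using IVT2'[of f "2 * pi" 0 pi] cont by auto
  then have "t \<noteq> pi" "t \<noteq> 2 * pi"
    using \<open>f pi = pi\<close> \<open>f (2 * pi) = - 2 * pi\<close> pi_gt_zero by auto
  then have "pi < t \<and> t < 2 * pi \<and> tan t = t"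
    using t iff[of t] by auto
  moreover have "s = t" if "pi < s \<and> s < 2 * pi \<and> tan s = s" for s
    using that \<open>pi < t \<and> t < 2 * pi \<and> tan t = t\<close> iff[of s] iff[of t] decr[of s t] decr[of t s]
    by (cases s t rule: linorder_cases) auto
  ultimately show ?thesis
    by blast
qed

definition u_I :: "real^2 \<Rightarrow> real" where
  "u_I x = (max (x $ 2) 0)\<^sup>2 / 2"

definition u_II :: "real^2 \<Rightarrow> real" where
  "u_II x = (let r = norm x; \<theta> = Arg2pi (Complex (x $ 1) (x $ 2)) in
     r\<^sup>2 / 4 * (1 - cos (2 * \<theta>) - 2 / t1 * (\<theta> - sin (2 * \<theta>) / 2)) * indicator {0..t1} \<theta>)"

definition u_III :: "real^2 \<Rightarrow> real" where
  "u_III x = (x $ 2)\<^sup>2 / 2"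

end

(*
In the coordinates x = e^s (cos t, sin t) a 2-homogeneous u is e^(2s) f(t), and its Laplacian is the
function g = f'' + 4 f of the angle alone. Hence f is of class C^1, and its zeros with f' nonzero are
isolated. Where f is nonzero almost everywhere, variations with compact support cannot increase
the measure term, so g'' = 0.

If f and f' have no common zero, g is affine on every angular window of length 2 pi, hence constant by
periodicity: type IV. Otherwise the circle splits at the common zeros, and on an arc of length l
between two of them f = A/4 (1 - cos 2t) + B/8 (2t - sin 2t). The two conditions at t = l force l = pi
and B = 0, or tan l = l and 2A = - B l.

The competitors e^(2s) f(t q(s)) move an endpoint of the arc as a function of the radius; the first
variation of the energy is a positive multiple of l (1 - (A + B l)^2). Shrinking an arc is always
possible, which gives |A + B l| >= 1. If the rest of the circle lies in the zero set, the arc may also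
be stretched, and |A + B l| = 1: types I and II. The only other possibility is that two arcs of length
pi fill the circle; then f is nonzero almost everywhere, so g is affine across the common zero and
both arcs carry the same amplitude: type III.
*)
theory Submission imports Defs begin

section \<open>Smooth functions of one variable\<close>

text \<open>The obstacle is that \<open>u\<close> and its Laplacian are known only modulo null sets
  and through weak derivatives, while the argument speaks of values, arcs and their ends; so every
  identity is obtained by testing. The coordinate s = ln r turns dilations into translations and the
  Laplacian into e^(-2s) (d^2/ds^2 + d^2/dt^2), so that product test functions separate radius from
  angle, and integration by parts against e^(2s) yields the factor 4. Competitors are C^1 with
  Lipschitz first derivatives, because second derivatives jump at the ends of an arc. Their weak
  derivatives all rest on one fact: a directional derivative of a compactly supported Lipschitz
  function has integral zero. When an end of an arc moves, so does the region where the competitor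
  is nonzero; the substitution y = (t - a) q(s) carries it to a fixed rectangle, where the energy is
  differentiated under the integral. A competitor overwrites \<open>u\<close> on the angles that it
  newly covers, whence the asymmetry between stretching and shrinking. The number A + B l is the
  limit of the Laplacian at the moved end.\<close>

primrec Cn :: "nat \<Rightarrow> (real \<Rightarrow> real) \<Rightarrow> bool" where
  "Cn 0 f \<longleftrightarrow> True"
| "Cn (Suc n) f \<longleftrightarrow> (\<exists>f'. (\<forall>x. (f has_real_derivative f' x) (at x)) \<and> Cn n f')"

text \<open>No continuity is asked for in \<open>Cn\<close>: each derivative is itself
  differentiable at the next order. Asking for all orders separately keeps the closure properties
  plain inductions.\<close>

definition smooth1 :: "(real \<Rightarrow> real) \<Rightarrow> bool" where
  "smooth1 f \<longleftrightarrow> (\<forall>n. Cn n f)"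

lemma Cn_SucI: "(\<And>x. (f has_real_derivative f' x) (at x)) \<Longrightarrow> Cn n f' \<Longrightarrow> Cn (Suc n) f"
  by auto

lemma Cn_SucD: "Cn (Suc n) f \<Longrightarrow> Cn n f"
  by (induction n arbitrary: f) auto

text \<open>It suffices to exhibit a class of functions that differentiation does not leave; no
  formula for the n-th derivative is ever written down.\<close>

lemma smooth1_coinduct:
  assumes "f \<in> S" and "\<And>f. f \<in> S \<Longrightarrow> \<exists>f'\<in>S. \<forall>x. (f has_real_derivative f' x) (at x)"
  shows "smooth1 f"
proof -
  have "\<forall>f\<in>S. Cn n f" for n
    by (induction n) (use assms(2) in \<open>auto, blast\<close>)
  then show ?thesis
    using assms(1) by (auto simp: smooth1_def)
qed

lemma smooth1_deriv:
  assumes "smooth1 f"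
  shows "(f has_real_derivative deriv f x) (at x)" and "smooth1 (deriv f)"
proof -
  have ex: "\<exists>f'. (\<forall>x. (f has_real_derivative f' x) (at x)) \<and> Cn n f'" for n
    using assms unfolding smooth1_def by (metis Cn.simps(2))
  \<comment> \<open>The derivative provided by \<open>Cn (Suc n) f\<close> may depend on n;
    uniqueness of derivatives makes it the same function for every n.\<close>
  have eq: "f' = deriv f" if "\<forall>x. (f has_real_derivative f' x) (at x)" for f'
  proof (rule ext)
    fix x
    have "(f has_real_derivative f' x) (at x)" using that by blast
    then show "f' x = deriv f x" by (rule DERIV_imp_deriv[symmetric])
  qed
  show "(f has_real_derivative deriv f x) (at x)"
    using ex eq by blast
  show "smooth1 (deriv f)"
    using ex eq unfolding smooth1_def by blast
qed

lemma smooth1I: "(\<And>x. (f has_real_derivative f' x) (at x)) \<Longrightarrow> smooth1 f' \<Longrightarrow> smooth1 f"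
  unfolding smooth1_def using Cn_SucI Cn_SucD by metis

lemma smooth1_continuous: "smooth1 f \<Longrightarrow> continuous_on A f"
  using smooth1_deriv(1) DERIV_continuous_on has_field_derivative_at_within by blast

lemma smooth1_borel [measurable (raw)]: "smooth1 f \<Longrightarrow> f \<in> borel_measurable borel"
  by (intro borel_measurable_continuous_onI smooth1_continuous)

lemma Cn_add: "Cn n f \<Longrightarrow> Cn n g \<Longrightarrow> Cn n (\<lambda>x. f x + g x)"
proof (induction n arbitrary: f g)
  case (Suc n)
  then obtain f' g' where "\<forall>x. (f has_real_derivative f' x) (at x)" "Cn n f'"
      "\<forall>x. (g has_real_derivative g' x) (at x)" "Cn n g'" by auto
  with Suc.IH show ?case
    by (intro Cn_SucI[where f'="\<lambda>x. f' x + g' x"]) (auto intro!: derivative_eq_intros)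
qed auto

lemma Cn_mult: "Cn n f \<Longrightarrow> Cn n g \<Longrightarrow> Cn n (\<lambda>x. f x * g x)"
proof (induction n arbitrary: f g)
  case (Suc n)
  then obtain f' g' where "\<forall>x. (f has_real_derivative f' x) (at x)" "Cn n f'"
      "\<forall>x. (g has_real_derivative g' x) (at x)" "Cn n g'" by auto
  with Suc show ?case
    by (intro Cn_SucI[where f'="\<lambda>x. f' x * g x + f x * g' x"])
       (auto intro!: derivative_eq_intros Cn_add dest: Cn_SucD simp del: Cn.simps)
qed auto

lemma smooth1_add [intro]: "smooth1 f \<Longrightarrow> smooth1 g \<Longrightarrow> smooth1 (\<lambda>x. f x + g x)"
  and smooth1_mult [intro]: "smooth1 f \<Longrightarrow> smooth1 g \<Longrightarrow> smooth1 (\<lambda>x. f x * g x)"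
  by (auto simp: smooth1_def Cn_add Cn_mult)

lemma smooth1_const [intro, simp]: "smooth1 (\<lambda>x. c)"
  by (rule smooth1_coinduct[of _ "range (\<lambda>c x. c)"]) (auto intro!: exI[of _ 0])

lemma smooth1_ident [intro, simp]: "smooth1 (\<lambda>x. x)"
  by (rule smooth1I[where f'="\<lambda>_. 1"]) (auto intro!: derivative_eq_intros)

lemma smooth1_cmult [intro]: "smooth1 f \<Longrightarrow> smooth1 (\<lambda>x. c * f x)"
  by (intro smooth1_mult smooth1_const)

lemma smooth1_diff [intro]: "smooth1 f \<Longrightarrow> smooth1 g \<Longrightarrow> smooth1 (\<lambda>x. f x - g x)"
  using smooth1_add[of f "\<lambda>x. (-1) * g x"] smooth1_cmult[of g "-1"] by simp

lemma smooth1_affine: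
  assumes "smooth1 f" shows "smooth1 (\<lambda>x. f (c * x + d))"
\<comment> \<open>The scalar k collects the powers of c that the chain rule produces.\<close>
proof (rule smooth1_coinduct[of _ "{(\<lambda>x. k * g (c * x + d)) |k g. smooth1 g}"])
  show "(\<lambda>x. f (c * x + d)) \<in> {(\<lambda>x. k * g (c * x + d)) |k g. smooth1 g}"
    using assms by (auto intro!: exI[of _ 1] exI[of _ f])
next
  fix h assume "h \<in> {(\<lambda>x. k * g (c * x + d)) |k g. smooth1 g}"
  then obtain k g where h: "h = (\<lambda>x. k * g (c * x + d))" "smooth1 g" by auto
  have "(h has_real_derivative k * c * deriv g (c * x + d)) (at x)" for x
    unfolding h(1) by (rule derivative_eq_intros DERIV_chain2[OF smooth1_deriv(1)[OF h(2)]] refl | simp)+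
  then show "\<exists>f'\<in>{(\<lambda>x. k * g (c * x + d)) |k g. smooth1 g}. \<forall>x. (h has_real_derivative f' x) (at x)"
    using smooth1_deriv(2)[OF h(2)] by (intro bexI[of _ "\<lambda>x. k * c * deriv g (c * x + d)"]) auto
qed

lemma smooth1_sin [simp]: "smooth1 sin" and smooth1_cos [simp]: "smooth1 cos"
proof -
  have *: "smooth1 (\<lambda>x. a * sin x + b * cos x)" for a b :: real
  proof (rule smooth1_coinduct[of _ "{(\<lambda>x. a * sin x + b * cos x) |a b. True}"])
    fix f :: "real \<Rightarrow> real" assume "f \<in> {(\<lambda>x. a * sin x + b * cos x) |a b. True}"
    then obtain a b where f: "f = (\<lambda>x. a * sin x + b * cos x)" by auto
    show "\<exists>f'\<in>{(\<lambda>x. a * sin x + b * cos x) |a b. True}. \<forall>x. (f has_real_derivative f' x) (at x)"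
      unfolding f by (intro bexI[of _ "\<lambda>x. (- b) * sin x + a * cos x"] CollectI exI[of _ "- b"] exI[of _ a])
        (auto intro!: derivative_eq_intros)
  qed auto
  show "smooth1 sin" using *[of 1 0] by simp
  show "smooth1 cos" using *[of 0 1] by simp
qed

lemma smooth1_exp_cmult [simp]: "smooth1 (\<lambda>x. exp (c * x))"
proof -
  have "smooth1 exp"
    by (rule smooth1_coinduct[of _ "{exp}"]) (auto intro!: DERIV_exp)
  then show ?thesis using smooth1_affine[of exp c 0] by simp
qed

text \<open>The derivatives of the classical e^(-1/x), extended by zero, are linear combinations of
  these functions; the power m makes the family closed under differentiation.\<close>

definition flat :: "nat \<Rightarrow> real \<Rightarrow> real" where
  "flat m x = (if x > 0 then exp (- (1 / x)) / x ^ m else 0)"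

text \<open>A single term of the exponential series at 1/x, the one of order m + 2, beats the pole
  and leaves two powers of x. Quadratic decay gives derivative 0 at the origin.\<close>

lemma flat_bound: "\<bar>flat m x\<bar> \<le> fact (m + 2) * x\<^sup>2"
proof (cases "x > 0")
  case True
  have "(1 / x) ^ (m + 2) / fact (m + 2) \<le> exp (1 / x)"
  proof -
    have "(1 / x) ^ (m + 2) /\<^sub>R fact (m + 2) \<le> (\<Sum>n. (1 / x) ^ n /\<^sub>R fact n)"
      using True sum_le_suminf[OF summable_exp_generic[of "1 / x"], of "{m + 2}"] by auto
    then show ?thesis unfolding exp_def by (simp add: divide_inverse mult.commute)
  qed
  moreover obtain c :: real where c: "c = fact (m + 2)" by blast
  ultimately have le: "(1 / x) ^ (m + 2) / c \<le> exp (1 / x)" by simp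
  have "c > 0" by (simp add: c)
  with le have "1 \<le> exp (1 / x) * (c * x ^ (m + 2))"
    using True by (simp add: field_simps)
  then show ?thesis using True unfolding c[symmetric]
    by (simp add: flat_def exp_minus field_simps power2_eq_square)
qed (auto simp: flat_def)

lemma flat_deriv: "(flat m has_real_derivative flat (m + 2) x - real m * flat (m + 1) x) (at x)"
proof (cases "x = 0")
  case True
  have "((\<lambda>h. (flat m (0 + h) - flat m 0) / h) \<longlongrightarrow> 0) (at 0)"
  proof (rule Lim_null_comparison)
    show "\<forall>\<^sub>F h in at 0. norm ((flat m (0 + h) - flat m 0) / h) \<le> fact (m + 2) * \<bar>h\<bar>"
    proof (rule eventuallyI)
      fix h :: real
      show "norm ((flat m (0 + h) - flat m 0) / h) \<le> fact (m + 2) * \<bar>h\<bar>"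
        using flat_bound[of m h]
        by (cases "h = 0") (auto simp: flat_def[of m 0] divide_le_eq power2_eq_square abs_mult mult.assoc simp del: fact_Suc)
    qed
    show "((\<lambda>h::real. fact (m + 2) * \<bar>h\<bar>) \<longlongrightarrow> 0) (at 0)"
      by (auto intro!: tendsto_eq_intros)
  qed
  then show ?thesis
    unfolding DERIV_def True by (simp add: flat_def)
next
  case False
  then consider "x > 0" | "x < 0" by linarith
  then show ?thesis
  proof cases
    case 1
    have "((\<lambda>x. exp (- (1 / x)) / x ^ m) has_real_derivative flat (m + 2) x - real m * flat (m + 1) x) (at x)"
    proof -
      have "x ^ m = x * x ^ (m - Suc 0)" if "m \<noteq> 0"
        using that by (cases m) auto
      then show ?thesis using 1
        by (cases "m = 0") (auto intro!: derivative_eq_intros simp: flat_def field_simps power2_eq_square)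
    qed
    moreover have "\<forall>\<^sub>F y in nhds x. flat m y = exp (- (1 / y)) / y ^ m"
      using eventually_nhds_in_open[of "{0<..}" x] 1 by (auto elim!: eventually_mono simp: flat_def)
    ultimately show ?thesis by (subst DERIV_cong_ev[OF refl _ refl])
  next
    case 2
    have "((\<lambda>x. 0) has_real_derivative flat (m + 2) x - real m * flat (m + 1) x) (at x)"
      using 2 by (auto simp: flat_def)
    moreover have "\<forall>\<^sub>F y in nhds x. flat m y = 0"
      using eventually_nhds_in_open[of "{..<0}" x] 2 by (auto elim!: eventually_mono simp: flat_def)
    ultimately show ?thesis by (subst DERIV_cong_ev[OF refl _ refl])
  qed
qed

lemma smooth1_flat: "smooth1 (flat m)"
proof -
  have "Cn k (flat m)" for k
  proof (induction k arbitrary: m)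
    case (Suc k)
    have "Cn k (\<lambda>x. flat (m + 2) x + (- real m) * flat (m + 1) x)"
      using Suc smooth1_const[of "- real m"] by (intro Cn_add Cn_mult) (auto simp only: smooth1_def)
    then show ?case
      using flat_deriv[of m] by (intro Cn_SucI[of _ "\<lambda>x. flat (m + 2) x + (- real m) * flat (m + 1) x"]) auto
  qed auto
  then show ?thesis by (auto simp: smooth1_def)
qed

section \<open>Bump functions on an interval\<close>

definition bumps :: "real \<Rightarrow> real \<Rightarrow> (real \<Rightarrow> real) set" where
  "bumps a b = {\<zeta>. smooth1 \<zeta> \<and> (\<forall>x. x \<notin> {a..b} \<longrightarrow> \<zeta> x = 0)}"

text \<open>The parameter n steepens both flanks. The bumps stay between 0 and 1 and tend to the
  indicator of the open interval, so dominated convergence turns tests against bumps into integrals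
  over intervals. For n = 0 the function vanishes, hence the \<open>Suc n\<close> in
  \<open>bump_pos\<close>.\<close>

definition bump :: "nat \<Rightarrow> real \<Rightarrow> real \<Rightarrow> real \<Rightarrow> real" where
  "bump n a b x = flat 0 (real n * (x - a)) * flat 0 (real n * (b - x))"

lemma flat0_bounds: "0 \<le> flat 0 x" "flat 0 x \<le> 1"
  by (auto simp: flat_def)

lemma bump_bounds: "0 \<le> bump n a b x" "bump n a b x \<le> 1"
  using flat0_bounds by (auto simp: bump_def intro!: mult_le_one)

lemma bump_pos: "0 < bump (Suc n) a b x" if "a < x" "x < b"
  using that unfolding bump_def flat_def by (auto intro!: mult_pos_pos simp: zero_less_mult_iff)

lemma bump_zero: "x \<le> a \<or> b \<le> x \<Longrightarrow> bump n a b x = 0"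
  by (auto simp: bump_def flat_def zero_less_mult_iff)

lemma bump_in_bumps: "bump n a b \<in> bumps a b"
proof -
  have "smooth1 (\<lambda>x. flat 0 (real n * x + (- real n * a)) * flat 0 ((- real n) * x + real n * b))"
    by (intro smooth1_mult smooth1_affine smooth1_flat)
  then have "smooth1 (bump n a b)"
    by (rule back_subst[of smooth1]) (simp add: fun_eq_iff bump_def algebra_simps)
  then show ?thesis by (auto simp: bumps_def bump_zero)
qed

lemma flat0_lim: "(\<lambda>n. flat 0 (real n * x)) \<longlonglongrightarrow> (if x > 0 then 1 else 0)"
proof (cases "x > 0")
  case True
  have "(\<lambda>n. exp (- (1 / (real n * x)))) \<longlonglongrightarrow> exp (- 0)"
  proof (intro tendsto_intros)
    have "LIM n sequentially. x * real n :> at_top"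
      using True by (intro filterlim_tendsto_pos_mult_at_top[OF tendsto_const] filterlim_real_sequentially)
    then show "(\<lambda>n. 1 / (real n * x)) \<longlonglongrightarrow> 0"
      by (intro tendsto_divide_0[OF tendsto_const] filterlim_at_top_imp_at_infinity) (simp add: mult.commute)
  qed
  moreover have "\<forall>\<^sub>F n in sequentially. exp (- (1 / (real n * x))) = flat 0 (real n * x)"
    using eventually_gt_at_top[of 0] by eventually_elim (use True in \<open>auto simp: flat_def\<close>)
  ultimately show ?thesis using True by (auto intro: Lim_transform_eventually)
qed (auto simp: flat_def zero_less_mult_iff)

lemma bump_lim: "(\<lambda>n. bump n a b x) \<longlonglongrightarrow> indicator {a<..<b} x"
  using tendsto_mult[OF flat0_lim[of "x - a"] flat0_lim[of "b - x"]]
  by (auto simp: bump_def indicator_def)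

section \<open>Functions determined by their integrals\<close>

text \<open>The positive and the negative part of k are densities of two measures that agree on
  boxes. Boxes form an intersection-stable generator, so the measures agree, and densities are
  unique almost everywhere.\<close>

lemma AE_zero_if_box_integrals_zero:
  fixes k :: "'a::euclidean_space \<Rightarrow> real"
  assumes k: "integrable lborel k"
    and box: "\<And>a b. (LINT x|lborel. indicator (box a b) x * k x) = 0"
  shows "AE x in lborel. k x = 0"
proof -
  have km: "k \<in> borel_measurable lborel" using k by auto
  let ?p = "\<lambda>x. ennreal (k x)" and ?m = "\<lambda>x. ennreal (- k x)"
  let ?E = "range (\<lambda>(a, b). box a b::'a set)"
  have fin: "emeasure (density lborel (\<lambda>x. ennreal (f x))) A \<noteq> \<infinity>"
    if "integrable lborel f" "A \<in> sets borel" for f :: "'a \<Rightarrow> real" and A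
  proof -
    have "(\<integral>\<^sup>+ x. ennreal (f x) * indicator A x \<partial>lborel) \<le> (\<integral>\<^sup>+ x. ennreal (norm (f x)) \<partial>lborel)"
      by (intro nn_integral_mono) (auto simp: indicator_def intro: ennreal_leI)
    also have "\<dots> < \<infinity>" using that(1) by (simp add: integrable_iff_bounded)
    finally show ?thesis using that by (subst emeasure_density) auto
  qed
  have "density lborel ?p = density lborel ?m"
  proof (rule measure_eqI_generator_eq)
    show "Int_stable ?E"
      by (auto simp: Int_stable_def box_Int_box)
    show "?E \<subseteq> Pow UNIV" "sets (density lborel ?p) = sigma_sets UNIV ?E" "sets (density lborel ?m) = sigma_sets UNIV ?E"
      by (simp_all add: borel_eq_box)
    let ?A = "\<lambda>n::nat. box (- (real n *\<^sub>R One)) (real n *\<^sub>R One) :: 'a set"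
    show "range ?A \<subseteq> ?E" "(\<Union>i. ?A i) = UNIV"
      unfolding UN_box_eq_UNIV by auto
    show "emeasure (density lborel ?p) (?A i) \<noteq> \<infinity>" for i
      using fin[OF k] by auto
    fix X :: "'a set" assume "X \<in> ?E"
    then obtain a b where X: "X = box a b" by auto
    have i: "integrable lborel (\<lambda>x. indicator X x * k x)"
      using k by (simp add: X integrable_real_mult_indicator mult.commute)
    have ip: "integrable lborel (\<lambda>x. indicator X x * max 0 (k x))" "integrable lborel (\<lambda>x. indicator X x * max 0 (- k x))"
      by (rule Bochner_Integration.integrable_bound[OF k]; use km in \<open>auto simp: X indicator_def\<close>)+
    have "(LINT x|lborel. indicator X x * max 0 (k x)) - (LINT x|lborel. indicator X x * max 0 (- k x)) =
        (LINT x|lborel. indicator X x * max 0 (k x) - indicator X x * max 0 (- k x))"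
      using ip by simp
    also have "\<dots> = (LINT x|lborel. indicator X x * k x)"
      by (intro Bochner_Integration.integral_cong) (auto simp: max_def indicator_def)
    finally have eq: "(LINT x|lborel. indicator X x * max 0 (k x)) = (LINT x|lborel. indicator X x * max 0 (- k x))"
      using box by (simp add: X)
    have "emeasure (density lborel ?p) X = (\<integral>\<^sup>+ x. ennreal (indicator X x * max 0 (k x)) \<partial>lborel)"
      using km by (subst emeasure_density) (auto simp: X indicator_def max_def intro!: nn_integral_cong ennreal_neg)
    also have "\<dots> = ennreal (LINT x|lborel. indicator X x * max 0 (k x))"
      using ip by (intro nn_integral_eq_integral) auto
    also have "\<dots> = (\<integral>\<^sup>+ x. ennreal (indicator X x * max 0 (- k x)) \<partial>lborel)"
      unfolding eq using ip by (intro nn_integral_eq_integral[symmetric]) auto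
    also have "\<dots> = emeasure (density lborel ?m) X"
      using km by (subst emeasure_density) (auto simp: X indicator_def max_def intro!: nn_integral_cong ennreal_neg)
    finally show "emeasure (density lborel ?p) X = emeasure (density lborel ?m) X" .
  qed
  then have "AE x in lborel. ?p x = ?m x"
    by (rule sigma_finite_measure.density_unique[OF sigma_finite_lborel, rotated 2]) (use km in auto)
  then show ?thesis
  proof eventually_elim
    case (elim x)
    \<comment> \<open>Since \<open>ennreal\<close> truncates at 0, equality of the two values says
      only that k and -k vanish or stay positive together, which happens for k = 0 alone.\<close>
    then have "k x \<le> 0 \<longleftrightarrow> - k x \<le> 0" by (metis ennreal_eq_0_iff)
    then show ?case by linarith
  qed
qed

lemma AE_zero_if_box_integrals_zero_lebesgue:
  fixes k :: "'a::euclidean_space \<Rightarrow> real"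
  assumes k: "integrable lebesgue k"
    and box: "\<And>a b. (LINT x|lebesgue. indicator (box a b) x * k x) = 0"
  shows "AE x in lebesgue. k x = 0"
proof -
  obtain k' where k': "k' \<in> borel_measurable lborel" and ae: "AE x in lborel. k x = k' x"
    using completion_ex_borel_measurable_real[of k lborel] k by auto
  have ae': "AE x in lebesgue. k x = k' x" using ae by (rule AE_completion)
  have "integrable lebesgue k'"
    using k k' ae' by (subst integrable_cong_AE[of k' _ k]) (auto intro: measurable_completion)
  then have i: "integrable lborel k'" using k' by (simp add: integrable_completion)
  have "AE x in lborel. k' x = 0"
  proof (rule AE_zero_if_box_integrals_zero[OF i])
    fix a b :: 'a
    have "(LINT x|lborel. indicator (box a b) x * k' x) = (LINT x|lebesgue. indicator (box a b) x * k' x)"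
      using k' by (intro integral_completion[symmetric]) auto
    also have "\<dots> = (LINT x|lebesgue. indicator (box a b) x * k x)"
      using ae' k k' by (intro integral_cong_AE borel_measurable_times borel_measurable_indicator)
        (auto intro: measurable_completion)
    finally show "(LINT x|lborel. indicator (box a b) x * k' x) = 0" using box by simp
  qed
  then have "AE x in lebesgue. k' x = 0" by (rule AE_completion)
  with ae' show ?thesis by auto
qed

definition boxbump :: "nat \<Rightarrow> 'a::euclidean_space \<Rightarrow> 'a \<Rightarrow> 'a \<Rightarrow> real" where
  "boxbump n a b x = (\<Prod>i\<in>Basis. bump n (a \<bullet> i) (b \<bullet> i) (x \<bullet> i))"

lemma boxbump_bounds: "0 \<le> boxbump n a b x" "boxbump n a b x \<le> 1"
  unfolding boxbump_def by (auto intro!: prod_nonneg prod_le_1 bump_bounds)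

lemma boxbump_zero: "x \<notin> box a b \<Longrightarrow> boxbump n a b x = 0"
proof -
  assume "x \<notin> box a b"
  then obtain i where i: "i \<in> Basis" "x \<bullet> i \<le> a \<bullet> i \<or> b \<bullet> i \<le> x \<bullet> i"
    by (auto simp: box_def not_less)
  then have "bump n (a \<bullet> i) (b \<bullet> i) (x \<bullet> i) = 0" by (rule_tac bump_zero)
  with i(1) show "boxbump n a b x = 0"
    unfolding boxbump_def by (intro prod_zero) auto
qed

lemma boxbump_lim: "(\<lambda>n. boxbump n a b x) \<longlonglongrightarrow> indicator (box a b) x"
proof -
  have "(\<lambda>n. boxbump n a b x) \<longlonglongrightarrow> (\<Prod>i\<in>Basis. indicator {a \<bullet> i<..<b \<bullet> i} (x \<bullet> i))"
    unfolding boxbump_def by (intro tendsto_prod bump_lim)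
  also have "(\<Prod>i\<in>Basis. indicator {a \<bullet> i<..<b \<bullet> i} (x \<bullet> i)) = (indicator (box a b) x :: real)"
    by (auto simp: box_def indicator_def)
  finally show ?thesis .
qed

lemma boxbump_borel [measurable]: "boxbump n a b \<in> borel_measurable borel"
proof -
  have "bump n c d \<in> borel_measurable borel" for c d
    using bump_in_bumps[of n c d] smooth1_borel by (auto simp: bumps_def)
  then show ?thesis unfolding boxbump_def by measurable
qed

text \<open>Bumps over a box converge to its indicator and are dominated on the closed box, so k has
  integral zero over every box whose closure lies in D. Inside one such box the previous lemma
  applies, and countably many of them with rational corners cover D.\<close>

lemma fundamental_lemma:
  fixes k :: "'a::euclidean_space \<Rightarrow> real"
  assumes D: "open D" and loc: "\<And>a b. cbox a b \<subseteq> D \<Longrightarrow> k absolutely_integrable_on cbox a b"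
    and zero: "\<And>a b n. cbox a b \<subseteq> D \<Longrightarrow> (LINT x|lebesgue. k x * boxbump n a b x) = 0"
  shows "AE x in lebesgue. x \<in> D \<longrightarrow> k x = 0"
proof -
  have box0: "(LINT x|lebesgue. indicator (box a b) x * k x) = 0" if "cbox a b \<subseteq> D" for a b
  proof (rule LIMSEQ_unique)
    have i: "integrable lebesgue (\<lambda>x. indicator (cbox a b) x * k x)"
      using loc[OF that] by (simp add: set_integrable_def)
    then have km: "(\<lambda>x. indicator (cbox a b) x * k x) \<in> borel_measurable lebesgue" by auto
    have sub: "box a b \<subseteq> cbox a b" by (simp add: box_subset_cbox)
    have eq1: "(\<lambda>x. k x * boxbump n a b x) = (\<lambda>x. (indicator (cbox a b) x * k x) * boxbump n a b x)" for n
      using boxbump_zero[of _ a b n] sub by (fastforce simp: fun_eq_iff indicator_def)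
    have eq2: "(\<lambda>x. indicator (box a b) x * k x) = (\<lambda>x. (indicator (cbox a b) x * k x) * indicator (box a b) x)"
      using sub by (auto simp: fun_eq_iff indicator_def)
    have bm: "boxbump n a b \<in> borel_measurable lebesgue" for n
      by (rule measurable_completion) simp
    have im: "(\<lambda>x. indicator (box a b) x :: real) \<in> borel_measurable lebesgue"
      by (rule borel_measurable_indicator) simp
    show "(\<lambda>n. LINT x|lebesgue. k x * boxbump n a b x) \<longlonglongrightarrow> (LINT x|lebesgue. indicator (box a b) x * k x)"
    proof (rule integral_dominated_convergence)
      show "integrable lebesgue (\<lambda>x. norm (indicator (cbox a b) x * k x))" using i by simp
      show "(\<lambda>x. indicator (box a b) x * k x) \<in> borel_measurable lebesgue"
        unfolding eq2 by (rule borel_measurable_times[OF km im])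
      show "(\<lambda>x. k x * boxbump n a b x) \<in> borel_measurable lebesgue" for n
        unfolding eq1 by (rule borel_measurable_times[OF km bm])
      show "AE x in lebesgue. (\<lambda>n. k x * boxbump n a b x) \<longlonglongrightarrow> indicator (box a b) x * k x"
        using tendsto_mult[OF boxbump_lim tendsto_const, of a b] by (intro AE_I2) (simp add: mult.commute[of "k _"])
      show "AE x in lebesgue. norm (k x * boxbump n a b x) \<le> norm (indicator (cbox a b) x * k x)" for n
      proof (rule AE_I2)
        fix x show "norm (k x * boxbump n a b x) \<le> norm (indicator (cbox a b) x * k x)"
        proof (cases "x \<in> cbox a b")
          case False
          then have "x \<notin> box a b" using sub by blast
          then show ?thesis by (simp add: boxbump_zero)
        qed (use boxbump_bounds[of n a b x] in \<open>auto simp: abs_mult mult_left_le\<close>)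
      qed
    qed
    show "(\<lambda>n. LINT x|lebesgue. k x * boxbump n a b x) \<longlonglongrightarrow> 0" using zero[OF that] by simp
  qed
  have loc0: "AE x in lebesgue. x \<in> box c d \<longrightarrow> k x = 0" if cd: "cbox c d \<subseteq> D" for c d
  proof -
    have sub: "box c d \<subseteq> cbox c d" by (simp add: box_subset_cbox)
    have "k absolutely_integrable_on box c d"
      using set_integrable_subset[OF loc[OF cd] _ sub] by simp
    then have i: "integrable lebesgue (\<lambda>x. indicator (box c d) x * k x)"
      by (simp add: set_integrable_def)
    have "AE x in lebesgue. indicator (box c d) x * k x = 0"
    proof (rule AE_zero_if_box_integrals_zero_lebesgue[OF i])
      fix a b
      \<comment> \<open>The intersection of two boxes is a box again, and its closed version still
        lies in D, so \<open>box0\<close> covers it.\<close>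
      let ?a = "\<Sum>i\<in>Basis. max (a \<bullet> i) (c \<bullet> i) *\<^sub>R i" and ?b = "\<Sum>i\<in>Basis. min (b \<bullet> i) (d \<bullet> i) *\<^sub>R i"
      have bx: "box a b \<inter> box c d = box ?a ?b" "cbox a b \<inter> cbox c d = cbox ?a ?b"
        by (auto simp: box_def cbox_def)
      have "(LINT x|lebesgue. indicator (box a b) x * (indicator (box c d) x * k x)) = (LINT x|lebesgue. indicator (box ?a ?b) x * k x)"
        unfolding bx(1)[symmetric] by (simp add: indicator_inter_arith mult.assoc)
      also have "\<dots> = 0" using cd bx(2) by (intro box0) auto
      finally show "(LINT x|lebesgue. indicator (box a b) x * (indicator (box c d) x * k x)) = 0" .
    qed
    then show ?thesis by eventually_elim (auto simp: indicator_def)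
  qed
  have "\<exists>I. countable I \<and> (\<forall>(a,b)\<in>I. cbox a b \<subseteq> D) \<and> D \<subseteq> (\<Union>(a,b)\<in>I. box a b)"
  proof -
    let ?f = "\<lambda>(f :: 'a \<Rightarrow> real \<times> real). ((\<Sum>i\<in>Basis. fst (f i) *\<^sub>R i) :: 'a, (\<Sum>i\<in>Basis. snd (f i) *\<^sub>R i) :: 'a)"
    let ?I = "{p \<in> ?f ` (Basis \<rightarrow>\<^sub>E \<rat> \<times> \<rat>). case p of (a,b) \<Rightarrow> cbox a b \<subseteq> D}"
    have "countable (?f ` (Basis \<rightarrow>\<^sub>E \<rat> \<times> \<rat>))"
      by (intro countable_image countable_PiE) (auto simp: countable_rat)
    then have cI: "countable ?I" by (rule countable_subset[rotated]) auto
    have cov: "x \<in> (\<Union>(a,b)\<in>?I. box a b)" if "x \<in> D" for x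
    proof -
      obtain e where "e > 0" "ball x e \<subseteq> D" using D \<open>x \<in> D\<close> openE by blast
      \<comment> \<open>Half the radius leaves room for the closure of the box inside D.\<close>
      then obtain a b where ab: "\<forall>i\<in>Basis. a \<bullet> i \<in> \<rat> \<and> b \<bullet> i \<in> \<rat>" "x \<in> box a b" "box a b \<subseteq> ball x (e / 2)"
        using rational_boxes[of "e / 2" x] by auto
      have "cbox a b = closure (box a b)" using ab(2) by (subst closure_box) auto
      also have "\<dots> \<subseteq> cball x (e / 2)" using closure_mono[OF ab(3)] \<open>e > 0\<close> by simp
      also have "\<dots> \<subseteq> ball x e" using \<open>e > 0\<close> by auto
      finally have cb: "cbox a b \<subseteq> D" using \<open>ball x e \<subseteq> D\<close> by blast
      have "(a, b) \<in> ?f ` (Basis \<rightarrow>\<^sub>E \<rat> \<times> \<rat>)"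
        using ab(1) by (intro image_eqI[of _ _ "\<lambda>i\<in>Basis. (a \<bullet> i, b \<bullet> i)"]) (auto simp: euclidean_representation)
      then show ?thesis using ab(2) cb by blast
    qed
    have "D \<subseteq> (\<Union>(a,b)\<in>?I. box a b)" using cov by blast
    with cI show ?thesis by (intro exI[of _ ?I]) auto
  qed
  then obtain I where I: "countable I" "\<forall>(a,b)\<in>I. cbox a b \<subseteq> D" "D \<subseteq> (\<Union>(a,b)\<in>I. box a b)" by blast
  have "AE x in lebesgue. \<forall>p\<in>I. (case p of (a,b) \<Rightarrow> x \<in> box a b \<longrightarrow> k x = 0)"
    unfolding AE_ball_countable[OF I(1)]
  proof
    fix p assume "p \<in> I"
    with I(2) show "AE x in lebesgue. (case p of (a,b) \<Rightarrow> x \<in> box a b \<longrightarrow> k x = 0)"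
      using loc0[of "fst p" "snd p"] by (auto simp: case_prod_beta)
  qed
  then show ?thesis by eventually_elim (use I(3) in blast)
qed

section \<open>Weak derivatives of Lipschitz functions\<close>

lemma integral_translation:
  fixes f :: "'a::euclidean_space \<Rightarrow> real"
  assumes "f \<in> borel_measurable borel"
  shows "(LINT x|lborel. f (x + c)) = (LINT x|lborel. f x)"
proof -
  have "(LINT x|lborel. f x) = (LINT x|distr lborel borel ((+) c). f x)" by (simp add: lborel_distr_plus)
  also have "\<dots> = (LINT x|lborel. f (c + x))" using assms by (subst integral_distr) auto
  finally show ?thesis by (simp add: add.commute)
qed

lemma integrable_cball_lborel: "integrable lborel (indicator (cball c r) :: 'a::euclidean_space \<Rightarrow> real)"
  using emeasure_lborel_cball_finite[of c r] by (intro integrable_real_indicator) auto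

lemma integrable_cball_lebesgue: "integrable lebesgue (indicator (cball c r) :: 'a::euclidean_space \<Rightarrow> real)"
  using integrable_cball_lborel[of c r] by (subst integrable_completion) auto

text \<open>The regularity shared by test functions, by competitors and by the first derivatives of
  competitors. Differentiability almost everywhere is supplied separately in each application,
  together with the derivative.\<close>

locale lipschitz_cpt =
  fixes w :: "'a::euclidean_space \<Rightarrow> real" and L R :: real
  assumes lip: "\<And>x y. \<bar>w x - w y\<bar> \<le> L * dist x y"
    and supp: "\<And>x. norm x > R \<Longrightarrow> w x = 0"
begin

lemma L_nonneg: "0 \<le> L"
proof -
  obtain b :: 'a where "b \<in> Basis" by fastforce
  then have "dist b 0 > 0" by auto
  then show ?thesis using lip[of b 0] by (metis abs_ge_zero order_trans zero_le_mult_iff not_le)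
qed

lemma cont: "continuous_on A w"
proof (rule continuous_on_subset[OF _ subset_UNIV])
  have "L-lipschitz_on UNIV w"
    using lip L_nonneg by (auto simp: lipschitz_on_def dist_real_def)
  then show "continuous_on UNIV w" by (rule lipschitz_on_continuous_on)
qed

lemma borel [measurable]: "w \<in> borel_measurable borel"
  by (intro borel_measurable_continuous_onI cont)

lemma bounded_ex: "\<exists>B. \<forall>x. \<bar>w x\<bar> \<le> B"
proof -
  have "compact (w ` cball 0 R)" by (intro compact_continuous_image cont compact_cball)
  then obtain B where B: "\<forall>y\<in>w ` cball 0 R. norm y \<le> B" using compact_imp_bounded bounded_iff by metis
  then have "\<bar>w x\<bar> \<le> max B 0" for x
    using supp[of x] by (cases "norm x > R") (auto simp: max.coboundedI1)
  then show ?thesis by blast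
qed

text \<open>Difference quotients of w integrate to zero by translation invariance and are bounded by
  L |b| on a fixed ball, so dominated convergence passes to the limit. Measurability of g and its
  bound are inherited from the quotients as well.\<close>

lemma integral_derivative_zero:
  assumes der: "AE x in lborel. ((\<lambda>t. w (x + t *\<^sub>R b)) has_real_derivative g x) (at 0)"
  shows "integrable lebesgue g" "(LINT x|lebesgue. g x) = 0"
    "AE x in lebesgue. \<bar>g x\<bar> \<le> (L * norm b) * indicator (cball 0 (R + norm b)) x"
proof -
  define h where "h n = 1 / real (Suc n)" for n
  define q where "q n x = (w (x + h n *\<^sub>R b) - w x) / h n" for n x
  have h: "h n > 0" "h n \<le> 1" for n by (auto simp: h_def)
  have h0: "h \<longlonglongrightarrow> 0" unfolding h_def by (rule LIMSEQ_Suc[OF lim_1_over_n])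
  have qm [measurable]: "q n \<in> borel_measurable borel" for n unfolding q_def by measurable
  have lim: "AE x in lebesgue. (\<lambda>n. q n x) \<longlonglongrightarrow> g x"
  proof (rule AE_completion, use der in eventually_elim)
    case (elim x)
    have "filterlim h (at 0) sequentially"
      using h0 h by (auto simp: filterlim_at less_le)
    with elim[unfolded DERIV_def] show ?case
      unfolding q_def by (auto dest: filterlim_compose)
  qed
  have "(\<lambda>x. lim (\<lambda>n. q n x)) \<in> borel_measurable lebesgue"
    by (intro measurable_completion) (simp add: borel_measurable_lim_metric)
  moreover have "AE x in lebesgue. lim (\<lambda>n. q n x) = g x"
    using lim by eventually_elim (auto intro: limI)
  ultimately have gm: "g \<in> borel_measurable lebesgue" by (rule borel_measurable_AE)
  let ?B = "\<lambda>x. (L * norm b) * indicator (cball 0 (R + norm b)) x :: real"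
  have qb: "\<bar>q n x\<bar> \<le> ?B x" for n x
  proof (cases "norm x \<le> R + norm b")
    case True
    have "\<bar>w (x + h n *\<^sub>R b) - w x\<bar> \<le> L * (h n * norm b)"
      using lip[of "x + h n *\<^sub>R b" x] h[of n] by (simp add: dist_norm)
    then show ?thesis using True h[of n] by (simp add: q_def divide_le_eq mult_ac)
  next
    case False
    have "norm (h n *\<^sub>R b) \<le> norm b" using h[of n] by (simp add: mult_left_le_one_le)
    moreover have "norm x - norm (h n *\<^sub>R b) \<le> norm (x + h n *\<^sub>R b)" by (rule norm_diff_ineq)
    moreover have "norm x > R + norm b" "norm b \<ge> 0" using False by auto
    ultimately have "norm (x + h n *\<^sub>R b) > R" "norm x > R" by linarith+
    then show ?thesis using False by (simp add: q_def supp)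
  qed
  have Bi: "integrable lebesgue ?B"
    by (intro integrable_mult_right integrable_cball_lebesgue)
  have conv: "(\<lambda>n. LINT x|lebesgue. q n x) \<longlonglongrightarrow> (LINT x|lebesgue. g x)" "integrable lebesgue g"
    using qb by (auto intro!: integral_dominated_convergence[OF gm _ Bi lim] integrable_dominated_convergence[OF gm _ Bi lim] measurable_completion)
  have wi: "integrable lborel w"
  proof -
    obtain B where B: "\<And>x. \<bar>w x\<bar> \<le> B" using bounded_ex by blast
    have "integrable lborel (\<lambda>x. B * indicator (cball 0 R) x)"
      by (intro integrable_mult_right integrable_cball_lborel)
    then show ?thesis
      by (rule Bochner_Integration.integrable_bound) (auto simp: indicator_def supp B[THEN order_trans, OF abs_ge_self])
  qed
  have "(LINT x|lebesgue. q n x) = 0" for n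
  proof -
    have i2: "integrable lborel (\<lambda>x. w (x + c))" for c
    proof -
      have "integrable (distr lborel borel ((+) c)) w" using wi by (simp add: lborel_distr_plus)
      then have "integrable lborel (\<lambda>x. w (c + x))" by (subst (asm) integrable_distr_eq) auto
      then show ?thesis by (simp add: add.commute)
    qed
    have "(LINT x|lebesgue. q n x) = (LINT x|lborel. q n x)" by (rule integral_completion) simp
    also have "\<dots> = 0" unfolding q_def using wi i2 by (simp add: integral_translation)
    finally show ?thesis .
  qed
  with conv(1) show "(LINT x|lebesgue. g x) = 0" by (simp add: LIMSEQ_const_iff)
  show "integrable lebesgue g" by (rule conv(2))
  show "AE x in lebesgue. \<bar>g x\<bar> \<le> ?B x"
    using lim
  proof eventually_elim
    case (elim x)
    then have "(\<lambda>n. \<bar>q n x\<bar>) \<longlonglongrightarrow> \<bar>g x\<bar>" by (rule tendsto_rabs)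
    then show ?case using qb by (intro LIMSEQ_le_const2) auto
  qed
qed

end

section \<open>Test functions\<close>

text \<open>The counterpart of \<open>smooth1_coinduct\<close> for several variables.\<close>

lemma Ck_closed_class:
  assumes S: "\<And>f. f \<in> S \<Longrightarrow> (\<forall>x. f differentiable (at x)) \<and> (\<forall>b\<in>Basis. (\<lambda>x. frechet_derivative f (at x) b) \<in> S)"
    and "f \<in> S"
  shows "Ck k f"
  using \<open>f \<in> S\<close>
proof (induction k arbitrary: f)
  case 0
  then show ?case using S[of f]
    by (auto intro!: continuous_at_imp_continuous_on differentiable_imp_continuous_within)
qed (use S in auto)

lemma Ck_borel: "Ck 0 f \<Longrightarrow> f \<in> borel_measurable borel"
  by (simp add: borel_measurable_continuous_onI)

lemma frechet_derivative_eq: "(f has_derivative f') (at x) \<Longrightarrow> frechet_derivative f (at x) v = f' v"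
  by (simp add: frechet_derivative_at[symmetric])

text \<open>Products of smooth one-variable factors form a class closed under partial
  derivatives.\<close>

lemma boxbump_test:
  assumes "cbox a b \<subseteq> D" shows "boxbump n a b \<in> test_functions D"
proof -
  let ?P = "\<lambda>s x. \<Prod>i\<in>Basis. s i (x \<bullet> i) :: real"
  let ?S = "{?P s |s. \<forall>i\<in>Basis. smooth1 (s i)} :: ('a \<Rightarrow> real) set"
  have der: "(?P s has_derivative (\<lambda>v. \<Sum>i\<in>Basis. (deriv (s i) (x \<bullet> i) * (v \<bullet> i)) * (\<Prod>j\<in>Basis - {i}. s j (x \<bullet> j)))) (at x)"
    if "\<forall>i\<in>Basis. smooth1 (s i)" for s and x :: 'a
  proof (rule has_derivative_prod)
    fix i :: 'a assume "i \<in> Basis"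
    then have "(s i has_real_derivative deriv (s i) (x \<bullet> i)) (at (x \<bullet> i))"
      using that smooth1_deriv(1) by blast
    then have "(s i has_derivative (\<lambda>h. deriv (s i) (x \<bullet> i) * h)) (at (x \<bullet> i))"
      by (simp add: has_field_derivative_def)
    moreover have "((\<lambda>x. x \<bullet> i) has_derivative (\<lambda>v. v \<bullet> i)) (at x)"
      by (auto intro!: derivative_eq_intros)
    ultimately show "((\<lambda>x. s i (x \<bullet> i)) has_derivative (\<lambda>v. deriv (s i) (x \<bullet> i) * (v \<bullet> i))) (at x)"
      using has_derivative_compose by fastforce
  qed
  have "Ck k (boxbump n a b)" for k
  proof (rule Ck_closed_class[of ?S])
    show "boxbump n a b \<in> ?S"
      using bump_in_bumps[of n] unfolding boxbump_def[abs_def] bumps_def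
      by (intro CollectI exI[of _ "\<lambda>i. bump n (a \<bullet> i) (b \<bullet> i)"]) auto
    fix f assume "f \<in> ?S"
    then obtain s where f: "f = ?P s" and s: "\<forall>i\<in>Basis. smooth1 (s i)" by auto
    \<comment> \<open>A partial derivative in direction c affects only the factor belonging to
      c.\<close>
    have fr: "frechet_derivative f (at x) c = ?P (s(c := deriv (s c))) x" if c: "c \<in> Basis" for x c
    proof -
      have "frechet_derivative f (at x) c = (\<Sum>i\<in>Basis. (deriv (s i) (x \<bullet> i) * (c \<bullet> i)) * (\<Prod>j\<in>Basis - {i}. s j (x \<bullet> j)))"
        unfolding f by (rule frechet_derivative_eq[OF der[OF s]])
      also have "\<dots> = (\<Sum>i\<in>Basis. if i = c then deriv (s c) (x \<bullet> c) * (\<Prod>j\<in>Basis - {c}. s j (x \<bullet> j)) else 0)"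
        using c by (intro sum.cong) (auto simp: inner_Basis)
      also have "\<dots> = deriv (s c) (x \<bullet> c) * (\<Prod>j\<in>Basis - {c}. s j (x \<bullet> j))" using c by simp
      also have "\<dots> = ?P (s(c := deriv (s c))) x"
        using c by (subst (2) prod.remove[of _ c]) auto
      finally show ?thesis .
    qed
    show "(\<forall>x. f differentiable at x) \<and> (\<forall>b\<in>Basis. (\<lambda>x. frechet_derivative f (at x) b) \<in> ?S)"
    proof (intro conjI allI ballI)
      show "f differentiable at x" for x unfolding f using der[OF s] by (rule differentiableI)
      fix c :: 'a assume c: "c \<in> Basis"
      have "(\<lambda>x. frechet_derivative f (at x) c) = ?P (s(c := deriv (s c)))" using fr[OF c] by auto
      moreover have "\<forall>i\<in>Basis. smooth1 ((s(c := deriv (s c))) i)" using s c smooth1_deriv(2) by auto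
      ultimately show "(\<lambda>x. frechet_derivative f (at x) c) \<in> ?S" by blast
    qed
  qed
  moreover have "\<forall>x. x \<notin> cbox a b \<longrightarrow> boxbump n a b x = 0"
    using boxbump_zero box_subset_cbox by blast
  ultimately show ?thesis using assms unfolding test_functions_def by (auto intro!: exI[of _ "cbox a b"])
qed

lemma test_functionsE:
  assumes "\<phi> \<in> test_functions D"
  obtains K where "compact K" "K \<subseteq> D" "\<And>x. x \<notin> K \<Longrightarrow> \<phi> x = 0" "\<And>k. Ck k \<phi>"
  using assms by (auto simp: test_functions_def)

lemma test_derivative:
  assumes "\<phi> \<in> test_functions D" "b \<in> Basis"
  shows "(\<lambda>x. frechet_derivative \<phi> (at x) b) \<in> test_functions D"
proof -
  obtain K where K: "compact K" "K \<subseteq> D" "\<And>x. x \<notin> K \<Longrightarrow> \<phi> x = 0" "\<And>k. Ck k \<phi>"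
    using assms(1) by (rule test_functionsE) blast
  have "frechet_derivative \<phi> (at x) b = 0" if "x \<notin> K" for x
  proof -
    have "(\<phi> has_derivative (\<lambda>_. 0)) (at x)"
      using K(1) that by (intro has_derivative_transform_within_open[OF has_derivative_const, of "- K" x 0])
        (auto simp: K(3) compact_imp_closed open_Compl)
    then show ?thesis by (simp add: frechet_derivative_eq)
  qed
  moreover have "Ck k (\<lambda>x. frechet_derivative \<phi> (at x) b)" for k using K(4)[of "Suc k"] assms(2) by auto
  ultimately show ?thesis using K(1,2) unfolding test_functions_def by (auto intro!: exI[of _ K])
qed

lemma test_borel: "\<phi> \<in> test_functions D \<Longrightarrow> \<phi> \<in> borel_measurable borel"
  using Ck_borel by (auto simp: test_functions_def simp del: Ck.simps)

lemma test_has_derivative: "\<phi> \<in> test_functions D \<Longrightarrow> (\<phi> has_derivative frechet_derivative \<phi> (at x)) (at x)"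
proof -
  assume "\<phi> \<in> test_functions D"
  then have "Ck (Suc 0) \<phi>" by (auto simp: test_functions_def simp del: Ck.simps)
  then show ?thesis using frechet_derivative_works by auto
qed

lemma test_bounded:
  assumes "\<phi> \<in> test_functions D" obtains B where "B \<ge> 0" "\<And>x. \<bar>\<phi> x\<bar> \<le> B"
proof -
  obtain K where K: "compact K" "\<And>x. x \<notin> K \<Longrightarrow> \<phi> x = 0" "\<And>k. Ck k \<phi>"
    using assms by (rule test_functionsE) blast
  have "continuous_on K \<phi>" using K(3)[of 0] continuous_on_subset by auto
  then have "bounded (\<phi> ` K)" using K(1) compact_continuous_image compact_imp_bounded by blast
  then obtain B where "\<forall>x\<in>K. \<bar>\<phi> x\<bar> \<le> B" by (auto simp: bounded_iff)
  then have "\<bar>\<phi> x\<bar> \<le> max 0 B" for x using K(2)[of x] by (cases "x \<in> K") (auto simp: max.coboundedI2)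
  then show ?thesis using that[of "max 0 B"] by auto
qed

lemma test_lipschitz:
  fixes \<phi> :: "'a::euclidean_space \<Rightarrow> real"
  assumes "\<phi> \<in> test_functions D" obtains L R where "lipschitz_cpt \<phi> L R"
proof -
  obtain K where K: "compact K" "\<And>x. x \<notin> K \<Longrightarrow> \<phi> x = 0"
    using assms by (rule test_functionsE) blast
  then obtain R where R: "\<forall>x\<in>K. norm x \<le> R" using compact_imp_bounded bounded_iff by metis
  have "\<exists>B. \<forall>x. \<bar>frechet_derivative \<phi> (at x) b\<bar> \<le> B" if "b \<in> Basis" for b
    using test_bounded[OF test_derivative[OF assms that]] by metis
  then obtain B where B: "\<And>b x. b \<in> Basis \<Longrightarrow> \<bar>frechet_derivative \<phi> (at x) b\<bar> \<le> B b" by metis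
  define L where "L = (\<Sum>b\<in>(Basis::'a set). B b)"
  have on: "onorm (frechet_derivative \<phi> (at x)) \<le> L" for x
  proof (rule onorm_le)
    fix v
    have lin: "linear (frechet_derivative \<phi> (at x))"
      using test_has_derivative[OF assms] has_derivative_linear by blast
    have "frechet_derivative \<phi> (at x) v = frechet_derivative \<phi> (at x) (\<Sum>b\<in>Basis. (v \<bullet> b) *\<^sub>R b)"
      by (simp add: euclidean_representation)
    also have "\<dots> = (\<Sum>b\<in>Basis. (v \<bullet> b) * frechet_derivative \<phi> (at x) b)"
      by (simp add: linear_sum[OF lin] linear_cmul[OF lin])
    finally have "norm (frechet_derivative \<phi> (at x) v) \<le> (\<Sum>b\<in>Basis. \<bar>(v \<bullet> b) * frechet_derivative \<phi> (at x) b\<bar>)"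
      by (metis real_norm_def sum_abs)
    also have "\<dots> \<le> (\<Sum>b\<in>Basis. norm v * B b)"
      unfolding abs_mult by (intro sum_mono mult_mono Basis_le_norm B) auto
    finally show "norm (frechet_derivative \<phi> (at x) v) \<le> L * norm v"
      by (simp add: L_def sum_distrib_left mult.commute)
  qed
  have "lipschitz_cpt \<phi> L R"
  proof
    show "\<bar>\<phi> x - \<phi> y\<bar> \<le> L * dist x y" for x y
      using differentiable_bound[OF convex_UNIV test_has_derivative[OF assms] on, of x y] by (simp add: dist_norm)
    show "\<phi> x = 0" if "norm x > R" for x
      using that R K(2)[of x] by force
  qed
  then show ?thesis by (rule that)
qed

lemma directional_derivative:
  fixes f :: "'a::euclidean_space \<Rightarrow> real"
  assumes "(f has_derivative f') (at x)"
  shows "((\<lambda>t. f (x + t *\<^sub>R b)) has_real_derivative f' b) (at 0)"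
proof -
  have "((\<lambda>t. x + t *\<^sub>R b) has_derivative (\<lambda>t. t *\<^sub>R b)) (at 0)" by (auto intro!: derivative_eq_intros)
  then have "((\<lambda>t. f (x + t *\<^sub>R b)) has_derivative (\<lambda>t. f' (t *\<^sub>R b))) (at 0)"
    using assms by (intro has_derivative_compose[of _ _ 0 UNIV f f']) auto
  moreover have "f' (t *\<^sub>R b) = f' b * t" for t
    using linear_cmul[OF has_derivative_linear[OF assms]] by simp
  ultimately show ?thesis by (simp add: has_field_derivative_def)
qed

lemma locally_integrable_times:
  assumes f: "locally_integrable D f" and K: "compact K" "K \<subseteq> D" "\<And>x. x \<notin> K \<Longrightarrow> \<psi> x = 0"
    and \<psi>: "\<psi> \<in> borel_measurable borel" "\<And>x. \<bar>\<psi> x\<bar> \<le> B"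
  shows "integrable lebesgue (\<lambda>x. f x * \<psi> x)" "integrable lebesgue (\<lambda>x. indicator D x * (f x * \<psi> x))"
proof -
  have i: "integrable lebesgue (\<lambda>x. indicator K x * f x)"
    using f K by (auto simp: locally_integrable_def set_integrable_def)
  have "\<psi> \<in> borel_measurable lebesgue" by (rule measurable_completion) (simp add: \<psi>)
  moreover have "norm (\<psi> x * (indicator K x * f x)) \<le> norm (B * (indicator K x * f x))" for x
    using \<psi>(2)[of x] unfolding norm_mult by (intro mult_right_mono) auto
  ultimately have "integrable lebesgue (\<lambda>x. \<psi> x * (indicator K x * f x))"
    using i by (intro Bochner_Integration.integrable_bound[OF integrable_mult_right[OF i, of B]]) auto
  moreover have "(\<lambda>x. \<psi> x * (indicator K x * f x)) = (\<lambda>x. f x * \<psi> x)"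
    using K(3) by (auto simp: fun_eq_iff indicator_def)
  moreover have "(\<lambda>x. indicator D x * (f x * \<psi> x)) = (\<lambda>x. f x * \<psi> x)"
    using K(2,3) by (fastforce simp: fun_eq_iff indicator_def)
  ultimately show "integrable lebesgue (\<lambda>x. f x * \<psi> x)" "integrable lebesgue (\<lambda>x. indicator D x * (f x * \<psi> x))"
    by auto
qed

lemma locally_integrable_test:
  assumes "locally_integrable D f" "\<phi> \<in> test_functions D"
  shows "integrable lebesgue (\<lambda>x. f x * \<phi> x)" "integrable lebesgue (\<lambda>x. indicator D x * (f x * \<phi> x))"
proof -
  obtain K where K: "compact K" "K \<subseteq> D" "\<And>x. x \<notin> K \<Longrightarrow> \<phi> x = 0"
    using assms(2) by (rule test_functionsE) blast
  obtain B where B: "\<And>x. \<bar>\<phi> x\<bar> \<le> B" using assms(2) test_bounded by blast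
  show "integrable lebesgue (\<lambda>x. f x * \<phi> x)" "integrable lebesgue (\<lambda>x. indicator D x * (f x * \<phi> x))"
    using locally_integrable_times[OF assms(1) K test_borel[OF assms(2)] B] by auto
qed

lemma integrable_imp_locally_integrable:
  assumes "integrable lebesgue f" shows "locally_integrable D f"
  unfolding locally_integrable_def
  using assms by (auto simp: set_integrable_def lmeasurable_compact fmeasurableD intro!: integrable_mult_indicator[of _ lebesgue f, unfolded real_scaleR_def])

lemma test_outside: "\<phi> \<in> test_functions D \<Longrightarrow> x \<notin> D \<Longrightarrow> \<phi> x = 0"
  by (auto simp: test_functions_def)

lemma test_integral: "\<phi> \<in> test_functions D \<Longrightarrow> (LINT x:D|lebesgue. f x * \<phi> x) = (LINT x|lebesgue. f x * \<phi> x)"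
  unfolding set_lebesgue_integral_def using test_outside
  by (intro Bochner_Integration.integral_cong) (auto simp: indicator_def)

section \<open>Weak derivatives\<close>

text \<open>For a test function \<phi> the product w \<phi> is again Lipschitz with compact support.
  Its derivative has integral zero, and the product rule reads this as integration by parts.\<close>

lemma (in lipschitz_cpt) has_weak_pderiv:
  assumes b: "b \<in> Basis" and der: "AE x in lborel. ((\<lambda>t. w (x + t *\<^sub>R b)) has_real_derivative w' x) (at 0)"
  shows "has_weak_pderiv D b w w'"
  unfolding has_weak_pderiv_def
proof (intro conjI ballI)
  have "integrable lborel w"
  proof -
    obtain B where B: "\<And>x. \<bar>w x\<bar> \<le> B" using bounded_ex by blast
    have "integrable lborel (\<lambda>x. B * indicator (cball 0 R) x)"
      by (intro integrable_mult_right integrable_cball_lborel)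
    then show ?thesis
      by (rule Bochner_Integration.integrable_bound) (auto simp: indicator_def supp B[THEN order_trans, OF abs_ge_self])
  qed
  then show lw: "locally_integrable D w"
    by (intro integrable_imp_locally_integrable) (simp add: integrable_completion)
  show lw': "locally_integrable D w'"
    by (intro integrable_imp_locally_integrable integral_derivative_zero[OF der])
  fix \<phi> :: "'a \<Rightarrow> real" assume \<phi>: "\<phi> \<in> test_functions D"
  obtain M S where p: "lipschitz_cpt \<phi> M S" using test_lipschitz[OF \<phi>] .
  interpret p: lipschitz_cpt \<phi> M S by (rule p)
  obtain B where B: "\<And>x. \<bar>w x\<bar> \<le> B" using bounded_ex by blast
  obtain B' where B': "\<And>x. \<bar>\<phi> x\<bar> \<le> B'" using p.bounded_ex by blast
  have "lipschitz_cpt (\<lambda>x. w x * \<phi> x) (B * M + B' * L) R"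
  proof
    fix x y
    have "w x * \<phi> x - w y * \<phi> y = w x * (\<phi> x - \<phi> y) + \<phi> y * (w x - w y)" by (simp add: algebra_simps)
    then have "\<bar>w x * \<phi> x - w y * \<phi> y\<bar> \<le> \<bar>w x\<bar> * \<bar>\<phi> x - \<phi> y\<bar> + \<bar>\<phi> y\<bar> * \<bar>w x - w y\<bar>"
      by (metis abs_mult abs_triangle_ineq)
    also have "\<dots> \<le> B * (M * dist x y) + B' * (L * dist x y)"
      using B B' order_trans[OF abs_ge_zero B] order_trans[OF abs_ge_zero B']
      by (intro add_mono mult_mono lip p.lip) auto
    finally show "\<bar>w x * \<phi> x - w y * \<phi> y\<bar> \<le> (B * M + B' * L) * dist x y" by (simp add: algebra_simps)
  qed (use supp in auto)
  then interpret q: lipschitz_cpt "\<lambda>x. w x * \<phi> x" "B * M + B' * L" R .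
  have "AE x in lborel. ((\<lambda>t. w (x + t *\<^sub>R b) * \<phi> (x + t *\<^sub>R b)) has_real_derivative
      w x * frechet_derivative \<phi> (at x) b + w' x * \<phi> x) (at 0)"
    using der
  proof eventually_elim
    case (elim x)
    show ?case
      using DERIV_mult[OF elim directional_derivative[OF test_has_derivative[OF \<phi>], of x b]]
      by (simp add: algebra_simps)
  qed
  then have "(LINT x|lebesgue. w x * frechet_derivative \<phi> (at x) b + w' x * \<phi> x) = 0"
    by (rule q.integral_derivative_zero)
  then show "(LINT x:D|lebesgue. w x * frechet_derivative \<phi> (at x) b) = - (LINT x:D|lebesgue. w' x * \<phi> x)"
    using locally_integrable_test[OF lw test_derivative[OF \<phi> b]] locally_integrable_test[OF lw' \<phi>]
    by (simp add: test_integral[OF \<phi>] test_integral[OF test_derivative[OF \<phi> b]])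
qed

text \<open>This makes the arbitrary choice in \<open>weak_pderiv\<close> harmless. Box bumps are
  test functions, so two candidates have the same pairing with each of them.\<close>

lemma weak_pderiv_unique:
  fixes g h :: "'a::euclidean_space \<Rightarrow> real"
  assumes D: "open D" and g: "has_weak_pderiv D b' f g" and h: "has_weak_pderiv D b' f h"
  shows "AE x in lebesgue. x \<in> D \<longrightarrow> g x = h x"
proof -
  have li: "locally_integrable D g" "locally_integrable D h" using g h by (auto simp: has_weak_pderiv_def)
  have "AE x in lebesgue. x \<in> D \<longrightarrow> g x - h x = 0"
  proof (rule fundamental_lemma[OF D])
    show "(\<lambda>x. g x - h x) absolutely_integrable_on cbox a b" if "cbox a b \<subseteq> D" for a b
      using li that by (auto simp: locally_integrable_def)
    show "(LINT x|lebesgue. (g x - h x) * boxbump n a b x) = 0" if ab: "cbox a b \<subseteq> D" for a b n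
    proof -
      note t = boxbump_test[OF ab, of n]
      have "(LINT x:D|lebesgue. f x * frechet_derivative (boxbump n a b) (at x) b') = - (LINT x:D|lebesgue. g x * boxbump n a b x)"
        using g t unfolding has_weak_pderiv_def by blast
      moreover have "(LINT x:D|lebesgue. f x * frechet_derivative (boxbump n a b) (at x) b') = - (LINT x:D|lebesgue. h x * boxbump n a b x)"
        using h t unfolding has_weak_pderiv_def by blast
      ultimately have "(LINT x|lebesgue. g x * boxbump n a b x) = (LINT x|lebesgue. h x * boxbump n a b x)"
        unfolding test_integral[OF t, symmetric] by linarith
      then show ?thesis using locally_integrable_test[OF li(1) t] locally_integrable_test[OF li(2) t]
        by (simp add: left_diff_distrib)
    qed
  qed
  then show ?thesis by eventually_elim auto
qed

lemma locally_integrable_cong: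
  assumes "AE x in lebesgue. x \<in> D \<longrightarrow> f x = f' x" "locally_integrable D f"
  shows "locally_integrable D f'"
  unfolding locally_integrable_def
proof (intro allI impI)
  fix K assume K: "compact K \<and> K \<subseteq> D"
  then have i: "integrable lebesgue (\<lambda>x. indicator K x * f x)"
    using assms(2) by (auto simp: locally_integrable_def set_integrable_def)
  have ae: "AE x in lebesgue. indicator K x * f x = indicator K x * f' x"
    using assms(1) by eventually_elim (use K in \<open>auto simp: indicator_def\<close>)
  have "(\<lambda>x. indicator K x * f' x) \<in> borel_measurable lebesgue"
    using i by (intro borel_measurable_AE[OF _ ae]) auto
  with i ae have "integrable lebesgue (\<lambda>x. indicator K x * f' x)"
    using integrable_cong_AE_imp by (metis (mono_tags, lifting) AE_cong)
  then show "f' absolutely_integrable_on K" by (simp add: set_integrable_def)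
qed

lemma test_integral_cong:
  assumes "AE x in lebesgue. x \<in> D \<longrightarrow> f x = f' x" "locally_integrable D f" "\<phi> \<in> test_functions D"
  shows "(LINT x:D|lebesgue. f x * \<phi> x) = (LINT x:D|lebesgue. f' x * \<phi> x)"
proof -
  note l = locally_integrable_cong[OF assms(1,2)]
  show ?thesis unfolding set_lebesgue_integral_def
    using locally_integrable_test(2)[OF assms(2,3)] locally_integrable_test(2)[OF l assms(3)] assms(1)
    by (intro integral_cong_AE) (auto elim!: eventually_mono simp: indicator_def)
qed

lemma has_weak_pderiv_cong:
  assumes "AE x in lebesgue. x \<in> D \<longrightarrow> f x = f' x" "AE x in lebesgue. x \<in> D \<longrightarrow> g x = g' x"
    and h: "has_weak_pderiv D b f g" and b: "b \<in> Basis"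
  shows "has_weak_pderiv D b f' g'"
  unfolding has_weak_pderiv_def
proof (intro conjI ballI)
  have li: "locally_integrable D f" "locally_integrable D g" using h by (auto simp: has_weak_pderiv_def)
  show "locally_integrable D f'" "locally_integrable D g'"
    using li assms locally_integrable_cong by blast+
  fix \<phi> assume t: "\<phi> \<in> test_functions D"
  show "(LINT x:D|lebesgue. f' x * frechet_derivative \<phi> (at x) b) = - (LINT x:D|lebesgue. g' x * \<phi> x)"
    using h t test_integral_cong[OF assms(1) li(1) test_derivative[OF t b]] test_integral_cong[OF assms(2) li(2) t]
    by (auto simp: has_weak_pderiv_def)
qed

lemma has_weak_pderiv_add:
  assumes 1: "has_weak_pderiv D b f g" and 2: "has_weak_pderiv D b f' g'" and b: "b \<in> Basis"
  shows "has_weak_pderiv D b (\<lambda>x. f x + f' x) (\<lambda>x. g x + g' x)"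
  unfolding has_weak_pderiv_def
proof (intro conjI ballI)
  have li: "locally_integrable D f" "locally_integrable D g" "locally_integrable D f'" "locally_integrable D g'"
    using 1 2 by (auto simp: has_weak_pderiv_def)
  then show "locally_integrable D (\<lambda>x. f x + f' x)" "locally_integrable D (\<lambda>x. g x + g' x)"
    by (auto simp: locally_integrable_def)
  fix \<phi> assume t: "\<phi> \<in> test_functions D"
  note t' = test_derivative[OF t b]
  have "(LINT x:D|lebesgue. (f x + f' x) * frechet_derivative \<phi> (at x) b) =
      (LINT x:D|lebesgue. f x * frechet_derivative \<phi> (at x) b) + (LINT x:D|lebesgue. f' x * frechet_derivative \<phi> (at x) b)"
    using locally_integrable_test[OF li(1) t'] locally_integrable_test[OF li(3) t']
    unfolding test_integral[OF t'] by (simp add: distrib_right)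
  also have "\<dots> = - (LINT x:D|lebesgue. g x * \<phi> x) - (LINT x:D|lebesgue. g' x * \<phi> x)"
    using 1 2 t by (simp add: has_weak_pderiv_def)
  also have "\<dots> = - (LINT x:D|lebesgue. (g x + g' x) * \<phi> x)"
    using locally_integrable_test[OF li(2) t] locally_integrable_test[OF li(4) t]
    unfolding test_integral[OF t] by (simp add: distrib_right)
  finally show "(LINT x:D|lebesgue. (f x + f' x) * frechet_derivative \<phi> (at x) b) = - (LINT x:D|lebesgue. (g x + g' x) * \<phi> x)" .
qed

lemma L2_iff:
  fixes D :: "'a::euclidean_space set"
  assumes "open D"
  shows "f \<in> L2 D \<longleftrightarrow> (\<lambda>x. indicator D x * f x) \<in> borel_measurable lebesgue \<and>
    integrable lebesgue (\<lambda>x. (indicator D x * f x)\<^sup>2)"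
proof -
  have "D \<in> sets lebesgue" using assms by simp
  moreover have "(\<lambda>x. indicator D x * (f x)\<^sup>2) = (\<lambda>x. (indicator D x * f x)\<^sup>2)" by (auto simp: indicator_def)
  ultimately show ?thesis
    unfolding L2_def by (simp add: borel_measurable_restrict_space_iff integrable_restrict_space set_integrable_def)
qed

lemma square_integrable_add:
  fixes f g :: "'a \<Rightarrow> real"
  assumes "f \<in> borel_measurable M" "g \<in> borel_measurable M" "integrable M (\<lambda>x. (f x)\<^sup>2)" "integrable M (\<lambda>x. (g x)\<^sup>2)"
  shows "integrable M (\<lambda>x. (f x + g x)\<^sup>2)"
proof (rule Bochner_Integration.integrable_bound)
  show "integrable M (\<lambda>x. 2 * (f x)\<^sup>2 + 2 * (g x)\<^sup>2)" using assms by auto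
  show "AE x in M. norm ((f x + g x)\<^sup>2) \<le> norm (2 * (f x)\<^sup>2 + 2 * (g x)\<^sup>2)"
  proof (rule AE_I2)
    fix x
    have "0 \<le> (f x - g x)\<^sup>2" by simp
    then have "(f x + g x)\<^sup>2 \<le> 2 * (f x)\<^sup>2 + 2 * (g x)\<^sup>2"
      by (simp add: power2_eq_square algebra_simps)
    then show "norm ((f x + g x)\<^sup>2) \<le> norm (2 * (f x)\<^sup>2 + 2 * (g x)\<^sup>2)"
      unfolding real_norm_def by (subst (1 2) abs_of_nonneg) auto
  qed
qed (use assms in auto)

lemma L2_add:
  fixes D :: "'a::euclidean_space set"
  assumes "open D" "f \<in> L2 D" "g \<in> L2 D" shows "(\<lambda>x. f x + g x) \<in> L2 D"
  using assms(2,3) square_integrable_add[of "\<lambda>x. indicator D x * f x" lebesgue "\<lambda>x. indicator D x * g x"]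
  unfolding L2_iff[OF assms(1)] by (auto simp: distrib_left)

lemma L2_cong:
  fixes D :: "'a::euclidean_space set"
  assumes D: "open D" and ae: "AE x in lebesgue. x \<in> D \<longrightarrow> f x = g x" and f: "f \<in> L2 D"
  shows "g \<in> L2 D"
proof -
  have ae': "AE x in lebesgue. indicator D x * f x = indicator D x * g x"
    using ae by eventually_elim (auto simp: indicator_def)
  have m: "(\<lambda>x. indicator D x * g x) \<in> borel_measurable lebesgue"
    using f D by (intro borel_measurable_AE[OF _ ae']) (simp add: L2_iff)
  have "AE x in lebesgue. (indicator D x * f x)\<^sup>2 = (indicator D x * g x)\<^sup>2"
    using ae' by eventually_elim (simp only:)
  then have "integrable lebesgue (\<lambda>x. (indicator D x * g x)\<^sup>2)"
    using f m unfolding L2_iff[OF D] by (subst integrable_cong_AE[where g="\<lambda>x. (indicator D x * f x)\<^sup>2"]) auto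
  with m show ?thesis by (simp add: L2_iff[OF D])
qed

lemma L2_bounded:
  fixes D :: "'a::euclidean_space set"
  assumes D: "open D" and h: "h \<in> borel_measurable lebesgue"
    and b: "AE x in lebesgue. \<bar>h x\<bar> \<le> C * indicator (cball 0 r) x"
  shows "h \<in> L2 D"
proof -
  have m: "(\<lambda>x. indicator D x * h x) \<in> borel_measurable lebesgue"
    using D h by (intro borel_measurable_times borel_measurable_indicator) auto
  have "integrable lebesgue (\<lambda>x. (indicator D x * h x)\<^sup>2)"
  proof (rule Bochner_Integration.integrable_bound)
    show "integrable lebesgue (\<lambda>x. C\<^sup>2 * indicator (cball 0 r) x)"
      by (intro integrable_mult_right integrable_cball_lebesgue)
    show "(\<lambda>x. (indicator D x * h x)\<^sup>2) \<in> borel_measurable lebesgue" using m by auto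
    show "AE x in lebesgue. norm ((indicator D x * h x)\<^sup>2) \<le> norm (C\<^sup>2 * indicator (cball 0 r) x)"
      using b
    proof eventually_elim
      case (elim x)
      then have "\<bar>h x\<bar>\<^sup>2 \<le> (C * indicator (cball 0 r) x)\<^sup>2" by (intro power_mono) auto
      then show ?case by (auto simp: indicator_def split: if_splits)
    qed
  qed
  with m show ?thesis by (simp add: L2_iff[OF D])
qed

section \<open>Functions in H2 and their perturbations\<close>

locale H2_function =
  fixes D :: "'a::euclidean_space set" and u :: "'a \<Rightarrow> real"
  assumes D: "open D" and u: "u \<in> H2 D"
begin

abbreviation "G b \<equiv> weak_pderiv D b u"
abbreviation "H b \<equiv> weak_pderiv D b (G b)"

lemma u_L2: "u \<in> L2 D" using u by (auto simp: H2_def)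

text \<open>Membership in \<open>H2\<close> provides some square integrable derivatives; the chosen
  ones agree with them almost everywhere and so inherit integrability and second
  derivatives.\<close>

lemma derivs:
  assumes b: "b \<in> Basis"
  shows "has_weak_pderiv D b u (G b)" "has_weak_pderiv D b (G b) (H b)" "H b \<in> L2 D" "G b \<in> L2 D"
    "\<And>c. c \<in> Basis \<Longrightarrow> \<exists>h\<in>L2 D. has_weak_pderiv D c (G b) h"
proof -
  obtain g where g: "g \<in> L2 D" "has_weak_pderiv D b u g" "\<And>c. c \<in> Basis \<Longrightarrow> \<exists>h\<in>L2 D. has_weak_pderiv D c g h"
    using u b unfolding H2_def by blast
  show G: "has_weak_pderiv D b u (G b)" unfolding weak_pderiv_def by (rule someI[of "has_weak_pderiv D b u", OF g(2)])
  have ae: "AE x in lebesgue. x \<in> D \<longrightarrow> g x = G b x" by (rule weak_pderiv_unique[OF D g(2) G])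
  show "G b \<in> L2 D" by (rule L2_cong[OF D ae g(1)])
  show *: "\<exists>h\<in>L2 D. has_weak_pderiv D c (G b) h" if c: "c \<in> Basis" for c
  proof -
    obtain h where "h \<in> L2 D" "has_weak_pderiv D c g h" using g(3)[OF c] by blast
    then show ?thesis using has_weak_pderiv_cong[OF ae _ _ c, of h h] by auto
  qed
  obtain h where h: "h \<in> L2 D" "has_weak_pderiv D b (G b) h" using *[OF b] by blast
  show H: "has_weak_pderiv D b (G b) (H b)" unfolding weak_pderiv_def[of D b "G b"] by (rule someI[of "has_weak_pderiv D b (G b)", OF h(2)])
  show "H b \<in> L2 D" by (rule L2_cong[OF D weak_pderiv_unique[OF D h(2) H] h(1)])
qed

lemma laplacian_L2: "weak_laplacian D u \<in> L2 D"
proof -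
  have "(\<lambda>x. \<Sum>b\<in>B. H b x) \<in> L2 D" if "finite B" "B \<subseteq> Basis" for B
    using that
  proof (induction B)
    case empty then show ?case by (simp add: L2_iff[OF D])
  next
    case (insert b B)
    then have "(\<lambda>x. H b x + (\<Sum>b\<in>B. H b x)) \<in> L2 D" by (intro L2_add[OF D] derivs) auto
    with insert show ?case by simp
  qed
  then show ?thesis unfolding weak_laplacian_def by simp
qed

lemma laplacian_test:
  assumes \<phi>: "\<phi> \<in> test_functions D"
  shows "(LINT x:D|lebesgue. weak_laplacian D u x * \<phi> x) =
    (LINT x:D|lebesgue. u x * (\<Sum>b\<in>Basis. frechet_derivative (\<lambda>y. frechet_derivative \<phi> (at y) b) (at x) b))"
proof -
  let ?d = "\<lambda>b x. frechet_derivative \<phi> (at x) b" and ?dd = "\<lambda>b x. frechet_derivative (\<lambda>y. frechet_derivative \<phi> (at y) b) (at x) b"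
  have each: "(LINT x|lebesgue. H b x * \<phi> x) = (LINT x|lebesgue. u x * ?dd b x)"
    "integrable lebesgue (\<lambda>x. H b x * \<phi> x)" "integrable lebesgue (\<lambda>x. u x * ?dd b x)"
    "\<forall>x. x \<notin> D \<longrightarrow> ?dd b x = 0" if b: "b \<in> Basis" for b
  proof -
    note t1 = test_derivative[OF \<phi> b]
    note t2 = test_derivative[OF t1 b]
    note d = derivs[OF b]
    show "(LINT x|lebesgue. H b x * \<phi> x) = (LINT x|lebesgue. u x * ?dd b x)"
    proof -
      have "(LINT x:D|lebesgue. u x * ?dd b x) = - (LINT x:D|lebesgue. G b x * ?d b x)"
        using d(1) t1 unfolding has_weak_pderiv_def by blast
      moreover have "(LINT x:D|lebesgue. G b x * ?d b x) = - (LINT x:D|lebesgue. H b x * \<phi> x)"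
        using d(2) \<phi> unfolding has_weak_pderiv_def by blast
      ultimately show ?thesis
        unfolding test_integral[OF t1] test_integral[OF t2] test_integral[OF \<phi>] by simp
    qed
    show "integrable lebesgue (\<lambda>x. H b x * \<phi> x)" "integrable lebesgue (\<lambda>x. u x * ?dd b x)"
      using d(1,2) locally_integrable_test[OF _ t2] locally_integrable_test[OF _ \<phi>] by (auto simp: has_weak_pderiv_def)
    show "\<forall>x. x \<notin> D \<longrightarrow> ?dd b x = 0" using test_outside[OF t2] by blast
  qed
  have "(LINT x:D|lebesgue. weak_laplacian D u x * \<phi> x) = (LINT x|lebesgue. (\<Sum>b\<in>Basis. H b x * \<phi> x))"
    unfolding test_integral[OF \<phi>] weak_laplacian_def by (simp add: sum_distrib_right)
  also have "\<dots> = (\<Sum>b\<in>Basis. (LINT x|lebesgue. H b x * \<phi> x))" using each(2) by simp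
  also have "\<dots> = (\<Sum>b\<in>Basis. (LINT x|lebesgue. u x * ?dd b x))" using each(1) by simp
  also have "\<dots> = (LINT x|lebesgue. (\<Sum>b\<in>Basis. u x * ?dd b x))" using each(3) by simp
  also have "\<dots> = (LINT x:D|lebesgue. u x * (\<Sum>b\<in>Basis. ?dd b x))"
    unfolding set_lebesgue_integral_def using each(4)
    by (intro Bochner_Integration.integral_cong) (auto simp: sum_distrib_left indicator_def)
  finally show ?thesis .
qed

end

text \<open>In \<open>C11 w w1 w2\<close>, \<open>w1 b\<close> is the derivative of \<open>w\<close> in direction \<open>b\<close> and \<open>w2 b c\<close>
  the derivative of \<open>w1 b\<close> in direction \<open>c\<close>.\<close>

definition C11 :: "('a::euclidean_space \<Rightarrow> real) \<Rightarrow> ('a \<Rightarrow> 'a \<Rightarrow> real) \<Rightarrow> ('a \<Rightarrow> 'a \<Rightarrow> 'a \<Rightarrow> real) \<Rightarrow> bool" where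
  "C11 w w1 w2 \<longleftrightarrow> (\<exists>L R. lipschitz_cpt w L R) \<and> (\<forall>b\<in>Basis. (\<exists>L R. lipschitz_cpt (w1 b) L R) \<and>
     (AE x in lborel. ((\<lambda>t. w (x + t *\<^sub>R b)) has_real_derivative w1 b x) (at 0)) \<and>
     (\<forall>c\<in>Basis. AE x in lborel. ((\<lambda>t. w1 b (x + t *\<^sub>R c)) has_real_derivative w2 b c x) (at 0)))"

lemma (in lipschitz_cpt) L2: "open D \<Longrightarrow> w \<in> L2 D"
proof -
  assume D: "open D"
  obtain B where B: "\<And>x. \<bar>w x\<bar> \<le> B" using bounded_ex by blast
  have "\<bar>w x\<bar> \<le> B * indicator (cball 0 R) x" for x
    using B[of x] supp[of x] by (auto simp: indicator_def not_le)
  then show ?thesis by (intro L2_bounded[OF D measurable_completion]) auto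
qed

lemma C11_weak:
  fixes D :: "'a::euclidean_space set"
  assumes "C11 w w1 w2" "open D" "b \<in> Basis" "c \<in> Basis"
  shows "w \<in> L2 D" "w1 b \<in> L2 D" "w2 b c \<in> L2 D" "has_weak_pderiv D b w (w1 b)" "has_weak_pderiv D c (w1 b) (w2 b c)"
proof -
  obtain L R L' R' where lw: "lipschitz_cpt w L R" "lipschitz_cpt (w1 b) L' R'" using assms by (auto simp: C11_def)
  interpret a: lipschitz_cpt w L R by fact
  interpret b: lipschitz_cpt "w1 b" L' R' by fact
  have d: "AE x in lborel. ((\<lambda>t. w (x + t *\<^sub>R b)) has_real_derivative w1 b x) (at 0)"
     "AE x in lborel. ((\<lambda>t. w1 b (x + t *\<^sub>R c)) has_real_derivative w2 b c x) (at 0)"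
    using assms by (auto simp: C11_def)
  show "w \<in> L2 D" "w1 b \<in> L2 D" using a.L2 b.L2 assms by auto
  have "w2 b c \<in> borel_measurable lebesgue" using b.integral_derivative_zero(1)[OF d(2)] by auto
  then show "w2 b c \<in> L2 D"
    by (rule L2_bounded[OF assms(2) _ b.integral_derivative_zero(3)[OF d(2)]])
  show "has_weak_pderiv D b w (w1 b)" "has_weak_pderiv D c (w1 b) (w2 b c)"
    using a.has_weak_pderiv[OF assms(3) d(1)] b.has_weak_pderiv[OF assms(4) d(2)] by auto
qed

text \<open>Competitors are written as u + w with w explicit, so that only w has to be
  differentiated classically. Uniqueness of weak derivatives then makes the chosen Laplacians
  additive.\<close>

lemma (in H2_function) perturbation:
  assumes w: "C11 w w1 w2"
  shows "(\<lambda>x. u x + w x) \<in> H2 D"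
    "AE x in lebesgue. x \<in> D \<longrightarrow> weak_laplacian D (\<lambda>x. u x + w x) x = weak_laplacian D u x + (\<Sum>b\<in>Basis. w2 b b x)"
proof -
  note c = C11_weak[OF w D]
  obtain b0 :: 'a where "b0 \<in> Basis" by fastforce
  show H2: "(\<lambda>x. u x + w x) \<in> H2 D"
    unfolding H2_def
  proof (intro CollectI conjI ballI)
    show "(\<lambda>x. u x + w x) \<in> L2 D" using u_L2 c(1) \<open>b0 \<in> Basis\<close> by (intro L2_add[OF D]) auto
    fix b :: 'a assume b: "b \<in> Basis"
    show "\<exists>g\<in>L2 D. has_weak_pderiv D b (\<lambda>x. u x + w x) g \<and> (\<forall>c\<in>Basis. \<exists>h\<in>L2 D. has_weak_pderiv D c g h)"
    proof (rule bexI[of _ "\<lambda>x. G b x + w1 b x"], intro conjI ballI)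
      show "(\<lambda>x. G b x + w1 b x) \<in> L2 D" using derivs[OF b] c[OF b b] by (intro L2_add[OF D]) auto
      show "has_weak_pderiv D b (\<lambda>x. u x + w x) (\<lambda>x. G b x + w1 b x)"
        using derivs[OF b] c[OF b b] by (intro has_weak_pderiv_add b)
      fix c' :: 'a assume c': "c' \<in> Basis"
      obtain h where "h \<in> L2 D" "has_weak_pderiv D c' (G b) h" using derivs(5)[OF b c'] by blast
      then show "\<exists>h\<in>L2 D. has_weak_pderiv D c' (\<lambda>x. G b x + w1 b x) h"
        using c[OF b c'] by (intro bexI[of _ "\<lambda>x. h x + w2 b c' x"] has_weak_pderiv_add L2_add[OF D] c')
    qed
  qed
  interpret v: H2_function D "\<lambda>x. u x + w x" by unfold_locales (use D H2 in auto)
  have "AE x in lebesgue. x \<in> D \<longrightarrow> v.H b x = H b x + w2 b b x" if b: "b \<in> Basis" for b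
  proof -
    have "AE x in lebesgue. x \<in> D \<longrightarrow> v.G b x = G b x + w1 b x"
      by (rule weak_pderiv_unique[OF D v.derivs(1)[OF b]]) (use derivs[OF b] c[OF b b] in \<open>intro has_weak_pderiv_add b\<close>)
    then have "has_weak_pderiv D b (\<lambda>x. G b x + w1 b x) (v.H b)"
      using has_weak_pderiv_cong[OF _ _ v.derivs(2)[OF b] b] by auto
    moreover have "has_weak_pderiv D b (\<lambda>x. G b x + w1 b x) (\<lambda>x. H b x + w2 b b x)"
      using derivs[OF b] c[OF b b] by (intro has_weak_pderiv_add b)
    ultimately show ?thesis by (rule weak_pderiv_unique[OF D])
  qed
  then have "AE x in lebesgue. \<forall>b\<in>Basis. x \<in> D \<longrightarrow> v.H b x = H b x + w2 b b x"
    by (subst AE_ball_countable) (auto simp: countable_finite)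
  then show "AE x in lebesgue. x \<in> D \<longrightarrow> weak_laplacian D (\<lambda>x. u x + w x) x = weak_laplacian D u x + (\<Sum>b\<in>Basis. w2 b b x)"
    by eventually_elim (simp add: weak_laplacian_def sum.distrib)
qed

text \<open>Finite measure of D bounds the volume term, and the Laplacian is square integrable. The
  energy thereby becomes a finite real integral, which may be subtracted and split.\<close>

lemma (in H2_function) energy_density_integrable:
  assumes fin: "emeasure lborel D < \<infinity>"
  shows "integrable lebesgue (\<lambda>x. indicator D x * ((weak_laplacian D u x)\<^sup>2 + indicator {x. u x \<noteq> 0} x))"
    and "energy u D = ennreal (LINT x|lebesgue. indicator D x * ((weak_laplacian D u x)\<^sup>2 + indicator {x. u x \<noteq> 0} x))"
proof -
  have "(\<lambda>x. indicator D x * u x) \<in> borel_measurable lebesgue" using u_L2 L2_iff[OF D] by blast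
  then have "{x \<in> space lebesgue. indicator D x * u x \<noteq> 0} \<in> sets lebesgue" by (rule borel_measurable_neq) simp
  then have m: "{x. indicator D x * u x \<noteq> 0} \<in> sets lebesgue" by simp
  have "emeasure lebesgue {x. indicator D x * u x \<noteq> 0} \<le> emeasure lebesgue D"
    using D by (intro emeasure_mono) (auto simp: indicator_def split: if_splits)
  also have "\<dots> < \<infinity>" using fin D by simp
  finally have "integrable lebesgue (indicator {x. indicator D x * u x \<noteq> 0} :: 'a \<Rightarrow> real)"
    using m by (intro integrable_real_indicator) auto
  moreover have "integrable lebesgue (\<lambda>x. (indicator D x * weak_laplacian D u x)\<^sup>2)" using laplacian_L2 L2_iff[OF D] by blast
  ultimately have "integrable lebesgue (\<lambda>x. (indicator D x * weak_laplacian D u x)\<^sup>2 + indicator {x. indicator D x * u x \<noteq> 0} x)"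
    by (intro Bochner_Integration.integrable_add)
  moreover have "(\<lambda>x. (indicator D x * weak_laplacian D u x)\<^sup>2 + indicator {x. indicator D x * u x \<noteq> 0} x) =
    (\<lambda>x. indicator D x * ((weak_laplacian D u x)\<^sup>2 + indicator {x. u x \<noteq> 0} x) :: real)"
    by (auto simp: fun_eq_iff indicator_def)
  ultimately show i: "integrable lebesgue (\<lambda>x. indicator D x * ((weak_laplacian D u x)\<^sup>2 + indicator {x. u x \<noteq> 0} x))" by simp
  have "energy u D = (\<integral>\<^sup>+x. ennreal (indicator D x * ((weak_laplacian D u x)\<^sup>2 + indicator {x. u x \<noteq> 0} x)) \<partial>lebesgue)"
    unfolding energy_def by (intro nn_integral_cong) (auto simp: indicator_def)
  also have "\<dots> = ennreal (LINT x|lebesgue. indicator D x * ((weak_laplacian D u x)\<^sup>2 + indicator {x. u x \<noteq> 0} x))"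
    by (intro nn_integral_eq_integral i) auto
  finally show "energy u D = ennreal (LINT x|lebesgue. indicator D x * ((weak_laplacian D u x)\<^sup>2 + indicator {x. u x \<noteq> 0} x))" .
qed

lemma minimizer_inequality:
  fixes D :: "'a::euclidean_space set"
  assumes D: "open D" "emeasure lborel D < \<infinity>" and u: "u \<in> minimizers D"
    and w: "C11 w w1 w2" and K: "compact K" "K \<subseteq> D" "\<And>x. x \<notin> K \<Longrightarrow> w x = 0"
  shows "(LINT x|lebesgue. indicator D x * ((weak_laplacian D u x)\<^sup>2 + indicator {x. u x \<noteq> 0} x)) \<le>
    (LINT x|lebesgue. indicator D x * ((weak_laplacian D u x + (\<Sum>b\<in>Basis. w2 b b x))\<^sup>2 + indicator {x. u x + w x \<noteq> 0} x))"
proof -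
  interpret H2_function D u by unfold_locales (use D u in \<open>auto simp: minimizers_def\<close>)
  note p = perturbation[OF w]
  interpret v: H2_function D "\<lambda>x. u x + w x" by unfold_locales (use D p in auto)
  have "energy u D \<le> energy (\<lambda>x. u x + w x) D"
  proof -
    have ex: "\<exists>K. compact K \<and> K \<subseteq> D \<and> (AE x in lebesgue_on D. u x \<noteq> u x + w x \<longrightarrow> x \<in> K)"
      using K by (intro exI[of _ K]) auto
    have "\<forall>v\<in>H2 D. (\<exists>K. compact K \<and> K \<subseteq> D \<and> (AE x in lebesgue_on D. u x \<noteq> v x \<longrightarrow> x \<in> K)) \<longrightarrow>
        energy u D \<le> energy v D"
      using assms(3) by (simp add: minimizers_def)
    from bspec[OF this p(1), THEN mp, OF ex] show ?thesis .
  qed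
  then have "(LINT x|lebesgue. indicator D x * ((weak_laplacian D u x)\<^sup>2 + indicator {x. u x \<noteq> 0} x)) \<le>
    (LINT x|lebesgue. indicator D x * ((weak_laplacian D (\<lambda>x. u x + w x) x)\<^sup>2 + indicator {x. u x + w x \<noteq> 0} x))"
    unfolding energy_density_integrable(2)[OF assms(2)] v.energy_density_integrable(2)[OF assms(2)]
    by (subst (asm) ennreal_le_iff) (auto intro!: integral_nonneg_AE)
  also have "\<dots> = (LINT x|lebesgue. indicator D x * ((weak_laplacian D u x + (\<Sum>b\<in>Basis. w2 b b x))\<^sup>2 + indicator {x. u x + w x \<noteq> 0} x))"
    (is "integral\<^sup>L lebesgue ?f = integral\<^sup>L lebesgue ?g")
  proof -
    have ae: "AE x in lebesgue. ?f x = ?g x" using p(2) by eventually_elim (auto simp: indicator_def)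
    have fm: "?f \<in> borel_measurable lebesgue" using v.energy_density_integrable(1)[OF assms(2)] by (rule borel_measurable_integrable)
    show ?thesis using fm borel_measurable_AE[OF fm ae] ae by (rule integral_cong_AE)
  qed
  finally show ?thesis .
qed

section \<open>Logarithmic polar coordinates\<close>

lemma norm_real2: "norm (x :: real^2) = sqrt ((x $ 1)\<^sup>2 + (x $ 2)\<^sup>2)"
  by (simp add: norm_eq_sqrt_inner inner_vec_def sum_2 power2_eq_square)

lemma vector2_eq: "(vector [a, b] :: real^2) = a *\<^sub>R axis 1 1 + b *\<^sub>R axis 2 1"
  by (simp add: vec_eq_iff forall_2 axis_def)

lemma Basis_real2: "(Basis :: (real^2) set) = {axis 1 1, axis 2 1}"
  by (auto simp: Basis_vec_def UNIV_2)

lemma axis_1_neq_2: "axis 1 1 \<noteq> (axis 2 1 :: real^2)"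
  by (simp add: axis_eq_axis)

lemma vector2_measurable: "(\<lambda>p::real\<times>real. vector [fst p, snd p] :: real^2) \<in> borel \<rightarrow>\<^sub>M borel"
  unfolding vector2_eq by (intro borel_measurable_continuous_onI continuous_intros)

text \<open>Differentiable changes of variables are carried out on \<open>real^2\<close>, iterated
  integrals on \<open>real \<times> real\<close>; this identifies the two measures.\<close>

lemma lborel_real2: "distr lborel borel (\<lambda>p::real\<times>real. vector [fst p, snd p] :: real^2) = lborel"
proof (rule lborel_eqI[symmetric])
  fix l u :: "real^2"
  assume le: "\<And>b. b \<in> Basis \<Longrightarrow> l \<bullet> b \<le> u \<bullet> b"
  have le': "l $ 1 \<le> u $ 1" "l $ 2 \<le> u $ 2"
    using le[of "axis 1 1"] le[of "axis 2 1"] by (auto simp: Basis_real2 inner_axis)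
  have "(\<lambda>p::real\<times>real. vector [fst p, snd p] :: real^2) -` box l u = {l $ 1<..<u $ 1} \<times> {l $ 2<..<u $ 2}"
    by (auto simp: box_def Basis_real2 inner_axis)
  then have "emeasure (distr lborel borel (\<lambda>p::real\<times>real. vector [fst p, snd p] :: real^2)) (box l u) =
      emeasure (lborel \<Otimes>\<^sub>M lborel) ({l $ 1<..<u $ 1} \<times> {l $ 2<..<u $ 2})"
    using vector2_measurable by (subst emeasure_distr) (auto simp: lborel_prod)
  also have "\<dots> = emeasure lborel {l $ 1<..<u $ 1} * emeasure lborel {l $ 2<..<u $ 2}"
    by (intro lborel.emeasure_pair_measure_Times) auto
  also have "\<dots> = ennreal ((u $ 1 - l $ 1) * (u $ 2 - l $ 2))"
    using le' by (simp add: ennreal_mult)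
  also have "(u $ 1 - l $ 1) * (u $ 2 - l $ 2) = (\<Prod>b\<in>Basis. (u - l) \<bullet> b)"
    by (simp add: Basis_real2 axis_1_neq_2 inner_axis)
  finally show "emeasure (distr lborel borel (\<lambda>p::real\<times>real. vector [fst p, snd p] :: real^2)) (box l u) =
      ennreal (\<Prod>b\<in>Basis. (u - l) \<bullet> b)" .
qed simp

definition logpolar :: "real \<times> real \<Rightarrow> real^2" where
  "logpolar p = vector [exp (fst p) * cos (snd p), exp (fst p) * sin (snd p)]"

text \<open>The angle counted from the ray of direction \<alpha>, in the interval from \<alpha> to
  \<alpha> + 2 pi. The cut along that ray is movable and is always placed away from the support of
  the function at hand.\<close>

definition ang :: "real \<Rightarrow> real^2 \<Rightarrow> real" where
  "ang \<alpha> x = \<alpha> + Arg2pi (cis (- \<alpha>) * Complex (x $ 1) (x $ 2))"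

definition chart :: "real \<Rightarrow> real^2 \<Rightarrow> real \<times> real" where
  "chart \<alpha> x = (ln (norm x), ang \<alpha> x)"

definition strip :: "real \<Rightarrow> (real \<times> real) set" where
  "strip \<alpha> = {..<0} \<times> {\<alpha><..<\<alpha> + 2 * pi}"

lemma logpolar_nth [simp]: "logpolar p $ 1 = exp (fst p) * cos (snd p)" "logpolar p $ 2 = exp (fst p) * sin (snd p)"
  by (simp_all add: logpolar_def)

lemma norm_logpolar [simp]: "norm (logpolar p) = exp (fst p)"
proof -
  have "(exp (fst p) * cos (snd p))\<^sup>2 + (exp (fst p) * sin (snd p))\<^sup>2 = (exp (fst p))\<^sup>2"
    by (simp add: power_mult_distrib distrib_left[symmetric] add.commute)
  then show ?thesis by (simp add: norm_real2)
qed

lemma Complex_logpolar: "Complex (logpolar p $ 1) (logpolar p $ 2) = complex_of_real (exp (fst p)) * cis (snd p)"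
  by (simp add: complex_eq_iff)

lemma ang_range: "\<alpha> \<le> ang \<alpha> x" "ang \<alpha> x < \<alpha> + 2 * pi"
  using Arg2pi[of "cis (- \<alpha>) * Complex (x $ 1) (x $ 2)"] by (auto simp: ang_def)

lemma ang_zero [simp]: "ang \<alpha> 0 = \<alpha>"
proof -
  have "Complex 0 0 = 0" by (simp add: complex_eq_iff)
  then show ?thesis by (simp add: ang_def)
qed

lemma chart_logpolar: "\<alpha> \<le> snd p \<Longrightarrow> snd p < \<alpha> + 2 * pi \<Longrightarrow> chart \<alpha> (logpolar p) = p"
proof -
  assume p: "\<alpha> \<le> snd p" "snd p < \<alpha> + 2 * pi"
  have "Arg2pi (cis (- \<alpha>) * (complex_of_real (exp (fst p)) * cis (snd p))) = snd p - \<alpha>"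
  proof (rule Arg2pi_unique[of "exp (fst p)"])
    have "cis (- \<alpha>) * cis (snd p) = cis (snd p - \<alpha>)" by (simp add: cis_mult)
    then show "complex_of_real (exp (fst p)) * exp (\<i> * complex_of_real (snd p - \<alpha>)) = cis (- \<alpha>) * (complex_of_real (exp (fst p)) * cis (snd p))"
      unfolding cis_conv_exp[symmetric] by (simp only: mult.left_commute[of "cis (- \<alpha>)"])
  qed (use p in auto)
  then show ?thesis unfolding chart_def ang_def Complex_logpolar by (simp add: prod_eq_iff)
qed

lemma logpolar_chart: "x \<noteq> 0 \<Longrightarrow> logpolar (chart \<alpha> x) = x"
proof -
  assume x: "x \<noteq> 0"
  let ?z = "Complex (x $ 1) (x $ 2)"
  have n: "cmod ?z = norm x" by (simp add: norm_real2 complex_norm)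
  have "cis (- \<alpha>) * ?z = of_real (norm x) * exp (\<i> * of_real (Arg2pi (cis (- \<alpha>) * ?z)))"
    using Arg2pi_eq[of "cis (- \<alpha>) * ?z"] by (simp add: norm_mult n)
  then have "cis \<alpha> * (cis (- \<alpha>) * ?z) = of_real (norm x) * (cis \<alpha> * cis (Arg2pi (cis (- \<alpha>) * ?z)))"
    by (simp add: cis_conv_exp[symmetric] mult.left_commute)
  then have "?z = of_real (norm x) * cis (ang \<alpha> x)"
    unfolding mult.assoc[symmetric] cis_mult ang_def by (simp add: cis_mult)
  then have eqs: "x $ 1 = norm x * cos (ang \<alpha> x)" "x $ 2 = norm x * sin (ang \<alpha> x)"
    by (simp_all add: complex_eq_iff)
  have e: "exp (ln (norm x)) = norm x" using x by simp
  show ?thesis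
    unfolding vec_eq_iff forall_2 logpolar_nth chart_def fst_conv snd_conv e by (intro conjI; rule sym; fact)
qed

lemma ang_eq_iff: "ang \<alpha> x = \<alpha> \<longleftrightarrow> cis (- \<alpha>) * Complex (x $ 1) (x $ 2) \<in> \<real>\<^sub>\<ge>\<^sub>0"
  unfolding ang_def using Arg2pi_eq_0 complex_nonneg_Reals_iff complex_is_Real_iff by auto

lemma continuous_Complex: "continuous_on A (\<lambda>x::real^2. cis (- \<alpha>) * Complex (x $ 1) (x $ 2))"
  unfolding Complex_eq by (intro continuous_intros)

lemma open_chart_domain: "open {x. ang \<alpha> x \<noteq> \<alpha>}"
proof -
  have "closed ((\<lambda>x::real^2. cis (- \<alpha>) * Complex (x $ 1) (x $ 2)) -` \<real>\<^sub>\<ge>\<^sub>0)"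
    by (intro closed_vimage closed_nonneg_Reals_complex continuous_Complex)
  then have "open (- ((\<lambda>x::real^2. cis (- \<alpha>) * Complex (x $ 1) (x $ 2)) -` \<real>\<^sub>\<ge>\<^sub>0))" by (rule open_Compl)
  also have "- ((\<lambda>x::real^2. cis (- \<alpha>) * Complex (x $ 1) (x $ 2)) -` \<real>\<^sub>\<ge>\<^sub>0) = {x. ang \<alpha> x \<noteq> \<alpha>}"
    by (auto simp: ang_eq_iff)
  finally show ?thesis .
qed

text \<open>The chart is a branch of the complex logarithm, whose differential is v / z. Off the
  excluded ray the angle is pi plus the imaginary part of \<open>Ln\<close> of the negated number;
  the negation moves the cut of \<open>Ln\<close> onto that ray.\<close>

lemma chart_derivative:
  assumes "ang \<alpha> x \<noteq> \<alpha>"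
  shows "(chart \<alpha> has_derivative (\<lambda>v. ((x $ 1 * v $ 1 + x $ 2 * v $ 2) / (norm x)\<^sup>2, (x $ 1 * v $ 2 - x $ 2 * v $ 1) / (norm x)\<^sup>2))) (at x)"
proof -
  have x0: "x \<noteq> 0" using assms by auto
  let ?Z = "\<lambda>x::real^2. Complex (x $ 1) (x $ 2)"
  have Zb: "bounded_linear ?Z"
    unfolding Complex_eq
    by (intro bounded_linear_add bounded_linear_const_mult bounded_linear_compose[OF bounded_linear_of_real bounded_linear_vec_nth])
  have dZ: "((\<lambda>x. - (cis (- \<alpha>) * ?Z x)) has_derivative (\<lambda>v. - (cis (- \<alpha>) * ?Z v))) (at x)"
    using bounded_linear.has_derivative[OF Zb has_derivative_ident] by (auto intro!: derivative_eq_intros)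
  have nz: "cis (- \<alpha>) * ?Z x \<notin> \<real>\<^sub>\<ge>\<^sub>0" using assms ang_eq_iff by blast
  then have nz': "- (cis (- \<alpha>) * ?Z x) \<notin> \<real>\<^sub>\<le>\<^sub>0" by (auto simp: complex_nonpos_Reals_iff complex_nonneg_Reals_iff)
  have Z0: "?Z x \<noteq> 0" using x0 by (auto simp: complex_eq_iff vec_eq_iff forall_2)
  have "((\<lambda>x. Ln (- (cis (- \<alpha>) * ?Z x))) has_derivative
      (\<lambda>v. inverse (- (cis (- \<alpha>) * ?Z x)) * - (cis (- \<alpha>) * ?Z v))) (at x)"
    using has_derivative_compose[OF dZ has_field_derivative_Ln[OF nz', unfolded has_field_derivative_def]] .
  moreover have "inverse (- (cis (- \<alpha>) * ?Z x)) * - (cis (- \<alpha>) * ?Z v) = ?Z v / ?Z x" for v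
    using Z0 by (simp add: field_simps)
  ultimately have "((\<lambda>x. Ln (- (cis (- \<alpha>) * ?Z x))) has_derivative (\<lambda>v. ?Z v / ?Z x)) (at x)" by (simp only:)
  then have "((\<lambda>x. Im (Ln (- (cis (- \<alpha>) * ?Z x)))) has_derivative (\<lambda>v. Im (?Z v / ?Z x))) (at x)"
    by (rule bounded_linear.has_derivative[OF bounded_linear_Im])
  moreover have "Im (?Z v / ?Z x) = (x $ 1 * v $ 2 - x $ 2 * v $ 1) / (norm x)\<^sup>2" for v
    by (simp add: Im_divide norm_real2 mult.commute)
  ultimately have "((\<lambda>x. Im (Ln (- (cis (- \<alpha>) * ?Z x)))) has_derivative
     (\<lambda>v. (x $ 1 * v $ 2 - x $ 2 * v $ 1) / (norm x)\<^sup>2)) (at x)" by (simp only:)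
  from has_derivative_add[OF has_derivative_const has_derivative_add[OF this has_derivative_const]]
  have "((\<lambda>x. \<alpha> + (Im (Ln (- (cis (- \<alpha>) * ?Z x))) + pi)) has_derivative
     (\<lambda>v. (x $ 1 * v $ 2 - x $ 2 * v $ 1) / (norm x)\<^sup>2)) (at x)" by simp
  then have d2: "(ang \<alpha> has_derivative (\<lambda>v. (x $ 1 * v $ 2 - x $ 2 * v $ 1) / (norm x)\<^sup>2)) (at x)"
  proof (rule has_derivative_transform_within_open[OF _ open_chart_domain])
    show "x \<in> {x. ang \<alpha> x \<noteq> \<alpha>}" using assms by simp
    fix y assume "y \<in> {x. ang \<alpha> x \<noteq> \<alpha>}"
    then have pos: "0 < Arg2pi (cis (- \<alpha>) * ?Z y)"
      using Arg2pi[of "cis (- \<alpha>) * ?Z y"] by (auto simp: ang_def)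
    show "\<alpha> + (Im (Ln (- (cis (- \<alpha>) * ?Z y))) + pi) = ang \<alpha> y"
      unfolding ang_def Arg2pi_Ln[OF pos] by (rule refl)
  qed
  have "((\<lambda>x. ln (norm x)) has_derivative (\<lambda>v. (x $ 1 * v $ 1 + x $ 2 * v $ 2) / (norm x)\<^sup>2)) (at x)"
  proof -
    have "(norm has_derivative (\<lambda>v. v \<bullet> sgn x)) (at x)" by (rule has_derivative_norm[OF x0])
    then have "((\<lambda>x. ln (norm x)) has_derivative (\<lambda>v. (v \<bullet> sgn x) * (1 / norm x))) (at x)"
      using x0 by (auto intro!: derivative_eq_intros simp: divide_inverse)
    moreover have "(v \<bullet> sgn x) * (1 / norm x) = (x $ 1 * v $ 1 + x $ 2 * v $ 2) / (norm x)\<^sup>2" for v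
      by (simp add: sgn_div_norm inner_vec_def sum_2 power2_eq_square divide_simps)
    ultimately show ?thesis by simp
  qed
  with d2 show ?thesis unfolding chart_def[abs_def] by (intro has_derivative_Pair)
qed

lemma chart_derivative_logpolar:
  assumes "\<alpha> < snd p" "snd p < \<alpha> + 2 * pi"
  shows "(chart \<alpha> has_derivative (\<lambda>v. (exp (- fst p) * (cos (snd p) * v $ 1 + sin (snd p) * v $ 2),
     exp (- fst p) * (cos (snd p) * v $ 2 - sin (snd p) * v $ 1)))) (at (logpolar p))"
proof -
  have "ang \<alpha> (logpolar p) = snd p" using chart_logpolar[of \<alpha> p] assms by (auto simp: chart_def prod_eq_iff)
  with assms have "ang \<alpha> (logpolar p) \<noteq> \<alpha>" by simp
  moreover have "(logpolar p $ 1 * v $ 1 + logpolar p $ 2 * v $ 2) / (norm (logpolar p))\<^sup>2 = exp (- fst p) * (cos (snd p) * v $ 1 + sin (snd p) * v $ 2)"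
    "(logpolar p $ 1 * v $ 2 - logpolar p $ 2 * v $ 1) / (norm (logpolar p))\<^sup>2 = exp (- fst p) * (cos (snd p) * v $ 2 - sin (snd p) * v $ 1)" for v :: "real^2"
    by (simp_all add: exp_minus field_simps power2_eq_square)
  ultimately show ?thesis using chart_derivative[of \<alpha> "logpolar p"] by (simp only: HOL.simp_thms not_False_eq_True)
qed

lemma chart_measurable: "chart \<alpha> \<in> borel \<rightarrow>\<^sub>M borel"
proof -
  have c: "continuous_on {x. ang \<alpha> x \<noteq> \<alpha>} (ang \<alpha>)"
  proof (intro continuous_at_imp_continuous_on ballI)
    fix x assume "x \<in> {x. ang \<alpha> x \<noteq> \<alpha>}"
    then have "isCont (\<lambda>x. snd (chart \<alpha> x)) x"
      by (intro continuous_snd has_derivative_continuous[OF chart_derivative]) auto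
    then show "isCont (ang \<alpha>) x" by (simp add: chart_def)
  qed
  have "(\<lambda>x. indicator {x. ang \<alpha> x \<noteq> \<alpha>} x *\<^sub>R ang \<alpha> x) \<in> borel_measurable borel"
    by (intro borel_measurable_continuous_on_indicator c borel_open open_chart_domain)
  moreover have "(\<lambda>x. indicator (- {x. ang \<alpha> x \<noteq> \<alpha>}) x * \<alpha>) \<in> borel_measurable borel"
    by (intro borel_measurable_times borel_measurable_indicator borel_comp borel_open open_chart_domain) auto
  ultimately have "(\<lambda>x. indicator {x. ang \<alpha> x \<noteq> \<alpha>} x *\<^sub>R ang \<alpha> x + indicator (- {x. ang \<alpha> x \<noteq> \<alpha>}) x * \<alpha>) \<in> borel_measurable borel"
    by (rule borel_measurable_add)
  also have "(\<lambda>x. indicator {x. ang \<alpha> x \<noteq> \<alpha>} x *\<^sub>R ang \<alpha> x + indicator (- {x. ang \<alpha> x \<noteq> \<alpha>}) x * \<alpha>) = ang \<alpha>"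
    by (auto simp: fun_eq_iff indicator_def)
  finally have "ang \<alpha> \<in> borel_measurable borel" .
  then show ?thesis unfolding chart_def[abs_def] borel_prod[symmetric] by measurable
qed

lemma logpolar_measurable: "logpolar \<in> borel \<rightarrow>\<^sub>M borel"
  unfolding logpolar_def vector2_eq by (intro borel_measurable_continuous_onI continuous_intros)

lemma strip_measurable [measurable]: "strip \<alpha> \<in> sets borel"
  unfolding strip_def borel_prod[symmetric] by measurable

text \<open>The missed points have angle \<alpha> or are the origin; all of them lie on one
  line.\<close>

lemma ball_minus_logpolar_negligible: "negligible (ball 0 1 - logpolar ` strip \<alpha>)"
proof (rule negligible_subset)
  let ?n = "vector [- sin \<alpha>, cos \<alpha>] :: real^2"
  have "sin \<alpha> \<noteq> 0 \<or> cos \<alpha> \<noteq> 0"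
    using sin_cos_squared_add[of \<alpha>] by (metis add_0 power_zero_numeral zero_neq_one)
  then have "?n \<noteq> 0" by (auto simp: vec_eq_iff forall_2)
  then show "negligible {x. ?n \<bullet> x = 0}" by (intro negligible_hyperplane) simp
  show "ball 0 1 - logpolar ` strip \<alpha> \<subseteq> {x. ?n \<bullet> x = 0}"
  proof
    fix x assume x: "x \<in> ball 0 1 - logpolar ` strip \<alpha>"
    have "ang \<alpha> x = \<alpha>"
    proof (rule ccontr)
      assume a: "ang \<alpha> x \<noteq> \<alpha>"
      then have x0: "x \<noteq> 0" by auto
      have "chart \<alpha> x \<in> strip \<alpha>"
        using x x0 a ang_range[of \<alpha> x] by (auto simp: chart_def strip_def)
      then show False using x logpolar_chart[OF x0, of \<alpha>] by (metis DiffD2 image_eqI)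
    qed
    then show "x \<in> {x. ?n \<bullet> x = 0}"
      unfolding ang_eq_iff by (simp add: complex_nonneg_Reals_iff inner_vec_def sum_2)
  qed
qed

lemma logpolar_weight_measurable [measurable]: "(\<lambda>p. exp (2 * fst p) * indicator (strip \<alpha>) p :: real) \<in> borel_measurable borel"
proof (rule borel_measurable_times)
  show "(\<lambda>p::real\<times>real. exp (2 * fst p)) \<in> borel_measurable borel"
    by (intro borel_measurable_continuous_onI continuous_intros)
  show "(indicator (strip \<alpha>) :: _ \<Rightarrow> real) \<in> borel_measurable borel"
    by (intro borel_measurable_indicator strip_measurable)
qed

lemma ball_weight_measurable: "(\<lambda>x. ennreal (indicator (ball 0 1 :: (real^2) set) x)) \<in> borel_measurable lborel"
  by (intro measurable_compose[OF _ measurable_ennreal] borel_measurable_indicator) simp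

lemma strip_weight_measurable: "(\<lambda>p. ennreal (exp (2 * fst p) * indicator (strip \<alpha>) p)) \<in> borel_measurable lborel"
  using logpolar_weight_measurable by simp

text \<open>Change of variables with Jacobian e^(2s). As an equality of measures it transfers
  integrals, integrability and null sets alike.\<close>

lemma logpolar_measure:
  "distr (density lborel (\<lambda>p. ennreal (exp (2 * fst p) * indicator (strip \<alpha>) p))) borel logpolar =
   density lborel (\<lambda>x. ennreal (indicator (ball 0 1) x))"
proof (rule measure_eqI)
  fix A :: "(real^2) set"
  assume "A \<in> sets (distr (density lborel (\<lambda>p. ennreal (exp (2 * fst p) * indicator (strip \<alpha>) p))) borel logpolar)"
  then have A: "A \<in> sets borel" by simp
  let ?v = "\<lambda>p::real\<times>real. vector [fst p, snd p] :: real^2"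
  define g :: "real^2 \<Rightarrow> real^2" where "g z = logpolar (z $ 1, z $ 2)" for z
  define g' :: "real^2 \<Rightarrow> real^2 \<Rightarrow> real^2" where "g' z h = vector [exp (z $ 1) * (cos (z $ 2) * h $ 1 - sin (z $ 2) * h $ 2),
     exp (z $ 1) * (sin (z $ 2) * h $ 1 + cos (z $ 2) * h $ 2)]" for z h
  have gb: "g \<in> borel \<rightarrow>\<^sub>M borel"
    unfolding g_def logpolar_def vector2_eq by (intro borel_measurable_continuous_onI continuous_intros)
  define S where "S = {z::real^2. (z $ 1, z $ 2) \<in> strip \<alpha>} \<inter> g -` A"
  have nthb: "(\<lambda>z::real^2. (z $ 1, z $ 2)) \<in> borel \<rightarrow>\<^sub>M borel"
    by (intro borel_measurable_continuous_onI continuous_intros)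
  have Sb: "S \<in> sets borel"
    unfolding S_def using measurable_sets[OF gb A] measurable_sets[OF nthb strip_measurable, of \<alpha>]
    by (auto simp: vimage_def)
  have der: "(g has_derivative g' z) (at z within S)" for z
    unfolding g_def[abs_def] g'_def[abs_def] logpolar_def vector2_eq fst_conv snd_conv
    by (auto intro!: derivative_eq_intros bounded_linear_imp_has_derivative[OF bounded_linear_vec_nth] ext simp: algebra_simps)
  have det: "\<bar>det (matrix (g' z))\<bar> = exp (2 * z $ 1)" for z
  proof -
    have e: "x * c * (x * c) + x * t * (x * t) = x\<^sup>2 * (c\<^sup>2 + t\<^sup>2)" for x c t :: real
      by (simp add: power2_eq_square algebra_simps)
    have "det (matrix (g' z)) = exp (z $ 1) * cos (z $ 2) * (exp (z $ 1) * cos (z $ 2)) + exp (z $ 1) * sin (z $ 2) * (exp (z $ 1) * sin (z $ 2))"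
      by (simp add: det_2 matrix_def g'_def axis_def)
    also have "\<dots> = (exp (z $ 1))\<^sup>2 * ((cos (z $ 2))\<^sup>2 + (sin (z $ 2))\<^sup>2)" by (rule e)
    also have "\<dots> = exp (2 * z $ 1)" by (simp add: exp_double)
    finally show ?thesis by simp
  qed
  have inj: "inj_on g S"
  proof (rule inj_onI)
    fix x y assume xy: "x \<in> S" "y \<in> S" "g x = g y"
    have "chart \<alpha> (g x) = (x $ 1, x $ 2)" "chart \<alpha> (g y) = (y $ 1, y $ 2)"
      unfolding g_def using xy by (auto intro!: chart_logpolar simp: S_def strip_def)
    then show "x = y" using xy(3) by (simp add: vec_eq_iff forall_2)
  qed
  have img: "g ` S = logpolar ` strip \<alpha> \<inter> A"
  proof (intro equalityI subsetI)
    fix x assume "x \<in> logpolar ` strip \<alpha> \<inter> A"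
    then obtain p where p: "p \<in> strip \<alpha>" "x = logpolar p" "x \<in> A" by auto
    have "g (?v p) = x" using p by (simp add: g_def)
    with p show "x \<in> g ` S" by (intro image_eqI[of _ _ "?v p"]) (auto simp: S_def)
  qed (auto simp: S_def g_def)
  have sub: "logpolar ` strip \<alpha> \<inter> A \<subseteq> ball 0 1 \<inter> A"
    by (auto simp: strip_def)
  have lm: "ball 0 1 \<inter> A \<in> lmeasurable"
    using A by (intro bounded_set_imp_lmeasurable bounded_Int) auto
  have neg: "negligible ((ball 0 1 \<inter> A - logpolar ` strip \<alpha> \<inter> A) \<union> (logpolar ` strip \<alpha> \<inter> A - ball 0 1 \<inter> A))"
    using sub by (intro negligible_subset[OF ball_minus_logpolar_negligible[of \<alpha>]]) auto
  have "g ` S \<in> lmeasurable \<and> measure lebesgue (g ` S) = measure lebesgue (ball 0 1 \<inter> A)"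
    unfolding img using lmeasurable_negligible_symdiff[OF lm neg] measure_negligible_symdiff[OF lm neg] by auto
  then have "((\<lambda>z. exp (2 * z $ 1)) has_integral (measure lebesgue (ball 0 1 \<inter> A))) S"
    using has_measure_differentiable_image[of S g g' "measure lebesgue (ball 0 1 \<inter> A)"] Sb der inj by (simp add: det)
  then have "((\<lambda>z. indicator S z * exp (2 * z $ 1)) has_integral (measure lebesgue (ball 0 1 \<inter> A))) UNIV"
    by (subst (asm) has_integral_restrict_UNIV[symmetric]) (simp add: indicator_def of_bool_def if_distrib if_distribR cong: if_cong)
  moreover have m1: "(\<lambda>z::real^2. exp (2 * z $ 1)) \<in> borel_measurable borel"
    by (intro borel_measurable_continuous_onI continuous_intros)
  ultimately have "(\<integral>\<^sup>+z. ennreal (indicator S z * exp (2 * z $ 1)) \<partial>lborel) = ennreal (measure lebesgue (ball 0 1 \<inter> A))"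
    using Sb by (intro nn_integral_has_integral_lborel) (auto intro!: borel_measurable_times)
  also have "\<dots> = emeasure lebesgue (ball 0 1 \<inter> A)" using lm by (simp add: emeasure_eq_measure2)
  also have "\<dots> = emeasure lborel (ball 0 1 \<inter> A)" using A by simp
  finally have 1: "emeasure lborel (ball 0 1 \<inter> A) = (\<integral>\<^sup>+z. ennreal (indicator S z * exp (2 * z $ 1)) \<partial>lborel)" ..
  also have "\<dots> = (\<integral>\<^sup>+z. ennreal (indicator S z * exp (2 * z $ 1)) \<partial>distr lborel borel ?v)"
    by (simp add: lborel_real2)
  also have "\<dots> = (\<integral>\<^sup>+p. ennreal (indicator S (?v p) * exp (2 * fst p)) \<partial>lborel)"
    using Sb m1 vector2_measurable by (subst nn_integral_distr) auto
  also have "\<dots> = (\<integral>\<^sup>+p. ennreal (exp (2 * fst p) * indicator (strip \<alpha>) p) * indicator (logpolar -` A) p \<partial>lborel)"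
    by (intro nn_integral_cong) (auto simp: S_def g_def indicator_def)
  also have "\<dots> = emeasure (density lborel (\<lambda>p. ennreal (exp (2 * fst p) * indicator (strip \<alpha>) p))) (logpolar -` A)"
    using measurable_sets[OF logpolar_measurable A] by (subst emeasure_density[OF strip_weight_measurable]) auto
  also have "\<dots> = emeasure (distr (density lborel (\<lambda>p. ennreal (exp (2 * fst p) * indicator (strip \<alpha>) p))) borel logpolar) A"
    using A logpolar_measurable by (subst emeasure_distr) auto
  finally have "emeasure (distr (density lborel (\<lambda>p. ennreal (exp (2 * fst p) * indicator (strip \<alpha>) p))) borel logpolar) A
     = emeasure lborel (ball 0 1 \<inter> A)" by simp
  also have "\<dots> = emeasure (density lborel (\<lambda>x. ennreal (indicator (ball 0 1) x))) A"
    using A by (subst emeasure_density) (auto simp: indicator_inter_arith[symmetric] ennreal_indicator nn_integral_indicator[symmetric] simp del: nn_integral_indicator intro!: nn_integral_cong simp: indicator_def)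
  finally show "emeasure (distr (density lborel (\<lambda>p. ennreal (exp (2 * fst p) * indicator (strip \<alpha>) p))) borel logpolar) A =
      emeasure (density lborel (\<lambda>x. ennreal (indicator (ball 0 1) x))) A" .
qed simp

lemma logpolar_integral:
  fixes h :: "real^2 \<Rightarrow> real"
  assumes h: "h \<in> borel_measurable borel"
  shows "integrable lborel (\<lambda>x. indicator (ball 0 1) x * h x) \<longleftrightarrow>
      integrable lborel (\<lambda>p. exp (2 * fst p) * indicator (strip \<alpha>) p * h (logpolar p))"
    and "(LINT x|lborel. indicator (ball 0 1) x * h x) = (LINT p|lborel. exp (2 * fst p) * indicator (strip \<alpha>) p * h (logpolar p))"
proof -
  let ?d = "density lborel (\<lambda>p. ennreal (exp (2 * fst p) * indicator (strip \<alpha>) p))"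
  have hl: "(\<lambda>p. h (logpolar p)) \<in> borel_measurable borel"
    using measurable_compose[OF logpolar_measurable h] .
  have "integrable lborel (\<lambda>x. indicator (ball 0 1) x * h x) \<longleftrightarrow> integrable (density lborel (\<lambda>x. ennreal (indicator (ball 0 1) x))) h"
    using h by (subst integrable_density) (auto intro!: borel_measurable_indicator)
  also have "\<dots> \<longleftrightarrow> integrable (distr ?d borel logpolar) h" by (simp only: logpolar_measure)
  also have "\<dots> \<longleftrightarrow> integrable ?d (\<lambda>p. h (logpolar p))"
    using h logpolar_measurable by (subst integrable_distr_eq) auto
  also have "\<dots> \<longleftrightarrow> integrable lborel (\<lambda>p. exp (2 * fst p) * indicator (strip \<alpha>) p * h (logpolar p))"
    using hl by (subst integrable_density) auto
  finally show "integrable lborel (\<lambda>x. indicator (ball 0 1) x * h x) \<longleftrightarrow>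
      integrable lborel (\<lambda>p. exp (2 * fst p) * indicator (strip \<alpha>) p * h (logpolar p))" .
  have "(LINT x|lborel. indicator (ball 0 1) x * h x) = (LINT x|density lborel (\<lambda>x. ennreal (indicator (ball 0 1) x)). h x)"
    using h by (subst integral_density) (auto intro!: borel_measurable_indicator)
  also have "\<dots> = (LINT x|distr ?d borel logpolar. h x)" by (simp only: logpolar_measure)
  also have "\<dots> = (LINT p|?d. h (logpolar p))"
    using h logpolar_measurable by (subst integral_distr) auto
  also have "\<dots> = (LINT p|lborel. exp (2 * fst p) * indicator (strip \<alpha>) p * h (logpolar p))"
    using hl by (subst integral_density) auto
  finally show "(LINT x|lborel. indicator (ball 0 1) x * h x) = (LINT p|lborel. exp (2 * fst p) * indicator (strip \<alpha>) p * h (logpolar p))" .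
qed

lemma AE_ball_imp_strip:
  assumes "AE x in lborel. x \<in> ball 0 1 \<longrightarrow> P x"
  shows "AE p in lborel. p \<in> strip \<alpha> \<longrightarrow> P (logpolar p)"
proof -
  let ?d = "density lborel (\<lambda>p. ennreal (exp (2 * fst p) * indicator (strip \<alpha>) p))"
  have "AE x in density lborel (\<lambda>x. ennreal (indicator (ball 0 1) x)). P x"
    using assms by (subst AE_density[OF ball_weight_measurable]) (auto elim!: eventually_mono simp: indicator_def)
  then have "AE x in distr ?d borel logpolar. P x" by (simp only: logpolar_measure)
  then have "AE p in ?d. P (logpolar p)"
    using AE_distrD[of logpolar ?d borel P] logpolar_measurable by simp
  then show ?thesis by (subst (asm) AE_density[OF strip_weight_measurable]) (auto elim!: eventually_mono simp: indicator_def)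
qed

lemma AE_strip_imp_ball:
  assumes "AE p in lborel. p \<in> strip \<alpha> \<longrightarrow> P p"
  shows "AE x in lborel. x \<in> ball 0 1 \<longrightarrow> P (chart \<alpha> x)"
proof -
  let ?d = "density lborel (\<lambda>p. ennreal (exp (2 * fst p) * indicator (strip \<alpha>) p))"
  from AE_E[OF assms] obtain N where "{p \<in> space lborel. \<not> (p \<in> strip \<alpha> \<longrightarrow> P p)} \<subseteq> N"
    "emeasure lborel N = 0" "N \<in> sets lborel" .
  then have N: "{p \<in> space lborel. \<not> (p \<in> strip \<alpha> \<longrightarrow> P p)} \<subseteq> N" "N \<in> null_sets lborel" by auto
  then have Nb: "N \<in> sets borel" by auto
  have "AE p in lborel. p \<notin> N" using N(2) by (rule AE_not_in)
  then have "AE p in ?d. chart \<alpha> (logpolar p) \<notin> N"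
    by (subst AE_density[OF strip_weight_measurable]) (auto elim!: eventually_mono simp: indicator_def strip_def chart_logpolar)
  moreover have m: "{x \<in> space borel. chart \<alpha> x \<notin> N} \<in> sets borel"
    using measurable_sets[OF chart_measurable Nb, of \<alpha>] by (auto simp: vimage_def Compl_eq[symmetric] Collect_neg_eq)
  ultimately have "AE x in distr ?d borel logpolar. chart \<alpha> x \<notin> N"
    using logpolar_measurable by (subst AE_distr_iff) auto
  then have "AE x in density lborel (\<lambda>x. ennreal (indicator (ball 0 1) x)). chart \<alpha> x \<notin> N" by (simp only: logpolar_measure)
  then have *: "AE x in lborel. x \<in> ball 0 1 \<longrightarrow> chart \<alpha> x \<notin> N"
    by (subst (asm) AE_density[OF ball_weight_measurable]) (auto elim!: eventually_mono simp: indicator_def)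
  have "ball 0 1 - logpolar ` strip \<alpha> \<in> null_sets lebesgue"
    using ball_minus_logpolar_negligible by (simp add: negligible_iff_null_sets)
  then have "AE x in lebesgue. x \<notin> ball 0 1 - logpolar ` strip \<alpha>" by (rule AE_not_in)
  then have "AE x in lborel. x \<notin> ball 0 1 - logpolar ` strip \<alpha>" by (simp add: AE_completion_iff)
  with * show ?thesis
  proof eventually_elim
    case (elim x)
    show ?case
    proof
      assume x: "x \<in> ball 0 1"
      with elim obtain p where p: "p \<in> strip \<alpha>" "x = logpolar p" by blast
      then have "chart \<alpha> x = p" by (auto simp: strip_def chart_logpolar)
      with elim x p N(1) show "P (chart \<alpha> x)" by auto
    qed
  qed
qed

section \<open>Locally Lipschitz functions\<close>

text \<open>Unlike a global Lipschitz bound, the local one survives products, and it may be checked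
  separately on and off the support. Compact support restores a global constant in
  \<open>loc_lip_imp_lipschitz_cpt\<close>.\<close>

definition loc_lip :: "('a::metric_space \<Rightarrow> 'b::metric_space) \<Rightarrow> 'a \<Rightarrow> bool" where
  "loc_lip f x \<longleftrightarrow> (\<exists>e>0. \<exists>C\<ge>0. \<forall>y\<in>ball x e. \<forall>z\<in>ball x e. dist (f y) (f z) \<le> C * dist y z)"

lemma loc_lipE:
  assumes "loc_lip f x"
  obtains e C where "e > 0" "C \<ge> 0" "\<And>y z. y \<in> ball x e \<Longrightarrow> z \<in> ball x e \<Longrightarrow> dist (f y) (f z) \<le> C * dist y z"
  using assms unfolding loc_lip_def by blast

lemma loc_lip_const [intro]: "loc_lip (\<lambda>x. c) x"
  unfolding loc_lip_def by (intro exI[of _ 1] conjI exI[of _ 0]) auto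

lemma lipschitz_imp_loc_lip: "(\<And>y z. dist (f y) (f z) \<le> C * dist y z) \<Longrightarrow> C \<ge> 0 \<Longrightarrow> loc_lip f x"
  unfolding loc_lip_def by (intro exI[of _ 1] conjI exI[of _ C]) auto

lemma loc_lip_fst [intro]: "loc_lip fst x" and loc_lip_snd [intro]: "loc_lip snd x"
  by (rule lipschitz_imp_loc_lip[of _ 1]; simp add: dist_fst_le dist_snd_le)+

lemma loc_lip_compose:
  assumes g: "loc_lip g (f x)" and f: "loc_lip f x"
  shows "loc_lip (\<lambda>x. g (f x)) x"
proof -
  obtain e C where e: "e > 0" "C \<ge> 0" "\<And>y z. y \<in> ball x e \<Longrightarrow> z \<in> ball x e \<Longrightarrow> dist (f y) (f z) \<le> C * dist y z"
    using f by (rule loc_lipE) blast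
  obtain e' C' where e': "e' > 0" "C' \<ge> 0" "\<And>y z. y \<in> ball (f x) e' \<Longrightarrow> z \<in> ball (f x) e' \<Longrightarrow> dist (g y) (g z) \<le> C' * dist y z"
    using g by (rule loc_lipE) blast
  let ?d = "min e (e' / (C + 1))"
  have d: "?d > 0" using e e' by auto
  have in_ball: "f y \<in> ball (f x) e'" if "y \<in> ball x ?d" for y
  proof -
    have "dist (f x) (f y) \<le> C * dist x y" using that e(1) e(3)[of x y] by auto
    also have "\<dots> \<le> (C + 1) * dist x y" by (intro mult_right_mono) auto
    also have "\<dots> < (C + 1) * (e' / (C + 1))" using that e(2) by (intro mult_strict_left_mono) auto
    also have "\<dots> = e'" using e(2) by simp
    finally show ?thesis by simp
  qed
  have "dist (g (f y)) (g (f z)) \<le> (C' * C) * dist y z" if "y \<in> ball x ?d" "z \<in> ball x ?d" for y z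
  proof -
    have "dist (g (f y)) (g (f z)) \<le> C' * dist (f y) (f z)" using that in_ball by (intro e'(3)) auto
    also have "\<dots> \<le> C' * (C * dist y z)" using that e'(2) by (intro mult_left_mono e(3)) auto
    finally show ?thesis by (simp add: mult.assoc)
  qed
  then show ?thesis unfolding loc_lip_def using d e(2) e'(2) by (intro exI[of _ ?d] conjI exI[of _ "C' * C"]) auto
qed

lemma loc_lip_cong:
  assumes "loc_lip f x" "open U" "x \<in> U" "\<And>y. y \<in> U \<Longrightarrow> g y = f y"
  shows "loc_lip g x"
proof -
  obtain e C where e: "e > 0" "C \<ge> 0" "\<And>y z. y \<in> ball x e \<Longrightarrow> z \<in> ball x e \<Longrightarrow> dist (f y) (f z) \<le> C * dist y z"
    using assms(1) by (rule loc_lipE) blast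
  obtain d where d: "d > 0" "ball x d \<subseteq> U" using assms(2,3) openE by blast
  show ?thesis unfolding loc_lip_def
    using d e assms(4) by (intro exI[of _ "min e d"] conjI exI[of _ C]) (auto simp: subset_iff)
qed

lemma loc_lip_add:
  fixes f g :: "'a::metric_space \<Rightarrow> real"
  assumes "loc_lip f x" "loc_lip g x" shows "loc_lip (\<lambda>x. f x + g x) x"
proof -
  obtain e C where e: "e > 0" "C \<ge> 0" "\<And>y z. y \<in> ball x e \<Longrightarrow> z \<in> ball x e \<Longrightarrow> dist (f y) (f z) \<le> C * dist y z"
    using assms(1) by (rule loc_lipE) blast
  obtain e' C' where e': "e' > 0" "C' \<ge> 0" "\<And>y z. y \<in> ball x e' \<Longrightarrow> z \<in> ball x e' \<Longrightarrow> dist (g y) (g z) \<le> C' * dist y z"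
    using assms(2) by (rule loc_lipE) blast
  have "dist (f y + g y) (f z + g z) \<le> (C + C') * dist y z" if "y \<in> ball x (min e e')" "z \<in> ball x (min e e')" for y z
    using e(3)[of y z] e'(3)[of y z] that dist_triangle_add[of "f y" "g y" "f z" "g z"] by (simp add: distrib_right)
  then show ?thesis unfolding loc_lip_def using e e'
    by (intro exI[of _ "min e e'"] conjI exI[of _ "C + C'"]) auto
qed

lemma loc_lip_mult:
  fixes f g :: "'a::metric_space \<Rightarrow> real"
  assumes "loc_lip f x" "loc_lip g x" shows "loc_lip (\<lambda>x. f x * g x) x"
proof -
  obtain e C where e: "e > 0" "C \<ge> 0" "\<And>y z. y \<in> ball x e \<Longrightarrow> z \<in> ball x e \<Longrightarrow> dist (f y) (f z) \<le> C * dist y z"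
    using assms(1) by (rule loc_lipE) blast
  obtain e' C' where e': "e' > 0" "C' \<ge> 0" "\<And>y z. y \<in> ball x e' \<Longrightarrow> z \<in> ball x e' \<Longrightarrow> dist (g y) (g z) \<le> C' * dist y z"
    using assms(2) by (rule loc_lipE) blast
  define A where "A = \<bar>f x\<bar> + C * e"
  define B where "B = \<bar>g x\<bar> + C' * e'"
  have AB: "A \<ge> 0" "B \<ge> 0" using e e' by (auto simp: A_def B_def)
  have fA: "\<bar>f y\<bar> \<le> A" if "y \<in> ball x e" for y
  proof -
    have "dist (f y) (f x) \<le> C * dist y x" using that e by auto
    also have "\<dots> \<le> C * e" using that e by (intro mult_left_mono) (auto simp: dist_commute)
    finally show ?thesis by (auto simp: A_def dist_real_def)
  qed
  have gB: "\<bar>g y\<bar> \<le> B" if "y \<in> ball x e'" for y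
  proof -
    have "dist (g y) (g x) \<le> C' * dist y x" using that e' by auto
    also have "\<dots> \<le> C' * e'" using that e' by (intro mult_left_mono) (auto simp: dist_commute)
    finally show ?thesis by (auto simp: B_def dist_real_def)
  qed
  have "dist (f y * g y) (f z * g z) \<le> (A * C' + B * C) * dist y z" if "y \<in> ball x (min e e')" "z \<in> ball x (min e e')" for y z
  proof -
    have "f y * g y - f z * g z = f y * (g y - g z) + g z * (f y - f z)" by (simp add: algebra_simps)
    then have "\<bar>f y * g y - f z * g z\<bar> \<le> \<bar>f y\<bar> * \<bar>g y - g z\<bar> + \<bar>g z\<bar> * \<bar>f y - f z\<bar>"
      by (metis abs_mult abs_triangle_ineq)
    also have "\<dots> \<le> A * (C' * dist y z) + B * (C * dist y z)"
      using that AB fA[of y] gB[of z] e(3)[of y z] e'(3)[of y z]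
      by (intro add_mono mult_mono) (auto simp: dist_real_def)
    finally show ?thesis by (simp add: dist_real_def algebra_simps)
  qed
  then show ?thesis unfolding loc_lip_def using e e' AB
    by (intro exI[of _ "min e e'"] conjI exI[of _ "A * C' + B * C"]) auto
qed

lemma loc_lip_derivative:
  fixes f :: "'a::real_normed_vector \<Rightarrow> 'b::real_normed_vector"
  assumes U: "open U" "x \<in> U" and der: "\<And>y. y \<in> U \<Longrightarrow> (f has_derivative f' y) (at y)"
    and bound: "\<And>y v. y \<in> U \<Longrightarrow> norm (f' y v) \<le> C * norm v" and C: "C \<ge> 0"
  shows "loc_lip f x"
proof -
  obtain e where e: "e > 0" "ball x e \<subseteq> U" using U openE by blast
  have "dist (f y) (f z) \<le> C * dist y z" if "y \<in> ball x e" "z \<in> ball x e" for y z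
    unfolding dist_norm
  proof (rule differentiable_bound[OF convex_ball _ _ that])
    show "(f has_derivative f' y) (at y within ball x e)" if "y \<in> ball x e" for y
      using der that e by (blast intro: has_derivative_at_withinI)
    show "onorm (f' y) \<le> C" if "y \<in> ball x e" for y
      by (rule onorm_bound[OF C]) (use bound that e in blast)
  qed
  then show ?thesis unfolding loc_lip_def using e C by blast
qed

lemma loc_lip_smooth1: "smooth1 f \<Longrightarrow> loc_lip f x"
proof -
  assume f: "smooth1 f"
  have "continuous_on (cball x 1) (deriv f)" using smooth1_deriv(2)[OF f] smooth1_continuous by blast
  then have "bounded (deriv f ` cball x 1)" using compact_continuous_image compact_imp_bounded compact_cball by blast
  then obtain C where "\<forall>y\<in>cball x 1. \<bar>deriv f y\<bar> \<le> C" by (auto simp: bounded_iff)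
  then have C: "\<bar>deriv f y\<bar> \<le> C" if "y \<in> cball x 1" for y using that by blast
  show ?thesis
  proof (rule loc_lip_derivative[of "ball x 1" x f "\<lambda>y v. deriv f y * v" C])
    show "(f has_derivative (\<lambda>v. deriv f y * v)) (at y)" for y
      using smooth1_deriv(1)[OF f, of y] by (simp add: has_field_derivative_def)
    show "norm (deriv f y * v) \<le> C * norm v" if "y \<in> ball x 1" for y v
      using C[of y] that by (auto simp: abs_mult intro!: mult_right_mono)
    show "C \<ge> 0" using C[of x] by (auto intro: order_trans[OF abs_ge_zero])
  qed auto
qed

text \<open>Compactness gives one constant on a ball that exceeds the support by 1. If one point
  lies outside that ball, either both values vanish or the points are at distance at least 1, and a
  bound for |w| serves as the constant.\<close>

lemma loc_lip_imp_lipschitz_cpt: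
  fixes w :: "'a::euclidean_space \<Rightarrow> real"
  assumes lip: "\<And>x. loc_lip w x" and supp: "\<And>x. norm x > R \<Longrightarrow> w x = 0"
  shows "\<exists>L R. lipschitz_cpt w L R"
proof -
  define R' where "R' = \<bar>R\<bar>"
  let ?X = "cball 0 (R' + 1) :: 'a set"
  have "local_lipschitz {0::real} ?X (\<lambda>t. w)"
  proof (rule local_lipschitzI)
    fix t :: real and x assume "t \<in> {0}" "x \<in> ?X"
    obtain e C where e: "e > 0" "C \<ge> 0" "\<And>y z. y \<in> ball x e \<Longrightarrow> z \<in> ball x e \<Longrightarrow> dist (w y) (w z) \<le> C * dist y z"
      using lip[of x] by (rule loc_lipE) blast
    then show "\<exists>u>0. \<exists>L. \<forall>t\<in>cball t u \<inter> {0}. L-lipschitz_on (cball x u \<inter> ?X) w"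
      by (intro exI[of _ "e / 2"] conjI exI[of _ C]) (auto simp: lipschitz_on_def)
  qed
  then obtain L where L: "L-lipschitz_on ?X w"
    by (rule local_lipschitz_compact_implies_lipschitz) auto
  then have L0: "L \<ge> 0" and Ll: "\<And>x y. x \<in> ?X \<Longrightarrow> y \<in> ?X \<Longrightarrow> \<bar>w x - w y\<bar> \<le> L * dist x y"
    by (auto simp: lipschitz_on_def dist_real_def)
  have "continuous_on ?X w" using L by (rule lipschitz_on_continuous_on)
  then have "bounded (w ` ?X)" using compact_continuous_image compact_imp_bounded compact_cball by blast
  then obtain B where "\<forall>x\<in>?X. \<bar>w x\<bar> \<le> B" by (auto simp: bounded_iff)
  then have B: "\<bar>w x\<bar> \<le> B" if "x \<in> ?X" for x using that by blast
  have far: "\<bar>w x - w y\<bar> \<le> max L B * dist x y" if "norm y > R' + 1" for x y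
  proof (cases "norm x > R'")
    case True
    then show ?thesis using that supp[of x] supp[of y] L0 by (auto simp: R'_def)
  next
    case False
    have "1 \<le> dist x y" using norm_triangle_ineq2[of y x] that False by (simp add: dist_norm norm_minus_commute)
    have "\<bar>w x - w y\<bar> \<le> B" using supp[of y] that B[of x] False by (auto simp: R'_def)
    also have "\<dots> \<le> max L B * 1" by simp
    also have "\<dots> \<le> max L B * dist x y" using \<open>1 \<le> dist x y\<close> L0 by (intro mult_left_mono) auto
    finally show ?thesis .
  qed
  have "lipschitz_cpt w (max L B) R'"
  proof
    fix x y
    consider "norm y > R' + 1" | "norm x > R' + 1" | "x \<in> ?X" "y \<in> ?X" by fastforce
    then show "\<bar>w x - w y\<bar> \<le> max L B * dist x y"
    proof cases
      case 2 then show ?thesis using far[of x y] by (simp add: dist_commute abs_minus_commute)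
    next
      case 3
      have "L * dist x y \<le> max L B * dist x y" by (intro mult_right_mono) auto
      with Ll[OF 3] show ?thesis by simp
    qed (rule far)
  qed (use supp in \<open>auto simp: R'_def\<close>)
  then show ?thesis by blast
qed

section \<open>Functions given in logarithmic polar coordinates\<close>

abbreviation "e1 \<equiv> axis 1 1 :: real^2"
abbreviation "e2 \<equiv> axis 2 1 :: real^2"

text \<open>The derivative of \<open>W \<circ> chart \<alpha>\<close> in direction \<open>b\<close>, in terms of the partial derivatives \<open>W1\<close> and \<open>W2\<close>.\<close>

definition dop :: "real^2 \<Rightarrow> (real \<times> real \<Rightarrow> real) \<Rightarrow> (real \<times> real \<Rightarrow> real) \<Rightarrow> real \<times> real \<Rightarrow> real" where
  "dop b W1 W2 p = exp (- fst p) * (W1 p * (b $ 1 * cos (snd p) + b $ 2 * sin (snd p)) +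
     W2 p * (b $ 2 * cos (snd p) - b $ 1 * sin (snd p)))"

lemma loc_lip_chart:
  assumes "ang \<alpha> x \<noteq> \<alpha>" shows "loc_lip (chart \<alpha>) x"
proof -
  have x0: "x \<noteq> 0" using assms by auto
  let ?U = "{y. ang \<alpha> y \<noteq> \<alpha>} \<inter> {y. norm y > norm x / 2}"
  show ?thesis
  \<comment> \<open>Where |y| > |x| / 2, each component of the derivative is at most |v| / |y|, so
    both together are at most 4 |v| / |x|.\<close>
  proof (rule loc_lip_derivative[of ?U x _ _ "4 / norm x"])
    show "open ?U" by (intro open_Int open_chart_domain open_Collect_less continuous_intros)
    show "x \<in> ?U" using assms x0 by auto
    show "(chart \<alpha> has_derivative (\<lambda>v. ((y $ 1 * v $ 1 + y $ 2 * v $ 2) / (norm y)\<^sup>2, (y $ 1 * v $ 2 - y $ 2 * v $ 1) / (norm y)\<^sup>2))) (at y)"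
      if "y \<in> ?U" for y using that by (intro chart_derivative) auto
    show "norm ((y $ 1 * v $ 1 + y $ 2 * v $ 2) / (norm y)\<^sup>2, (y $ 1 * v $ 2 - y $ 2 * v $ 1) / (norm y)\<^sup>2) \<le> 4 / norm x * norm v"
      if "y \<in> ?U" for y and v :: "real^2"
    proof -
      have y: "norm y > norm x / 2" "norm y > 0" using that x0 by (auto intro: less_trans[rotated])
      let ?v = "vector [v $ 2, - v $ 1] :: real^2"
      have "\<bar>y \<bullet> v\<bar> \<le> norm y * norm v" "\<bar>y \<bullet> ?v\<bar> \<le> norm y * norm ?v" by (rule Cauchy_Schwarz_ineq2)+
      moreover have "norm ?v = norm v" by (simp add: norm_real2 add.commute)
      ultimately have b: "\<bar>y $ 1 * v $ 1 + y $ 2 * v $ 2\<bar> \<le> norm y * norm v" "\<bar>y $ 1 * v $ 2 - y $ 2 * v $ 1\<bar> \<le> norm y * norm v"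
        by (simp_all add: inner_vec_def sum_2)
      have "norm ((y $ 1 * v $ 1 + y $ 2 * v $ 2) / (norm y)\<^sup>2, (y $ 1 * v $ 2 - y $ 2 * v $ 1) / (norm y)\<^sup>2)
        \<le> \<bar>(y $ 1 * v $ 1 + y $ 2 * v $ 2) / (norm y)\<^sup>2\<bar> + \<bar>(y $ 1 * v $ 2 - y $ 2 * v $ 1) / (norm y)\<^sup>2\<bar>"
        using norm_Pair_le by (metis real_norm_def)
      also have "\<dots> \<le> norm y * norm v / (norm y)\<^sup>2 + norm y * norm v / (norm y)\<^sup>2"
        using b unfolding abs_divide by (intro add_mono divide_mono) (use y in auto)
      also have "\<dots> = 2 * norm v / norm y" using y by (simp add: power2_eq_square)
      also have "\<dots> \<le> 2 * norm v / (norm x / 2)" using y x0 by (intro divide_left_mono mult_pos_pos) auto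
      also have "\<dots> = 4 / norm x * norm v" by simp
      finally show ?thesis .
    qed
  qed auto
qed

text \<open>A closed rectangle inside the strip has a compact image in the disc that avoids the cut
  and the origin. A function supported on it can be pulled back to the plane and is locally zero
  wherever the chart misbehaves.\<close>

locale polar_rect =
  fixes \<alpha> s0 s1 ta tb :: real
  assumes t: "\<alpha> < ta" "tb < \<alpha> + 2 * pi" and s: "s1 < 0"
begin

definition "Q = {s0..s1} \<times> {ta..tb}"

definition "K = logpolar ` Q"

lemma compact_K: "compact K"
  unfolding K_def Q_def logpolar_def vector2_eq
  by (intro compact_continuous_image continuous_intros compact_Times compact_Icc)

lemma K_ball: "K \<subseteq> ball 0 1"
  using s by (auto simp: K_def Q_def)

lemma Q_strip: "Q \<subseteq> strip \<alpha>"
  using s t by (auto simp: Q_def strip_def)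

lemma chart_Q: "p \<in> Q \<Longrightarrow> chart \<alpha> (logpolar p) = p"
  using t by (intro chart_logpolar) (auto simp: Q_def)

lemma chart_in_Q: "chart \<alpha> x \<in> Q \<Longrightarrow> x \<in> K \<and> ang \<alpha> x \<noteq> \<alpha> \<and> x \<noteq> 0 \<and> logpolar (chart \<alpha> x) = x"
proof -
  assume q: "chart \<alpha> x \<in> Q"
  then have a: "ang \<alpha> x \<noteq> \<alpha>" using t by (auto simp: chart_def Q_def)
  then have x: "x \<noteq> 0" by auto
  then show ?thesis using q a logpolar_chart[OF x, of \<alpha>] unfolding K_def by (metis image_eqI)
qed

lemma not_K: "x \<notin> K \<Longrightarrow> chart \<alpha> x \<notin> Q"
  using chart_in_Q by blast

lemma pull_has_derivative:
  assumes supp: "\<And>p. p \<notin> Q \<Longrightarrow> W p = 0 \<and> W1 p = 0 \<and> W2 p = 0"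
    and der: "chart \<alpha> x \<in> Q \<Longrightarrow> (W has_derivative (\<lambda>q. W1 (chart \<alpha> x) * fst q + W2 (chart \<alpha> x) * snd q)) (at (chart \<alpha> x))"
  shows "((\<lambda>x. W (chart \<alpha> x)) has_derivative (\<lambda>v. dop v W1 W2 (chart \<alpha> x))) (at x)"
proof (cases "x \<in> K")
  case True
  then obtain p where p: "p \<in> Q" "x = logpolar p" by (auto simp: K_def)
  have cx: "chart \<alpha> x = p" using p chart_Q by simp
  have "(chart \<alpha> has_derivative (\<lambda>v. (exp (- fst p) * (cos (snd p) * v $ 1 + sin (snd p) * v $ 2),
     exp (- fst p) * (cos (snd p) * v $ 2 - sin (snd p) * v $ 1)))) (at x)"
    unfolding p(2) using p(1) t by (intro chart_derivative_logpolar) (auto simp: Q_def)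
  from has_derivative_compose[OF this, of W "\<lambda>q. W1 p * fst q + W2 p * snd q"] der p(1) cx
  show ?thesis by (simp add: dop_def algebra_simps)
next
  case False
  have "((\<lambda>x. W (chart \<alpha> x)) has_derivative (\<lambda>v. 0)) (at x)"
    using not_K supp False compact_K
    by (intro has_derivative_transform_within_open[OF has_derivative_const[of 0], of "- K"]) (auto intro: compact_imp_closed)
  then show ?thesis using supp[OF not_K[OF False]] by (simp add: dop_def)
qed

lemma pull_loc_lip:
  fixes W :: "real \<times> real \<Rightarrow> real"
  assumes supp: "\<And>p. p \<notin> Q \<Longrightarrow> W p = 0" and lip: "\<And>p. loc_lip W p"
  shows "\<exists>L R. lipschitz_cpt (\<lambda>x. W (chart \<alpha> x)) L R"
proof (rule loc_lip_imp_lipschitz_cpt[of _ 1])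
  fix x
  show "loc_lip (\<lambda>x. W (chart \<alpha> x)) x"
  proof (cases "x \<in> K")
    case True
    then have "ang \<alpha> x \<noteq> \<alpha>" using chart_in_Q chart_Q by (auto simp: K_def)
    then show ?thesis by (rule loc_lip_compose[OF lip loc_lip_chart])
  next
    case False
    show ?thesis using not_K supp False compact_K
      by (intro loc_lip_cong[OF loc_lip_const[of 0], of "- K"]) (auto intro: compact_imp_closed)
  qed
next
  fix x :: "real^2" assume "1 < norm x"
  then have "x \<notin> K" using K_ball by auto
  then show "W (chart \<alpha> x) = 0" using supp not_K by blast
qed

end

lemma loc_lip_dop:
  assumes "loc_lip W1 p" "loc_lip W2 p" shows "loc_lip (dop b W1 W2) p"
proof -
  have e: "loc_lip (\<lambda>p::real\<times>real. exp (- fst p)) p"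
    using loc_lip_compose[OF loc_lip_smooth1[OF smooth1_exp_cmult[of "-1"]] loc_lip_fst] by simp
  have c: "loc_lip (\<lambda>p::real\<times>real. cos (snd p)) p" "loc_lip (\<lambda>p::real\<times>real. sin (snd p)) p"
    by (rule loc_lip_compose[OF loc_lip_smooth1 loc_lip_snd]; simp)+
  have "loc_lip (\<lambda>p. exp (- fst p) * (W1 p * (b $ 1 * cos (snd p) + b $ 2 * sin (snd p)) +
     W2 p * (b $ 2 * cos (snd p) + (- b $ 1) * sin (snd p)))) p"
    by (intro loc_lip_mult loc_lip_add loc_lip_const assms e c)
  then show ?thesis unfolding dop_def[abs_def] by simp
qed

text \<open>The s-derivative of \<open>dop b W1 W2\<close>; the subtracted term comes from the
  factor e^(-s).\<close>

definition dop_s :: "real^2 \<Rightarrow> _ \<Rightarrow> _ \<Rightarrow> _ \<Rightarrow> _ \<Rightarrow> real \<times> real \<Rightarrow> real" where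
  "dop_s b W1 W2 W11 W21 p = dop b W11 W21 p - dop b W1 W2 p"

text \<open>The t-derivative of \<open>dop b W1 W2\<close>; differentiating the cosines and sines
  amounts to turning b by a right angle.\<close>

definition dop_t :: "real^2 \<Rightarrow> _ \<Rightarrow> _ \<Rightarrow> _ \<Rightarrow> _ \<Rightarrow> real \<times> real \<Rightarrow> real" where
  "dop_t b W1 W2 W12 W22 p = dop b W12 W22 p + dop (vector [b $ 2, - b $ 1]) W1 W2 p"

lemma dop_has_derivative:
  assumes "(W1 has_derivative (\<lambda>q. W11 p * fst q + W12 p * snd q)) (at p)"
    and "(W2 has_derivative (\<lambda>q. W21 p * fst q + W22 p * snd q)) (at p)"
  shows "(dop b W1 W2 has_derivative (\<lambda>q. dop_s b W1 W2 W11 W21 p * fst q + dop_t b W1 W2 W12 W22 p * snd q)) (at p)"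
  unfolding dop_def[abs_def]
  by (rule derivative_eq_intros assms refl | simp)+
     (auto simp: fun_eq_iff dop_s_def dop_t_def dop_def algebra_simps)

text \<open>The coordinates are conformal: first-order terms and mixed derivatives cancel between
  the two axes, and only the scale factor e^(-2s) remains.\<close>

lemma laplacian_polar:
  "dop e1 (dop_s e1 W1 W2 W11 W21) (dop_t e1 W1 W2 W12 W22) p + dop e2 (dop_s e2 W1 W2 W11 W21) (dop_t e2 W1 W2 W12 W22) p
    = exp (- 2 * fst p) * (W11 p + W22 p)"
proof -
  define E c d where "E = exp (- fst p)" and "c = cos (snd p)" and "d = sin (snd p)"
  have EE: "exp (- 2 * fst p) = E * E" by (simp add: E_def exp_add[symmetric])
  have cd: "d * d = 1 - c * c" using sin_cos_squared_add[of "snd p"] by (simp add: c_def d_def power2_eq_square)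
  have cd': "d * (d * x) = x - c * (c * x)" for x
  proof -
    have "d * (d * x) = (d * d) * x" by simp
    also have "\<dots> = x - c * (c * x)" unfolding cd by (simp add: algebra_simps)
    finally show ?thesis .
  qed
  show ?thesis
    unfolding dop_def dop_s_def dop_t_def EE unfolding E_def[symmetric] c_def[symmetric] d_def[symmetric]
    by (simp add: axis_def algebra_simps cd cd')
qed

text \<open>Second derivatives are demanded only almost everywhere, because those of the later
  competitors jump across the free boundary.\<close>

lemma (in polar_rect) pull_C11:
  assumes supp: "\<And>p. p \<notin> Q \<Longrightarrow> W p = 0 \<and> W1 p = 0 \<and> W2 p = 0 \<and> W11 p = 0 \<and> W12 p = 0 \<and> W21 p = 0 \<and> W22 p = 0"
    and lip: "\<And>p. loc_lip W p" "\<And>p. loc_lip W1 p" "\<And>p. loc_lip W2 p"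
    and der: "\<And>p. p \<in> Q \<Longrightarrow> (W has_derivative (\<lambda>q. W1 p * fst q + W2 p * snd q)) (at p)"
    and der2: "AE p in lborel. p \<in> Q \<longrightarrow> (W1 has_derivative (\<lambda>q. W11 p * fst q + W12 p * snd q)) (at p) \<and>
      (W2 has_derivative (\<lambda>q. W21 p * fst q + W22 p * snd q)) (at p)"
  shows "C11 (\<lambda>x. W (chart \<alpha> x)) (\<lambda>b x. dop b W1 W2 (chart \<alpha> x))
     (\<lambda>b c x. dop c (dop_s b W1 W2 W11 W21) (dop_t b W1 W2 W12 W22) (chart \<alpha> x))"
  unfolding C11_def
proof (intro conjI ballI)
  show "\<exists>L R. lipschitz_cpt (\<lambda>x. W (chart \<alpha> x)) L R"
    using supp lip(1) by (intro pull_loc_lip) auto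
  fix b :: "real^2" assume "b \<in> Basis"
  have d0: "p \<notin> Q \<Longrightarrow> dop b W1 W2 p = 0" for p b using supp by (simp add: dop_def)
  show "\<exists>L R. lipschitz_cpt (\<lambda>x. dop b W1 W2 (chart \<alpha> x)) L R"
    using d0 lip by (intro pull_loc_lip loc_lip_dop) auto
  have "((\<lambda>x. W (chart \<alpha> x)) has_derivative (\<lambda>v. dop v W1 W2 (chart \<alpha> x))) (at x)" for x
    using supp der by (intro pull_has_derivative) auto
  from directional_derivative[OF this] show "AE x in lborel. ((\<lambda>t. W (chart \<alpha> (x + t *\<^sub>R b))) has_real_derivative dop b W1 W2 (chart \<alpha> x)) (at 0)"
    by (intro AE_I2)
  fix c :: "real^2" assume "c \<in> Basis"
  let ?d = "\<lambda>p. (W1 has_derivative (\<lambda>q. W11 p * fst q + W12 p * snd q)) (at p) \<and>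
      (W2 has_derivative (\<lambda>q. W21 p * fst q + W22 p * snd q)) (at p)"
  have "AE p in lborel. p \<in> strip \<alpha> \<longrightarrow> (p \<in> Q \<longrightarrow> ?d p)"
    using der2 by eventually_elim auto
  then have "AE x in lborel. x \<in> ball 0 1 \<longrightarrow> (chart \<alpha> x \<in> Q \<longrightarrow> ?d (chart \<alpha> x))"
    by (rule AE_strip_imp_ball)
  then show "AE x in lborel. ((\<lambda>t. dop b W1 W2 (chart \<alpha> (x + t *\<^sub>R c))) has_real_derivative
     dop c (dop_s b W1 W2 W11 W21) (dop_t b W1 W2 W12 W22) (chart \<alpha> x)) (at 0)"
  proof eventually_elim
    case (elim x)
    have "((\<lambda>x. dop b W1 W2 (chart \<alpha> x)) has_derivative
      (\<lambda>v. dop v (dop_s b W1 W2 W11 W21) (dop_t b W1 W2 W12 W22) (chart \<alpha> x))) (at x)"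
    proof (rule pull_has_derivative)
      show "dop b W1 W2 p = 0 \<and> dop_s b W1 W2 W11 W21 p = 0 \<and> dop_t b W1 W2 W12 W22 p = 0" if "p \<notin> Q" for p
        using supp[OF that] by (simp add: dop_s_def dop_t_def dop_def)
      assume q: "chart \<alpha> x \<in> Q"
      then have "x \<in> ball 0 1" using chart_in_Q K_ball by blast
      with elim q show "(dop b W1 W2 has_derivative (\<lambda>q. dop_s b W1 W2 W11 W21 (chart \<alpha> x) * fst q +
          dop_t b W1 W2 W12 W22 (chart \<alpha> x) * snd q)) (at (chart \<alpha> x))"
        by (intro dop_has_derivative) auto
    qed
    from directional_derivative[OF this] show ?case .
  qed
qed

section \<open>Products of bumps as test functions in the disc\<close>

lemma bumps_smooth: "\<rho> \<in> bumps a b \<Longrightarrow> smooth1 \<rho>"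
  and bumps_zero: "\<rho> \<in> bumps a b \<Longrightarrow> x \<notin> {a..b} \<Longrightarrow> \<rho> x = 0"
  by (auto simp: bumps_def)

lemma bumps_has_deriv: "\<rho> \<in> bumps a b \<Longrightarrow> (\<rho> has_real_derivative deriv \<rho> x) (at x)"
  using smooth1_deriv(1) bumps_smooth by blast

lemma bumps_deriv: "\<rho> \<in> bumps a b \<Longrightarrow> deriv \<rho> \<in> bumps a b"
proof -
  assume r: "\<rho> \<in> bumps a b"
  have "deriv \<rho> x = 0" if "x \<notin> {a..b}" for x
  proof (rule DERIV_imp_deriv, rule DERIV_cong_ev[THEN iffD2, OF refl _ refl])
    have "open (- {a..b})" by (simp add: open_Compl)
    then show "\<forall>\<^sub>F x in nhds x. \<rho> x = 0"
      using eventually_nhds_in_open[of "- {a..b}" x] that bumps_zero[OF r] by (auto elim!: eventually_mono)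
    show "((\<lambda>x. 0) has_real_derivative 0) (at x)" by simp
  qed
  then show ?thesis using r smooth1_deriv(2) by (auto simp: bumps_def)
qed

lemma bumps_mult: "\<rho> \<in> bumps a b \<Longrightarrow> smooth1 g \<Longrightarrow> (\<lambda>x. g x * \<rho> x) \<in> bumps a b"
  by (auto simp: bumps_def)

lemma smooth1_product_derivative:
  assumes "smooth1 \<rho>" "smooth1 \<zeta>"
  shows "((\<lambda>p. \<rho> (fst p) * \<zeta> (snd p)) has_derivative
     (\<lambda>q. deriv \<rho> (fst p) * \<zeta> (snd p) * fst q + \<rho> (fst p) * deriv \<zeta> (snd p) * snd q)) (at p)"
proof -
  have 1: "((\<lambda>p. \<rho> (fst p)) has_derivative (\<lambda>q. deriv \<rho> (fst p) * fst q)) (at p)"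
    using has_derivative_compose[OF has_derivative_fst[OF has_derivative_ident] smooth1_deriv(1)[OF assms(1), unfolded has_field_derivative_def]] .
  have 2: "((\<lambda>p. \<zeta> (snd p)) has_derivative (\<lambda>q. deriv \<zeta> (snd p) * snd q)) (at p)"
    using has_derivative_compose[OF has_derivative_snd[OF has_derivative_ident] smooth1_deriv(1)[OF assms(2), unfolded has_field_derivative_def]] .
  from has_derivative_mult[OF 1 2] show ?thesis by (simp add: algebra_simps)
qed

lemma loc_lip_product:
  assumes "smooth1 \<rho>" "smooth1 \<zeta>" shows "loc_lip (\<lambda>p. \<rho> (fst p) * \<zeta> (snd p)) p"
  by (intro loc_lip_mult loc_lip_compose[OF loc_lip_smooth1[OF assms(1)] loc_lip_fst]
      loc_lip_compose[OF loc_lip_smooth1[OF assms(2)] loc_lip_snd])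

text \<open>A partial derivative of a pulled back product is a sum of two such products, since
  e^(-s), cos t and sin t can be absorbed into the bump factors. Sums make the class closed under
  differentiation.\<close>

inductive_set polar_class for \<alpha> s0 s1 ta tb where
  base: "\<rho> \<in> bumps s0 s1 \<Longrightarrow> \<zeta> \<in> bumps ta tb \<Longrightarrow> (\<lambda>x. \<rho> (fst (chart \<alpha> x)) * \<zeta> (snd (chart \<alpha> x))) \<in> polar_class \<alpha> s0 s1 ta tb"
| add: "F \<in> polar_class \<alpha> s0 s1 ta tb \<Longrightarrow> H \<in> polar_class \<alpha> s0 s1 ta tb \<Longrightarrow> (\<lambda>x. F x + H x) \<in> polar_class \<alpha> s0 s1 ta tb"

context polar_rect
begin

lemma product_supp:
  assumes "\<rho> \<in> bumps s0 s1" "\<zeta> \<in> bumps ta tb" "p \<notin> Q" shows "\<rho> (fst p) * \<zeta> (snd p) = 0"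
  using assms bumps_zero by (cases p) (auto simp: Q_def)

lemma product_pull_derivative:
  assumes r: "\<rho> \<in> bumps s0 s1" and z: "\<zeta> \<in> bumps ta tb"
  shows "((\<lambda>x. \<rho> (fst (chart \<alpha> x)) * \<zeta> (snd (chart \<alpha> x))) has_derivative
     (\<lambda>v. dop v (\<lambda>p. deriv \<rho> (fst p) * \<zeta> (snd p)) (\<lambda>p. \<rho> (fst p) * deriv \<zeta> (snd p)) (chart \<alpha> x))) (at x)"
  using product_supp[OF r z] product_supp[OF bumps_deriv[OF r] z] product_supp[OF r bumps_deriv[OF z]]
    smooth1_product_derivative[OF bumps_smooth[OF r] bumps_smooth[OF z]]
  by (intro pull_has_derivative) auto

lemma dop_in_polar_class:
  assumes r: "\<rho> \<in> bumps s0 s1" and z: "\<zeta> \<in> bumps ta tb"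
  shows "(\<lambda>x. dop b (\<lambda>p. deriv \<rho> (fst p) * \<zeta> (snd p)) (\<lambda>p. \<rho> (fst p) * deriv \<zeta> (snd p)) (chart \<alpha> x)) \<in> polar_class \<alpha> s0 s1 ta tb"
proof -
  have e: "smooth1 (\<lambda>x. exp (- x))" using smooth1_exp_cmult[of "-1"] by simp
  note r' = bumps_mult[OF bumps_deriv[OF r] e] bumps_mult[OF r e]
  have z': "(\<lambda>x. (b $ 1 * cos x + b $ 2 * sin x) * \<zeta> x) \<in> bumps ta tb"
    "(\<lambda>x. (b $ 2 * cos x - b $ 1 * sin x) * deriv \<zeta> x) \<in> bumps ta tb"
    by (intro bumps_mult z bumps_deriv smooth1_add smooth1_diff smooth1_cmult smooth1_cos smooth1_sin)+
  from polar_class.add[OF polar_class.base[OF r'(1) z'(1), of \<alpha>] polar_class.base[OF r'(2) z'(2), of \<alpha>]]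
  show ?thesis by (rule back_subst[of "\<lambda>F. F \<in> polar_class \<alpha> s0 s1 ta tb"]) (simp add: dop_def fun_eq_iff algebra_simps)
qed

lemma polar_class_derivative:
  assumes "F \<in> polar_class \<alpha> s0 s1 ta tb"
  shows "(\<forall>x. F differentiable at x) \<and> (\<forall>b\<in>Basis. (\<lambda>x. frechet_derivative F (at x) b) \<in> polar_class \<alpha> s0 s1 ta tb)"
  using assms
proof induction
  case (base \<rho> \<zeta>)
  note d = product_pull_derivative[OF base]
  show ?case using d dop_in_polar_class[OF base] unfolding frechet_derivative_eq[OF d] by (auto intro: differentiableI)
next
  case (add F H)
  have "frechet_derivative (\<lambda>x. F x + H x) (at x) b = frechet_derivative F (at x) b + frechet_derivative H (at x) b" for x b
  proof (rule frechet_derivative_eq)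
    show "((\<lambda>x. F x + H x) has_derivative (\<lambda>b. frechet_derivative F (at x) b + frechet_derivative H (at x) b)) (at x)"
      using add.IH by (intro has_derivative_add) (auto simp: frechet_derivative_works[symmetric])
  qed
  then show ?case using add.IH by (auto intro: polar_class.add)
qed

lemma product_pull_test:
  assumes r: "\<rho> \<in> bumps s0 s1" and z: "\<zeta> \<in> bumps ta tb"
  shows "(\<lambda>x. \<rho> (fst (chart \<alpha> x)) * \<zeta> (snd (chart \<alpha> x))) \<in> test_functions (ball 0 1)" (is "?\<phi> \<in> _")
    and "(\<Sum>b\<in>Basis. frechet_derivative (\<lambda>y. frechet_derivative (\<lambda>x. \<rho> (fst (chart \<alpha> x)) * \<zeta> (snd (chart \<alpha> x))) (at y) b) (at x) b) =
      exp (- 2 * fst (chart \<alpha> x)) * (deriv (deriv \<rho>) (fst (chart \<alpha> x)) * \<zeta> (snd (chart \<alpha> x)) +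
        \<rho> (fst (chart \<alpha> x)) * deriv (deriv \<zeta>) (snd (chart \<alpha> x)))"
proof -
  have "Ck k ?\<phi>" for k
    by (rule Ck_closed_class[of "polar_class \<alpha> s0 s1 ta tb"]) (use polar_class_derivative polar_class.base[OF r z] in auto)
  moreover have "?\<phi> x = 0" if "x \<notin> K" for x using product_supp[OF r z not_K[OF that]] .
  ultimately show "?\<phi> \<in> test_functions (ball 0 1)"
    unfolding test_functions_def using compact_K K_ball by blast
  let ?W1 = "\<lambda>p. deriv \<rho> (fst p) * \<zeta> (snd p)" and ?W2 = "\<lambda>p. \<rho> (fst p) * deriv \<zeta> (snd p)"
  let ?W11 = "\<lambda>p. deriv (deriv \<rho>) (fst p) * \<zeta> (snd p)" and ?W12 = "\<lambda>p. deriv \<rho> (fst p) * deriv \<zeta> (snd p)"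
    and ?W22 = "\<lambda>p. \<rho> (fst p) * deriv (deriv \<zeta>) (snd p)"
  note r' = bumps_deriv[OF r] and z' = bumps_deriv[OF z]
  have 1: "frechet_derivative ?\<phi> (at y) b = dop b ?W1 ?W2 (chart \<alpha> y)" for y b
    by (rule frechet_derivative_eq[OF product_pull_derivative[OF r z]])
  have 2: "frechet_derivative (\<lambda>y. dop b ?W1 ?W2 (chart \<alpha> y)) (at x) c =
     dop c (dop_s b ?W1 ?W2 ?W11 ?W12) (dop_t b ?W1 ?W2 ?W12 ?W22) (chart \<alpha> x)" for b c
  proof (rule frechet_derivative_eq, rule pull_has_derivative)
    note supp = product_supp[OF r' z] product_supp[OF r z'] product_supp[OF bumps_deriv[OF r'] z]
      product_supp[OF r' z'] product_supp[OF r bumps_deriv[OF z']]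
    show "dop b ?W1 ?W2 p = 0 \<and> dop_s b ?W1 ?W2 ?W11 ?W12 p = 0 \<and> dop_t b ?W1 ?W2 ?W12 ?W22 p = 0" if "p \<notin> Q" for p
      unfolding dop_s_def dop_t_def dop_def by (simp only: supp[OF that]) simp
    show "(dop b ?W1 ?W2 has_derivative (\<lambda>q. dop_s b ?W1 ?W2 ?W11 ?W12 (chart \<alpha> x) * fst q + dop_t b ?W1 ?W2 ?W12 ?W22 (chart \<alpha> x) * snd q)) (at (chart \<alpha> x))"
      using smooth1_product_derivative[OF bumps_smooth[OF r'] bumps_smooth[OF z], of "chart \<alpha> x"]
        smooth1_product_derivative[OF bumps_smooth[OF r] bumps_smooth[OF z'], of "chart \<alpha> x"]
      by (rule dop_has_derivative)
  qed
  show "(\<Sum>b\<in>Basis. frechet_derivative (\<lambda>y. frechet_derivative ?\<phi> (at y) b) (at x) b) =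
      exp (- 2 * fst (chart \<alpha> x)) * (deriv (deriv \<rho>) (fst (chart \<alpha> x)) * \<zeta> (snd (chart \<alpha> x)) +
        \<rho> (fst (chart \<alpha> x)) * deriv (deriv \<zeta>) (snd (chart \<alpha> x)))"
    unfolding 1 2 Basis_real2 using axis_1_neq_2 by (simp add: laplacian_polar)
qed

end

section \<open>Integration in the parameter plane\<close>

lemma lborel2_snd:
  fixes h :: "real \<times> real \<Rightarrow> real"
  assumes "integrable lborel h"
  shows "integrable lborel (\<lambda>y. LINT x|lborel. h (x, y))" "(LINT y|lborel. LINT x|lborel. h (x, y)) = (LINT p|lborel. h p)"
proof -
  have i: "integrable (lborel \<Otimes>\<^sub>M lborel) (\<lambda>(x, y). h (x, y))" using assms by (simp add: lborel_prod)
  show "integrable lborel (\<lambda>y. LINT x|lborel. h (x, y))" using lborel_pair.integrable_snd[OF i] .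
  show "(LINT y|lborel. LINT x|lborel. h (x, y)) = (LINT p|lborel. h p)"
    using lborel_pair.integral_snd[OF i] by (simp add: lborel_prod)
qed

lemma lborel2_product:
  fixes f g :: "real \<Rightarrow> real"
  assumes f: "integrable lborel f" and g: "integrable lborel g"
  shows "integrable lborel (\<lambda>p. f (fst p) * g (snd p))"
    "(LINT p|lborel. f (fst p) * g (snd p)) = (LINT x|lborel. f x) * (LINT y|lborel. g y)"
proof -
  have fm: "f \<in> borel_measurable borel" "g \<in> borel_measurable borel" using f g by auto
  have "integrable (lborel \<Otimes>\<^sub>M lborel) (\<lambda>p. f (fst p) * g (snd p))"
  proof (rule lborel_pair.Fubini_integrable)
    show "(\<lambda>p. f (fst p) * g (snd p)) \<in> borel_measurable (lborel \<Otimes>\<^sub>M lborel)" using fm by measurable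
    have "integrable lborel (\<lambda>x. \<bar>f x\<bar> * (LINT y|lborel. \<bar>g y\<bar>))"
      using f by (intro integrable_mult_left) auto
    then show "integrable lborel (\<lambda>x. LINT y|lborel. norm (f (fst (x, y)) * g (snd (x, y))))"
      by (simp add: abs_mult)
    show "AE x in lborel. integrable lborel (\<lambda>y. f (fst (x, y)) * g (snd (x, y)))" using g by auto
  qed
  then show i: "integrable lborel (\<lambda>p. f (fst p) * g (snd p))" by (simp add: lborel_prod)
  show "(LINT p|lborel. f (fst p) * g (snd p)) = (LINT x|lborel. f x) * (LINT y|lborel. g y)"
    using lborel2_snd(2)[OF i] by simp
qed

text \<open>One factor e^(2s) is the Jacobian, the other the homogeneity of \<open>u\<close>. The
  value 1 / 4 is the reason for the factor 4 in the definition of \<open>F\<close>.\<close>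

lemma integrable_exp_negative:
  "integrable lborel (\<lambda>s::real. indicator {..<0} s * exp (4 * s))" "(LINT s|lborel. indicator {..<0::real} s * exp (4 * s)) = 1 / 4"
proof -
  have "((\<lambda>x::real. exp (- 4 * x)) has_integral exp (- 4 * 0) / 4) {0..}"
    by (rule has_integral_exp_minus_to_infinity) simp
  then have "((\<lambda>x::real. indicator {0..} x * exp (- 4 * x)) has_integral 1 / 4) UNIV"
    by (subst (asm) has_integral_restrict_UNIV[symmetric]) (simp add: indicator_def of_bool_def if_distrib if_distribR cong: if_cong)
  then have "(\<integral>\<^sup>+x. ennreal (indicator {0..} x * exp (- 4 * x)) \<partial>lborel) = ennreal (1 / 4 :: real)"
    by (intro nn_integral_has_integral_lborel) (auto intro!: borel_measurable_times borel_measurable_continuous_onI continuous_intros borel_measurable_indicator)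
  then have "has_bochner_integral lborel (\<lambda>x::real. indicator {0..} x * exp (- 4 * x)) (1 / 4)"
    by (intro has_bochner_integral_nn_integral) (auto intro!: borel_measurable_times borel_measurable_indicator borel_measurable_exp)
  then have i: "integrable lborel (\<lambda>x::real. indicator {0..} x * exp (- 4 * x))"
    and v: "(LINT x|lborel. indicator {0..} x * exp (- 4 * x)) = (1 / 4 :: real)"
    by (auto simp: has_bochner_integral_iff)
  have m: "(\<lambda>s::real. indicator {..<0} s * exp (4 * s)) \<in> borel_measurable lborel"
    by (auto intro!: borel_measurable_times borel_measurable_indicator borel_measurable_exp)
  have i': "integrable lborel (\<lambda>s::real. indicator {0..} (0 + (-1) * s) * exp (- 4 * (0 + (-1) * s)))"
    using lborel_integrable_real_affine[OF i, of "-1" 0] by simp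
  have ae: "AE s in lborel. indicator {0..} (0 + (-1) * s) * exp (- 4 * (0 + (-1) * s)) = indicator {..<0} s * exp (4 * s :: real)"
    using AE_lborel_singleton[of "0::real"] by eventually_elim (auto simp: indicator_def)
  show "integrable lborel (\<lambda>s::real. indicator {..<0} s * exp (4 * s))"
    using i' m ae by (rule integrable_cong_AE_imp)
  have "(LINT s|lborel. indicator {..<0::real} s * exp (4 * s)) = (LINT s|lborel. indicator {0..} (0 + (-1) * s) * exp (- 4 * (0 + (-1) * s)))"
    using m i' ae by (intro integral_cong_AE) auto
  also have "\<dots> = 1 / 4"
    using lborel_integral_real_affine[of "-1" "\<lambda>x::real. indicator {0..} x * exp (- 4 * x)" 0] v by simp
  finally show "(LINT s|lborel. indicator {..<0::real} s * exp (4 * s)) = 1 / 4" .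
qed

lemma bumps_integrable:
  assumes "\<rho> \<in> bumps a b" shows "integrable lborel \<rho>"
proof -
  have "integrable lborel (\<lambda>x. indicator {a..b} x *\<^sub>R \<rho> x)"
    using smooth1_continuous[OF bumps_smooth[OF assms]] by (intro borel_integrable_compact) auto
  also have "(\<lambda>x. indicator {a..b} x *\<^sub>R \<rho> x) = \<rho>" using bumps_zero[OF assms] by (auto simp: fun_eq_iff indicator_def)
  finally show ?thesis .
qed

lemma bumps_borel: "\<rho> \<in> bumps a b \<Longrightarrow> \<rho> \<in> borel_measurable borel"
  using bumps_smooth smooth1_borel by blast

lemma bumps_lipschitz: assumes "\<rho> \<in> bumps a b" shows "\<exists>L R. lipschitz_cpt \<rho> L R"
proof (rule loc_lip_imp_lipschitz_cpt[of _ "\<bar>a\<bar> + \<bar>b\<bar>"])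
  show "loc_lip \<rho> x" for x using assms by (intro loc_lip_smooth1 bumps_smooth)
  show "\<rho> x = 0" if "\<bar>a\<bar> + \<bar>b\<bar> < norm x" for x
    using that by (intro bumps_zero[OF assms]) auto
qed

lemma bumps_bounded:
  assumes "\<rho> \<in> bumps a b" obtains B where "\<And>x. \<bar>\<rho> x\<bar> \<le> B"
  using bumps_lipschitz[OF assms] lipschitz_cpt.bounded_ex by metis

lemma bumps_deriv_integral:
  assumes r: "\<rho> \<in> bumps a b" shows "(LINT x|lborel. deriv \<rho> x) = 0"
proof -
  obtain L R where l: "lipschitz_cpt \<rho> L R" using bumps_lipschitz[OF r] by blast
  have "((\<lambda>t. \<rho> (x + t *\<^sub>R 1)) has_real_derivative deriv \<rho> x) (at 0)" for x
    using bumps_has_deriv[OF r, of x] DERIV_shift[of \<rho> "deriv \<rho> x" 0 x] by (simp add: add.commute)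
  then have "(LINT x|lebesgue. deriv \<rho> x) = 0"
    by (intro lipschitz_cpt.integral_derivative_zero(2)[OF l, of 1] AE_I2)
  then show ?thesis using bumps_borel[OF bumps_deriv[OF r]] by (simp add: integral_completion)
qed

text \<open>The second derivative of e^(2s) is 4 e^(2s), and the auxiliary h collects the boundary
  terms of two integrations by parts. This 4 becomes the coefficient in F'' + 4 F = g.\<close>

lemma bumps_exp_integral:
  assumes r: "\<rho> \<in> bumps a b"
  shows "(LINT s|lborel. exp (2 * s) * deriv (deriv \<rho>) s) = 4 * (LINT s|lborel. exp (2 * s) * \<rho> s)"
proof -
  have e: "(\<lambda>s. exp (2 * s) * f s) \<in> bumps a b" if "f \<in> bumps a b" for f using that by (intro bumps_mult) auto
  define h where "h s = exp (2 * s) * (deriv \<rho> s + (-2) * \<rho> s)" for s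
  have "(\<lambda>s. deriv \<rho> s + (-2) * \<rho> s) \<in> bumps a b"
    using r bumps_deriv[OF r] by (auto simp: bumps_def)
  then have h: "h \<in> bumps a b" unfolding h_def[abs_def] by (rule e)
  have dh: "deriv h s = exp (2 * s) * deriv (deriv \<rho>) s - 4 * (exp (2 * s) * \<rho> s)" for s
    unfolding h_def
    by (rule DERIV_imp_deriv) (auto intro!: derivative_eq_intros bumps_has_deriv[OF r] bumps_has_deriv[OF bumps_deriv[OF r]] simp: algebra_simps)
  have "0 = (LINT s|lborel. deriv h s)" using bumps_deriv_integral[OF h] by simp
  also have "\<dots> = (LINT s|lborel. exp (2 * s) * deriv (deriv \<rho>) s) - 4 * (LINT s|lborel. exp (2 * s) * \<rho> s)"
    unfolding dh using bumps_integrable[OF e[OF r]] bumps_integrable[OF e[OF bumps_deriv[OF bumps_deriv[OF r]]]] by simp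
  finally show ?thesis by simp
qed

lemma integrable_times_bounded:
  fixes f g :: "'a \<Rightarrow> real"
  assumes "integrable M f" "g \<in> borel_measurable M" "\<And>x. \<bar>g x\<bar> \<le> B"
  shows "integrable M (\<lambda>x. g x * f x)"
proof (rule Bochner_Integration.integrable_bound[OF integrable_mult_right[OF assms(1), of B]])
  show "AE x in M. norm (g x * f x) \<le> norm (B * f x)"
    using assms(3) order_trans[OF abs_ge_zero assms(3)] by (auto simp: abs_mult intro!: mult_right_mono)
qed (use assms in auto)

section \<open>The polar profile of a homogeneous minimizer\<close>

text \<open>Composition with the chart and iterated integrals call for Borel functions. On a set of
  finite measure |v| <= 1 + v^2 turns square integrability into integrability.\<close>

lemma L2_borel_representative:
  fixes D :: "'a::euclidean_space set"
  assumes D: "open D" "emeasure lborel D < \<infinity>" and f: "f \<in> L2 D"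
  shows "\<exists>v. v \<in> borel_measurable borel \<and> (AE x in lebesgue. x \<in> D \<longrightarrow> f x = v x) \<and>
    integrable lborel (\<lambda>x. indicator D x * v x) \<and> integrable lborel (\<lambda>x. indicator D x * (v x)\<^sup>2)"
proof -
  have fm: "(\<lambda>x. indicator D x * f x) \<in> borel_measurable lebesgue" "integrable lebesgue (\<lambda>x. (indicator D x * f x)\<^sup>2)"
    using f unfolding L2_iff[OF D(1)] by auto
  obtain v where v: "v \<in> borel_measurable lborel" and ae: "AE x in lborel. indicator D x * f x = v x"
    using completion_ex_borel_measurable_real[OF fm(1)] by blast
  have ae': "AE x in lebesgue. indicator D x * f x = v x" using ae by (rule AE_completion)
  have "AE x in lebesgue. x \<in> D \<longrightarrow> f x = v x" using ae' by eventually_elim (auto simp: indicator_def)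
  moreover have sq: "integrable lborel (\<lambda>x. indicator D x * (v x)\<^sup>2)"
  proof -
    have vm: "v \<in> borel_measurable lebesgue" using v by (rule measurable_completion)
    have "AE x in lebesgue. (indicator D x * f x)\<^sup>2 = indicator D x * (v x)\<^sup>2"
      using ae' by eventually_elim (auto simp: indicator_def)
    moreover have "(\<lambda>x. indicator D x * (v x)\<^sup>2) \<in> borel_measurable lebesgue"
      using vm D by (intro borel_measurable_times borel_measurable_indicator borel_measurable_power) auto
    ultimately have "integrable lebesgue (\<lambda>x. indicator D x * (v x)\<^sup>2)"
      using fm(2) by (metis (mono_tags, lifting) integrable_cong_AE_imp AE_cong)
    then show ?thesis using v D by (subst (asm) integrable_completion) (auto intro!: borel_measurable_times borel_measurable_indicator)
  qed
  moreover have "integrable lborel (\<lambda>x. indicator D x * v x)"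
  proof (rule Bochner_Integration.integrable_bound)
    show "integrable lborel (\<lambda>x. indicator D x + indicator D x * (v x)\<^sup>2)"
      using sq D by (intro Bochner_Integration.integrable_add integrable_real_indicator) auto
    show "AE x in lborel. norm (indicator D x * v x) \<le> norm (indicator D x + indicator D x * (v x)\<^sup>2)"
    proof (rule AE_I2)
      fix x
      have "0 \<le> (\<bar>v x\<bar> - 1)\<^sup>2" "0 \<le> \<bar>v x\<bar>" by auto
      then have "\<bar>v x\<bar> \<le> 1 + (v x)\<^sup>2" by (simp add: power2_eq_square algebra_simps)
      then show "norm (indicator D x * v x) \<le> norm (indicator D x + indicator D x * (v x)\<^sup>2)"
        by (auto simp: indicator_def)
    qed
    show "(\<lambda>x. indicator D x * v x) \<in> borel_measurable lborel"
      using v D by (intro borel_measurable_times borel_measurable_indicator) auto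
  qed
  ultimately show ?thesis using v by auto
qed

abbreviation "disc \<equiv> ball 0 1 :: (real^2) set"

lemma disc_finite: "emeasure lborel disc < \<infinity>"
  using emeasure_lborel_ball_finite[of "0::real^2" 1] by simp

locale homogeneous_minimizer =
  fixes u :: "real^2 \<Rightarrow> real"
  assumes u: "u \<in> minimizers disc" and hom: "two_homogeneous u"
begin

sublocale H2_function disc u
  by unfold_locales (use u in \<open>auto simp: minimizers_def\<close>)

definition v :: "real^2 \<Rightarrow> real" where
  "v = (SOME v. v \<in> borel_measurable borel \<and> (AE x in lebesgue. x \<in> disc \<longrightarrow> u x = v x) \<and>
    integrable lborel (\<lambda>x. indicator disc x * v x) \<and> integrable lborel (\<lambda>x. indicator disc x * (v x)\<^sup>2))"

definition lap :: "real^2 \<Rightarrow> real" where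
  "lap = (SOME v. v \<in> borel_measurable borel \<and> (AE x in lebesgue. x \<in> disc \<longrightarrow> weak_laplacian disc u x = v x) \<and>
    integrable lborel (\<lambda>x. indicator disc x * v x) \<and> integrable lborel (\<lambda>x. indicator disc x * (v x)\<^sup>2))"

lemma v: "v \<in> borel_measurable borel" "AE x in lebesgue. x \<in> disc \<longrightarrow> u x = v x"
    "integrable lborel (\<lambda>x. indicator disc x * v x)" "integrable lborel (\<lambda>x. indicator disc x * (v x)\<^sup>2)"
  using someI_ex[OF L2_borel_representative[OF open_ball disc_finite u_L2]] unfolding v_def[symmetric] by auto

lemma lap: "lap \<in> borel_measurable borel" "AE x in lebesgue. x \<in> disc \<longrightarrow> weak_laplacian disc u x = lap x"
    "integrable lborel (\<lambda>x. indicator disc x * lap x)" "integrable lborel (\<lambda>x. indicator disc x * (lap x)\<^sup>2)"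
  using someI_ex[OF L2_borel_representative[OF open_ball disc_finite laplacian_L2]] unfolding lap_def[symmetric] by auto

text \<open>Homogeneity is given for \<open>u\<close> itself. Passing to the representative also at
  r x requires that the exceptional set, dilated by 1 / r, is still null.\<close>

lemma v_homogeneous:
  assumes r: "0 < r" "r < 1"
  shows "AE x in lborel. x \<in> disc \<longrightarrow> v (r *\<^sub>R x) = r\<^sup>2 * v x"
proof -
  have "AE x in lebesgue_on disc. u (r *\<^sub>R x) = r\<^sup>2 * u x" using hom r by (auto simp: two_homogeneous_def)
  then have 1: "AE x in lebesgue. x \<in> disc \<longrightarrow> u (r *\<^sub>R x) = r\<^sup>2 * u x" by (subst (asm) AE_restrict_space_iff) auto
  obtain N where N: "N \<in> null_sets lebesgue" "{x. \<not> (x \<in> disc \<longrightarrow> u x = v x)} \<subseteq> N"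
    using v(2) unfolding eventually_ae_filter by auto
  have "negligible ((\<lambda>x. (1 / r) *\<^sub>R x) ` N)"
    using N(1) by (intro negligible_differentiable_image_negligible linear_imp_differentiable_on)
      (auto simp: negligible_iff_null_sets linear_scaleR)
  then have "AE x in lebesgue. x \<notin> (\<lambda>x. (1 / r) *\<^sub>R x) ` N" by (intro AE_not_in) (simp add: negligible_iff_null_sets)
  then have 2: "AE x in lebesgue. x \<in> disc \<longrightarrow> u (r *\<^sub>R x) = v (r *\<^sub>R x)"
  proof eventually_elim
    case (elim x)
    show ?case
    proof
      assume x: "x \<in> disc"
      have "x = (1 / r) *\<^sub>R (r *\<^sub>R x)" using r by simp
      then have "r *\<^sub>R x \<notin> N" using elim by blast
      then have "r *\<^sub>R x \<in> disc \<longrightarrow> u (r *\<^sub>R x) = v (r *\<^sub>R x)" using N(2) by blast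
      moreover have "norm (r *\<^sub>R x) < 1"
      proof -
        have "r * norm x \<le> 1 * norm x" using r by (intro mult_right_mono) auto
        then show ?thesis using x r by simp
      qed
      ultimately show "u (r *\<^sub>R x) = v (r *\<^sub>R x)" by simp
    qed
  qed
  have "AE x in lebesgue. x \<in> disc \<longrightarrow> v (r *\<^sub>R x) = r\<^sup>2 * v x"
    using 1 2 v(2) by eventually_elim auto
  then show ?thesis by (simp add: AE_completion_iff)
qed

text \<open>The profiles of \<open>u\<close> and of its Laplacian are obtained by averaging over the radius, since \<open>u\<close> is known only
  almost everywhere and has no well-defined restriction to a circle.\<close>

definition F :: "real \<Rightarrow> real" where
  "F \<theta> = 4 * (LINT s|lborel. indicator {..<0} s * (exp (2 * s) * v (logpolar (s, \<theta>))))"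

definition window :: "real \<Rightarrow> real \<Rightarrow> real" where
  "window \<alpha> \<theta> = indicator {\<alpha><..<\<alpha> + 2 * pi} \<theta>"

lemma strip_split: "indicator (strip \<alpha>) (s, \<theta>) = indicator {..<0} s * window \<alpha> \<theta>"
  by (auto simp: strip_def window_def indicator_def)

lemma vl_borel [measurable]: "(\<lambda>p. v (logpolar p)) \<in> borel_measurable borel"
  using measurable_compose[OF logpolar_measurable v(1)] .

lemma lapl_borel [measurable]: "(\<lambda>p. lap (logpolar p)) \<in> borel_measurable borel"
  using measurable_compose[OF logpolar_measurable lap(1)] .

lemma strip_ind_borel [measurable]: "(\<lambda>p. indicator (strip \<alpha>) p :: real) \<in> borel_measurable borel"
  by (intro borel_measurable_indicator strip_measurable)

lemma exp_fst_borel [measurable]: "(\<lambda>p::real\<times>real. exp (c * fst p)) \<in> borel_measurable borel"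
  by (intro borel_measurable_continuous_onI continuous_intros)

lemma snd_compose_borel: "f \<in> borel_measurable borel \<Longrightarrow> (\<lambda>p::real\<times>real. f (snd p) :: real) \<in> borel_measurable borel"
  by (rule measurable_compose[of snd borel borel f borel]) (auto intro!: borel_measurable_continuous_onI continuous_intros)

lemma fst_compose_borel: "f \<in> borel_measurable borel \<Longrightarrow> (\<lambda>p::real\<times>real. f (fst p) :: real) \<in> borel_measurable borel"
  by (rule measurable_compose[of fst borel borel f borel]) (auto intro!: borel_measurable_continuous_onI continuous_intros)

lemma partial_integral_borel:
  fixes h :: "real \<times> real \<Rightarrow> real"
  assumes "h \<in> borel_measurable borel" shows "(\<lambda>\<theta>. LINT s|lborel. h (s, \<theta>)) \<in> borel_measurable borel"
proof -
  have "(\<lambda>p. h (snd p, fst p)) \<in> borel_measurable borel"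
    by (rule measurable_compose[OF _ assms]) (intro borel_measurable_continuous_onI continuous_intros)
  then have "(\<lambda>(y, x). h (x, y)) \<in> borel_measurable (lborel \<Otimes>\<^sub>M lborel)"
    by (subst lborel_prod) (simp add: case_prod_beta)
  then have "(\<lambda>y. LINT x|lborel. h (x, y)) \<in> borel_measurable lborel"
    by (rule lborel.borel_measurable_lebesgue_integral)
  then show ?thesis by simp
qed

lemma neg_ind_borel: "(\<lambda>p::real\<times>real. indicator {..<0} (fst p) :: real) \<in> borel_measurable borel"
  by (rule fst_compose_borel) (auto intro: borel_measurable_indicator)

lemma F_borel [measurable]: "F \<in> borel_measurable borel"
proof -
  have "(\<lambda>p. indicator {..<0} (fst p) * (exp (2 * fst p) * v (logpolar p))) \<in> borel_measurable borel"
    by (intro borel_measurable_times neg_ind_borel vl_borel exp_fst_borel)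
  from partial_integral_borel[OF this] show ?thesis unfolding F_def[abs_def] by simp
qed

lemma logpolar_periodic: "logpolar (s, \<theta> + 2 * pi) = logpolar (s, \<theta>)"
  by (simp add: logpolar_def)

lemma F_periodic: "F (\<theta> + 2 * pi) = F \<theta>"
  by (simp add: F_def logpolar_periodic)

lemma v_strip_integrable: "integrable lborel (\<lambda>p. exp (2 * fst p) * indicator (strip \<alpha>) p * v (logpolar p))"
  using logpolar_integral(1)[OF v(1)] v(3) by blast

lemma F_integrable: "integrable lborel (\<lambda>\<theta>. window \<alpha> \<theta> * F \<theta>)"
proof -
  have eq: "(LINT s|lborel. exp (2 * fst (s, \<theta>)) * indicator (strip \<alpha>) (s, \<theta>) * v (logpolar (s, \<theta>))) = window \<alpha> \<theta> * F \<theta> / 4" for \<theta>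
  proof -
    have "(LINT s|lborel. exp (2 * fst (s, \<theta>)) * indicator (strip \<alpha>) (s, \<theta>) * v (logpolar (s, \<theta>))) =
      (LINT s|lborel. window \<alpha> \<theta> * (indicator {..<0} s * (exp (2 * s) * v (logpolar (s, \<theta>)))))"
      by (intro Bochner_Integration.integral_cong) (auto simp: strip_split)
    then show ?thesis by (simp add: F_def)
  qed
  have "integrable lborel (\<lambda>\<theta>. window \<alpha> \<theta> * F \<theta> / 4)"
    using lborel2_snd(1)[OF v_strip_integrable[of \<alpha>]] unfolding eq .
  from integrable_mult_right[OF this, of 4] show ?thesis by simp
qed

lemma logpolar_shift: "logpolar (p + (t, 0)) = exp t *\<^sub>R logpolar p"
  by (simp add: vec_eq_iff forall_2 exp_add)

text \<open>The Jacobian e^(2s) times the defect v - e^(2s) F of the separated form. It scales by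
  e^(4t) under the shift s + t, and the constant in \<open>F\<close> is chosen so that its
  s-integral vanishes.\<close>

definition k0 :: "real \<times> real \<Rightarrow> real" where
  "k0 p = exp (2 * fst p) * v (logpolar p) - exp (4 * fst p) * F (snd p)"

lemma k0_borel [measurable]: "k0 \<in> borel_measurable borel"
  unfolding k0_def[abs_def]
  by (intro borel_measurable_diff borel_measurable_times exp_fst_borel vl_borel snd_compose_borel F_borel)

lemma k0_integrable: "integrable lborel (\<lambda>p. indicator (strip \<alpha>) p * k0 p)"
proof -
  have "integrable lborel (\<lambda>p. (indicator {..<0} (fst p) * exp (4 * fst p)) * (window \<alpha> (snd p) * F (snd p)))"
    by (rule lborel2_product(1)[OF integrable_exp_negative(1) F_integrable])
  from Bochner_Integration.integrable_diff[OF v_strip_integrable[of \<alpha>] this]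
  show ?thesis
    by (rule back_subst[of "integrable lborel"]) (auto simp: fun_eq_iff k0_def strip_split algebra_simps)
qed

lemma k0_homogeneous:
  assumes "t < 0"
  shows "AE p in lborel. p \<in> strip \<alpha> \<longrightarrow> k0 (p + (t, 0)) = exp (4 * t) * k0 p"
proof -
  have "AE p in lborel. p \<in> strip \<alpha> \<longrightarrow> v (exp t *\<^sub>R logpolar p) = (exp t)\<^sup>2 * v (logpolar p)"
    using assms by (intro AE_ball_imp_strip v_homogeneous) auto
  then show ?thesis
  proof eventually_elim
    case (elim p)
    have e: "exp (2 * (fst p + t)) = exp (2 * fst p) * exp (2 * t)" "exp (4 * (fst p + t)) = exp (4 * fst p) * exp (4 * t)"
      by (simp_all add: exp_add distrib_left)
    have e': "exp (4 * t) = exp (2 * t) * exp (2 * t)" by (simp flip: exp_add)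
    have e'': "(exp t)\<^sup>2 = exp (2 * t)" by (simp add: exp_double)
    show ?case using elim unfolding k0_def logpolar_shift fst_add snd_add fst_conv snd_conv e e'' e'
      by (auto simp: algebra_simps)
  qed
qed

definition kint :: "real \<Rightarrow> real set \<Rightarrow> real \<Rightarrow> real" where
  "kint \<alpha> J t = (LINT p|lborel. indicator {..<t} (fst p) * indicator J (snd p) * (indicator (strip \<alpha>) p * k0 p))"

text \<open>For t = 0 the integral vanishes by the choice of \<open>F\<close>. For t < 0 a shift
  maps the half-strip s < 0 onto s < t and multiplies the integral by e^(4t), so it vanishes
  too.\<close>

lemma kint_zero:
  assumes J: "J \<in> sets borel" and t: "t \<le> 0" shows "kint \<alpha> J t = 0"
proof -
  have 0: "kint \<alpha> J 0 = 0"
  proof -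
    have J': "(\<lambda>x. indicator J x :: real) \<in> borel_measurable borel" using J by (rule borel_measurable_indicator)
    have JF: "integrable lborel (\<lambda>\<theta>. indicator J \<theta> * (window \<alpha> \<theta> * F \<theta>))"
      by (rule integrable_times_bounded[OF F_integrable, where B=1]) (use J' in \<open>auto simp: indicator_def\<close>)
    let ?A = "\<lambda>p. indicator J (snd p) * (exp (2 * fst p) * indicator (strip \<alpha>) p * v (logpolar p))"
    let ?B = "\<lambda>p. (indicator {..<0} (fst p) * exp (4 * fst p)) * (indicator J (snd p) * (window \<alpha> (snd p) * F (snd p)))"
    have iA: "integrable lborel ?A"
      by (rule integrable_times_bounded[OF v_strip_integrable, where B=1])
        (use snd_compose_borel[OF J'] in \<open>auto simp: indicator_def\<close>)
    have iB: "integrable lborel ?B" by (rule lborel2_product(1)[OF integrable_exp_negative(1) JF])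
    have "(LINT p|lborel. ?A p) = (LINT \<theta>|lborel. LINT s|lborel. ?A (s, \<theta>))"
      using lborel2_snd(2)[OF iA] by simp
    also have "(\<lambda>\<theta>. LINT s|lborel. ?A (s, \<theta>)) = (\<lambda>\<theta>. (1 / 4) * (indicator J \<theta> * (window \<alpha> \<theta> * F \<theta>)))"
    proof
      fix \<theta>
      have "(LINT s|lborel. ?A (s, \<theta>)) = (LINT s|lborel. (indicator J \<theta> * window \<alpha> \<theta>) * (indicator {..<0} s * (exp (2 * s) * v (logpolar (s, \<theta>)))))"
        by (intro Bochner_Integration.integral_cong) (auto simp: strip_split)
      then show "(LINT s|lborel. ?A (s, \<theta>)) = (1 / 4) * (indicator J \<theta> * (window \<alpha> \<theta> * F \<theta>))" by (simp add: F_def)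
    qed
    also have "(LINT \<theta>|lborel. (1 / 4) * (indicator J \<theta> * (window \<alpha> \<theta> * F \<theta>))) = (LINT p|lborel. ?B p)"
      unfolding lborel2_product(2)[OF integrable_exp_negative(1) JF] integrable_exp_negative(2) by simp
    finally have eq: "(LINT p|lborel. ?A p) = (LINT p|lborel. ?B p)" .
    have "kint \<alpha> J 0 = (LINT p|lborel. ?A p - ?B p)"
      unfolding kint_def by (intro Bochner_Integration.integral_cong) (auto simp: k0_def strip_def window_def indicator_def algebra_simps split: prod.splits)
    then show ?thesis using iA iB eq by simp
  qed
  show ?thesis
  proof (cases "t = 0")
    case False
    with t have t: "t < 0" by simp
    let ?h = "\<lambda>p. indicator {..<t} (fst p) * indicator J (snd p) * (indicator (strip \<alpha>) p * k0 p)"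
    have hb: "?h \<in> borel_measurable borel"
      using J by (intro borel_measurable_times fst_compose_borel snd_compose_borel borel_measurable_indicator strip_measurable k0_borel) auto
    have hb0: "(\<lambda>p. exp (4 * t) * (indicator {..<0} (fst p) * indicator J (snd p) * (indicator (strip \<alpha>) p * k0 p))) \<in> borel_measurable lborel"
      using J by (auto intro!: borel_measurable_times fst_compose_borel snd_compose_borel borel_measurable_indicator strip_measurable k0_borel)
    have "kint \<alpha> J t = (LINT p|lborel. ?h (p + (t, 0)))" unfolding kint_def by (rule integral_translation[OF hb, symmetric])
    also have "\<dots> = (LINT p|lborel. exp (4 * t) * (indicator {..<0} (fst p) * indicator J (snd p) * (indicator (strip \<alpha>) p * k0 p)))"
    proof (rule integral_cong_AE)
      show "(\<lambda>p. ?h (p + (t, 0))) \<in> borel_measurable lborel"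
        using measurable_compose[OF _ hb, of "\<lambda>p. p + (t, 0)" borel] by (auto intro!: borel_measurable_continuous_onI continuous_intros)
      show "AE p in lborel. ?h (p + (t, 0)) = exp (4 * t) * (indicator {..<0} (fst p) * indicator J (snd p) * (indicator (strip \<alpha>) p * k0 p))"
        using k0_homogeneous[OF t, of \<alpha>]
      proof eventually_elim
        case (elim p)
        obtain s \<theta> where p: "p = (s, \<theta>)" by force
        show ?case using elim t unfolding p by (auto simp: strip_def indicator_def)
      qed
    qed (rule hb0)
    also have "\<dots> = exp (4 * t) * kint \<alpha> J 0" by (simp add: kint_def)
    finally show ?thesis using 0 by simp
  qed (use 0 in simp)
qed

lemma AE_fst_neq: "AE p in lborel. fst (p :: real \<times> real) \<noteq> c"
proof -
  have "negligible {p :: real \<times> real. (1, 0) \<bullet> p = c}" by (intro negligible_hyperplane) (auto simp: zero_prod_def)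
  also have "{p :: real \<times> real. (1, 0) \<bullet> p = c} = {p. fst p = c}" by (auto simp: inner_prod_def)
  finally have "AE p in lebesgue. p \<notin> {p :: real \<times> real. fst p = c}"
    by (intro AE_not_in) (simp add: negligible_iff_null_sets)
  then show ?thesis by (simp add: AE_completion_iff)
qed

text \<open>Up to a vertical line, the part of a box in the strip is the difference of two
  half-strips over the same angles, on both of which \<open>k0\<close> integrates to zero.\<close>

lemma v_polar: "AE p in lborel. p \<in> strip \<alpha> \<longrightarrow> v (logpolar p) = exp (2 * fst p) * F (snd p)"
proof -
  have "AE p in lborel. indicator (strip \<alpha>) p * k0 p = 0"
  proof (rule AE_zero_if_box_integrals_zero[OF k0_integrable])
    fix a b :: "real \<times> real"
    let ?J = "{snd a<..<snd b}" and ?k = "\<lambda>p. indicator (strip \<alpha>) p * k0 p"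
    let ?I = "\<lambda>t p. indicator {..<t} (fst p) * indicator ?J (snd p) * ?k p"
    \<comment> \<open>Taking minima with 0 and between the corners also covers boxes that leave the
      strip and empty boxes.\<close>
    define tb where "tb = min 0 (min (fst a) (fst b))"
    define t2 where "t2 = min 0 (fst b)"
    have Ii: "integrable lborel (?I t)" for t
    proof (rule integrable_times_bounded[OF k0_integrable, of _ 1])
      show "(\<lambda>p. indicator {..<t} (fst p) * indicator ?J (snd p) :: real) \<in> borel_measurable lborel"
        by (auto intro!: borel_measurable_times fst_compose_borel snd_compose_borel borel_measurable_indicator)
    qed (auto simp: indicator_def)
    have bb: "box a b = {fst a<..<fst b} \<times> ?J"
      by (auto simp: box_def Basis_prod_def inner_prod_def)
    have "(LINT p|lborel. indicator (box a b) p * ?k p) = (LINT p|lborel. ?I t2 p - ?I tb p)"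
    proof (rule integral_cong_AE)
      show "(\<lambda>p. indicator (box a b) p * ?k p) \<in> borel_measurable lborel"
        using k0_integrable by (intro borel_measurable_times borel_measurable_indicator) auto
      show "(\<lambda>p. ?I t2 p - ?I tb p) \<in> borel_measurable lborel" using Ii by (intro borel_measurable_diff) auto
      show "AE p in lborel. indicator (box a b) p * ?k p = ?I t2 p - ?I tb p"
        using AE_fst_neq[of "fst a"]
        by eventually_elim (auto simp: bb tb_def t2_def indicator_def strip_def split: prod.splits)
    qed
    also have "\<dots> = kint \<alpha> ?J t2 - kint \<alpha> ?J tb" unfolding kint_def using Ii by simp
    also have "\<dots> = 0" using kint_zero[of ?J] by (simp add: tb_def t2_def)
    finally show "(LINT p|lborel. indicator (box a b) p * ?k p) = 0" .
  qed
  then show ?thesis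
  proof eventually_elim
    case (elim p)
    have e: "exp (4 * fst p) = exp (2 * fst p) * exp (2 * fst p)" by (simp flip: exp_add)
    show ?case using elim by (auto simp: k0_def e)
  qed
qed

end

lemma integral_lebesgue_AE:
  fixes f h :: "'a::euclidean_space \<Rightarrow> real"
  assumes h: "h \<in> borel_measurable borel" and ae: "AE x in lebesgue. f x = h x"
  shows "(LINT x|lebesgue. f x) = (LINT x|lborel. h x)" "integrable lebesgue f \<longleftrightarrow> integrable lborel h"
proof -
  have hl: "h \<in> borel_measurable lebesgue" by (rule measurable_completion) (simp add: h)
  have ae': "AE x in lebesgue. h x = f x" using ae by eventually_elim simp
  have fl: "f \<in> borel_measurable lebesgue" using hl ae' by (rule borel_measurable_AE)
  have "(LINT x|lebesgue. f x) = (LINT x|lebesgue. h x)" using fl hl ae by (rule integral_cong_AE)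
  also have "\<dots> = (LINT x|lborel. h x)" using h by (intro integral_completion) simp
  finally show "(LINT x|lebesgue. f x) = (LINT x|lborel. h x)" .
  have "integrable lebesgue f \<longleftrightarrow> integrable lebesgue h" using fl hl ae by (rule integrable_cong_AE)
  then show "integrable lebesgue f \<longleftrightarrow> integrable lborel h" using h by (simp add: integrable_completion)
qed

lemma integral_pos_interval:
  fixes h :: "real \<Rightarrow> real"
  assumes i: "integrable lborel h" and nn: "\<And>x. h x \<ge> 0" and pos: "\<And>x. a < x \<Longrightarrow> x < b \<Longrightarrow> h x > 0" and ab: "a < b"
  shows "(LINT x|lborel. h x) > 0"
proof -
  have "(LINT x|lborel. h x) \<noteq> 0"
  proof
    assume "(LINT x|lborel. h x) = 0"
    then have "AE x in lborel. h x = 0" using integral_nonneg_eq_0_iff_AE[OF i] nn by auto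
    then have "AE x in lborel. x \<notin> {a<..<b}" by eventually_elim (use pos in force)
    then have "emeasure lborel {a<..<b} = 0" by (subst (asm) AE_iff_measurable[of "{a<..<b}"]) auto
    then show False using ab by simp
  qed
  moreover have "(LINT x|lborel. h x) \<ge> 0" using nn by (intro integral_nonneg_AE) auto
  ultimately show ?thesis by simp
qed

section \<open>The profile of the Laplacian and the weak equation on the circle\<close>

context homogeneous_minimizer
begin

definition c0 :: real where "c0 = (LINT s|lborel. exp (2 * s) * bump 1 (-2) (-1) s)"

text \<open>Homogeneity of the Laplacian is not known at this stage. Averaging against a compactly
  supported weight, instead of the half-line, makes the average admissible as a test in
  \<open>polar_weak\<close>; the normalisation makes it reproduce functions of the angle.\<close>

definition \<rho>0 :: "real \<Rightarrow> real" where "\<rho>0 s = (1 / c0) * bump 1 (-2) (-1) s"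

definition g :: "real \<Rightarrow> real" where
  "g \<theta> = (LINT s|lborel. lap (logpolar (s, \<theta>)) * (exp (2 * s) * \<rho>0 s))"

lemma exp_bumps: "f \<in> bumps a b \<Longrightarrow> (\<lambda>s. exp (2 * s) * f s) \<in> bumps a b"
  by (intro bumps_mult) auto

lemma c0_pos: "c0 > 0"
proof -
  have "(\<lambda>s. exp (2 * s) * bump 1 (-2) (-1) s) \<in> bumps (-2) (-1)" by (intro exp_bumps bump_in_bumps)
  then show ?thesis unfolding c0_def
    using bump_bounds(1) bump_pos[of "-2" _ "-1" 0]
    by (intro integral_pos_interval[where a="-2" and b="-1"] bumps_integrable) auto
qed

lemma \<rho>0_bumps: "\<rho>0 \<in> bumps (-2) (-1)"
  unfolding \<rho>0_def[abs_def] by (intro bumps_mult bump_in_bumps) auto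

lemma \<rho>0_integral: "(LINT s|lborel. exp (2 * s) * \<rho>0 s) = 1"
proof -
  have "(LINT s|lborel. exp (2 * s) * \<rho>0 s) = (LINT s|lborel. (1 / c0) * (exp (2 * s) * bump 1 (-2) (-1) s))"
    by (simp add: \<rho>0_def mult.left_commute)
  also have "\<dots> = (1 / c0) * c0" unfolding c0_def by simp
  finally show ?thesis using c0_pos by simp
qed

lemma lap_strip_integrable: "integrable lborel (\<lambda>p. exp (2 * fst p) * indicator (strip \<alpha>) p * lap (logpolar p))"
  using logpolar_integral(1)[OF lap(1)] lap(3) by blast

lemma bumps_fst_borel: "\<rho> \<in> bumps a b \<Longrightarrow> (\<lambda>p::real\<times>real. \<rho> (fst p)) \<in> borel_measurable borel"
  and bumps_snd_borel: "\<rho> \<in> bumps a b \<Longrightarrow> (\<lambda>p::real\<times>real. \<rho> (snd p)) \<in> borel_measurable borel"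
  by (intro fst_compose_borel snd_compose_borel bumps_borel; assumption)+

lemma g_borel [measurable]: "g \<in> borel_measurable borel"
proof -
  have "(\<lambda>p. lap (logpolar p) * (exp (2 * fst p) * \<rho>0 (fst p))) \<in> borel_measurable borel"
    by (intro borel_measurable_times lapl_borel exp_fst_borel bumps_fst_borel[OF \<rho>0_bumps])
  from partial_integral_borel[OF this] show ?thesis unfolding g_def[abs_def] by simp
qed

lemma g_periodic: "g (\<theta> + 2 * pi) = g \<theta>"
  by (simp add: g_def logpolar_periodic)

lemma g_joint:
  shows "integrable lborel (\<lambda>p. \<rho>0 (fst p) * (exp (2 * fst p) * indicator (strip \<alpha>) p * lap (logpolar p)))"
    "(LINT s|lborel. \<rho>0 (fst (s, \<theta>)) * (exp (2 * fst (s, \<theta>)) * indicator (strip \<alpha>) (s, \<theta>) * lap (logpolar (s, \<theta>)))) = window \<alpha> \<theta> * g \<theta>"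
proof -
  obtain B where B: "\<And>x. \<bar>\<rho>0 x\<bar> \<le> B" using bumps_bounded[OF \<rho>0_bumps] by blast
  show "integrable lborel (\<lambda>p. \<rho>0 (fst p) * (exp (2 * fst p) * indicator (strip \<alpha>) p * lap (logpolar p)))"
    by (rule integrable_times_bounded[OF lap_strip_integrable, where B=B])
       (use B bumps_fst_borel[OF \<rho>0_bumps] in auto)
  have "(LINT s|lborel. \<rho>0 (fst (s, \<theta>)) * (exp (2 * fst (s, \<theta>)) * indicator (strip \<alpha>) (s, \<theta>) * lap (logpolar (s, \<theta>)))) =
      (LINT s|lborel. window \<alpha> \<theta> * (lap (logpolar (s, \<theta>)) * (exp (2 * s) * \<rho>0 s)))"
  proof (rule Bochner_Integration.integral_cong[OF refl])
    fix s
    show "\<rho>0 (fst (s, \<theta>)) * (exp (2 * fst (s, \<theta>)) * indicator (strip \<alpha>) (s, \<theta>) * lap (logpolar (s, \<theta>))) =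
        window \<alpha> \<theta> * (lap (logpolar (s, \<theta>)) * (exp (2 * s) * \<rho>0 s))"
      using bumps_zero[OF \<rho>0_bumps, of s] by (cases "s \<in> {-2..-1}") (auto simp: strip_split)
  qed
  then show "(LINT s|lborel. \<rho>0 (fst (s, \<theta>)) * (exp (2 * fst (s, \<theta>)) * indicator (strip \<alpha>) (s, \<theta>) * lap (logpolar (s, \<theta>)))) = window \<alpha> \<theta> * g \<theta>"
    by (simp add: g_def)
qed

lemma g_integrable: "integrable lborel (\<lambda>\<theta>. window \<alpha> \<theta> * g \<theta>)"
  using lborel2_snd(1)[OF g_joint(1)[of \<alpha>]] unfolding g_joint(2) .

lemma window_test:
  assumes z: "\<zeta> \<in> bumps ta tb" and t: "\<alpha> < ta" "tb < \<alpha> + 2 * pi" and h: "integrable lborel (\<lambda>\<theta>. window \<alpha> \<theta> * h \<theta>)"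
  shows "integrable lborel (\<lambda>\<theta>. h \<theta> * \<zeta> \<theta>)"
proof -
  obtain B where B: "\<And>x. \<bar>\<zeta> x\<bar> \<le> B" using bumps_bounded[OF z] by blast
  have "integrable lborel (\<lambda>\<theta>. \<zeta> \<theta> * (window \<alpha> \<theta> * h \<theta>))"
    by (rule integrable_times_bounded[OF h, where B=B]) (use B bumps_borel[OF z] in auto)
  also have "(\<lambda>\<theta>. \<zeta> \<theta> * (window \<alpha> \<theta> * h \<theta>)) = (\<lambda>\<theta>. h \<theta> * \<zeta> \<theta>)"
  proof
    fix \<theta> show "\<zeta> \<theta> * (window \<alpha> \<theta> * h \<theta>) = h \<theta> * \<zeta> \<theta>"
      using bumps_zero[OF z, of \<theta>] t by (cases "\<theta> \<in> {ta..tb}") (auto simp: window_def)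
  qed
  finally show ?thesis .
qed

text \<open>The Laplacian of a pulled back product carries e^(-2s), which cancels the Jacobian; what
  remains is e^(2s) F against a sum of products, and the integrals separate. The right side sees
  \<rho> only through the integral of e^(2s) \<rho>, which is why the Laplacian depends on the angle
  alone.\<close>

lemma polar_weak:
  assumes "\<alpha> < ta" "tb < \<alpha> + 2 * pi" "s1 < 0" and r: "\<rho> \<in> bumps s0 s1" and z: "\<zeta> \<in> bumps ta tb"
  shows "(LINT p|lborel. exp (2 * fst p) * lap (logpolar p) * (\<rho> (fst p) * \<zeta> (snd p))) =
    (LINT s|lborel. exp (2 * s) * \<rho> s) * (LINT \<theta>|lborel. F \<theta> * (4 * \<zeta> \<theta> + deriv (deriv \<zeta>) \<theta>))"
proof -
  interpret polar_rect \<alpha> s0 s1 ta tb by unfold_locales fact+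
  let ?\<phi> = "\<lambda>x. \<rho> (fst (chart \<alpha> x)) * \<zeta> (snd (chart \<alpha> x))"
  let ?\<psi> = "\<lambda>p. exp (- 2 * fst p) * (deriv (deriv \<rho>) (fst p) * \<zeta> (snd p) + \<rho> (fst p) * deriv (deriv \<zeta>) (snd p))"
  note r2 = bumps_deriv[OF bumps_deriv[OF r]] and z2 = bumps_deriv[OF bumps_deriv[OF z]]
  have ind: "(indicator disc :: _ \<Rightarrow> real) \<in> borel_measurable borel" by (intro borel_measurable_indicator) simp
  have chart_comp: "(\<lambda>x. h (chart \<alpha> x)) \<in> borel_measurable borel" if "h \<in> borel_measurable borel" for h :: "_ \<Rightarrow> real"
    using measurable_compose[OF chart_measurable that] .
  have \<phi>b: "?\<phi> \<in> borel_measurable borel"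
    using chart_comp[of "\<lambda>p. \<rho> (fst p) * \<zeta> (snd p)"] bumps_fst_borel[OF r] bumps_snd_borel[OF z] by (auto intro: borel_measurable_times)
  have \<psi>b: "?\<psi> \<in> borel_measurable borel"
    by (intro borel_measurable_times borel_measurable_add exp_fst_borel bumps_fst_borel[OF r] bumps_fst_borel[OF r2] bumps_snd_borel[OF z] bumps_snd_borel[OF z2])
  have "(LINT x:disc|lebesgue. weak_laplacian disc u x * ?\<phi> x) = (LINT x:disc|lebesgue. u x * ?\<psi> (chart \<alpha> x))"
    using laplacian_test[OF product_pull_test(1)[OF r z]] unfolding product_pull_test(2)[OF r z] .
  also have "(LINT x:disc|lebesgue. u x * ?\<psi> (chart \<alpha> x)) = (LINT x|lborel. indicator disc x * (v x * ?\<psi> (chart \<alpha> x)))"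
    unfolding set_lebesgue_integral_def real_scaleR_def
  proof (rule integral_lebesgue_AE)
    show "(\<lambda>x. indicator disc x * (v x * ?\<psi> (chart \<alpha> x))) \<in> borel_measurable borel"
      by (intro borel_measurable_times ind v(1) chart_comp[OF \<psi>b])
    show "AE x in lebesgue. indicator disc x * (u x * ?\<psi> (chart \<alpha> x)) = indicator disc x * (v x * ?\<psi> (chart \<alpha> x))"
      using v(2) by eventually_elim (auto simp: indicator_def)
  qed
  also have "\<dots> = (LINT p|lborel. exp (2 * fst p) * indicator (strip \<alpha>) p * (v (logpolar p) * ?\<psi> (chart \<alpha> (logpolar p))))"
    by (rule logpolar_integral(2)) (intro borel_measurable_times v(1) chart_comp[OF \<psi>b])
  also have "\<dots> = (LINT p|lborel. (exp (2 * fst p) * deriv (deriv \<rho>) (fst p)) * (F (snd p) * \<zeta> (snd p)) +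
      (exp (2 * fst p) * \<rho> (fst p)) * (F (snd p) * deriv (deriv \<zeta>) (snd p)))"
  proof (rule integral_cong_AE)
    have "(\<lambda>p. ?\<psi> (chart \<alpha> (logpolar p))) \<in> borel_measurable borel"
      using measurable_compose[OF logpolar_measurable chart_comp[OF \<psi>b]] .
    then show "(\<lambda>p. exp (2 * fst p) * indicator (strip \<alpha>) p * (v (logpolar p) * ?\<psi> (chart \<alpha> (logpolar p)))) \<in> borel_measurable lborel"
      using borel_measurable_times[OF logpolar_weight_measurable borel_measurable_times[OF vl_borel]] by simp
    show "(\<lambda>p. (exp (2 * fst p) * deriv (deriv \<rho>) (fst p)) * (F (snd p) * \<zeta> (snd p)) +
      (exp (2 * fst p) * \<rho> (fst p)) * (F (snd p) * deriv (deriv \<zeta>) (snd p))) \<in> borel_measurable lborel"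
      unfolding measurable_lborel2
      by (intro borel_measurable_times borel_measurable_add exp_fst_borel bumps_fst_borel[OF r] bumps_fst_borel[OF r2]
        bumps_snd_borel[OF z] bumps_snd_borel[OF z2] snd_compose_borel[OF F_borel])
    show "AE p in lborel. exp (2 * fst p) * indicator (strip \<alpha>) p * (v (logpolar p) * ?\<psi> (chart \<alpha> (logpolar p))) =
      (exp (2 * fst p) * deriv (deriv \<rho>) (fst p)) * (F (snd p) * \<zeta> (snd p)) +
      (exp (2 * fst p) * \<rho> (fst p)) * (F (snd p) * deriv (deriv \<zeta>) (snd p))"
      using v_polar[of \<alpha>]
    proof eventually_elim
      case (elim p)
      show ?case
      proof (cases "p \<in> strip \<alpha>")
        case True
        then have c: "chart \<alpha> (logpolar p) = p" by (intro chart_logpolar) (auto simp: strip_def)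
        have e: "exp (2 * fst p) * exp (- 2 * fst p) = 1" by (simp flip: exp_add)
        have "exp (2 * fst p) * indicator (strip \<alpha>) p * (v (logpolar p) * ?\<psi> (chart \<alpha> (logpolar p))) =
          (exp (2 * fst p) * exp (- 2 * fst p)) * (v (logpolar p) * (deriv (deriv \<rho>) (fst p) * \<zeta> (snd p) + \<rho> (fst p) * deriv (deriv \<zeta>) (snd p)))"
          unfolding c using True by simp
        also have "\<dots> = exp (2 * fst p) * F (snd p) * (deriv (deriv \<rho>) (fst p) * \<zeta> (snd p) + \<rho> (fst p) * deriv (deriv \<zeta>) (snd p))"
          unfolding e using elim True by simp
        also have "\<dots> = (exp (2 * fst p) * deriv (deriv \<rho>) (fst p)) * (F (snd p) * \<zeta> (snd p)) +
          (exp (2 * fst p) * \<rho> (fst p)) * (F (snd p) * deriv (deriv \<zeta>) (snd p))"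
          by (simp add: algebra_simps)
        finally show ?thesis .
      next
        case False
        then have "p \<notin> Q" using Q_strip by blast
        then have "fst p \<notin> {s0..s1} \<or> snd p \<notin> {ta..tb}" by (cases p) (auto simp: Q_def)
        then show ?thesis using False bumps_zero[OF r, of "fst p"] bumps_zero[OF r2, of "fst p"] bumps_zero[OF z, of "snd p"] bumps_zero[OF z2, of "snd p"]
          by auto
      qed
    qed
  qed
  also have "\<dots> = (LINT s|lborel. exp (2 * s) * deriv (deriv \<rho>) s) * (LINT \<theta>|lborel. F \<theta> * \<zeta> \<theta>) +
      (LINT s|lborel. exp (2 * s) * \<rho> s) * (LINT \<theta>|lborel. F \<theta> * deriv (deriv \<zeta>) \<theta>)"
    using lborel2_product[OF bumps_integrable[OF exp_bumps[OF r2]] window_test[OF z t F_integrable]]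
      lborel2_product[OF bumps_integrable[OF exp_bumps[OF r]] window_test[OF z2 t F_integrable]] by simp
  also have "\<dots> = (LINT s|lborel. exp (2 * s) * \<rho> s) * (4 * (LINT \<theta>|lborel. F \<theta> * \<zeta> \<theta>) + (LINT \<theta>|lborel. F \<theta> * deriv (deriv \<zeta>) \<theta>))"
    unfolding bumps_exp_integral[OF r] by (simp add: algebra_simps)
  also have "4 * (LINT \<theta>|lborel. F \<theta> * \<zeta> \<theta>) + (LINT \<theta>|lborel. F \<theta> * deriv (deriv \<zeta>) \<theta>) = (LINT \<theta>|lborel. 4 * (F \<theta> * \<zeta> \<theta>) + F \<theta> * deriv (deriv \<zeta>) \<theta>)"
    using window_test[OF z t F_integrable] window_test[OF z2 t F_integrable] by simp
  also have "\<dots> = (LINT \<theta>|lborel. F \<theta> * (4 * \<zeta> \<theta> + deriv (deriv \<zeta>) \<theta>))" by (simp add: algebra_simps)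
  finally have main: "(LINT x:disc|lebesgue. weak_laplacian disc u x * ?\<phi> x) =
     (LINT s|lborel. exp (2 * s) * \<rho> s) * (LINT \<theta>|lborel. F \<theta> * (4 * \<zeta> \<theta> + deriv (deriv \<zeta>) \<theta>))" .
  have "(LINT x:disc|lebesgue. weak_laplacian disc u x * ?\<phi> x) = (LINT x|lborel. indicator disc x * (lap x * ?\<phi> x))"
    unfolding set_lebesgue_integral_def real_scaleR_def
  proof (rule integral_lebesgue_AE)
    show "(\<lambda>x. indicator disc x * (lap x * ?\<phi> x)) \<in> borel_measurable borel"
      by (rule borel_measurable_times[OF ind borel_measurable_times[OF lap(1) \<phi>b]])
    show "AE x in lebesgue. indicator disc x * (weak_laplacian disc u x * ?\<phi> x) = indicator disc x * (lap x * ?\<phi> x)"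
      using lap(2) by eventually_elim (auto simp: indicator_def)
  qed
  also have "\<dots> = (LINT p|lborel. exp (2 * fst p) * indicator (strip \<alpha>) p * (lap (logpolar p) * ?\<phi> (logpolar p)))"
    by (rule logpolar_integral(2)[OF borel_measurable_times[OF lap(1) \<phi>b]])
  also have "\<dots> = (LINT p|lborel. exp (2 * fst p) * lap (logpolar p) * (\<rho> (fst p) * \<zeta> (snd p)))"
  proof (rule Bochner_Integration.integral_cong[OF refl])
    fix p :: "real \<times> real"
    show "exp (2 * fst p) * indicator (strip \<alpha>) p * (lap (logpolar p) * ?\<phi> (logpolar p)) = exp (2 * fst p) * lap (logpolar p) * (\<rho> (fst p) * \<zeta> (snd p))"
    proof (cases "p \<in> strip \<alpha>")
      case True
      then have "chart \<alpha> (logpolar p) = p" by (intro chart_logpolar) (auto simp: strip_def)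
      then show ?thesis using True by simp
    next
      case False
      then have "p \<notin> Q" using Q_strip by blast
      then show ?thesis using product_supp[OF r z] False by simp
    qed
  qed
  finally show ?thesis using main by simp
qed

text \<open>With the normalised weight the left side of \<open>polar_weak\<close> becomes the
  pairing of \<open>g\<close> with \<zeta>. The result is the weak form of F'' + 4 F = g on each
  window shorter than the circle.\<close>

lemma F_weak:
  assumes "\<alpha> < ta" "tb < \<alpha> + 2 * pi" and z: "\<zeta> \<in> bumps ta tb"
  shows "(LINT \<theta>|lborel. F \<theta> * (4 * \<zeta> \<theta> + deriv (deriv \<zeta>) \<theta>)) = (LINT \<theta>|lborel. g \<theta> * \<zeta> \<theta>)"
proof -
  interpret polar_rect \<alpha> "-2" "-1" ta tb by unfold_locales (use assms in auto)
  obtain B where B: "\<And>x. \<bar>\<zeta> x\<bar> \<le> B" using bumps_bounded[OF z] by blast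
  let ?h = "\<lambda>p. \<rho>0 (fst p) * (exp (2 * fst p) * indicator (strip \<alpha>) p * lap (logpolar p))"
  have i: "integrable lborel (\<lambda>p. \<zeta> (snd p) * ?h p)"
    by (rule integrable_times_bounded[OF g_joint(1), where B=B]) (use B bumps_snd_borel[OF z] in auto)
  have "(LINT \<theta>|lborel. F \<theta> * (4 * \<zeta> \<theta> + deriv (deriv \<zeta>) \<theta>)) = (LINT p|lborel. exp (2 * fst p) * lap (logpolar p) * (\<rho>0 (fst p) * \<zeta> (snd p)))"
    using polar_weak[OF assms(1,2) _ \<rho>0_bumps z] by (simp add: \<rho>0_integral)
  also have "\<dots> = (LINT p|lborel. \<zeta> (snd p) * ?h p)"
  proof (rule Bochner_Integration.integral_cong[OF refl])
    fix p :: "real \<times> real"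
    show "exp (2 * fst p) * lap (logpolar p) * (\<rho>0 (fst p) * \<zeta> (snd p)) = \<zeta> (snd p) * ?h p"
      using product_supp[OF \<rho>0_bumps z, of p] Q_strip by (cases "p \<in> strip \<alpha>") auto
  qed
  also have "\<dots> = (LINT \<theta>|lborel. LINT s|lborel. \<zeta> (snd (s, \<theta>)) * ?h (s, \<theta>))" using lborel2_snd(2)[OF i] by simp
  also have "\<dots> = (LINT \<theta>|lborel. \<zeta> \<theta> * (window \<alpha> \<theta> * g \<theta>))"
    unfolding snd_conv integral_mult_right_zero g_joint(2) ..
  also have "\<dots> = (LINT \<theta>|lborel. g \<theta> * \<zeta> \<theta>)"
  proof (rule Bochner_Integration.integral_cong[OF refl])
    fix \<theta> show "\<zeta> \<theta> * (window \<alpha> \<theta> * g \<theta>) = g \<theta> * \<zeta> \<theta>"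
      using bumps_zero[OF z, of \<theta>] assms by (cases "\<theta> \<in> {ta..tb}") (auto simp: window_def)
  qed
  finally show ?thesis .
qed

end

lemma open_strip: "open (strip \<alpha>)"
  unfolding strip_def by (intro open_Times) auto

lemma boxbump_prod: "boxbump n a b p = bump n (fst a) (fst b) (fst p) * bump n (snd a) (snd b) (snd (p :: real \<times> real))"
proof -
  have B: "(Basis :: (real \<times> real) set) = {(1, 0), (0, 1)}" by (auto simp: Basis_prod_def)
  show ?thesis unfolding boxbump_def B by (simp add: inner_prod_def)
qed

context homogeneous_minimizer
begin

text \<open>A box bump in the strip is a product of bumps, and by \<open>polar_weak\<close> and
  \<open>F_weak\<close> the functions \<open>lap\<close> and \<open>g\<close> have the same pairing
  with it.\<close>

lemma lap_polar: "AE p in lborel. p \<in> strip \<alpha> \<longrightarrow> lap (logpolar p) = g (snd p)"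
proof -
  let ?k = "\<lambda>p. exp (2 * fst p) * (lap (logpolar p) - g (snd p))"
  have kb: "?k \<in> borel_measurable borel"
    by (intro borel_measurable_times borel_measurable_diff exp_fst_borel lapl_borel snd_compose_borel g_borel)
  have rect: "\<alpha> < snd a \<and> snd b < \<alpha> + 2 * pi \<and> fst b < 0 \<and> cbox a b = {fst a..fst b} \<times> {snd a..snd b}"
    if "cbox a b \<subseteq> strip \<alpha>" "cbox a b \<noteq> {}" for a b
  proof -
    have c: "cbox a b = {fst a..fst b} \<times> {snd a..snd b}" by (metis cbox_Pair_eq cbox_interval prod.collapse)
    then have "fst a \<le> fst b" "snd a \<le> snd b" using that(2) by auto
    then have "(fst b, snd a) \<in> cbox a b" "(fst b, snd b) \<in> cbox a b" using c by (auto simp: mem_Times_iff)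
    then have "(fst b, snd a) \<in> strip \<alpha>" "(fst b, snd b) \<in> strip \<alpha>" using that(1) by blast+
    then show ?thesis using c by (simp add: strip_def mem_Times_iff)
  qed
  have "AE p in lebesgue. p \<in> strip \<alpha> \<longrightarrow> ?k p = 0"
  proof (rule fundamental_lemma[OF open_strip])
    fix a b assume ab: "cbox a b \<subseteq> strip \<alpha>"
    show "?k absolutely_integrable_on cbox a b"
    proof (cases "cbox a b = {}")
      case False
      note r = rect[OF ab False]
      have 1: "integrable lborel (\<lambda>p. indicator (cbox a b) p * (exp (2 * fst p) * indicator (strip \<alpha>) p * lap (logpolar p)))"
        by (rule integrable_times_bounded[OF lap_strip_integrable, where B=1]) (auto simp: indicator_def)
      have "integrable lborel (\<lambda>s. indicator {fst a..fst b} s *\<^sub>R exp (2 * s))"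
        by (intro borel_integrable_compact continuous_intros) auto
      moreover have "integrable lborel (\<lambda>\<theta>. indicator {snd a..snd b} \<theta> * (window \<alpha> \<theta> * g \<theta>))"
        by (rule integrable_times_bounded[OF g_integrable, where B=1]) (auto simp: indicator_def)
      ultimately have 2: "integrable lborel (\<lambda>p. (indicator {fst a..fst b} (fst p) *\<^sub>R exp (2 * fst p)) *
         (indicator {snd a..snd b} (snd p) * (window \<alpha> (snd p) * g (snd p))))"
        by (rule lborel2_product(1))
      have "integrable lborel (\<lambda>p. indicator (cbox a b) p *\<^sub>R ?k p)"
      proof (rule back_subst[of "integrable lborel", OF Bochner_Integration.integrable_diff[OF 1 2]], rule ext)
        fix p :: "real \<times> real"
        show "indicator (cbox a b) p * (exp (2 * fst p) * indicator (strip \<alpha>) p * lap (logpolar p)) -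
          (indicator {fst a..fst b} (fst p) *\<^sub>R exp (2 * fst p)) * (indicator {snd a..snd b} (snd p) * (window \<alpha> (snd p) * g (snd p))) =
          indicator (cbox a b) p *\<^sub>R ?k p"
        proof (cases "p \<in> cbox a b")
          case True
          then have "p \<in> strip \<alpha>" using ab by blast
          moreover have "fst p \<in> {fst a..fst b}" "snd p \<in> {snd a..snd b}" using True r by auto
          moreover have "window \<alpha> (snd p) = 1" using \<open>p \<in> strip \<alpha>\<close> by (auto simp: window_def strip_def)
          ultimately show ?thesis using True by (simp add: algebra_simps)
        next
          case False
          then have "fst p \<notin> {fst a..fst b} \<or> snd p \<notin> {snd a..snd b}" using r by (cases p) auto
          then show ?thesis using False by (auto simp: indicator_def)
        qed
      qed
      then show ?thesis unfolding set_integrable_def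
        using kb by (subst integrable_completion) (auto intro!: borel_measurable_scaleR borel_measurable_indicator)
    qed simp
    fix n
    show "(LINT p|lebesgue. ?k p * boxbump n a b p) = 0"
    proof (cases "cbox a b = {}")
      case True
      then have "box a b = {}" using box_subset_cbox by blast
      then show ?thesis by (simp add: boxbump_zero)
    next
      case False
      note r = rect[OF ab False]
      let ?\<rho> = "bump n (fst a) (fst b)" and ?\<zeta> = "bump n (snd a) (snd b)"
      have z: "?\<zeta> \<in> bumps (snd a) (snd b)" and rho: "?\<rho> \<in> bumps (fst a) (fst b)" by (rule bump_in_bumps)+
      have gz: "integrable lborel (\<lambda>\<theta>. g \<theta> * ?\<zeta> \<theta>)" using r by (intro window_test[OF z _ _ g_integrable]) auto
      note i2 = lborel2_product[OF bumps_integrable[OF exp_bumps[OF rho]] gz]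
      let ?h = "\<lambda>p. exp (2 * fst p) * lap (logpolar p) * (?\<rho> (fst p) * ?\<zeta> (snd p))"
      have i1: "integrable lborel ?h"
      proof (rule back_subst[of "integrable lborel"])
        show "integrable lborel (\<lambda>p. (?\<rho> (fst p) * ?\<zeta> (snd p)) * (exp (2 * fst p) * indicator (strip \<alpha>) p * lap (logpolar p)))"
          by (rule integrable_times_bounded[OF lap_strip_integrable, where B=1])
            (use bump_bounds bumps_fst_borel[OF rho] bumps_snd_borel[OF z] in \<open>auto simp: abs_mult intro!: mult_le_one borel_measurable_times\<close>)
        show "(\<lambda>p. (?\<rho> (fst p) * ?\<zeta> (snd p)) * (exp (2 * fst p) * indicator (strip \<alpha>) p * lap (logpolar p))) = ?h"
        proof
          fix p
          show "(?\<rho> (fst p) * ?\<zeta> (snd p)) * (exp (2 * fst p) * indicator (strip \<alpha>) p * lap (logpolar p)) = ?h p"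
          proof (cases "p \<in> strip \<alpha>")
            case False
            then have "p \<notin> box a b" using ab box_subset_cbox by blast
            then have "?\<rho> (fst p) * ?\<zeta> (snd p) = 0" using boxbump_zero[of p a b n] by (simp add: boxbump_prod)
            then show ?thesis by auto
          qed simp
        qed
      qed
      have "(LINT p|lebesgue. ?k p * boxbump n a b p) = (LINT p|lborel. ?k p * boxbump n a b p)"
        using kb by (intro integral_completion) (auto intro!: borel_measurable_times)
      also have "\<dots> = (LINT p|lborel. ?h p - (exp (2 * fst p) * ?\<rho> (fst p)) * (g (snd p) * ?\<zeta> (snd p)))"
        by (intro Bochner_Integration.integral_cong) (auto simp: boxbump_prod algebra_simps)
      also have "\<dots> = (LINT p|lborel. ?h p) - (LINT s|lborel. exp (2 * s) * ?\<rho> s) * (LINT \<theta>|lborel. g \<theta> * ?\<zeta> \<theta>)"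
        using i1 i2 by simp
      also have "(LINT \<theta>|lborel. g \<theta> * ?\<zeta> \<theta>) = (LINT \<theta>|lborel. F \<theta> * (4 * ?\<zeta> \<theta> + deriv (deriv ?\<zeta>) \<theta>))"
        using r by (intro F_weak[symmetric, OF _ _ z]) auto
      also have "(LINT p|lborel. ?h p) = (LINT s|lborel. exp (2 * s) * ?\<rho> s) * (LINT \<theta>|lborel. F \<theta> * (4 * ?\<zeta> \<theta> + deriv (deriv ?\<zeta>) \<theta>))"
        using r by (intro polar_weak[OF _ _ _ rho z, of \<alpha>]) auto
      finally show ?thesis by simp
    qed
  qed
  then have "AE p in lborel. p \<in> strip \<alpha> \<longrightarrow> ?k p = 0" by (simp add: AE_completion_iff)
  then show ?thesis by eventually_elim auto
qed

lemma u_polar: "AE x in lebesgue. x \<in> disc \<longrightarrow> u x = (norm x)\<^sup>2 * F (ang \<alpha> x)"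
proof -
  have "AE p in lborel. p \<in> strip \<alpha> \<longrightarrow> v (logpolar p) = exp (2 * fst p) * F (snd p)" by (rule v_polar)
  then have 1: "AE x in lborel. x \<in> disc \<longrightarrow> v (logpolar (chart \<alpha> x)) = exp (2 * fst (chart \<alpha> x)) * F (snd (chart \<alpha> x))"
    by (rule AE_strip_imp_ball)
  have "AE x in lborel. x \<noteq> (0 :: real^2)" by (rule AE_lborel_singleton)
  with 1 have "AE x in lborel. x \<in> disc \<longrightarrow> v x = (norm x)\<^sup>2 * F (ang \<alpha> x)"
  proof eventually_elim
    case (elim x)
    then have "exp (2 * ln (norm x)) = (norm x)\<^sup>2" by (simp add: exp_double)
    with elim show ?case by (simp add: logpolar_chart) (simp add: chart_def)
  qed
  then have "AE x in lebesgue. x \<in> disc \<longrightarrow> v x = (norm x)\<^sup>2 * F (ang \<alpha> x)" by (rule AE_completion)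
  with v(2) show ?thesis by eventually_elim auto
qed

text \<open>A and B are the energy densities of \<open>u\<close> and of \<open>u\<close> plus the
  pullback of W, with the Jacobian included. They coincide off Q, so minimality in the disc becomes
  an inequality over Q; integrability over Q is recorded because later steps split these
  integrals.\<close>

lemma minimality_polar:
  assumes ta: "\<alpha> < ta" "tb < \<alpha> + 2 * pi" "s1 < 0"
    and Q: "Q = {s0..s1} \<times> {ta..tb}"
    and supp: "\<And>p. p \<notin> Q \<Longrightarrow> W p = 0 \<and> W1 p = 0 \<and> W2 p = 0 \<and> W11 p = 0 \<and> W12 p = 0 \<and> W21 p = 0 \<and> W22 p = 0"
    and lip: "\<And>p. loc_lip W p" "\<And>p. loc_lip W1 p" "\<And>p. loc_lip W2 p"
    and der: "\<And>p. p \<in> Q \<Longrightarrow> (W has_derivative (\<lambda>q. W1 p * fst q + W2 p * snd q)) (at p)"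
    and der2: "AE p in lborel. p \<in> Q \<longrightarrow> (W1 has_derivative (\<lambda>q. W11 p * fst q + W12 p * snd q)) (at p) \<and>
      (W2 has_derivative (\<lambda>q. W21 p * fst q + W22 p * snd q)) (at p)"
    and meas: "W \<in> borel_measurable borel" "W11 \<in> borel_measurable borel" "W22 \<in> borel_measurable borel"
  defines "A \<equiv> \<lambda>p. exp (2 * fst p) * ((g (snd p))\<^sup>2 + indicator {p. F (snd p) \<noteq> 0} p)"
    and "B \<equiv> \<lambda>p. exp (2 * fst p) * ((g (snd p) + exp (- 2 * fst p) * (W11 p + W22 p))\<^sup>2 +
      indicator {p. exp (2 * fst p) * F (snd p) + W p \<noteq> 0} p)"
  shows "integrable lborel (\<lambda>p. indicator Q p * A p)" "integrable lborel (\<lambda>p. indicator Q p * B p)"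
    "(LINT p|lborel. indicator Q p * A p) \<le> (LINT p|lborel. indicator Q p * B p)"
proof -
  interpret R: polar_rect \<alpha> s0 s1 ta tb by unfold_locales fact+
  have QQ: "Q = R.Q" by (simp add: Q R.Q_def)
  let ?w = "\<lambda>x. W (chart \<alpha> x)" and ?w2 = "\<lambda>b c x. dop c (dop_s b W1 W2 W11 W21) (dop_t b W1 W2 W12 W22) (chart \<alpha> x)"
  have w: "C11 ?w (\<lambda>b x. dop b W1 W2 (chart \<alpha> x)) ?w2"
    using supp lip der der2 unfolding QQ by (intro R.pull_C11) auto
  let ?L = "\<lambda>x. exp (- 2 * fst (chart \<alpha> x)) * (W11 (chart \<alpha> x) + W22 (chart \<alpha> x))"
  have sum: "(\<Sum>b\<in>Basis. ?w2 b b x) = ?L x" for x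
    unfolding Basis_real2 using axis_1_neq_2 by (simp add: laplacian_polar)
  have ind: "(indicator disc :: _ \<Rightarrow> real) \<in> borel_measurable borel" by (intro borel_measurable_indicator) simp
  have chart_comp: "(\<lambda>x. h (chart \<alpha> x)) \<in> borel_measurable borel" if "h \<in> borel_measurable borel" for h :: "_ \<Rightarrow> real"
    using measurable_compose[OF chart_measurable that] .
  have Lb: "?L \<in> borel_measurable borel"
    by (rule chart_comp[OF borel_measurable_times[OF exp_fst_borel borel_measurable_add[OF meas(2,3)]]])
  have wb: "?w \<in> borel_measurable borel" by (rule chart_comp[OF meas(1)])
  have nz: "(\<lambda>x. indicator {x. f x \<noteq> 0} x :: real) \<in> borel_measurable borel" if "f \<in> borel_measurable borel" for f :: "'z::topological_space \<Rightarrow> real"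
  proof (rule borel_measurable_indicator)
    have "{x \<in> space borel. f x \<noteq> 0} \<in> sets borel" using that by (rule borel_measurable_neq) simp
    then show "{x. f x \<noteq> 0} \<in> sets borel" by simp
  qed
  let ?a = "\<lambda>x. (lap x)\<^sup>2 + indicator {x. v x \<noteq> 0} x" and ?b = "\<lambda>x. (lap x + ?L x)\<^sup>2 + indicator {x. v x + ?w x \<noteq> 0} x :: real"
  have ab: "?a \<in> borel_measurable borel" "?b \<in> borel_measurable borel"
    by (intro borel_measurable_add borel_measurable_power lap(1) nz v(1) Lb wb)+
  note per = perturbation[OF w]
  interpret v: H2_function disc "\<lambda>x. u x + ?w x" by unfold_locales (use per in auto)
  have ea: "AE x in lebesgue. indicator disc x * ((weak_laplacian disc u x)\<^sup>2 + indicator {x. u x \<noteq> 0} x) = indicator disc x * ?a x"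
    using v(2) lap(2) by eventually_elim (auto simp: indicator_def)
  have eb: "AE x in lebesgue. indicator disc x * ((weak_laplacian disc (\<lambda>x. u x + ?w x) x)\<^sup>2 + indicator {x. u x + ?w x \<noteq> 0} x) = indicator disc x * ?b x"
    using v(2) lap(2) per(2)
  proof eventually_elim
    case (elim x)
    then show ?case unfolding sum by (auto simp: indicator_def)
  qed
  have eb': "AE x in lebesgue. indicator disc x * ((weak_laplacian disc u x + (\<Sum>b\<in>Basis. ?w2 b b x))\<^sup>2 + indicator {x. u x + ?w x \<noteq> 0} x) = indicator disc x * ?b x"
    using v(2) lap(2)
  proof eventually_elim
    case (elim x)
    then show ?case unfolding sum by (auto simp: indicator_def)
  qed
  have iab: "integrable lborel (\<lambda>x. indicator disc x * ?a x)" "integrable lborel (\<lambda>x. indicator disc x * ?b x)"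
    using energy_density_integrable(1)[OF disc_finite] v.energy_density_integrable(1)[OF disc_finite]
      integral_lebesgue_AE(2)[OF borel_measurable_times[OF ind ab(1)] ea] integral_lebesgue_AE(2)[OF borel_measurable_times[OF ind ab(2)] eb]
    by blast+
  have le: "(LINT x|lborel. indicator disc x * ?a x) \<le> (LINT x|lborel. indicator disc x * ?b x)"
    using minimizer_inequality[OF open_ball disc_finite u w R.compact_K R.K_ball] supp R.not_K
    unfolding integral_lebesgue_AE(1)[OF borel_measurable_times[OF ind ab(1)] ea] integral_lebesgue_AE(1)[OF borel_measurable_times[OF ind ab(2)] eb'] QQ
    by blast
  let ?s = "\<lambda>p. indicator (strip \<alpha>) p :: real"
  have Ab: "A \<in> borel_measurable borel"
    unfolding A_def by (intro borel_measurable_times borel_measurable_add borel_measurable_power exp_fst_borel snd_compose_borel g_borel nz F_borel)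
  have Bb: "B \<in> borel_measurable borel"
    unfolding B_def by (intro borel_measurable_times borel_measurable_add borel_measurable_power exp_fst_borel snd_compose_borel g_borel nz F_borel meas)
  have comp: "(\<lambda>p. exp (2 * fst p) * indicator (strip \<alpha>) p * h (logpolar p)) \<in> borel_measurable lborel" if "h \<in> borel_measurable borel" for h :: "_ \<Rightarrow> real"
    using borel_measurable_times[OF logpolar_weight_measurable measurable_compose[OF logpolar_measurable that]] by simp
  have sA: "(\<lambda>p. ?s p * A p) \<in> borel_measurable lborel" "(\<lambda>p. ?s p * B p) \<in> borel_measurable lborel"
    using Ab Bb strip_ind_borel by (auto intro: borel_measurable_times)
  have aeA: "AE p in lborel. exp (2 * fst p) * ?s p * ?a (logpolar p) = ?s p * A p"
    using v_polar[of \<alpha>] lap_polar[of \<alpha>]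
    by eventually_elim (auto simp: A_def indicator_def)
  have aeB: "AE p in lborel. exp (2 * fst p) * ?s p * ?b (logpolar p) = ?s p * B p"
    using v_polar[of \<alpha>] lap_polar[of \<alpha>]
  proof eventually_elim
    case (elim p)
    show ?case
    proof (cases "p \<in> strip \<alpha>")
      case True
      then have "chart \<alpha> (logpolar p) = p" by (intro chart_logpolar) (auto simp: strip_def)
      then show ?thesis using elim True by (simp add: B_def indicator_def)
    qed simp
  qed
  have iA: "integrable lborel (\<lambda>p. ?s p * A p)" "integrable lborel (\<lambda>p. ?s p * B p)"
    using iab logpolar_integral(1)[OF ab(1), of \<alpha>] logpolar_integral(1)[OF ab(2), of \<alpha>]
      integrable_cong_AE[OF comp[OF ab(1)] sA(1) aeA] integrable_cong_AE[OF comp[OF ab(2)] sA(2) aeB] by blast+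
  have leAB: "(LINT p|lborel. ?s p * A p) \<le> (LINT p|lborel. ?s p * B p)"
    using le unfolding logpolar_integral(2)[OF ab(1), of \<alpha>] logpolar_integral(2)[OF ab(2), of \<alpha>]
      integral_cong_AE[OF comp[OF ab(1)] sA(1) aeA] integral_cong_AE[OF comp[OF ab(2)] sA(2) aeB] .
  have Qm: "Q \<in> sets borel" unfolding Q borel_prod[symmetric] by measurable
  have iQ: "integrable lborel (\<lambda>p. indicator Q p * A p)" "integrable lborel (\<lambda>p. indicator Q p * B p)"
  proof -
    have sub: "indicator Q p * (?s p * h) = indicator Q p * h" for p h
      using R.Q_strip unfolding QQ by (auto simp: indicator_def)
    show "integrable lborel (\<lambda>p. indicator Q p * A p)" "integrable lborel (\<lambda>p. indicator Q p * B p)"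
      using integrable_times_bounded[OF iA(1), of "indicator Q" 1] integrable_times_bounded[OF iA(2), of "indicator Q" 1] Qm
      unfolding sub by (auto simp: indicator_def)
  qed
  then show "integrable lborel (\<lambda>p. indicator Q p * A p)" "integrable lborel (\<lambda>p. indicator Q p * B p)" .
  have "(LINT p|lborel. ?s p * B p) - (LINT p|lborel. ?s p * A p) = (LINT p|lborel. ?s p * B p - ?s p * A p)"
    using iA by simp
  also have "\<dots> = (LINT p|lborel. indicator Q p * B p - indicator Q p * A p)"
  proof (rule Bochner_Integration.integral_cong[OF refl])
    fix p :: "real \<times> real"
    show "?s p * B p - ?s p * A p = indicator Q p * B p - indicator Q p * A p"
    proof (cases "p \<in> Q")
      case True
      then have "p \<in> strip \<alpha>" using R.Q_strip QQ by blast
      then show ?thesis using True by simp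
    next
      case False
      then have "B p = A p" using supp[OF False] by (simp add: A_def B_def indicator_def)
      then show ?thesis using False by simp
    qed
  qed
  also have "\<dots> = (LINT p|lborel. indicator Q p * B p) - (LINT p|lborel. indicator Q p * A p)" using iQ by simp
  finally show "(LINT p|lborel. indicator Q p * A p) \<le> (LINT p|lborel. indicator Q p * B p)" using leAB by simp
qed

end

section \<open>Weak second derivatives on the line\<close>

lemma integral_derivative_Icc:
  fixes P \<psi> :: "real \<Rightarrow> real"
  assumes "\<And>x. (P has_real_derivative \<psi> x) (at x)" "continuous_on UNIV \<psi>" "x \<le> y"
  shows "(LINT t|lborel. \<psi> t * indicator {x..y} t) = P y - P x"
  using assms by (intro integral_FTC_Icc_real) (auto simp: continuous_on_eq_continuous_at)

lemma antiderivative_ex: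
  fixes \<psi> :: "real \<Rightarrow> real"
  assumes "continuous_on UNIV \<psi>" shows "\<exists>P. \<forall>x. (P has_real_derivative \<psi> x) (at x)"
proof -
  have "\<exists>P. \<forall>x. - \<infinity> < ereal x \<longrightarrow> ereal x < \<infinity> \<longrightarrow> (P has_vector_derivative \<psi> x) (at x)"
    using assms by (intro einterval_antiderivative) (auto simp: continuous_on_eq_continuous_at)
  then show ?thesis by (simp add: has_real_derivative_iff_has_vector_derivative)
qed

text \<open>Zero mean is what makes the primitive starting at a return to zero at b.\<close>

lemma bumps_primitive:
  assumes p: "\<psi> \<in> bumps a b" and ab: "a \<le> b" and zero: "(LINT x|lborel. \<psi> x) = 0"
  shows "\<exists>\<zeta>\<in>bumps a b. deriv \<zeta> = \<psi>"
proof -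
  have c: "continuous_on UNIV \<psi>" using smooth1_continuous[OF bumps_smooth[OF p]] .
  obtain P where P: "\<And>x. (P has_real_derivative \<psi> x) (at x)" using antiderivative_ex[OF c] by blast
  note I = integral_derivative_Icc[OF P c]
  have left: "P x = P a" if "x < a" for x
  proof -
    have "(LINT t|lborel. \<psi> t * indicator {x..a} t) = 0"
    proof (rule integral_eq_zero_AE)
      show "AE t in lborel. \<psi> t * indicator {x..a} t = 0"
        using AE_lborel_singleton[of a] by eventually_elim (use bumps_zero[OF p] in \<open>auto simp: indicator_def\<close>)
    qed
    then show ?thesis using I[of x a] that by simp
  qed
  have right: "P x = P a" if "x \<ge> b" for x
  proof -
    have "(LINT t|lborel. \<psi> t * indicator {a..x} t) = (LINT t|lborel. \<psi> t)"
      using bumps_zero[OF p] that by (intro Bochner_Integration.integral_cong) (fastforce simp: indicator_def)+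
    then show ?thesis using I[of a x] that ab zero by simp
  qed
  have D: "((\<lambda>x. P x - P a) has_real_derivative \<psi> x) (at x)" for x
    using P[of x] by (auto intro!: derivative_eq_intros)
  have "(\<lambda>x. P x - P a) \<in> bumps a b"
    unfolding bumps_def using left right smooth1I[OF D bumps_smooth[OF p]] by force
  moreover have "deriv (\<lambda>x. P x - P a) = \<psi>" using D DERIV_imp_deriv by blast
  ultimately show ?thesis by blast
qed

lemma bumps_add: "f \<in> bumps a b \<Longrightarrow> h \<in> bumps a b \<Longrightarrow> (\<lambda>x. f x + h x) \<in> bumps a b"
  by (auto simp: bumps_def)

lemma bumps_scale: "f \<in> bumps a b \<Longrightarrow> (\<lambda>x. c * f x) \<in> bumps a b"
  by (intro bumps_mult) auto

lemma bumps_ident: "f \<in> bumps a b \<Longrightarrow> (\<lambda>x. x * f x) \<in> bumps a b"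
  by (intro bumps_mult) auto

lemma bumps_mono: "f \<in> bumps a b \<Longrightarrow> a' \<le> a \<Longrightarrow> b \<le> b' \<Longrightarrow> f \<in> bumps a' b'"
  unfolding bumps_def by auto

lemma bumps_first_moment:
  assumes z: "\<zeta> \<in> bumps a b" shows "(LINT x|lborel. x * deriv \<zeta> x) = - (LINT x|lborel. \<zeta> x)"
proof -
  have D: "deriv (\<lambda>x. x * \<zeta> x) = (\<lambda>x. \<zeta> x + x * deriv \<zeta> x)"
    by (rule ext, rule DERIV_imp_deriv) (auto intro!: derivative_eq_intros bumps_has_deriv[OF z])
  have "0 = (LINT x|lborel. \<zeta> x + x * deriv \<zeta> x)" using bumps_deriv_integral[OF bumps_ident[OF z]] D by simp
  then show ?thesis using bumps_integrable[OF z] bumps_integrable[OF bumps_ident[OF bumps_deriv[OF z]]] by simp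
qed

lemma bumps_second_primitive:
  assumes p: "\<psi> \<in> bumps a b" and ab: "a \<le> b" and zero: "(LINT x|lborel. \<psi> x) = 0" "(LINT x|lborel. x * \<psi> x) = 0"
  shows "\<exists>\<zeta>\<in>bumps a b. deriv (deriv \<zeta>) = \<psi>"
proof -
  obtain \<zeta>1 where 1: "\<zeta>1 \<in> bumps a b" "deriv \<zeta>1 = \<psi>" using bumps_primitive[OF p ab zero(1)] by blast
  have "(LINT x|lborel. \<zeta>1 x) = 0" using bumps_first_moment[OF 1(1)] zero(2) 1(2) by simp
  then obtain \<zeta> where "\<zeta> \<in> bumps a b" "deriv \<zeta> = \<zeta>1" using bumps_primitive[OF 1(1) ab] by blast
  then show ?thesis using 1 by blast
qed

definition loc_int :: "(real \<Rightarrow> real) \<Rightarrow> bool" where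
  "loc_int h \<longleftrightarrow> h \<in> borel_measurable borel \<and> (\<forall>c d. integrable lborel (\<lambda>x. indicator {c..d} x * h x))"

lemma loc_int_borel: "loc_int h \<Longrightarrow> h \<in> borel_measurable borel"
  by (simp add: loc_int_def)

lemma loc_int_times_bumps:
  assumes h: "loc_int h" and z: "\<zeta> \<in> bumps a b" shows "integrable lborel (\<lambda>x. h x * \<zeta> x)"
proof -
  obtain B where B: "\<And>x. \<bar>\<zeta> x\<bar> \<le> B" using bumps_bounded[OF z] by blast
  have "integrable lborel (\<lambda>x. \<zeta> x * (indicator {a..b} x * h x))"
    by (rule integrable_times_bounded[where B=B]) (use h B bumps_borel[OF z] in \<open>auto simp: loc_int_def\<close>)
  also have "(\<lambda>x. \<zeta> x * (indicator {a..b} x * h x)) = (\<lambda>x. h x * \<zeta> x)"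
    using bumps_zero[OF z] by (auto simp: fun_eq_iff indicator_def)
  finally show ?thesis .
qed

lemma loc_int_diff: "loc_int f \<Longrightarrow> loc_int h \<Longrightarrow> loc_int (\<lambda>x. f x - h x)"
  by (auto simp: loc_int_def right_diff_distrib)

lemma loc_int_cmult: "loc_int f \<Longrightarrow> loc_int (\<lambda>x. c * f x)"
  unfolding loc_int_def by (auto simp: mult.left_commute intro!: borel_measurable_times)

lemma loc_int_continuous:
  assumes "continuous_on UNIV f" shows "loc_int f"
  unfolding loc_int_def
proof (intro conjI allI)
  show "f \<in> borel_measurable borel" using assms by (rule borel_measurable_continuous_onI)
  fix c d :: real
  have "continuous_on {c..d} f" using assms continuous_on_subset by blast
  then show "integrable lborel (\<lambda>x. indicator {c..d} x * f x)"
    using borel_integrable_compact[of "{c..d}" f] by simp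
qed

lemma fundamental_lemma_real:
  fixes h :: "real \<Rightarrow> real"
  assumes h: "loc_int h" and zero: "\<And>n c d. a < c \<Longrightarrow> c \<le> d \<Longrightarrow> d < b \<Longrightarrow> (LINT x|lborel. h x * bump n c d x) = 0"
  shows "AE x in lborel. x \<in> {a<..<b} \<longrightarrow> h x = 0"
proof -
  have hb: "h \<in> borel_measurable borel" using h by (rule loc_int_borel)
  have "AE x in lebesgue. x \<in> {a<..<b} \<longrightarrow> h x = 0"
  proof (rule fundamental_lemma)
    fix c d assume cd: "cbox c d \<subseteq> {a<..<b}"
    have "integrable lborel (\<lambda>x. indicator {c..d} x *\<^sub>R h x)" using h by (simp add: loc_int_def)
    then show "h absolutely_integrable_on cbox c d"
      unfolding set_integrable_def using hb by (subst integrable_completion) auto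
    fix n
    have bb: "boxbump n c d x = bump n c d x" for x :: real by (simp add: boxbump_def)
    have "(LINT x|lebesgue. h x * boxbump n c d x) = (LINT x|lborel. h x * bump n c d x)"
      using hb bumps_borel[OF bump_in_bumps[of n c d]] unfolding bb by (intro integral_completion) auto
    also have "\<dots> = 0"
    proof (cases "c \<le> d")
      case True
      then show ?thesis using cd by (intro zero) auto
    next
      case False
      then have "bump n c d x = 0" for x by (intro bump_zero) auto
      then show ?thesis by simp
    qed
    finally show "(LINT x|lebesgue. h x * boxbump n c d x) = 0" .
  qed simp
  then show ?thesis by (simp add: AE_completion_iff)
qed

text \<open>A bump \<open>\<beta>\<close> becomes a second derivative after subtracting the combination of a fixed bump \<open>p\<close> and
  its derivative that has the same moments of order zero and one.\<close>

lemma du_Bois_Reymond_second_order: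
  fixes h :: "real \<Rightarrow> real"
  assumes h: "loc_int h" and ab: "a < b"
    and zero: "\<And>c d \<zeta>. a < c \<Longrightarrow> c \<le> d \<Longrightarrow> d < b \<Longrightarrow> \<zeta> \<in> bumps c d \<Longrightarrow> (LINT x|lborel. h x * deriv (deriv \<zeta>) x) = 0"
  shows "\<exists>x0 x1. AE x in lborel. x \<in> {a<..<b} \<longrightarrow> h x = x0 + x1 * x"
proof -
  define c where "c = (2 * a + b) / 3"
  define d where "d = (a + 2 * b) / 3"
  have cd: "a < c" "c < d" "d < b" using ab by (auto simp: c_def d_def)
  define N where "N = (LINT x|lborel. bump 1 c d x)"
  have N: "N > 0" unfolding N_def
    using bump_bounds(1) bump_pos[of c _ d 0] cd bump_in_bumps
    by (intro integral_pos_interval[where a=c and b=d] bumps_integrable) auto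
  define p where "p x = (1 / N) * bump 1 c d x" for x
  have p: "p \<in> bumps c d" unfolding p_def[abs_def] by (intro bumps_scale bump_in_bumps)
  have p1: "(LINT x|lborel. p x) = 1" unfolding p_def using N by (simp add: N_def)
  define \<mu> where "\<mu> = (LINT x|lborel. x * p x)"
  define x1 where "x1 = - (LINT x|lborel. h x * deriv p x)"
  define x0 where "x0 = (LINT x|lborel. h x * p x) - \<mu> * x1"
  have "AE x in lborel. x \<in> {a<..<b} \<longrightarrow> h x - (x0 + x1 * x) = 0"
  proof (rule fundamental_lemma_real)
    show "loc_int (\<lambda>x. h x - (x0 + x1 * x))"
      by (intro loc_int_diff h loc_int_continuous continuous_intros)
    fix n c' d' assume cd': "a < c'" "c' \<le> d'" "d' < b"
    define \<beta> where "\<beta> = bump n c' d'"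
    define lo where "lo = min c c'"
    define hi where "hi = max d d'"
    have lohi: "a < lo" "lo \<le> hi" "hi < b" using cd cd' by (auto simp: lo_def hi_def)
    have B: "\<beta> \<in> bumps lo hi" unfolding \<beta>_def by (rule bumps_mono[OF bump_in_bumps]) (auto simp: lo_def hi_def)
    have P: "p \<in> bumps lo hi" by (rule bumps_mono[OF p]) (auto simp: lo_def hi_def)
    note P' = bumps_deriv[OF P]
    define m0 where "m0 = (LINT x|lborel. \<beta> x)"
    define m1 where "m1 = (LINT x|lborel. x * \<beta> x)"
    \<comment> \<open>The function p has mean 1 and first moment \<mu>, while \<open>deriv p\<close>
      has moments 0 and -1. The first correction removes the mean of \<beta>, the second what is
      left of the first moment.\<close>
    define \<psi> where "\<psi> x = \<beta> x + ((- m0) * p x + (m1 - m0 * \<mu>) * deriv p x)" for x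
    have psi: "\<psi> \<in> bumps lo hi" unfolding \<psi>_def[abs_def] by (intro bumps_add bumps_scale B P P')
    have "(LINT x|lborel. \<psi> x) = m0 + ((- m0) * (LINT x|lborel. p x) + (m1 - m0 * \<mu>) * (LINT x|lborel. deriv p x))"
      unfolding \<psi>_def m0_def using bumps_integrable[OF B] bumps_integrable[OF P] bumps_integrable[OF P'] by simp
    then have z0: "(LINT x|lborel. \<psi> x) = 0" using p1 bumps_deriv_integral[OF P] by simp
    have "(LINT x|lborel. x * \<psi> x) = (LINT x|lborel. x * \<beta> x + ((- m0) * (x * p x) + (m1 - m0 * \<mu>) * (x * deriv p x)))"
      by (intro Bochner_Integration.integral_cong) (auto simp: \<psi>_def algebra_simps)
    also have "\<dots> = m1 + ((- m0) * \<mu> + (m1 - m0 * \<mu>) * (LINT x|lborel. x * deriv p x))"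
      unfolding m1_def \<mu>_def using bumps_integrable[OF bumps_ident[OF B]] bumps_integrable[OF bumps_ident[OF P]] bumps_integrable[OF bumps_ident[OF P']] by simp
    finally have z1: "(LINT x|lborel. x * \<psi> x) = 0" using p1 bumps_first_moment[OF P] by simp
    obtain \<zeta> where zz: "\<zeta> \<in> bumps lo hi" "deriv (deriv \<zeta>) = \<psi>" using bumps_second_primitive[OF psi lohi(2) z0 z1] by blast
    note hi' = loc_int_times_bumps[OF h B] loc_int_times_bumps[OF h P] loc_int_times_bumps[OF h P']
    have "0 = (LINT x|lborel. h x * \<psi> x)" using zero[OF lohi zz(1)] zz(2) by simp
    also have "\<dots> = (LINT x|lborel. h x * \<beta> x + ((- m0) * (h x * p x) + (m1 - m0 * \<mu>) * (h x * deriv p x)))"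
      by (intro Bochner_Integration.integral_cong) (auto simp: \<psi>_def algebra_simps)
    also have "\<dots> = (LINT x|lborel. h x * \<beta> x) + ((- m0) * (LINT x|lborel. h x * p x) + (m1 - m0 * \<mu>) * (LINT x|lborel. h x * deriv p x))"
      using hi' by simp
    finally have hb: "(LINT x|lborel. h x * \<beta> x) = m0 * x0 + m1 * x1"
      by (simp add: x0_def x1_def algebra_simps)
    have "(LINT x|lborel. (h x - (x0 + x1 * x)) * \<beta> x) = (LINT x|lborel. h x * \<beta> x - (x0 * \<beta> x + x1 * (x * \<beta> x)))"
      by (intro Bochner_Integration.integral_cong) (auto simp: algebra_simps)
    also have "\<dots> = (LINT x|lborel. h x * \<beta> x) - (x0 * m0 + x1 * m1)"
      unfolding m0_def m1_def using hi' bumps_integrable[OF B] bumps_integrable[OF bumps_ident[OF B]] by simp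
    finally show "(LINT x|lborel. (h x - (x0 + x1 * x)) * bump n c' d' x) = 0" using hb unfolding \<beta>_def by simp
  qed
  then have "AE x in lborel. x \<in> {a<..<b} \<longrightarrow> h x = x0 + x1 * x" by eventually_elim auto
  then show ?thesis by blast
qed

section \<open>Primitives of locally integrable functions\<close>

lemma lborel2_fst:
  fixes h :: "real \<times> real \<Rightarrow> real"
  assumes "integrable lborel h"
  shows "(LINT x|lborel. LINT y|lborel. h (x, y)) = (LINT p|lborel. h p)"
  using lborel_pair.integral_fst'[of h] assms by (simp add: lborel_prod)

text \<open>The oriented integral of k from 0 to x; the second indicator takes care of negative
  x.\<close>

definition prim :: "(real \<Rightarrow> real) \<Rightarrow> real \<Rightarrow> real" where
  "prim k x = (LINT t|lborel. (indicator {0<..x} t - indicator {x<..0} t) * k t)"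

lemma loc_int_Ioc: "loc_int k \<Longrightarrow> integrable lborel (\<lambda>t. indicator {x<..y} t * k t)"
proof -
  assume k: "loc_int k"
  then have "integrable lborel (\<lambda>t. indicator {x<..y} t * (indicator {x..y} t * k t))"
    by (intro integrable_times_bounded[of lborel "\<lambda>t. indicator {x..y} t * k t" _ 1])
      (auto simp: loc_int_def indicator_le_1)
  also have "(\<lambda>t. indicator {x<..y} t * (indicator {x..y} t * k t)) = (\<lambda>t. indicator {x<..y} t * k t)"
    by (auto simp: fun_eq_iff indicator_def)
  finally show ?thesis .
qed

lemma prim_diff:
  assumes k: "loc_int k" and xy: "x \<le> y"
  shows "prim k y - prim k x = (LINT t|lborel. indicator {x<..y} t * k t)"
proof -
  have i: "integrable lborel (\<lambda>t. (indicator {0<..x} t - indicator {x<..0} t) * k t)" for x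
    unfolding left_diff_distrib by (intro Bochner_Integration.integrable_diff loc_int_Ioc k)
  have "prim k y - prim k x = (LINT t|lborel. (indicator {0<..y} t - indicator {y<..0} t) * k t - (indicator {0<..x} t - indicator {x<..0} t) * k t)"
    unfolding prim_def using i by simp
  also have "\<dots> = (LINT t|lborel. indicator {x<..y} t * k t)"
    using xy by (intro Bochner_Integration.integral_cong) (auto simp: indicator_def)
  finally show ?thesis .
qed

lemma prim_diff_HK:
  assumes k: "loc_int k" and xy: "x \<le> y"
  shows "k integrable_on {x..y}" "prim k y - prim k x = integral {x..y} k"
proof -
  have s: "set_integrable lborel {x..y} k" using k by (simp add: loc_int_def set_integrable_def)
  show "k integrable_on {x..y}" using set_borel_integral_eq_integral(1)[OF s] .
  have "(LINT t|lborel. indicator {x<..y} t * k t) = (LINT t:{x..y}|lborel. k t)"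
    unfolding set_lebesgue_integral_def real_scaleR_def
  proof (rule integral_cong_AE)
    show "AE t in lborel. indicator {x<..y} t * k t = indicator {x..y} t * k t"
      using AE_lborel_singleton[of x] by eventually_elim (auto simp: indicator_def)
  qed (use loc_int_borel[OF k] in \<open>auto intro!: borel_measurable_times borel_measurable_indicator\<close>)
  then show "prim k y - prim k x = integral {x..y} k"
    using prim_diff[OF k xy] set_borel_integral_eq_integral(2)[OF s] by simp
qed

lemma prim_continuous:
  assumes k: "loc_int k" shows "continuous_on UNIV (prim k)"
proof -
  have "isCont (prim k) x" for x
  proof -
    have "continuous_on {x - 1..x + 1} (\<lambda>y. prim k (x - 1) + integral {x - 1..y} k)"
      using prim_diff_HK(1)[OF k, of "x - 1" "x + 1"] by (intro continuous_intros indefinite_integral_continuous_1) auto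
    moreover have "prim k (x - 1) + integral {x - 1..y} k = prim k y" if "y \<in> {x - 1..x + 1}" for y
      using prim_diff_HK(2)[OF k, of "x - 1" y] that by simp
    ultimately have "continuous_on {x - 1..x + 1} (prim k)"
      by (rule continuous_on_eq)
    then show ?thesis by (rule continuous_on_interior) simp
  qed
  then show ?thesis by (simp add: continuous_on_eq_continuous_at)
qed

text \<open>As k is merely integrable, \<open>prim k\<close> has no pointwise derivative to use.
  Instead the double integral over the triangle y <= x is evaluated in both orders.\<close>

lemma prim_by_parts:
  assumes k: "loc_int k" and z: "\<zeta> \<in> bumps a b" and ab: "a \<le> b"
  shows "(LINT x|lborel. prim k x * deriv \<zeta> x) = - (LINT x|lborel. k x * \<zeta> x)"
proof -
  note z' = bumps_deriv[OF z]
  let ?h = "\<lambda>p. indicator {p. snd p \<le> fst p} p * (deriv \<zeta> (fst p) * (indicator {a<..b} (snd p) * k (snd p))) :: real"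
  have hm: "{p :: real \<times> real. snd p \<le> fst p} \<in> sets borel"
    by (intro borel_closed closed_Collect_le continuous_intros)
  have ih: "integrable lborel ?h"
  proof (rule integrable_times_bounded[OF lborel2_product(1)[OF bumps_integrable[OF z'] loc_int_Ioc[OF k]], where B=1])
    show "(indicator {p :: real \<times> real. snd p \<le> fst p} :: _ \<Rightarrow> real) \<in> borel_measurable lborel"
      using borel_measurable_indicator[OF hm] by simp
  qed (simp add: indicator_def)
  have fstI: "(LINT y|lborel. ?h (x, y)) = deriv \<zeta> x * (prim k x - prim k a)" for x
  proof (cases "x \<in> {a..b}")
    case True
    have "(LINT y|lborel. ?h (x, y)) = (LINT y|lborel. deriv \<zeta> x * (indicator {a<..x} y * k y))"
      using True by (intro Bochner_Integration.integral_cong) (auto simp: indicator_def)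
    then show ?thesis using prim_diff[OF k, of a x] True by simp
  next
    case False
    then show ?thesis using bumps_zero[OF z' False] by simp
  qed
  have sndI: "(LINT x|lborel. ?h (x, y)) = - (indicator {a<..b} y * (k y * \<zeta> y))" for y
  proof (cases "y \<in> {a<..b}")
    case True
    \<comment> \<open>The upper end b + 1 lies outside the support of \<zeta>, so only the value at
      y survives.\<close>
    have "(LINT x|lborel. ?h (x, y)) = (LINT x|lborel. k y * (deriv \<zeta> x * indicator {y..b + 1} x))"
      using True bumps_zero[OF z'] by (intro Bochner_Integration.integral_cong) (auto simp: indicator_def)
    also have "\<dots> = k y * (\<zeta> (b + 1) - \<zeta> y)"
      using integral_derivative_Icc[OF bumps_has_deriv[OF z] smooth1_continuous[OF bumps_smooth[OF z']], of y "b + 1"] True by simp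
    finally show ?thesis using True bumps_zero[OF z, of "b + 1"] by simp
  qed auto
  have pi: "integrable lborel (\<lambda>x. prim k x * deriv \<zeta> x)"
    by (intro loc_int_times_bumps[OF _ z'] loc_int_continuous prim_continuous k)
  have "(LINT x|lborel. prim k x * deriv \<zeta> x) = (LINT x|lborel. prim k x * deriv \<zeta> x) - prim k a * (LINT x|lborel. deriv \<zeta> x)"
    using bumps_deriv_integral[OF z] by simp
  also have "\<dots> = (LINT x|lborel. prim k x * deriv \<zeta> x - prim k a * deriv \<zeta> x)"
    using pi bumps_integrable[OF z'] by simp
  also have "\<dots> = (LINT x|lborel. LINT y|lborel. ?h (x, y))" unfolding fstI by (simp add: algebra_simps)
  also have "\<dots> = (LINT y|lborel. LINT x|lborel. ?h (x, y))" using lborel2_fst[OF ih] lborel2_snd(2)[OF ih] by simp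
  also have "\<dots> = - (LINT y|lborel. indicator {a<..b} y * (k y * \<zeta> y))" unfolding sndI by simp
  also have "(LINT y|lborel. indicator {a<..b} y * (k y * \<zeta> y)) = (LINT y|lborel. k y * \<zeta> y)"
  proof (rule integral_cong_AE)
    show "AE y in lborel. indicator {a<..b} y * (k y * \<zeta> y) = k y * \<zeta> y"
      using AE_lborel_singleton[of a]
    proof eventually_elim
      case (elim y)
      then show ?case using bumps_zero[OF z, of y] by (cases "y \<in> {a..b}") (auto simp: indicator_def)
    qed
  qed (use loc_int_borel[OF k] bumps_borel[OF z] in \<open>auto intro!: borel_measurable_times borel_measurable_indicator\<close>)
  finally show ?thesis .
qed

lemma AE_interval_ex:
  fixes a b :: real
  assumes "AE x in lborel. P x" "a < b" shows "\<exists>x. a < x \<and> x < b \<and> P x"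
proof (rule ccontr)
  assume "\<not> (\<exists>x. a < x \<and> x < b \<and> P x)"
  with assms(1) have "AE x in lborel. x \<notin> {a<..<b}" by (auto elim!: eventually_mono)
  then have "emeasure lborel {a<..<b} = 0" by (subst (asm) AE_iff_measurable[of "{a<..<b}"]) auto
  then show False using assms(2) by simp
qed

lemma affine_AE_eq:
  fixes x0 x1 y0 y1 :: real
  assumes "AE x in lborel. x \<in> {a<..<b} \<longrightarrow> x0 + x1 * x = y0 + y1 * x" "a < b"
  shows "x0 = y0 \<and> x1 = y1"
proof -
  obtain c where c: "a < c" "c < (a + b) / 2" "x0 + x1 * c = y0 + y1 * c"
    using AE_interval_ex[OF assms(1), of a "(a + b) / 2"] assms(2) by auto
  obtain d where d: "(a + b) / 2 < d" "d < b" "x0 + x1 * d = y0 + y1 * d"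
    using AE_interval_ex[OF assms(1), of "(a + b) / 2" b] assms(2) by auto
  have "(x1 - y1) * (d - c) = 0" using c(3) d(3) by (simp add: algebra_simps)
  moreover have "d - c \<noteq> 0" using c d by simp
  ultimately have "x1 = y1" by simp
  with c(3) show ?thesis by simp
qed

lemma AE_translate:
  fixes P :: "real \<Rightarrow> bool"
  assumes "AE x in lborel. P x" shows "AE x in lborel. P (x + c)"
proof -
  have "AE x in distr lborel borel ((+) c). P x" unfolding lborel_distr_plus by (rule assms)
  then have "AE x in lborel. P (c + x)" using AE_distrD[of "(+) c" lborel borel P] by simp
  then show ?thesis by (simp add: add.commute)
qed

lemma continuous_AE_eq:
  fixes f h :: "real \<Rightarrow> real"
  assumes "continuous_on UNIV f" "continuous_on UNIV h" "AE x in lborel. f x = h x"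
  shows "f x = h x"
proof -
  have "closed {x. f x = h x}" using assms(1,2) by (rule closed_Collect_eq)
  moreover have "AE x in lebesgue. x \<in> {x. f x = h x}" using assms(3) by (intro AE_completion) simp
  ultimately have "x \<in> {x. f x = h x}" by (rule mem_closed_if_AE_lebesgue)
  then show ?thesis by simp
qed

section \<open>Regularity of the profile and the Euler-Lagrange equation\<close>

context homogeneous_minimizer
begin

text \<open>An interval of length pi fits into an open window of length 2 pi with margin pi / 2 on
  both sides, and finitely many such intervals cover any bounded one.\<close>

lemma window_imp_loc_int:
  assumes hb: "h \<in> borel_measurable borel" and h: "\<And>\<alpha>. integrable lborel (\<lambda>x. window \<alpha> x * h x)"
  shows "loc_int h"
proof -
  have unit: "set_integrable lborel {e..e + pi} h" for e
  proof -
    have "integrable lborel (\<lambda>x. indicator {e..e + pi} x * (window (e - pi / 2) x * h x))"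
      by (rule integrable_times_bounded[OF h, where B=1]) (auto simp: indicator_le_1)
    also have "(\<lambda>x. indicator {e..e + pi} x * (window (e - pi / 2) x * h x)) = (\<lambda>x. indicator {e..e + pi} x *\<^sub>R h x)"
    proof
      fix x show "indicator {e..e + pi} x * (window (e - pi / 2) x * h x) = indicator {e..e + pi} x *\<^sub>R h x"
      proof (cases "x \<in> {e..e + pi}")
        case True
        then have "x \<in> {e - pi / 2<..<e - pi / 2 + 2 * pi}"
          using pi_gt_zero unfolding atLeastAtMost_iff greaterThanLessThan_iff by linarith
        then have "window (e - pi / 2) x = 1" unfolding window_def by (rule indicator_simps(1))
        then show ?thesis by simp
      qed simp
    qed
    finally show ?thesis by (simp add: set_integrable_def)
  qed
  have many: "set_integrable lborel {c..c + real n * pi} h" for c n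
  proof (induction n)
    case 0
    show ?case using unit[of c] by (rule set_integrable_subset) auto
  next
    case (Suc n)
    have e: "c + real (Suc n) * pi = c + real n * pi + pi" by (simp add: algebra_simps)
    have "{c..c + real (Suc n) * pi} = {c..c + real n * pi} \<union> {c + real n * pi..c + real n * pi + pi}"
      unfolding e by (rule ivl_disj_un_two_touch(4)[symmetric]) auto
    then show ?case using Suc unit[of "c + real n * pi"] by (auto intro!: set_integrable_Un)
  qed
  have "set_integrable lborel {c..d} h" for c d
  proof -
    obtain n :: nat where "(d - c) / pi \<le> real n" using real_arch_simple by blast
    then have "d \<le> c + real n * pi" using pi_gt_zero by (simp add: field_simps)
    then have "{c..d} \<subseteq> {c..c + real n * pi}" by auto
    from set_integrable_subset[OF many _ this] show ?thesis by simp
  qed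
  then show ?thesis using hb by (simp add: loc_int_def set_integrable_def)
qed

lemma F_loc_int: "loc_int F" by (intro window_imp_loc_int F_borel F_integrable)
lemma g_loc_int: "loc_int g" by (intro window_imp_loc_int g_borel g_integrable)

text \<open>A double primitive \<open>K2\<close> of g - 4 F satisfies the same weak equation, so F -
  K2 is affine on each window. Overlaps force one affine function on the whole line, and adding it
  to \<open>K2\<close> gives a C^1 representative of \<open>F\<close>.\<close>

lemma regularity:
  "\<exists>f f'. (\<forall>x. (f has_real_derivative f' x) (at x)) \<and> continuous_on UNIV f' \<and>
     (\<forall>x y. x \<le> y \<longrightarrow> (\<lambda>t. g t - 4 * F t) integrable_on {x..y} \<and> f' y - f' x = integral {x..y} (\<lambda>t. g t - 4 * F t)) \<and>
     (AE x in lborel. F x = f x)"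
proof -
  define k where "k t = g t - 4 * F t" for t
  have k: "loc_int k" unfolding k_def[abs_def] by (intro loc_int_diff loc_int_cmult F_loc_int g_loc_int)
  define K1 where "K1 = prim k"
  have K1c: "continuous_on UNIV K1" unfolding K1_def by (rule prim_continuous[OF k])
  obtain K2 where K2: "\<And>x. (K2 has_real_derivative K1 x) (at x)" using antiderivative_ex[OF K1c] by blast
  have K2c: "continuous_on UNIV K2" using K2 DERIV_continuous_on has_field_derivative_at_within by blast
  have K2l: "loc_int K2" using K2c by (rule loc_int_continuous)
  have zero: "(LINT x|lborel. (F x - K2 x) * deriv (deriv \<zeta>) x) = 0"
    if ac: "\<alpha> < c" "c \<le> d" "d < \<alpha> + 2 * pi" and z: "\<zeta> \<in> bumps c d" for \<alpha> c d \<zeta>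
  proof -
    note z1 = bumps_deriv[OF z] and z2 = bumps_deriv[OF bumps_deriv[OF z]]
    note i = loc_int_times_bumps[OF F_loc_int z] loc_int_times_bumps[OF F_loc_int z2] loc_int_times_bumps[OF g_loc_int z]
      loc_int_times_bumps[OF K2l z2] loc_int_times_bumps[OF loc_int_continuous[OF K1c] z1]
    have "(LINT x|lborel. g x * \<zeta> x) = (LINT x|lborel. 4 * (F x * \<zeta> x) + F x * deriv (deriv \<zeta>) x)"
      using F_weak[OF ac(1,3) z] by (simp add: algebra_simps)
    also have "\<dots> = 4 * (LINT x|lborel. F x * \<zeta> x) + (LINT x|lborel. F x * deriv (deriv \<zeta>) x)" using i by simp
    finally have 1: "(LINT x|lborel. F x * deriv (deriv \<zeta>) x) = (LINT x|lborel. g x * \<zeta> x) - 4 * (LINT x|lborel. F x * \<zeta> x)" by simp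
    have "(LINT x|lborel. k x * \<zeta> x) = (LINT x|lborel. g x * \<zeta> x - 4 * (F x * \<zeta> x))"
      by (intro Bochner_Integration.integral_cong) (auto simp: k_def algebra_simps)
    also have "\<dots> = (LINT x|lborel. g x * \<zeta> x) - 4 * (LINT x|lborel. F x * \<zeta> x)" using i by simp
    finally have 2: "(LINT x|lborel. F x * deriv (deriv \<zeta>) x) = (LINT x|lborel. k x * \<zeta> x)" using 1 by simp
    have "(LINT x|lborel. (K1 x * deriv \<zeta> x + K2 x * deriv (deriv \<zeta>) x) * indicator {c - 1..d + 1} x) = K2 (d + 1) * deriv \<zeta> (d + 1) - K2 (c - 1) * deriv \<zeta> (c - 1)"
    proof (rule integral_derivative_Icc)
      show "((\<lambda>x. K2 x * deriv \<zeta> x) has_real_derivative K1 x * deriv \<zeta> x + K2 x * deriv (deriv \<zeta>) x) (at x)" for x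
        by (auto intro!: derivative_eq_intros K2 bumps_has_deriv[OF z1])
      show "continuous_on UNIV (\<lambda>x. K1 x * deriv \<zeta> x + K2 x * deriv (deriv \<zeta>) x)"
        by (intro continuous_intros K1c K2c smooth1_continuous bumps_smooth[OF z1] bumps_smooth[OF z2])
    qed (use ac in simp)
    also have "\<dots> = 0" using bumps_zero[OF z1, of "c - 1"] bumps_zero[OF z1, of "d + 1"] by simp
    also have "(LINT x|lborel. (K1 x * deriv \<zeta> x + K2 x * deriv (deriv \<zeta>) x) * indicator {c - 1..d + 1} x) = (LINT x|lborel. K1 x * deriv \<zeta> x + K2 x * deriv (deriv \<zeta>) x)"
    proof (rule Bochner_Integration.integral_cong[OF refl])
      fix x show "(K1 x * deriv \<zeta> x + K2 x * deriv (deriv \<zeta>) x) * indicator {c - 1..d + 1} x = K1 x * deriv \<zeta> x + K2 x * deriv (deriv \<zeta>) x"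
        using bumps_zero[OF z1, of x] bumps_zero[OF z2, of x] by (cases "x \<in> {c..d}") auto
    qed
    finally have "(LINT x|lborel. K1 x * deriv \<zeta> x) + (LINT x|lborel. K2 x * deriv (deriv \<zeta>) x) = 0" using i by simp
    then have "(LINT x|lborel. K2 x * deriv (deriv \<zeta>) x) = (LINT x|lborel. k x * \<zeta> x)"
      using prim_by_parts[OF k z ac(2)] by (simp add: K1_def)
    with 2 i show ?thesis by (simp add: left_diff_distrib)
  qed
  have "\<exists>x0 x1. AE x in lborel. x \<in> {\<alpha><..<\<alpha> + 2 * pi} \<longrightarrow> F x - K2 x = x0 + x1 * x" for \<alpha>
    using zero[of \<alpha>] by (intro du_Bois_Reymond_second_order loc_int_diff F_loc_int K2l) auto
  then obtain X0 X1 where X: "\<And>\<alpha>. AE x in lborel. x \<in> {\<alpha><..<\<alpha> + 2 * pi} \<longrightarrow> F x - K2 x = X0 \<alpha> + X1 \<alpha> * x" by metis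
  \<comment> \<open>Windows shifted by pi overlap in an interval of length pi, enough to identify
    two affine functions that agree there almost everywhere.\<close>
  have step: "X0 \<alpha> = X0 (\<alpha> + pi) \<and> X1 \<alpha> = X1 (\<alpha> + pi)" for \<alpha>
  proof (rule affine_AE_eq)
    show "AE x in lborel. x \<in> {\<alpha> + pi<..<\<alpha> + 2 * pi} \<longrightarrow> X0 \<alpha> + X1 \<alpha> * x = X0 (\<alpha> + pi) + X1 (\<alpha> + pi) * x"
      using X[of \<alpha>] X[of "\<alpha> + pi"]
    proof eventually_elim
      case (elim x)
      show ?case
      proof
        assume "x \<in> {\<alpha> + pi<..<\<alpha> + 2 * pi}"
        then have "x \<in> {\<alpha><..<\<alpha> + 2 * pi}" "x \<in> {\<alpha> + pi<..<\<alpha> + pi + 2 * pi}" using pi_gt_zero by auto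
        then show "X0 \<alpha> + X1 \<alpha> * x = X0 (\<alpha> + pi) + X1 (\<alpha> + pi) * x" using elim by metis
      qed
    qed
  qed simp
  have const: "X0 (of_int n * pi) = X0 0 \<and> X1 (of_int n * pi) = X1 0" for n :: int
  proof (induction n rule: int_induct[where k=0])
    case (step1 i)
    then show ?case using step[of "of_int i * pi"] by (simp add: algebra_simps)
  next
    case (step2 i)
    then show ?case using step[of "of_int (i - 1) * pi"] by (simp add: algebra_simps)
  qed simp
  have "AE x in lborel. \<forall>n::int. x \<in> {of_int n * pi<..<of_int n * pi + 2 * pi} \<longrightarrow> F x - K2 x = X0 0 + X1 0 * x"
    unfolding AE_all_countable
  proof
    fix n :: int
    show "AE x in lborel. x \<in> {of_int n * pi<..<of_int n * pi + 2 * pi} \<longrightarrow> F x - K2 x = X0 0 + X1 0 * x"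
      using X[of "of_int n * pi"] const[of n] by simp
  qed
  then have ae: "AE x in lborel. F x = K2 x + (X0 0 + X1 0 * x)"
  proof eventually_elim
    case (elim x)
    \<comment> \<open>The windows are open: the ceiling minus one makes n pi strictly smaller than
      x, also when x is a multiple of pi.\<close>
    define n where "n = \<lceil>x / pi\<rceil> - 1"
    have "of_int n < x / pi" "x / pi \<le> of_int n + 1" unfolding n_def by linarith+
    then have "of_int n * pi < x" "x \<le> (of_int n + 1) * pi" using pi_gt_zero by (simp_all add: field_simps)
    then have "x \<in> {of_int n * pi<..<of_int n * pi + 2 * pi}" using pi_gt_zero by (auto simp: algebra_simps)
    then show ?case using elim by fastforce
  qed
  show ?thesis
  proof (intro exI conjI allI impI)
    show "((\<lambda>x. K2 x + (X0 0 + X1 0 * x)) has_real_derivative K1 x + X1 0) (at x)" for x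
      by (auto intro!: derivative_eq_intros K2)
    show "continuous_on UNIV (\<lambda>x. K1 x + X1 0)" by (intro continuous_intros K1c)
    show "AE x in lborel. F x = K2 x + (X0 0 + X1 0 * x)" by (rule ae)
    fix x y :: real assume "x \<le> y"
    from prim_diff_HK[OF k this]
    show "(\<lambda>t. g t - 4 * F t) integrable_on {x..y}" "K1 y + X1 0 - (K1 x + X1 0) = integral {x..y} (\<lambda>t. g t - 4 * F t)"
      unfolding K1_def k_def[abs_def] by simp_all
  qed
qed

definition f :: "real \<Rightarrow> real" where
  "f = (SOME f. \<exists>f'. (\<forall>x. (f has_real_derivative f' x) (at x)) \<and> continuous_on UNIV f' \<and>
     (\<forall>x y. x \<le> y \<longrightarrow> (\<lambda>t. g t - 4 * F t) integrable_on {x..y} \<and> f' y - f' x = integral {x..y} (\<lambda>t. g t - 4 * F t)) \<and>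
     (AE x in lborel. F x = f x))"

lemma f: "(f has_real_derivative deriv f x) (at x)" "continuous_on UNIV (deriv f)"
   "x \<le> y \<Longrightarrow> (\<lambda>t. g t - 4 * F t) integrable_on {x..y}"
   "x \<le> y \<Longrightarrow> deriv f y - deriv f x = integral {x..y} (\<lambda>t. g t - 4 * F t)"
   "AE x in lborel. F x = f x" "continuous_on UNIV f"
proof -
  obtain f' where f': "\<forall>x. (f has_real_derivative f' x) (at x)" "continuous_on UNIV f'"
     "\<forall>x y. x \<le> y \<longrightarrow> (\<lambda>t. g t - 4 * F t) integrable_on {x..y} \<and> f' y - f' x = integral {x..y} (\<lambda>t. g t - 4 * F t)"
     "AE x in lborel. F x = f x"
    using someI_ex[OF regularity] unfolding f_def[symmetric] by blast
  then have e: "f' = deriv f" using DERIV_imp_deriv by (metis ext)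
  show "(f has_real_derivative deriv f x) (at x)" "continuous_on UNIV (deriv f)"
   "x \<le> y \<Longrightarrow> (\<lambda>t. g t - 4 * F t) integrable_on {x..y}"
   "x \<le> y \<Longrightarrow> deriv f y - deriv f x = integral {x..y} (\<lambda>t. g t - 4 * F t)" "AE x in lborel. F x = f x"
    using f' unfolding e by auto
  show "continuous_on UNIV f" using f'(1) DERIV_continuous_on has_field_derivative_at_within by blast
qed

lemma f_periodic: "f (x + 2 * pi) = f x"
proof (rule continuous_AE_eq[of "\<lambda>x. f (x + 2 * pi)" f])
  show "continuous_on UNIV (\<lambda>x. f (x + 2 * pi))"
    by (intro continuous_on_compose2[OF f(6)] continuous_intros) auto
  show "AE x in lborel. f (x + 2 * pi) = f x"
    using f(5) AE_translate[OF f(5), of "2 * pi"] by eventually_elim (simp add: F_periodic)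
qed (rule f(6))

lemma f'_periodic: "deriv f (x + 2 * pi) = deriv f x"
proof -
  have "((\<lambda>x. f (x + 2 * pi)) has_real_derivative deriv f (x + 2 * pi)) (at x)"
    using f(1)[of "x + 2 * pi"] by (simp add: DERIV_shift)
  then have "(f has_real_derivative deriv f (x + 2 * pi)) (at x)" by (simp add: f_periodic)
  then show ?thesis using DERIV_unique f(1) by blast
qed

text \<open>The variation \<epsilon> \<rho>(s) \<zeta>(t) changes the energy by at most a quadratic
  polynomial in \<epsilon>, so the linear coefficient vanishes. In it the Jacobian cancels the
  factor e^(-2s) of the Laplacian and the integral of \<rho>'' is zero, which leaves the integral of
  \<rho> times that of g \<zeta>''.\<close>

lemma euler_lagrange:
  assumes ab: "a < b" "b \<le> a + 2 * pi" and nz: "AE x in lborel. x \<in> {a<..<b} \<longrightarrow> f x \<noteq> 0"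
  shows "\<exists>A B. AE x in lborel. x \<in> {a<..<b} \<longrightarrow> g x = A + B * x"
proof (rule du_Bois_Reymond_second_order[OF g_loc_int ab(1)])
  fix c d \<zeta> assume cd: "a < c" "c \<le> d" "d < b" and z: "\<zeta> \<in> bumps c d"
  define \<rho> where "\<rho> = bump 1 (-2) (-1)"
  have r: "\<rho> \<in> bumps (-2) (-1)" unfolding \<rho>_def by (rule bump_in_bumps)
  have rpos: "(LINT s|lborel. \<rho> s) > 0" unfolding \<rho>_def
    using bump_bounds(1) bump_pos[of "-2" _ "-1" 0] by (intro integral_pos_interval[OF bumps_integrable[OF bump_in_bumps], where a="-2" and b="-1"]) auto
  note r1 = bumps_deriv[OF r] and z1 = bumps_deriv[OF z]
  note r2 = bumps_deriv[OF r1] and z2 = bumps_deriv[OF z1]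
  interpret R: polar_rect a "-2" "-1" c d by unfold_locales (use cd ab in auto)
  \<comment> \<open>\<open>D\<close> is the Laplacian of \<rho> \<zeta> in the parameter plane, and
    \<open>T\<close> the coefficient of \<epsilon>^2 in the energy density.\<close>
  define D where "D p = deriv (deriv \<rho>) (fst p) * \<zeta> (snd p) + \<rho> (fst p) * deriv (deriv \<zeta>) (snd p)" for p
  define T where "T p = exp (- 2 * fst p) * (D p)\<^sup>2" for p
  have Dz: "D p = 0" if "p \<notin> R.Q" for p
    unfolding D_def R.product_supp[OF r2 z that] R.product_supp[OF r z2 that] by simp
  have Db: "D \<in> borel_measurable borel"
    unfolding D_def[abs_def] by (intro borel_measurable_add borel_measurable_times bumps_fst_borel[OF r] bumps_fst_borel[OF r2] bumps_snd_borel[OF z] bumps_snd_borel[OF z2])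
  have sc: "continuous_on A (\<lambda>p::real\<times>real. \<sigma> (fst p))" "continuous_on A (\<lambda>p::real\<times>real. \<sigma> (snd p))"
    if "smooth1 \<sigma>" for \<sigma> A
  proof -
    have c: "continuous_on UNIV \<sigma>" by (rule smooth1_continuous[OF that])
    show "continuous_on A (\<lambda>p::real\<times>real. \<sigma> (fst p))"
      by (rule continuous_on_compose2[OF c continuous_on_fst[OF continuous_on_id]]) simp
    show "continuous_on A (\<lambda>p::real\<times>real. \<sigma> (snd p))"
      by (rule continuous_on_compose2[OF c continuous_on_snd[OF continuous_on_id]]) simp
  qed
  have Dc: "continuous_on A D" for A
    unfolding D_def[abs_def]
    by (rule continuous_on_add[OF continuous_on_mult continuous_on_mult])
      (rule sc(1)[OF bumps_smooth[OF r2]] sc(2)[OF bumps_smooth[OF z]] sc(1)[OF bumps_smooth[OF r]] sc(2)[OF bumps_smooth[OF z2]])+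
  have Ti: "integrable lborel T"
  proof -
    have "integrable lborel (\<lambda>p. indicator R.Q p *\<^sub>R T p)"
      unfolding T_def[abs_def] R.Q_def by (intro borel_integrable_compact compact_Times compact_Icc continuous_intros Dc)
    also have "(\<lambda>p. indicator R.Q p *\<^sub>R T p) = T" using Dz by (auto simp: T_def fun_eq_iff indicator_def)
    finally show ?thesis .
  qed
  note gz = loc_int_times_bumps[OF g_loc_int z] and gz2 = loc_int_times_bumps[OF g_loc_int z2]
  note i1 = lborel2_product[OF bumps_integrable[OF r2] gz] and i2 = lborel2_product[OF bumps_integrable[OF r] gz2]
  have gD: "(\<lambda>p. g (snd p) * D p) = (\<lambda>p. deriv (deriv \<rho>) (fst p) * (g (snd p) * \<zeta> (snd p)) + \<rho> (fst p) * (g (snd p) * deriv (deriv \<zeta>) (snd p)))"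
    by (auto simp: D_def algebra_simps)
  have gDi: "integrable lborel (\<lambda>p. g (snd p) * D p)" unfolding gD using i1 i2 by simp
  have gDI: "(LINT p|lborel. g (snd p) * D p) = (LINT s|lborel. \<rho> s) * (LINT x|lborel. g x * deriv (deriv \<zeta>) x)"
    unfolding gD using i1 i2 bumps_deriv_integral[OF r1] by simp
  have ineq: "0 \<le> 2 * \<epsilon> * (LINT p|lborel. g (snd p) * D p) + \<epsilon>\<^sup>2 * (LINT p|lborel. T p)" for \<epsilon> :: real
  proof -
    let ?A = "\<lambda>p. exp (2 * fst p) * ((g (snd p))\<^sup>2 + indicator {p. F (snd p) \<noteq> 0} p)"
    let ?W = "\<lambda>p. \<epsilon> * (\<rho> (fst p) * \<zeta> (snd p))"
    let ?W11 = "\<lambda>p. \<epsilon> * (deriv (deriv \<rho>) (fst p) * \<zeta> (snd p))" and ?W22 = "\<lambda>p. \<epsilon> * (\<rho> (fst p) * deriv (deriv \<zeta>) (snd p))"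
    let ?B = "\<lambda>p. exp (2 * fst p) * ((g (snd p) + exp (- 2 * fst p) * (?W11 p + ?W22 p))\<^sup>2 +
      indicator {p. exp (2 * fst p) * F (snd p) + ?W p \<noteq> 0} p)"
    let ?W1 = "\<lambda>p. \<epsilon> * (deriv \<rho> (fst p) * \<zeta> (snd p))" and ?W2 = "\<lambda>p. \<epsilon> * (\<rho> (fst p) * deriv \<zeta> (snd p))"
    let ?W12 = "\<lambda>p. \<epsilon> * (deriv \<rho> (fst p) * deriv \<zeta> (snd p))"
    have der: "((\<lambda>p. \<epsilon> * (\<sigma> (fst p) * \<xi> (snd p))) has_derivative (\<lambda>q. \<epsilon> * (deriv \<sigma> (fst p) * \<xi> (snd p)) * fst q + \<epsilon> * (\<sigma> (fst p) * deriv \<xi> (snd p)) * snd q)) (at p)"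
      if "smooth1 \<sigma>" "smooth1 \<xi>" for \<sigma> \<xi> p
      using has_derivative_mult_right[OF smooth1_product_derivative[OF that], of \<epsilon> p] by (simp add: algebra_simps)
    have mb: "(\<lambda>p::real\<times>real. \<epsilon> * (\<sigma> (fst p) * \<xi> (snd p))) \<in> borel_measurable borel" if "\<sigma> \<in> bumps a1 b1" "\<xi> \<in> bumps a2 b2" for \<sigma> \<xi> a1 b1 a2 b2
      by (intro borel_measurable_times bumps_fst_borel[OF that(1)] bumps_snd_borel[OF that(2)]) simp
    note sm = bumps_smooth[OF r] bumps_smooth[OF z] bumps_smooth[OF r1] bumps_smooth[OF z1]
    have M: "integrable lborel (\<lambda>p. indicator R.Q p * ?A p)" "integrable lborel (\<lambda>p. indicator R.Q p * ?B p)"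
      "(LINT p|lborel. indicator R.Q p * ?A p) \<le> (LINT p|lborel. indicator R.Q p * ?B p)"
    proof -
      have c1: "a < c" "d < a + 2 * pi" "(-1::real) < 0" using cd ab by auto
      have c2: "?W p = 0 \<and> ?W1 p = 0 \<and> ?W2 p = 0 \<and> ?W11 p = 0 \<and> ?W12 p = 0 \<and> ?W12 p = 0 \<and> ?W22 p = 0" if "p \<notin> R.Q" for p
        unfolding R.product_supp[OF r z that] R.product_supp[OF r1 z that] R.product_supp[OF r z1 that]
          R.product_supp[OF r2 z that] R.product_supp[OF r1 z1 that] R.product_supp[OF r z2 that] by simp
      have c3: "loc_lip ?W p" "loc_lip ?W1 p" "loc_lip ?W2 p" for p
        by (intro loc_lip_mult loc_lip_const loc_lip_product sm)+
      have c4: "(?W has_derivative (\<lambda>q. ?W1 p * fst q + ?W2 p * snd q)) (at p)" for p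
        by (rule der) (rule sm)+
      have c5: "AE p in lborel. p \<in> R.Q \<longrightarrow> (?W1 has_derivative (\<lambda>q. ?W11 p * fst q + ?W12 p * snd q)) (at p) \<and>
        (?W2 has_derivative (\<lambda>q. ?W12 p * fst q + ?W22 p * snd q)) (at p)"
        by (intro AE_I2 impI conjI der sm)
      note mp = minimality_polar[OF c1 R.Q_def c2 c3 c4 c5 mb[OF r z] mb[OF r2 z] mb[OF r z2]]
      show "integrable lborel (\<lambda>p. indicator R.Q p * ?A p)" "integrable lborel (\<lambda>p. indicator R.Q p * ?B p)"
        "(LINT p|lborel. indicator R.Q p * ?A p) \<le> (LINT p|lborel. indicator R.Q p * ?B p)"
        using mp by auto
    qed
    have Fnz: "AE p in lborel. p \<in> R.Q \<longrightarrow> F (snd p) \<noteq> 0"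
    proof -
      have "AE x in lborel. x \<in> {a<..<b} \<longrightarrow> F x \<noteq> 0" using nz f(5) by eventually_elim auto
      then have "AE p in (lborel :: real measure) \<Otimes>\<^sub>M (lborel :: real measure). snd p \<in> {a<..<b} \<longrightarrow> F (snd p) \<noteq> 0"
      proof (intro lborel_pair.AE_pair_measure)
        have "Measurable.pred borel (\<lambda>x. x \<in> {a<..<b} \<longrightarrow> F x \<noteq> 0)" by measurable
        then show "{p \<in> space ((lborel :: real measure) \<Otimes>\<^sub>M (lborel :: real measure)). snd p \<in> {a<..<b} \<longrightarrow> F (snd p) \<noteq> 0} \<in> sets (lborel \<Otimes>\<^sub>M lborel)"
          by measurable
      qed auto
      then have "AE p in (lborel :: (real \<times> real) measure). snd p \<in> {a<..<b} \<longrightarrow> F (snd p) \<noteq> 0" unfolding lborel_prod .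
      then show ?thesis by eventually_elim (use cd in \<open>auto simp: R.Q_def\<close>)
    qed
    have "0 \<le> (LINT p|lborel. indicator R.Q p * ?B p - indicator R.Q p * ?A p)" using M by simp
    also have "\<dots> \<le> (LINT p|lborel. 2 * \<epsilon> * (g (snd p) * D p) + \<epsilon>\<^sup>2 * T p)"
    proof (rule integral_mono_AE)
      show "integrable lborel (\<lambda>p. indicator R.Q p * ?B p - indicator R.Q p * ?A p)" using M by simp
      show "integrable lborel (\<lambda>p. 2 * \<epsilon> * (g (snd p) * D p) + \<epsilon>\<^sup>2 * T p)" using gDi Ti by simp
      show "AE p in lborel. indicator R.Q p * ?B p - indicator R.Q p * ?A p \<le> 2 * \<epsilon> * (g (snd p) * D p) + \<epsilon>\<^sup>2 * T p"
        using Fnz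
      proof eventually_elim
        case (elim p)
        show ?case
        proof (cases "p \<in> R.Q")
          case True
          have w: "?W11 p + ?W22 p = \<epsilon> * D p" by (simp add: D_def algebra_simps)
          have e: "exp (2 * fst p) * exp (- 2 * fst p) = 1" by (simp flip: exp_add)
          have e3: "exp (2 * fst p) * ((g (snd p) + exp (- 2 * fst p) * (\<epsilon> * D p))\<^sup>2 + 1) - exp (2 * fst p) * ((g (snd p))\<^sup>2 + 1)
             = (exp (2 * fst p) * exp (- 2 * fst p)) * (2 * \<epsilon> * (g (snd p) * D p) + \<epsilon>\<^sup>2 * (exp (- 2 * fst p) * (D p)\<^sup>2))"
            by (simp add: power2_eq_square algebra_simps)
          have e4: "exp (2 * fst p) * ((g (snd p) + exp (- 2 * fst p) * (\<epsilon> * D p))\<^sup>2 + 1) - exp (2 * fst p) * ((g (snd p))\<^sup>2 + 1)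
             = 2 * \<epsilon> * (g (snd p) * D p) + \<epsilon>\<^sup>2 * T p"
            using e3 unfolding e T_def by (simp only: mult_1)
          \<comment> \<open>The measure term of the competitor is at most 1, and for
            \<open>u\<close> it equals 1 almost everywhere on the rectangle.\<close>
          have mB: "?B p \<le> exp (2 * fst p) * ((g (snd p) + exp (- 2 * fst p) * (\<epsilon> * D p))\<^sup>2 + 1)"
            unfolding w by (intro mult_left_mono add_left_mono) (auto simp: indicator_def)
          have mA: "exp (2 * fst p) * ((g (snd p))\<^sup>2 + 1) = ?A p" using elim True by (simp add: indicator_def)
          have "?B p - ?A p \<le> 2 * \<epsilon> * (g (snd p) * D p) + \<epsilon>\<^sup>2 * T p"
            using diff_mono[OF mB eq_refl[OF mA]] unfolding e4 .
          then show ?thesis using True by (simp only: indicator_simps mult_1)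
        next
          case False
          then show ?thesis using Dz[OF False] by (simp add: T_def)
        qed
      qed
    qed
    also have "\<dots> = 2 * \<epsilon> * (LINT p|lborel. g (snd p) * D p) + \<epsilon>\<^sup>2 * (LINT p|lborel. T p)" using gDi Ti by simp
    finally show ?thesis .
  qed
  have "I = 0" if "\<And>\<epsilon>. 0 \<le> 2 * \<epsilon> * I + \<epsilon>\<^sup>2 * J" for I J :: real
  proof (rule ccontr)
    assume I: "I \<noteq> 0"
    \<comment> \<open>At this value the quadratic term is at most |\<epsilon> I|, only half of the
      negative linear term.\<close>
    define \<epsilon> where "\<epsilon> = - I / (\<bar>J\<bar> + 1)"
    have "\<bar>J\<bar> + 1 \<noteq> 0" by linarith
    then have em: "\<epsilon> * (\<bar>J\<bar> + 1) = - I" by (simp add: \<epsilon>_def)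
    have "\<epsilon>\<^sup>2 * J \<le> \<epsilon>\<^sup>2 * (\<bar>J\<bar> + 1)" by (intro mult_left_mono) auto
    also have "\<dots> = \<epsilon> * (\<epsilon> * (\<bar>J\<bar> + 1))" by (simp only: power2_eq_square mult.assoc)
    also have "\<dots> = - \<epsilon> * I" unfolding em by simp
    finally have "0 \<le> \<epsilon> * I" using that[of \<epsilon>] by linarith
    moreover have "\<epsilon> * I = - (I\<^sup>2 / (\<bar>J\<bar> + 1))" by (simp add: \<epsilon>_def power2_eq_square)
    moreover have "I\<^sup>2 / (\<bar>J\<bar> + 1) > 0" using I by (intro divide_pos_pos) auto
    ultimately show False by simp
  qed
  from this[OF ineq] gDI rpos show "(LINT x|lborel. g x * deriv (deriv \<zeta>) x) = 0" by simp
qed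

end

section \<open>The first variation of an arc\<close>

text \<open>The solution of p'' + 4 p = A + B t with p(0) = p'(0) = 0; \<open>pf1\<close> and
  \<open>pf2\<close> are its derivatives.\<close>

definition pf :: "real \<Rightarrow> real \<Rightarrow> real \<Rightarrow> real" where
  "pf A B t = A / 4 * (1 - cos (2 * t)) + B / 8 * (2 * t - sin (2 * t))"

definition pf1 :: "real \<Rightarrow> real \<Rightarrow> real \<Rightarrow> real" where
  "pf1 A B t = A / 2 * sin (2 * t) + B / 4 * (1 - cos (2 * t))"

definition pf2 :: "real \<Rightarrow> real \<Rightarrow> real \<Rightarrow> real" where
  "pf2 A B t = A * cos (2 * t) + B / 2 * sin (2 * t)"

lemma pf_deriv: "(pf A B has_real_derivative pf1 A B t) (at t)"
  unfolding pf_def[abs_def] pf1_def by (auto intro!: derivative_eq_intros simp: field_simps)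

lemma pf1_deriv: "(pf1 A B has_real_derivative pf2 A B t) (at t)"
  unfolding pf1_def[abs_def] pf2_def by (auto intro!: derivative_eq_intros simp: field_simps)

lemma pf_ode: "4 * pf A B t + pf2 A B t = A + B * t"
  by (simp add: pf_def pf2_def field_simps)

lemma pf_zero [simp]: "pf A B 0 = 0" "pf1 A B 0 = 0"
  by (simp_all add: pf_def pf1_def)

lemma smooth1_pf: "smooth1 (pf A B)" "smooth1 (pf1 A B)" "smooth1 (pf2 A B)"
proof -
  have c: "smooth1 (\<lambda>t. cos (2 * t))" "smooth1 (\<lambda>t. sin (2 * t))"
    using smooth1_affine[OF smooth1_cos, of 2 0] smooth1_affine[OF smooth1_sin, of 2 0] by simp_all
  show "smooth1 (pf A B)" "smooth1 (pf1 A B)" "smooth1 (pf2 A B)"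
    unfolding pf_def[abs_def] pf1_def[abs_def] pf2_def[abs_def]
    by (intro smooth1_add smooth1_cmult smooth1_diff smooth1_const smooth1_ident c)+
qed

definition eta :: "real \<Rightarrow> real" where "eta = bump 1 (-2) (-1)"

lemma eta: "eta \<in> bumps (-2) (-1)" "deriv eta \<in> bumps (-2) (-1)" "deriv (deriv eta) \<in> bumps (-2) (-1)"
  and eta_bounds: "0 \<le> eta s" "eta s \<le> 1"
  unfolding eta_def using bump_in_bumps bumps_deriv bump_bounds by auto

text \<open>The radius-dependent dilation of the angle. A profile of length l evaluated at (t - a)
  q(s) ends at a + l / q(s): positive \<epsilon> stretches the arc, negative \<epsilon> shrinks
  it.\<close>

definition qf :: "real \<Rightarrow> real \<Rightarrow> real" where "qf \<epsilon> s = 1 - \<epsilon> * eta s"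

lemma qf_pos: "\<bar>\<epsilon>\<bar> < 1 / 2 \<Longrightarrow> qf \<epsilon> s > 0"
proof -
  assume e: "\<bar>\<epsilon>\<bar> < 1 / 2"
  have "\<bar>\<epsilon> * eta s\<bar> \<le> \<bar>\<epsilon>\<bar> * 1" unfolding abs_mult using eta_bounds[of s] by (intro mult_left_mono) auto
  then show ?thesis using e by (simp add: qf_def)
qed

lemma smooth1_qf: "smooth1 (qf \<epsilon>)"
  unfolding qf_def[abs_def] by (intro smooth1_diff smooth1_cmult smooth1_const bumps_smooth[OF eta(1)])

lemma qf_deriv: "(qf \<epsilon> has_real_derivative - \<epsilon> * deriv eta s) (at s)"
  unfolding qf_def[abs_def] by (auto intro!: derivative_eq_intros bumps_has_deriv[OF eta(1)])

text \<open>For the competitor \<open>r\<^sup>2 p((\<theta> - a) q(s))\<close> the function \<open>Nf\<close> is its Laplacian at \<open>\<sigma> = (\<theta> - a) q(s)\<close>,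
  and \<open>Rf\<close> the energy density after the substitution \<open>\<theta> = a + \<sigma> / q(s)\<close>.\<close>

definition Nf :: "real \<Rightarrow> real \<Rightarrow> real \<Rightarrow> real \<Rightarrow> real \<Rightarrow> real" where
  "Nf A B \<epsilon> s y = 4 * pf A B y + (- (4 * deriv eta s + deriv (deriv eta) s) * y * pf1 A B y) * (\<epsilon> / qf \<epsilon> s) +
     ((deriv eta s)\<^sup>2 * y\<^sup>2 * pf2 A B y) * (\<epsilon>\<^sup>2 / (qf \<epsilon> s)\<^sup>2) + pf2 A B y * (qf \<epsilon> s)\<^sup>2"

definition Rf :: "real \<Rightarrow> real \<Rightarrow> real \<Rightarrow> real \<times> real \<Rightarrow> real" where
  "Rf A B \<epsilon> p = exp (2 * fst p) * (((Nf A B \<epsilon> (fst p) (snd p))\<^sup>2 + 1) * (1 / qf \<epsilon> (fst p)))"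

definition Nf' :: "real \<Rightarrow> real \<Rightarrow> real \<Rightarrow> real \<Rightarrow> real \<Rightarrow> real" where
  "Nf' A B \<epsilon> s y = (- (4 * deriv eta s + deriv (deriv eta) s) * y * pf1 A B y) * (1 / qf \<epsilon> s + \<epsilon> * eta s / (qf \<epsilon> s)\<^sup>2) +
     ((deriv eta s)\<^sup>2 * y\<^sup>2 * pf2 A B y) * (2 * \<epsilon> / (qf \<epsilon> s)\<^sup>2 + 2 * \<epsilon>\<^sup>2 * eta s / (qf \<epsilon> s)^3) + pf2 A B y * (- 2 * eta s * qf \<epsilon> s)"

definition Rf' :: "real \<Rightarrow> real \<Rightarrow> real \<Rightarrow> real \<times> real \<Rightarrow> real" where
  "Rf' A B \<epsilon> p = exp (2 * fst p) * (2 * Nf A B \<epsilon> (fst p) (snd p) * Nf' A B \<epsilon> (fst p) (snd p) * (1 / qf \<epsilon> (fst p)) +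
     ((Nf A B \<epsilon> (fst p) (snd p))\<^sup>2 + 1) * (eta (fst p) / (qf \<epsilon> (fst p))\<^sup>2))"

lemma Rf_deriv:
  assumes e: "\<bar>\<epsilon>\<bar> < 1 / 2"
  shows "((\<lambda>\<epsilon>. Rf A B \<epsilon> p) has_real_derivative Rf' A B \<epsilon> p) (at \<epsilon>)"
proof -
  let ?s = "fst p" and ?y = "snd p"
  have q: "qf \<epsilon> ?s \<noteq> 0" using qf_pos[OF e, of ?s] by simp
  have dq: "((\<lambda>\<epsilon>. qf \<epsilon> ?s) has_real_derivative - eta ?s) (at \<epsilon>)"
    unfolding qf_def by (auto intro!: derivative_eq_intros)
  have d1: "((\<lambda>\<epsilon>. 1 / qf \<epsilon> ?s) has_real_derivative eta ?s / (qf \<epsilon> ?s)\<^sup>2) (at \<epsilon>)"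
    using DERIV_divide[OF DERIV_const dq q, of 1] by (simp add: power2_eq_square)
  have d2: "((\<lambda>\<epsilon>. \<epsilon> / qf \<epsilon> ?s) has_real_derivative 1 / qf \<epsilon> ?s + \<epsilon> * eta ?s / (qf \<epsilon> ?s)\<^sup>2) (at \<epsilon>)"
    using DERIV_mult[OF DERIV_ident d1] by (simp add: ac_simps)
  have d3: "((\<lambda>\<epsilon>. \<epsilon>\<^sup>2 / (qf \<epsilon> ?s)\<^sup>2) has_real_derivative 2 * \<epsilon> / (qf \<epsilon> ?s)\<^sup>2 + 2 * \<epsilon>\<^sup>2 * eta ?s / (qf \<epsilon> ?s)^3) (at \<epsilon>)"
  proof -
    have "((\<lambda>\<epsilon>. (\<epsilon> / qf \<epsilon> ?s) * (\<epsilon> / qf \<epsilon> ?s)) has_real_derivative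
      (1 / qf \<epsilon> ?s + \<epsilon> * eta ?s / (qf \<epsilon> ?s)\<^sup>2) * (\<epsilon> / qf \<epsilon> ?s) + (1 / qf \<epsilon> ?s + \<epsilon> * eta ?s / (qf \<epsilon> ?s)\<^sup>2) * (\<epsilon> / qf \<epsilon> ?s)) (at \<epsilon>)"
      by (rule DERIV_mult[OF d2 d2])
    moreover have "(1 / qf \<epsilon> ?s + \<epsilon> * eta ?s / (qf \<epsilon> ?s)\<^sup>2) * (\<epsilon> / qf \<epsilon> ?s) + (1 / qf \<epsilon> ?s + \<epsilon> * eta ?s / (qf \<epsilon> ?s)\<^sup>2) * (\<epsilon> / qf \<epsilon> ?s) =
      2 * \<epsilon> / (qf \<epsilon> ?s)\<^sup>2 + 2 * \<epsilon>\<^sup>2 * eta ?s / (qf \<epsilon> ?s)^3"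
      using q by (simp add: field_simps power2_eq_square power3_eq_cube)
    ultimately show ?thesis by (simp add: power2_eq_square)
  qed
  have d4: "((\<lambda>\<epsilon>. (qf \<epsilon> ?s)\<^sup>2) has_real_derivative - 2 * eta ?s * qf \<epsilon> ?s) (at \<epsilon>)"
    using DERIV_mult[OF dq dq] by (simp add: power2_eq_square algebra_simps)
  have dN: "((\<lambda>\<epsilon>. Nf A B \<epsilon> ?s ?y) has_real_derivative Nf' A B \<epsilon> ?s ?y) (at \<epsilon>)"
    unfolding Nf_def Nf'_def
    using DERIV_add[OF DERIV_add[OF DERIV_add[OF DERIV_const DERIV_cmult[OF d2]] DERIV_cmult[OF d3]] DERIV_cmult[OF d4]]
    by (simp only: add_0)
  have dN2: "((\<lambda>\<epsilon>. (Nf A B \<epsilon> ?s ?y)\<^sup>2 + 1) has_real_derivative 2 * Nf A B \<epsilon> ?s ?y * Nf' A B \<epsilon> ?s ?y) (at \<epsilon>)"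
    using DERIV_add[OF DERIV_mult[OF dN dN] DERIV_const, of 1] by (simp add: power2_eq_square algebra_simps)
  show ?thesis unfolding Rf_def Rf'_def
    using DERIV_cmult[OF DERIV_mult[OF dN2 d1], of "exp (2 * ?s)"] by (simp add: algebra_simps)
qed

lemma continuous_on_smooth1_fst: "smooth1 \<sigma> \<Longrightarrow> continuous_on S (\<lambda>z::real \<times> real. \<sigma> (fst z))"
  and continuous_on_smooth1_sfst: "smooth1 \<sigma> \<Longrightarrow> continuous_on T (\<lambda>z::real \<times> real \<times> real. \<sigma> (fst (snd z)))"
proof -
  assume s: "smooth1 \<sigma>"
  note c = smooth1_continuous[OF s, of UNIV]
  show "continuous_on S (\<lambda>z::real \<times> real. \<sigma> (fst z))"
    by (rule continuous_on_compose2[OF c]; (intro continuous_intros | simp))+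
  show "continuous_on T (\<lambda>z::real \<times> real \<times> real. \<sigma> (fst (snd z)))"
    by (rule continuous_on_compose2[OF c]; (intro continuous_intros | simp))+
qed

lemma Nf_continuous:
  assumes c: "continuous_on T e" "continuous_on T s" "continuous_on T y" and q: "\<And>z. z \<in> T \<Longrightarrow> qf (e z) (s z) \<noteq> 0"
  shows "continuous_on T (\<lambda>z. qf (e z) (s z))" "continuous_on T (\<lambda>z. Nf A B (e z) (s z) (y z))" "continuous_on T (\<lambda>z. Nf' A B (e z) (s z) (y z))"
proof -
  have sm: "continuous_on T (\<lambda>z. \<sigma> (s z))" "continuous_on T (\<lambda>z. \<sigma> (y z))" if "smooth1 \<sigma>" for \<sigma>
    by (rule continuous_on_compose2[OF smooth1_continuous[OF that, of UNIV]]; use c in simp)+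
  note sms = sm(1)[OF bumps_smooth[OF eta(1)]] sm(1)[OF bumps_smooth[OF eta(2)]] sm(1)[OF bumps_smooth[OF eta(3)]]
    sm(2)[OF smooth1_pf(1)] sm(2)[OF smooth1_pf(2)] sm(2)[OF smooth1_pf(3)]
  show qc: "continuous_on T (\<lambda>z. qf (e z) (s z))" unfolding qf_def by (intro continuous_intros c sms)
  show "continuous_on T (\<lambda>z. Nf A B (e z) (s z) (y z))" unfolding Nf_def
    by (intro continuous_intros c sms qc) (use q in auto)
  show "continuous_on T (\<lambda>z. Nf' A B (e z) (s z) (y z))" unfolding Nf'_def
    by (intro continuous_intros c sms qc) (use q in auto)
qed

lemma Rf_continuous: "\<bar>\<epsilon>\<bar> < 1 / 2 \<Longrightarrow> continuous_on S (Rf A B \<epsilon>)"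
proof -
  assume e: "\<bar>\<epsilon>\<bar> < 1 / 2"
  have q: "qf \<epsilon> s \<noteq> 0" for s using qf_pos[OF e, of s] by simp
  note N = Nf_continuous[of S "\<lambda>_. \<epsilon>" fst snd, OF continuous_on_const continuous_on_fst[OF continuous_on_id] continuous_on_snd[OF continuous_on_id] q]
  show ?thesis unfolding Rf_def[abs_def] by (intro continuous_intros N) (use q in auto)
qed

definition c1 :: real where "c1 = (LINT s|lborel. exp (2 * s) * eta s)"

lemma c1_pos: "c1 > 0"
  unfolding c1_def eta_def
  using bump_bounds(1) bump_pos[of "-2" _ "-1" 0]
  by (intro integral_pos_interval[OF bumps_integrable[OF bumps_mult[OF bump_in_bumps smooth1_exp_cmult]], where a="-2" and b="-1"]) auto

text \<open>One integration by parts against e^(2s) gives -2, two give 4, and 4 * (-2) + 4 =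
  -4.\<close>

lemma eta_moment: "(LINT s|lborel. exp (2 * s) * (4 * deriv eta s + deriv (deriv eta) s)) = - 4 * c1"
proof -
  have e: "(\<lambda>s. exp (2 * s) * \<sigma> s) \<in> bumps (-2) (-1)" if "\<sigma> \<in> bumps (-2) (-1)" for \<sigma> using that by (intro bumps_mult) auto
  have d: "deriv (\<lambda>s. exp (2 * s) * eta s) = (\<lambda>s. exp (2 * s) * deriv eta s + 2 * (exp (2 * s) * eta s))"
    by (rule ext, rule DERIV_imp_deriv) (auto intro!: derivative_eq_intros bumps_has_deriv[OF eta(1)])
  have "(LINT s|lborel. exp (2 * s) * deriv eta s + 2 * (exp (2 * s) * eta s)) = 0"
    using bumps_deriv_integral[OF e[OF eta(1)]] unfolding d .
  then have 1: "(LINT s|lborel. exp (2 * s) * deriv eta s) = - 2 * c1"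
    using bumps_integrable[OF e[OF eta(1)]] bumps_integrable[OF e[OF eta(2)]] by (simp add: c1_def)
  have "(LINT s|lborel. exp (2 * s) * (4 * deriv eta s + deriv (deriv eta) s)) =
     (LINT s|lborel. 4 * (exp (2 * s) * deriv eta s) + exp (2 * s) * deriv (deriv eta) s)"
    by (intro Bochner_Integration.integral_cong) (auto simp: algebra_simps)
  also have "\<dots> = 4 * (LINT s|lborel. exp (2 * s) * deriv eta s) + (LINT s|lborel. exp (2 * s) * deriv (deriv eta) s)"
    using bumps_integrable[OF e[OF eta(2)]] bumps_integrable[OF e[OF eta(3)]] by simp
  also have "\<dots> = - 4 * c1" unfolding 1 bumps_exp_integral[OF eta(1)] by (simp add: c1_def)
  finally show ?thesis .
qed

lemma integral_cbox_lborel: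
  fixes h :: "real \<times> real \<Rightarrow> real"
  assumes "continuous_on (cbox a b) h"
  shows "integrable lborel (\<lambda>p. indicator (cbox a b) p * h p)" "integral (cbox a b) h = (LINT p|lborel. indicator (cbox a b) p * h p)"
proof -
  have "integrable lborel (\<lambda>p. indicator (cbox a b) p *\<^sub>R h p)"
    using assms by (intro borel_integrable_compact compact_cbox)
  then show "integrable lborel (\<lambda>p. indicator (cbox a b) p * h p)" by simp
  then have s: "set_integrable lborel (cbox a b) h" by (simp add: set_integrable_def)
  show "integral (cbox a b) h = (LINT p|lborel. indicator (cbox a b) p * h p)"
    using set_borel_integral_eq_integral(2)[OF s] by (simp add: set_lebesgue_integral_def)
qed

text \<open>On the fixed rectangle the density is smooth in \<epsilon>, so Leibniz' rule applies. At
  \<epsilon> = 0 the s-dependence enters only through two moments, c1 and -4 c1, and the remaining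
  angular integral has an explicit primitive.\<close>

lemma first_variation:
  assumes l: "l > 0" and z: "pf A B l = 0" "pf1 A B l = 0"
  shows "((\<lambda>\<epsilon>. integral (cbox (-2, 0) (-1, l)) (Rf A B \<epsilon>)) has_real_derivative c1 * (l * (1 - (A + B * l)\<^sup>2))) (at 0)"
proof -
  let ?U = "{-(1/2)<..<1/2::real}" and ?C = "cbox (-2, 0) (-1, l) :: (real \<times> real) set"
  have U: "\<bar>e\<bar> < 1 / 2" if "e \<in> ?U" for e using that by auto
  have "((\<lambda>\<epsilon>. integral ?C (Rf A B \<epsilon>)) has_real_derivative integral ?C (Rf' A B 0)) (at 0 within ?U)"
  proof (rule leibniz_rule_field_derivative)
    show "((\<lambda>\<epsilon>. Rf A B \<epsilon> t) has_real_derivative Rf' A B x t) (at x within ?U)" if "x \<in> ?U" for x t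
      using Rf_deriv[OF U[OF that]] by (rule has_field_derivative_at_within)
    show "Rf A B x integrable_on ?C" if "x \<in> ?U" for x
      by (intro integrable_continuous Rf_continuous U that)
    have q: "qf (fst z) (fst (snd z)) \<noteq> 0" if "z \<in> ?U \<times> ?C" for z :: "real \<times> real \<times> real"
      using qf_pos[of "fst z"] that by (cases z) (auto simp: abs_less_iff less_imp_neq[symmetric])
    have c: "continuous_on (?U \<times> ?C) (\<lambda>z. fst z)" "continuous_on (?U \<times> ?C) (\<lambda>z. fst (snd z))" "continuous_on (?U \<times> ?C) (\<lambda>z. snd (snd z))"
      by (intro continuous_intros)+
    note N = Nf_continuous[OF c q]
    show "continuous_on (?U \<times> ?C) (\<lambda>(x, t). Rf' A B x t)"
      unfolding Rf'_def case_prod_beta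
      by (intro continuous_intros N c continuous_on_smooth1_sfst[OF bumps_smooth[OF eta(1)]]) (use q in auto)
  qed auto
  then have D: "((\<lambda>\<epsilon>. integral ?C (Rf A B \<epsilon>)) has_real_derivative integral ?C (Rf' A B 0)) (at 0)"
    by (subst (asm) at_within_open) auto
  let ?H = "\<lambda>y. A + B * y"
  \<comment> \<open>The coefficients of \<open>eta\<close> and of 4 \<open>eta\<close>' +
    \<open>eta\<close>'' in the \<epsilon>-derivative of the density at 0, apart from the weight
    e^(2s).\<close>
  define u1 where "u1 y = (?H y)\<^sup>2 + 1 - 4 * ?H y * pf2 A B y" for y
  define u2 where "u2 y = - 2 * ?H y * y * pf1 A B y" for y
  have R0: "Rf' A B 0 p = (exp (2 * fst p) * eta (fst p)) * u1 (snd p) + (exp (2 * fst p) * (4 * deriv eta (fst p) + deriv (deriv eta) (fst p))) * u2 (snd p)" for p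
  proof -
    have q1: "qf 0 s = 1" for s by (simp add: qf_def)
    have N0: "Nf A B 0 s y = ?H y" for s y using pf_ode[of A B y] by (simp add: Nf_def q1)
    have N1: "Nf' A B 0 s y = - (4 * deriv eta s + deriv (deriv eta) s) * y * pf1 A B y - 2 * eta s * pf2 A B y" for s y
      by (simp add: Nf'_def q1)
    show ?thesis unfolding Rf'_def u1_def u2_def q1 N0 N1 by (simp add: algebra_simps power2_eq_square)
  qed
  have u12: "continuous_on UNIV u1" "continuous_on UNIV u2"
    unfolding u1_def[abs_def] u2_def[abs_def] by (intro continuous_intros smooth1_continuous smooth1_pf)+
  have iu: "integrable lborel (\<lambda>y. indicator {0..l} y * u1 y)" "integrable lborel (\<lambda>y. indicator {0..l} y * u2 y)"
    using loc_int_continuous[OF u12(1)] loc_int_continuous[OF u12(2)] by (auto simp: loc_int_def)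
  have e: "(\<lambda>s. exp (2 * s) * \<sigma> s) \<in> bumps (-2) (-1)" if "\<sigma> \<in> bumps (-2) (-1)" for \<sigma> using that by (intro bumps_mult) auto
  have h: "(\<lambda>s. 4 * deriv eta s + deriv (deriv eta) s) \<in> bumps (-2) (-1)" by (intro bumps_add bumps_scale eta)
  note i1 = lborel2_product[OF bumps_integrable[OF e[OF eta(1)]] iu(1)] and i2 = lborel2_product[OF bumps_integrable[OF e[OF h]] iu(2)]
  have Rc: "continuous_on ?C (Rf' A B 0)"
    unfolding R0[abs_def]
    by (intro continuous_intros continuous_on_smooth1_fst[OF bumps_smooth[OF eta(1)]] continuous_on_smooth1_fst[OF bumps_smooth[OF eta(2)]]
       continuous_on_smooth1_fst[OF bumps_smooth[OF eta(3)]] continuous_on_compose2[OF u12(1) continuous_on_snd[OF continuous_on_id]]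
       continuous_on_compose2[OF u12(2) continuous_on_snd[OF continuous_on_id]]) auto
  have C: "?C = {-2..-1} \<times> {0..l}" by (simp add: cbox_Pair_eq)
  have "integral ?C (Rf' A B 0) = (LINT p|lborel. indicator ?C p * Rf' A B 0 p)" by (rule integral_cbox_lborel(2)[OF Rc])
  also have "\<dots> = (LINT p|lborel. (exp (2 * fst p) * eta (fst p)) * (indicator {0..l} (snd p) * u1 (snd p)) +
     (exp (2 * fst p) * (4 * deriv eta (fst p) + deriv (deriv eta) (fst p))) * (indicator {0..l} (snd p) * u2 (snd p)))"
  proof (rule Bochner_Integration.integral_cong[OF refl])
    fix p :: "real \<times> real"
    show "indicator ?C p * Rf' A B 0 p = (exp (2 * fst p) * eta (fst p)) * (indicator {0..l} (snd p) * u1 (snd p)) +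
     (exp (2 * fst p) * (4 * deriv eta (fst p) + deriv (deriv eta) (fst p))) * (indicator {0..l} (snd p) * u2 (snd p))"
      unfolding R0 C using bumps_zero[OF eta(1), of "fst p"] bumps_zero[OF eta(2), of "fst p"] bumps_zero[OF eta(3), of "fst p"]
      by (cases p, cases "fst p \<in> {-2..-1}") (auto simp: indicator_def)
  qed
  also have "\<dots> = c1 * (LINT y|lborel. indicator {0..l} y * u1 y) + (- 4 * c1) * (LINT y|lborel. indicator {0..l} y * u2 y)"
    using i1 i2 unfolding eta_moment by (simp add: c1_def)
  also have "\<dots> = c1 * (LINT y|lborel. indicator {0..l} y * u1 y - 4 * (indicator {0..l} y * u2 y))"
  proof -
    have "(LINT y|lborel. indicator {0..l} y * u1 y - 4 * (indicator {0..l} y * u2 y)) =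
      (LINT y|lborel. indicator {0..l} y * u1 y) - 4 * (LINT y|lborel. indicator {0..l} y * u2 y)" using iu by simp
    moreover have "c1 * I1 + (- 4 * c1) * I2 = c1 * (I1 - 4 * I2)" for I1 I2 :: real by (simp add: algebra_simps)
    ultimately show ?thesis by presburger
  qed
  also have "(LINT y|lborel. indicator {0..l} y * u1 y - 4 * (indicator {0..l} y * u2 y)) = (LINT y|lborel. (u1 y - 4 * u2 y) * indicator {0..l} y)"
    by (intro Bochner_Integration.integral_cong) (auto simp: algebra_simps)
  also have "\<dots> = l * (1 - (A + B * l)\<^sup>2)"
  proof -
    \<comment> \<open>Every term except the first two contains \<open>pf\<close> or
      \<open>pf1\<close> and vanishes at both ends; at l the first two leave l (1 - (A + B l)^2), at
      0 nothing.\<close>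
    let ?\<Psi> = "\<lambda>y. y - y * (?H y)\<^sup>2 - 2 * ?H y * pf1 A B y + 2 * B * y * pf1 A B y + 8 * ?H y * y * pf A B y"
    have "(LINT y|lborel. (u1 y - 4 * u2 y) * indicator {0..l} y) = ?\<Psi> l - ?\<Psi> 0"
    proof (rule integral_derivative_Icc)
      fix y
      have "(?\<Psi> has_real_derivative 1 - ((?H y)\<^sup>2 + y * (2 * ?H y * B)) - (2 * B * pf1 A B y + 2 * ?H y * pf2 A B y) +
        (2 * B * pf1 A B y + 2 * B * y * pf2 A B y) + (8 * B * y * pf A B y + 8 * ?H y * pf A B y + 8 * ?H y * y * pf1 A B y)) (at y)"
        by (auto intro!: derivative_eq_intros pf_deriv pf1_deriv simp: algebra_simps)
      moreover have "1 - ((?H y)\<^sup>2 + y * (2 * ?H y * B)) - (2 * B * pf1 A B y + 2 * ?H y * pf2 A B y) +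
        (2 * B * pf1 A B y + 2 * B * y * pf2 A B y) + (8 * B * y * pf A B y + 8 * ?H y * pf A B y + 8 * ?H y * y * pf1 A B y) = u1 y - 4 * u2 y"
      proof -
        have p2: "pf2 A B y = ?H y - 4 * pf A B y" using pf_ode[of A B y] by simp
        show ?thesis unfolding u1_def u2_def p2 by (simp add: algebra_simps power2_eq_square)
      qed
      ultimately show "(?\<Psi> has_real_derivative u1 y - 4 * u2 y) (at y)" by simp
    qed (use l in \<open>auto intro!: continuous_intros u12\<close>)
    then show ?thesis using z by (simp add: algebra_simps)
  qed
  finally show ?thesis using D by simp
qed

lemma AE_snd:
  assumes "AE x in (lborel :: real measure). P x" shows "AE p in (lborel :: (real \<times> real) measure). P (snd p)"
proof -
  from AE_E[OF assms] obtain N where N: "{x \<in> space lborel. \<not> P x} \<subseteq> N" "emeasure lborel N = 0" "N \<in> sets lborel" .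
  have "AE x in lborel. x \<notin> N" using N by (intro AE_not_in) auto
  then have "AE p in (lborel :: real measure) \<Otimes>\<^sub>M (lborel :: real measure). snd p \<notin> N"
  proof (intro lborel_pair.AE_pair_measure)
    have "Measurable.pred borel (\<lambda>x. x \<notin> N)" using N(3) by measurable
    then show "{p \<in> space ((lborel :: real measure) \<Otimes>\<^sub>M (lborel :: real measure)). snd p \<notin> N} \<in> sets (lborel \<Otimes>\<^sub>M lborel)"
      by measurable
  qed auto
  then have "AE p in (lborel :: (real \<times> real) measure). snd p \<notin> N" unfolding lborel_prod .
  then show ?thesis by eventually_elim (use N(1) in auto)
qed

text \<open>The clamp used below has corners, but it does not increase distances, and a zero
  derivative of the outer function absorbs them.\<close>

lemma has_derivative_zero_compose:
  fixes \<phi> c :: "real \<Rightarrow> real"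
  assumes d: "(\<phi> has_real_derivative 0) (at (c x))" and c: "\<And>y. \<bar>c y - c x\<bar> \<le> \<bar>y - x\<bar>"
  shows "((\<lambda>y. \<phi> (c y)) has_real_derivative 0) (at x)"
  unfolding has_field_derivative_def has_derivative_at_alt
proof (intro conjI allI impI)
  fix e :: real assume "e > 0"
  then obtain \<delta> where \<delta>: "\<delta> > 0" "\<And>y. \<bar>y - c x\<bar> < \<delta> \<Longrightarrow> \<bar>\<phi> y - \<phi> (c x)\<bar> \<le> e * \<bar>y - c x\<bar>"
    using d unfolding has_field_derivative_def has_derivative_at_alt by (auto simp: real_norm_def)
  have "\<bar>\<phi> (c y) - \<phi> (c x)\<bar> \<le> e * \<bar>y - x\<bar>" if "\<bar>y - x\<bar> < \<delta>" for y
  proof -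
    have "\<bar>\<phi> (c y) - \<phi> (c x)\<bar> \<le> e * \<bar>c y - c x\<bar>" using that c[of y] by (intro \<delta>(2)) auto
    also have "\<dots> \<le> e * \<bar>y - x\<bar>" using \<open>e > 0\<close> c[of y] by (intro mult_left_mono) auto
    finally show ?thesis .
  qed
  then show "\<exists>d>0. \<forall>y. norm (y - x) < d \<longrightarrow> norm (\<phi> (c y) - \<phi> (c x) - 0 * (y - x)) \<le> e * norm (y - x)"
    using \<delta>(1) by (intro exI[of _ \<delta>]) auto
qed (rule bounded_linear_mult_right)

section \<open>Competitors with a moved end\<close>

locale arc_profile =
  fixes A B l :: real
  assumes l: "0 < l" and z: "pf A B l = 0" "pf1 A B l = 0"
begin

text \<open>Since \<open>pf A B\<close> and its derivative vanish at 0 and l, composing with this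
  clamp is extension by zero. The extension is C^1, and both it and its derivative inherit Lipschitz
  bounds from smooth functions.\<close>

definition cl :: "real \<Rightarrow> real" where "cl t = max 0 (min t l)"
definition h0 :: "real \<Rightarrow> real" where "h0 t = pf A B (cl t)"
definition h1 :: "real \<Rightarrow> real" where "h1 t = pf1 A B (cl t)"
definition h2 :: "real \<Rightarrow> real" where "h2 t = (if 0 \<le> t \<and> t \<le> l then pf2 A B t else 0)"

lemma cl_lip: "\<bar>cl y - cl x\<bar> \<le> \<bar>y - x\<bar>"
  using l by (auto simp: cl_def)

lemma h_inside: "0 \<le> t \<Longrightarrow> t \<le> l \<Longrightarrow> h0 t = pf A B t \<and> h1 t = pf1 A B t \<and> h2 t = pf2 A B t"
  by (simp add: h0_def h1_def h2_def cl_def)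

lemma h_outside: "t < 0 \<or> l < t \<Longrightarrow> h0 t = 0 \<and> h1 t = 0 \<and> h2 t = 0"
  using l z by (auto simp: h0_def h1_def h2_def cl_def)

lemma h0_deriv: "(h0 has_real_derivative h1 t) (at t)"
proof (cases "0 < t \<and> t < l")
  case True
  have "\<forall>\<^sub>F y in nhds t. h0 y = pf A B y"
    using eventually_nhds_in_open[of "{0<..<l}" t] True by (auto elim!: eventually_mono simp: h_inside)
  moreover have "(pf A B has_real_derivative h1 t) (at t)" using pf_deriv True h_inside[of t] by auto
  ultimately show ?thesis by (subst DERIV_cong_ev[OF refl _ refl])
next
  case False
  then have cc: "cl t = 0 \<or> cl t = l" using l by (auto simp: cl_def)
  then have 0: "pf1 A B (cl t) = 0" using z by auto
  have "((\<lambda>y. pf A B (cl y)) has_real_derivative 0) (at t)"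
    by (rule has_derivative_zero_compose[of "pf A B" cl t, OF _ cl_lip]) (use pf_deriv[of A B "cl t"] 0 in simp)
  then show ?thesis using 0 by (simp add: h0_def[abs_def] h1_def)
qed

lemma h1_deriv:
  assumes "t \<noteq> 0" "t \<noteq> l" shows "(h1 has_real_derivative h2 t) (at t)"
proof (cases "0 < t \<and> t < l")
  case True
  have "\<forall>\<^sub>F y in nhds t. h1 y = pf1 A B y"
    using eventually_nhds_in_open[of "{0<..<l}" t] True by (auto elim!: eventually_mono simp: h_inside)
  moreover have "(pf1 A B has_real_derivative h2 t) (at t)" using pf1_deriv True h_inside[of t] by auto
  ultimately show ?thesis by (subst DERIV_cong_ev[OF refl _ refl])
next
  case False
  then have t: "t \<in> - {0..l}" using assms by auto
  have "open (- {0..l})" by (simp add: open_Compl)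
  then have "\<forall>\<^sub>F y in nhds t. h1 y = 0"
    using eventually_nhds_in_open[of "- {0..l}" t] t by (auto elim!: eventually_mono simp: h_outside not_le)
  moreover have "((\<lambda>_. 0) has_real_derivative h2 t) (at t)" using t h_outside[of t] by auto
  ultimately show ?thesis by (subst DERIV_cong_ev[OF refl _ refl])
qed

lemma cl_loc_lip: "loc_lip cl t"
  by (rule lipschitz_imp_loc_lip[of _ 1]) (use cl_lip in \<open>auto simp: dist_real_def\<close>)

lemma h_loc_lip: "loc_lip h0 t" "loc_lip h1 t"
  unfolding h0_def[abs_def] h1_def[abs_def]
  by (rule loc_lip_compose[OF loc_lip_smooth1[OF smooth1_pf(1)] cl_loc_lip] loc_lip_compose[OF loc_lip_smooth1[OF smooth1_pf(2)] cl_loc_lip])+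

lemma h_borel: "h0 \<in> borel_measurable borel" "h1 \<in> borel_measurable borel" "h2 \<in> borel_measurable borel"
proof -
  have c: "continuous_on UNIV cl" unfolding cl_def[abs_def] by (intro continuous_intros)
  show "h0 \<in> borel_measurable borel" "h1 \<in> borel_measurable borel"
    unfolding h0_def[abs_def] h1_def[abs_def]
    by (rule borel_measurable_continuous_onI, rule continuous_on_compose2[OF smooth1_continuous[OF smooth1_pf(1), of UNIV] c] continuous_on_compose2[OF smooth1_continuous[OF smooth1_pf(2), of UNIV] c], simp)+
  have "(\<lambda>t. indicator {0..l} t * pf2 A B t) \<in> borel_measurable borel"
    by (intro borel_measurable_times borel_measurable_indicator smooth1_borel smooth1_pf) simp
  also have "(\<lambda>t. indicator {0..l} t * pf2 A B t) = h2" by (auto simp: fun_eq_iff h2_def indicator_def)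
  finally show "h2 \<in> borel_measurable borel" .
qed

end

locale variation = arc_profile +
  fixes a \<epsilon> :: real
  assumes e: "\<bar>\<epsilon>\<bar> < 1 / 2"
begin

definition q :: "real \<Rightarrow> real" where "q = qf \<epsilon>"
definition q1 :: "real \<Rightarrow> real" where "q1 s = - \<epsilon> * deriv eta s"
definition q2 :: "real \<Rightarrow> real" where "q2 s = - \<epsilon> * deriv (deriv eta) s"
definition T :: "real \<times> real \<Rightarrow> real" where "T p = (snd p - a) * q (fst p)"

lemma q_pos: "q s > 0" unfolding q_def by (rule qf_pos[OF e])

lemma q_deriv: "(q has_real_derivative q1 s) (at s)" "(q1 has_real_derivative q2 s) (at s)"
  unfolding q_def q1_def[abs_def] q2_def by (rule qf_deriv, rule DERIV_cmult[OF bumps_has_deriv[OF eta(2)]])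

lemma q_smooth: "smooth1 q" "smooth1 q1" "smooth1 q2"
  unfolding q_def q1_def[abs_def] q2_def[abs_def] by (intro smooth1_qf smooth1_cmult bumps_smooth[OF eta(2)] bumps_smooth[OF eta(3)])+

lemma q_outside: "s \<notin> {-2..-1} \<Longrightarrow> q s = 1 \<and> q1 s = 0 \<and> q2 s = 0"
  unfolding q_def q1_def q2_def qf_def using bumps_zero[OF eta(1)] bumps_zero[OF eta(2)] bumps_zero[OF eta(3)] by simp

lemma fst_der: "(\<phi> has_real_derivative d) (at (fst p)) \<Longrightarrow> ((\<lambda>p::real\<times>real. \<phi> (fst p)) has_derivative (\<lambda>h. d * fst h)) (at p)"
  using has_derivative_compose[OF has_derivative_fst[OF has_derivative_ident], of \<phi> "(*) d" p UNIV] by (simp add: has_field_derivative_def)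

lemma T_der: "(T has_derivative (\<lambda>h. (snd p - a) * q1 (fst p) * fst h + q (fst p) * snd h)) (at p)"
  unfolding T_def[abs_def]
  using has_derivative_mult[OF has_derivative_diff[OF has_derivative_snd[OF has_derivative_ident] has_derivative_const] fst_der[OF q_deriv(1)], of a p]
  by (simp add: algebra_simps)

lemma T_comp: "(\<phi> has_real_derivative d) (at (T p)) \<Longrightarrow> ((\<lambda>p. \<phi> (T p)) has_derivative (\<lambda>h. d * ((snd p - a) * q1 (fst p) * fst h + q (fst p) * snd h))) (at p)"
  using has_derivative_compose[OF T_der, of \<phi> "(*) d" p] by (simp add: has_field_derivative_def)

lemma snd_der: "((\<lambda>p::real\<times>real. snd p - a) has_derivative (\<lambda>h. snd h)) (at p)"
  by (auto intro!: derivative_eq_intros)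

lemma T0_comp: "(\<phi> has_real_derivative d) (at (snd p - a)) \<Longrightarrow> ((\<lambda>p::real\<times>real. \<phi> (snd p - a)) has_derivative (\<lambda>h. d * snd h)) (at p)"
  using has_derivative_compose[OF snd_der, where g = \<phi> and g' = "(*) d"] by (simp add: has_field_derivative_def)

lemma exp_der: "((\<lambda>p::real\<times>real. exp (2 * fst p)) has_derivative (\<lambda>h. 2 * exp (2 * fst p) * fst h)) (at p)"
  by (rule fst_der[of "\<lambda>s. exp (2 * s)"]) (auto intro!: derivative_eq_intros)

text \<open>The dilated profile minus the original one, both extended by zero. Only this difference
  is added to \<open>u\<close>, so nothing is assumed about \<open>u\<close> on angles where both
  terms vanish. The following definitions are its partial derivatives, the second ones valid almost
  everywhere.\<close>

definition W :: "real \<times> real \<Rightarrow> real" where "W p = exp (2 * fst p) * (h0 (T p) - h0 (snd p - a))"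
definition W1 :: "real \<times> real \<Rightarrow> real" where
  "W1 p = exp (2 * fst p) * (2 * h0 (T p) - 2 * h0 (snd p - a) + (snd p - a) * q1 (fst p) * h1 (T p))"
definition W2 :: "real \<times> real \<Rightarrow> real" where "W2 p = exp (2 * fst p) * (q (fst p) * h1 (T p) - h1 (snd p - a))"
definition W11 :: "real \<times> real \<Rightarrow> real" where
  "W11 p = exp (2 * fst p) * (4 * h0 (T p) - 4 * h0 (snd p - a) + 4 * (snd p - a) * q1 (fst p) * h1 (T p) +
     (snd p - a) * q2 (fst p) * h1 (T p) + ((snd p - a) * q1 (fst p))\<^sup>2 * h2 (T p))"
definition W12 :: "real \<times> real \<Rightarrow> real" where
  "W12 p = exp (2 * fst p) * (2 * q (fst p) * h1 (T p) - 2 * h1 (snd p - a) + q1 (fst p) * h1 (T p) +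
     (snd p - a) * q1 (fst p) * q (fst p) * h2 (T p))"
definition W22 :: "real \<times> real \<Rightarrow> real" where "W22 p = exp (2 * fst p) * ((q (fst p))\<^sup>2 * h2 (T p) - h2 (snd p - a))"

lemma W_der: "(W has_derivative (\<lambda>h. W1 p * fst h + W2 p * snd h)) (at p)"
  unfolding W_def[abs_def] W1_def W2_def
  using has_derivative_mult[OF exp_der has_derivative_diff[OF T_comp[OF h0_deriv] T0_comp[OF h0_deriv]], of p]
  by (simp add: algebra_simps)

lemma W1_der:
  assumes "T p \<noteq> 0" "T p \<noteq> l" "snd p - a \<noteq> 0" "snd p - a \<noteq> l"
  shows "(W1 has_derivative (\<lambda>h. W11 p * fst h + W12 p * snd h)) (at p)"
  unfolding W1_def[abs_def] W11_def W12_def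
  using has_derivative_mult[OF exp_der has_derivative_add[OF has_derivative_diff[OF
      has_derivative_mult_right[OF T_comp[OF h0_deriv], of 2] has_derivative_mult_right[OF T0_comp[OF h0_deriv], of 2]]
      has_derivative_mult[OF has_derivative_mult[OF snd_der fst_der[OF q_deriv(2)]] T_comp[OF h1_deriv[OF assms(1,2)]]]]]
  by (simp add: algebra_simps power2_eq_square)

lemma W2_der:
  assumes "T p \<noteq> 0" "T p \<noteq> l" "snd p - a \<noteq> 0" "snd p - a \<noteq> l"
  shows "(W2 has_derivative (\<lambda>h. W12 p * fst h + W22 p * snd h)) (at p)"
  unfolding W2_def[abs_def] W12_def W22_def
  using has_derivative_mult[OF exp_der has_derivative_diff[OF
      has_derivative_mult[OF fst_der[OF q_deriv(1)] T_comp[OF h1_deriv[OF assms(1,2)]]] T0_comp[OF h1_deriv[OF assms(3,4)]]]]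
  by (simp add: algebra_simps power2_eq_square)

text \<open>For fixed s the excluded angles are a, a + l and a + l / q(s), three points, so the
  exceptional set is null by Fubini.\<close>

lemma AE_regular: "AE p in lborel. T p \<noteq> 0 \<and> T p \<noteq> l \<and> snd p - a \<noteq> 0 \<and> snd p - a \<noteq> l"
proof -
  have Tb: "T \<in> borel_measurable borel"
    unfolding T_def[abs_def] by (intro borel_measurable_continuous_onI continuous_intros continuous_on_smooth1_fst[OF q_smooth(1)])
  have sb: "(\<lambda>p::real\<times>real. snd p - a) \<in> borel_measurable borel"
    by (intro borel_measurable_continuous_onI continuous_intros)
  have "AE p in lborel \<Otimes>\<^sub>M lborel. T p \<noteq> 0 \<and> T p \<noteq> l \<and> snd p - a \<noteq> 0 \<and> snd p - a \<noteq> l"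
  proof (rule lborel_pair.AE_pair_measure)
    have m: "{p \<in> space borel. T p \<noteq> c} \<in> sets borel" "{p \<in> space borel. snd p - a \<noteq> c} \<in> sets (borel :: (real \<times> real) measure)" for c
      using borel_measurable_neq[OF Tb borel_measurable_const] borel_measurable_neq[OF sb borel_measurable_const] by auto
    have "{p. T p \<noteq> 0} \<inter> ({p. T p \<noteq> l} \<inter> ({p. snd p - a \<noteq> 0} \<inter> {p. snd p - a \<noteq> l})) \<in> sets borel"
      using m[of 0] m[of l] unfolding space_borel by (intro sets.Int) simp_all
    then show "{p \<in> space (lborel \<Otimes>\<^sub>M lborel). T p \<noteq> 0 \<and> T p \<noteq> l \<and> snd p - a \<noteq> 0 \<and> snd p - a \<noteq> l} \<in> sets (lborel \<Otimes>\<^sub>M lborel)"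
      unfolding lborel_prod space_lborel sets_lborel space_borel by (simp only: Collect_conj_eq[symmetric] mem_Collect_eq UNIV_I simp_thms)
    show "AE x in lborel. AE y in lborel. T (x, y) \<noteq> 0 \<and> T (x, y) \<noteq> l \<and> snd (x, y) - a \<noteq> 0 \<and> snd (x, y) - a \<noteq> l"
    proof (rule AE_I2)
      fix x
      have "AE y in lborel. y \<noteq> a" "AE y in lborel. y \<noteq> a + l" "AE y in lborel. y \<noteq> a + l / q x"
        by (rule AE_lborel_singleton)+
      then show "AE y in lborel. T (x, y) \<noteq> 0 \<and> T (x, y) \<noteq> l \<and> snd (x, y) - a \<noteq> 0 \<and> snd (x, y) - a \<noteq> l"
      proof eventually_elim
        case (elim y)
        then show ?case using q_pos[of x] by (auto simp: T_def field_simps)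
      qed
    qed
  qed
  then show ?thesis unfolding lborel_prod .
qed

text \<open>The condition on d says that the moved end a + l / q(s) never passes a + l + d. Outside
  the support of \<open>eta\<close> in s both profiles coincide.\<close>

lemma W_outside:
  assumes d: "\<And>s. l \<le> (l + d) * q s" "d \<ge> 0" and p: "p \<notin> {-2..-1} \<times> {a..a + l + d}"
  shows "W p = 0 \<and> W1 p = 0 \<and> W2 p = 0 \<and> W11 p = 0 \<and> W12 p = 0 \<and> W12 p = 0 \<and> W22 p = 0"
proof -
  consider "fst p \<notin> {-2..-1}" | "snd p < a" | "snd p > a + l + d" using p by (cases p) fastforce
  then show ?thesis
  proof cases
    case 1
    note q_outside[OF 1]
    then show ?thesis by (simp add: W_def W1_def W2_def W11_def W12_def W22_def T_def)
  next
    case 2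
    then have "T p < 0" unfolding T_def using q_pos[of "fst p"] by (intro mult_neg_pos) auto
    then show ?thesis using 2 h_outside[of "T p"] h_outside[of "snd p - a"] by (simp add: W_def W1_def W2_def W11_def W12_def W22_def)
  next
    case 3
    have "l \<le> (l + d) * q (fst p)" by (rule d)
    also have "\<dots> < T p" unfolding T_def using 3 q_pos[of "fst p"] by (intro mult_strict_right_mono) auto
    finally have "l < T p" .
    then show ?thesis using 3 d(2) h_outside[of "T p"] h_outside[of "snd p - a"] by (simp add: W_def W1_def W2_def W11_def W12_def W22_def)
  qed
qed

lemma T_loc_lip: "loc_lip T p"
proof -
  have "loc_lip (\<lambda>p. (snd p + (- a)) * q (fst p)) p"
    by (intro loc_lip_mult loc_lip_add loc_lip_snd loc_lip_const loc_lip_compose[OF loc_lip_smooth1[OF q_smooth(1)] loc_lip_fst])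
  then show ?thesis unfolding T_def[abs_def] by simp
qed

lemma W_loc_lip: "loc_lip W p" "loc_lip W1 p" "loc_lip W2 p"
proof -
  have t: "loc_lip (\<lambda>p::real\<times>real. snd p + (- a)) p" by (intro loc_lip_add loc_lip_snd loc_lip_const)
  note c = loc_lip_compose[OF h_loc_lip(1) T_loc_lip, of p] loc_lip_compose[OF h_loc_lip(2) T_loc_lip, of p]
    loc_lip_compose[OF h_loc_lip(1) t] loc_lip_compose[OF h_loc_lip(2) t]
    loc_lip_compose[OF loc_lip_smooth1[OF smooth1_exp_cmult[of 2]] loc_lip_fst, of p]
    loc_lip_compose[OF loc_lip_smooth1[OF q_smooth(1)] loc_lip_fst, of p] loc_lip_compose[OF loc_lip_smooth1[OF q_smooth(2)] loc_lip_fst, of p]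
  have "loc_lip (\<lambda>p. exp (2 * fst p) * (h0 (T p) + (-1) * h0 (snd p + (- a)))) p"
    "loc_lip (\<lambda>p. exp (2 * fst p) * (2 * h0 (T p) + (-2) * h0 (snd p + (- a)) + (snd p + (- a)) * q1 (fst p) * h1 (T p))) p"
    "loc_lip (\<lambda>p. exp (2 * fst p) * (q (fst p) * h1 (T p) + (-1) * h1 (snd p + (- a)))) p"
    by (intro loc_lip_mult loc_lip_add loc_lip_const c t)+
  then show "loc_lip W p" "loc_lip W1 p" "loc_lip W2 p"
    unfolding W_def[abs_def] W1_def[abs_def] W2_def[abs_def] by simp_all
qed

lemma W_borel: "W \<in> borel_measurable borel" "W11 \<in> borel_measurable borel" "W22 \<in> borel_measurable borel"
proof -
  have Tb: "T \<in> borel_measurable borel"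
    unfolding T_def[abs_def] by (intro borel_measurable_continuous_onI continuous_intros continuous_on_smooth1_fst[OF q_smooth(1)])
  have sb: "(\<lambda>p::real\<times>real. snd p - a) \<in> borel_measurable borel"
    by (intro borel_measurable_continuous_onI continuous_intros)
  have eb: "(\<lambda>p::real\<times>real. exp (2 * fst p)) \<in> borel_measurable borel"
    by (intro borel_measurable_continuous_onI continuous_intros)
  have qb: "(\<lambda>p::real\<times>real. q (fst p)) \<in> borel_measurable borel" "(\<lambda>p::real\<times>real. q1 (fst p)) \<in> borel_measurable borel" "(\<lambda>p::real\<times>real. q2 (fst p)) \<in> borel_measurable borel"
    by (intro borel_measurable_continuous_onI continuous_on_smooth1_fst q_smooth)+
  note c = measurable_compose[OF Tb h_borel(1)] measurable_compose[OF Tb h_borel(2)] measurable_compose[OF Tb h_borel(3)]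
    measurable_compose[OF sb h_borel(1)] measurable_compose[OF sb h_borel(2)] measurable_compose[OF sb h_borel(3)]
  show "W \<in> borel_measurable borel" "W11 \<in> borel_measurable borel" "W22 \<in> borel_measurable borel"
    unfolding W_def[abs_def] W11_def[abs_def] W22_def[abs_def]
    by (intro borel_measurable_times borel_measurable_diff borel_measurable_add borel_measurable_power borel_measurable_const sb eb qb c)+
qed

text \<open>The parameter region below the moved end. The density \<open>RB\<close> on it counts the
  measure term as 1 throughout, an upper bound for the competitor.\<close>

definition S :: "(real \<times> real) set" where
  "S = {p. -2 \<le> fst p \<and> fst p \<le> -1 \<and> a \<le> snd p \<and> T p \<le> l}"

definition RB :: "real \<times> real \<Rightarrow> real" where
  "RB p = indicator S p * (exp (2 * fst p) * ((Nf A B \<epsilon> (fst p) (T p))\<^sup>2 + 1))"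

lemma RB_nonneg: "RB p \<ge> 0"
  by (simp add: RB_def indicator_def)

lemma T_continuous: "continuous_on X T"
  unfolding T_def[abs_def] by (intro continuous_intros continuous_on_smooth1_fst[OF q_smooth(1)])

lemma compact_S: "compact S"
proof -
  have "closed S" unfolding S_def
    by (intro closed_Collect_conj closed_Collect_le continuous_intros T_continuous)
  moreover have "S \<subseteq> {-2..-1} \<times> {a..a + 2 * l}"
  proof
    fix p assume p: "p \<in> S"
    have "\<bar>\<epsilon> * eta (fst p)\<bar> \<le> \<bar>\<epsilon>\<bar> * 1" unfolding abs_mult using eta_bounds[of "fst p"] by (intro mult_left_mono) auto
    then have "q (fst p) \<ge> 1 / 2" using e by (simp add: q_def qf_def)
    then have "(snd p - a) * (1 / 2) \<le> T p" unfolding T_def using p by (intro mult_left_mono) (auto simp: S_def)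
    also have "\<dots> \<le> l" using p by (simp add: S_def)
    finally show "p \<in> {-2..-1} \<times> {a..a + 2 * l}" using p by (cases p) (auto simp: S_def)
  qed
  then have "bounded S" by (rule bounded_subset[rotated]) (intro compact_imp_bounded compact_Times compact_Icc)
  ultimately show ?thesis by (simp add: compact_eq_bounded_closed)
qed

lemma RB_integrable: "integrable lborel RB"
proof -
  have qn: "qf \<epsilon> s \<noteq> 0" for s using qf_pos[OF e, of s] by simp
  have "integrable lborel (\<lambda>p. indicator S p *\<^sub>R (exp (2 * fst p) * ((Nf A B \<epsilon> (fst p) (T p))\<^sup>2 + 1)))"
  proof (rule borel_integrable_compact[OF compact_S])
    show "continuous_on S (\<lambda>p. exp (2 * fst p) * ((Nf A B \<epsilon> (fst p) (T p))\<^sup>2 + 1))"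
      by (intro continuous_intros Nf_continuous(2)[of S "\<lambda>_. \<epsilon>" fst T] T_continuous qn)
  qed
  then show ?thesis unfolding RB_def[abs_def] by simp
qed

text \<open>On each line of constant s the substitution t = a + y / q(s) straightens the moving end;
  its factor 1 / q(s) is the one in \<open>Rf\<close>.\<close>

lemma RB_integral: "(LINT p|lborel. RB p) = integral (cbox (-2, 0) (-1, l)) (Rf A B \<epsilon>)"
proof -
  let ?C = "cbox (-2, 0) (-1, l) :: (real \<times> real) set"
  note R = integral_cbox_lborel[OF Rf_continuous[OF e], of "(-2, 0)" "(-1, l)" A B]
  have inner: "(LINT y|lborel. RB (x, y)) = (LINT y|lborel. indicator ?C (x, y) * Rf A B \<epsilon> (x, y))" for x
  proof -
    have q: "q x > 0" by (rule q_pos)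
    have "(LINT y|lborel. RB (x, y)) = \<bar>1 / q x\<bar> *\<^sub>R (LINT y|lborel. RB (x, a + (1 / q x) * y))"
      using q by (intro lborel_integral_real_affine) simp
    also have "\<dots> = (LINT y|lborel. (1 / q x) * RB (x, a + (1 / q x) * y))" using q by simp
    also have "\<dots> = (LINT y|lborel. indicator ?C (x, y) * Rf A B \<epsilon> (x, y))"
    proof (rule Bochner_Integration.integral_cong[OF refl])
      fix y
      have T: "T (x, a + (1 / q x) * y) = y" using q by (simp add: T_def)
      have "(x, a + (1 / q x) * y) \<in> S \<longleftrightarrow> (x, y) \<in> ?C"
        using q unfolding S_def mem_Collect_eq T by (auto simp: cbox_Pair_eq zero_le_divide_iff zero_le_mult_iff)
      then have i: "indicator S (x, a + (1 / q x) * y) = (indicator ?C (x, y) :: real)" by (simp add: indicator_def)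
      show "(1 / q x) * RB (x, a + (1 / q x) * y) = indicator ?C (x, y) * Rf A B \<epsilon> (x, y)"
        unfolding RB_def i T by (simp add: Rf_def q_def)
    qed
    finally show ?thesis .
  qed
  have "(LINT p|lborel. RB p) = (LINT x|lborel. LINT y|lborel. RB (x, y))" using lborel2_fst[OF RB_integrable] by simp
  also have "\<dots> = (LINT p|lborel. indicator ?C p * Rf A B \<epsilon> p)" unfolding inner using lborel2_fst[OF R(1)] by simp
  finally show ?thesis using R(2) by simp
qed

end

context homogeneous_minimizer
begin

text \<open>The unperturbed integral is at most the energy of \<open>u\<close> on Q, which by
  minimality is at most that of the competitor, and this is bounded by the integral of
  \<open>V.RB\<close>. The instance \<open>V0\<close> with parameter 0 expresses the first integral
  in the same form.\<close>

lemma arc_variation: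
  assumes l: "0 < l" and z: "pf A B l = 0" "pf1 A B l = 0" and dom: "\<alpha> < a" "a + l + d < \<alpha> + 2 * pi" "0 \<le> d"
    and e: "\<bar>\<epsilon>\<bar> < 1 / 2" and q: "\<And>s. l \<le> (l + d) * qf \<epsilon> s"
    and fin: "\<And>t. 0 \<le> t \<Longrightarrow> t \<le> l \<Longrightarrow> f (a + t) = pf A B t"
    and gin: "AE x in lborel. x \<in> {a<..<a + l} \<longrightarrow> g x = A + B * (x - a) \<and> f x \<noteq> 0"
    and out: "AE x in lborel. x \<in> {a + l<..<a + l + d} \<longrightarrow> f x = 0 \<and> g x = 0"
  shows "integral (cbox (-2, 0) (-1, l)) (Rf A B 0) \<le> integral (cbox (-2, 0) (-1, l)) (Rf A B \<epsilon>)"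
proof -
  interpret V: variation A B l a \<epsilon> by unfold_locales fact+
  interpret V0: variation A B l a 0 by unfold_locales (use l z in auto)
  define Q :: "(real \<times> real) set" where "Q = {-2..-1} \<times> {a..a + l + d}"
  let ?A = "\<lambda>p. exp (2 * fst p) * ((g (snd p))\<^sup>2 + indicator {p. F (snd p) \<noteq> 0} p)"
  let ?B = "\<lambda>p. exp (2 * fst p) * ((g (snd p) + exp (- 2 * fst p) * (V.W11 p + V.W22 p))\<^sup>2 +
      indicator {p. exp (2 * fst p) * F (snd p) + V.W p \<noteq> 0} p)"
  have M: "integrable lborel (\<lambda>p. indicator Q p * ?A p)" "integrable lborel (\<lambda>p. indicator Q p * ?B p)"
      "(LINT p|lborel. indicator Q p * ?A p) \<le> (LINT p|lborel. indicator Q p * ?B p)"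
  proof -
    have c2: "V.W p = 0 \<and> V.W1 p = 0 \<and> V.W2 p = 0 \<and> V.W11 p = 0 \<and> V.W12 p = 0 \<and> V.W12 p = 0 \<and> V.W22 p = 0" if "p \<notin> Q" for p
      using V.W_outside[of d p] q dom(3) that unfolding Q_def V.q_def by blast
    have c5: "AE p in lborel. p \<in> Q \<longrightarrow> (V.W1 has_derivative (\<lambda>q. V.W11 p * fst q + V.W12 p * snd q)) (at p) \<and>
        (V.W2 has_derivative (\<lambda>q. V.W12 p * fst q + V.W22 p * snd q)) (at p)"
      using V.AE_regular by eventually_elim (use V.W1_der V.W2_der in blast)
    have neg: "(-1::real) < 0" by simp
    note mp = minimality_polar[OF dom(1,2) neg Q_def c2 V.W_loc_lip V.W_der c5 V.W_borel]
    show "integrable lborel (\<lambda>p. indicator Q p * ?A p)" "integrable lborel (\<lambda>p. indicator Q p * ?B p)"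
      "(LINT p|lborel. indicator Q p * ?A p) \<le> (LINT p|lborel. indicator Q p * ?B p)"
      using mp by auto
  qed
  note ae = AE_snd[OF f(5)] AE_snd[OF gin] AE_snd[OF out] V.AE_regular AE_snd[OF AE_lborel_singleton[of "a + l + d"]]
  have V0T: "V0.T p = snd p - a" for p by (simp add: V0.T_def V0.q_def qf_def)
  have N0: "Nf A B 0 s y = A + B * y" for s y
    using pf_ode[of A B y] by (simp add: Nf_def qf_def)
  have "integral (cbox (-2, 0) (-1, l)) (Rf A B 0) = (LINT p|lborel. V0.RB p)" by (simp add: V0.RB_integral)
  also have "\<dots> \<le> (LINT p|lborel. indicator Q p * ?A p)"
  proof (rule integral_mono_AE[OF V0.RB_integrable M(1)])
    show "AE p in lborel. V0.RB p \<le> indicator Q p * ?A p"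
      using ae
    proof eventually_elim
      case (elim p)
      show ?case
      proof (cases "p \<in> V0.S")
        case True
        then have r: "fst p \<in> {-2..-1}" "a \<le> snd p" "snd p - a \<le> l" by (auto simp: V0.S_def V0T)
        then have "snd p \<in> {a<..<a + l}" using elim by auto
        then have gf: "g (snd p) = A + B * (snd p - a)" "F (snd p) \<noteq> 0" using elim by auto
        have "p \<in> Q" using r dom(3) by (cases p) (auto simp: Q_def)
        then show ?thesis using True gf by (simp add: V0.RB_def V0T N0)
      qed (simp add: V0.RB_def indicator_def)
    qed
  qed
  also have "\<dots> \<le> (LINT p|lborel. indicator Q p * ?B p)" by (rule M(3))
  also have "\<dots> \<le> (LINT p|lborel. V.RB p)"
  proof (rule integral_mono_AE[OF M(2) V.RB_integrable])
    show "AE p in lborel. indicator Q p * ?B p \<le> V.RB p"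
      using ae
    proof eventually_elim
      case (elim p)
      show ?case
      proof (cases "p \<in> Q")
        case True
        define t s where "t = snd p - a" and "s = fst p"
        have st: "s \<in> {-2..-1}" "0 \<le> t" "t \<le> l + d" using True by (cases p; auto simp: Q_def t_def s_def)+
        have tt: "t \<noteq> 0" "t \<noteq> l" using elim by (auto simp: t_def)
        have td: "t \<noteq> l + d" using elim by (auto simp: t_def)
        \<comment> \<open>On all of Q the minimizer is given by the zero extension
          \<open>h0\<close>: by \<open>fin\<close> and \<open>gin\<close> on the arc, by
          \<open>out\<close> on the angles into which it may grow.\<close>
        have "g (snd p) = 4 * V.h0 t + V.h2 t \<and> F (snd p) = V.h0 t"
        proof (cases "t < l")
          case True
          then have "snd p \<in> {a<..<a + l}" using st tt by (auto simp: t_def)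
          then have "g (snd p) = A + B * t" "F (snd p) = pf A B t" using elim fin[of t] st True by (auto simp: t_def)
          then show ?thesis using V.h_inside[of t] pf_ode[of A B t] st True by auto
        next
          case False
          then have "snd p \<in> {a + l<..<a + l + d}" using st tt td by (auto simp: t_def)
          then have "g (snd p) = 0" "F (snd p) = 0" using elim by auto
          then show ?thesis using V.h_outside[of t] False tt by auto
        qed
        then have gF: "g (snd p) = 4 * V.h0 t + V.h2 t" "F (snd p) = V.h0 t" by blast+
        have T: "V.T p = t * V.q s" by (simp add: V.T_def t_def s_def)
        have ee: "exp (- 2 * s) * (exp (2 * s) * y) = y" for y by (simp flip: exp_add mult.assoc)
        have lap: "g (snd p) + exp (- 2 * fst p) * (V.W11 p + V.W22 p) =
          4 * V.h0 (V.T p) + (4 * t * V.q1 s + t * V.q2 s) * V.h1 (V.T p) + (t * V.q1 s)\<^sup>2 * V.h2 (V.T p) + (V.q s)\<^sup>2 * V.h2 (V.T p)"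
          unfolding gF V.W11_def V.W22_def t_def[symmetric] s_def[symmetric] distrib_left[symmetric] ee by (simp add: algebra_simps)
        have val: "exp (2 * fst p) * F (snd p) + V.W p = exp (2 * fst p) * V.h0 (V.T p)"
          unfolding gF V.W_def t_def[symmetric] by (simp add: algebra_simps)
        show ?thesis
        proof (cases "V.T p < l")
          case True
          have qn: "V.q s > 0" by (rule V.q_pos)
          then have T0: "0 \<le> V.T p" using st unfolding T by simp
          then have "p \<in> V.S" using True st by (simp add: V.S_def s_def t_def)
          moreover have "4 * V.h0 (V.T p) + (4 * t * V.q1 s + t * V.q2 s) * V.h1 (V.T p) + (t * V.q1 s)\<^sup>2 * V.h2 (V.T p) + (V.q s)\<^sup>2 * V.h2 (V.T p)
            = Nf A B \<epsilon> s (V.T p)"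
          proof -
            have h: "V.h0 (V.T p) = pf A B (V.T p)" "V.h1 (V.T p) = pf1 A B (V.T p)" "V.h2 (V.T p) = pf2 A B (V.T p)"
              using V.h_inside[of "V.T p"] T0 True by auto
            have "t = V.T p / V.q s" using qn unfolding T by simp
            then have k: "4 * t * V.q1 s + t * V.q2 s = - (4 * deriv eta s + deriv (deriv eta) s) * V.T p * (\<epsilon> / V.q s)"
              "(t * V.q1 s)\<^sup>2 = (deriv eta s)\<^sup>2 * (V.T p)\<^sup>2 * (\<epsilon>\<^sup>2 / (V.q s)\<^sup>2)"
              by (simp_all add: V.q1_def V.q2_def power_mult_distrib power_divide add_divide_distrib algebra_simps)
            show ?thesis unfolding h k Nf_def V.q_def[symmetric] by (simp add: algebra_simps)
          qed
          ultimately have "V.RB p = exp (2 * fst p) * ((g (snd p) + exp (- 2 * fst p) * (V.W11 p + V.W22 p))\<^sup>2 + 1)"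
            unfolding lap V.RB_def by (simp add: s_def)
          moreover have "?B p \<le> exp (2 * fst p) * ((g (snd p) + exp (- 2 * fst p) * (V.W11 p + V.W22 p))\<^sup>2 + 1)"
            by (intro mult_left_mono add_left_mono) (auto simp: indicator_def)
          ultimately show ?thesis using \<open>p \<in> Q\<close> by (simp only: indicator_simps mult_1)
        next
          case False
          \<comment> \<open>Beyond the moved end the competitor and its Laplacian vanish, so this
            part of Q costs no energy.\<close>
          then have "V.T p > l" using elim by auto
          then have h: "V.h0 (V.T p) = 0" "V.h1 (V.T p) = 0" "V.h2 (V.T p) = 0" using V.h_outside[of "V.T p"] by auto
          have "indicator {p. exp (2 * fst p) * F (snd p) + V.W p \<noteq> 0} p = (0::real)" using val unfolding h by (simp add: indicator_def)
          then have "?B p = 0" unfolding lap h by simp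
          then show ?thesis using V.RB_nonneg[of p] by simp
        qed
      next
        case False
        then show ?thesis using V.RB_nonneg[of p] by simp
      qed
    qed
  qed
  also have "\<dots> = integral (cbox (-2, 0) (-1, l)) (Rf A B \<epsilon>)" by (rule V.RB_integral)
  finally show ?thesis .
qed

end

section \<open>Classification of the profiles\<close>

lemma periodic_int:
  fixes h :: "real \<Rightarrow> 'a"
  assumes "\<And>x. h (x + 2 * pi) = h x" shows "h (x + 2 * pi * of_int n) = h x"
proof -
  have nat: "h (x + 2 * pi * real n) = h x" for x n
  proof (induction n)
    case (Suc n)
    have "x + 2 * pi * real (Suc n) = (x + 2 * pi * real n) + 2 * pi" by (simp add: algebra_simps)
    then show ?case using Suc assms by metis
  qed simp
  show ?thesis
  proof (cases n rule: int_cases2)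
    case (nonneg m)
    then show ?thesis using nat[of x m] by simp
  next
    case (nonpos m)
    then show ?thesis using nat[of "x - 2 * pi * real m" m] by simp
  qed
qed

text \<open>If sin l = 0 then B = 0, and l = 2 pi is excluded by the common zero at pi. Otherwise
  eliminating A leaves B (l cos l - sin l) = 0 with B nonzero. There is no solution of tan l = l
  below pi, because sin t - t cos t increases from 0 there.\<close>

lemma arc_classify:
  assumes l: "0 < l" "l \<le> 2 * pi" and z: "pf A B l = 0" "pf1 A B l = 0"
    and nd: "\<And>t. 0 < t \<Longrightarrow> t < l \<Longrightarrow> \<not> (pf A B t = 0 \<and> pf1 A B t = 0)"
  shows "l = pi \<and> B = 0 \<or> l = t1 \<and> B = - 2 * A / l"
proof -
  let ?s = "sin l" and ?c = "cos l"
  have sc: "?s\<^sup>2 + ?c\<^sup>2 = 1" by simp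
  have d: "cos (2 * l) = 1 - 2 * ?s\<^sup>2" "sin (2 * l) = 2 * ?s * ?c" by (rule cos_double_sin, rule sin_double)
  have e1: "A / 2 * ?s\<^sup>2 + B / 4 * (l - ?s * ?c) = 0"
    using z(1) unfolding pf_def d by (simp add: algebra_simps)
  have e2: "?s * (A * ?c + B / 2 * ?s) = 0"
    using z(2) unfolding pf1_def d by (simp add: algebra_simps power2_eq_square)
  show ?thesis
  proof (cases "?s = 0")
    case True
    have "B = 0" using e1 l unfolding True by simp
    have "l = pi \<or> l = 2 * pi"
    proof (rule ccontr)
      assume "\<not> ?thesis"
      then consider "l < pi" | "pi < l" "l < 2 * pi" using l by linarith
      then show False
      proof cases
        case 1 then show False using sin_gt_zero[of l] l True by simp
      next
        case 2 then show False using sin_lt_zero[of l] True by simp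
      qed
    qed
    moreover have "l \<noteq> 2 * pi"
    proof
      assume "l = 2 * pi"
      then have "0 < pi" "pi < l" using pi_gt_zero by linarith+
      then show False using nd[of pi] \<open>B = 0\<close> by (simp add: pf_def pf1_def)
    qed
    ultimately show ?thesis using \<open>B = 0\<close> by simp
  next
    case False
    then have e3: "A * ?c = - (B / 2 * ?s)" using e2 by (simp add: add_eq_0_iff2)
    \<comment> \<open>Multiplication by cos l produces A cos l, which the second condition expresses
      through B.\<close>
    have "?c * (A / 2 * ?s\<^sup>2 + B / 4 * (l - ?s * ?c)) = (A * ?c) / 2 * ?s\<^sup>2 + B / 4 * (l * ?c - ?s * ?c\<^sup>2)"
      by (simp add: algebra_simps power2_eq_square)
    also have "\<dots> = B / 4 * (l * ?c - ?s * (?s\<^sup>2 + ?c\<^sup>2))"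
    proof -
      have "- (B / 2 * x) / 2 * x\<^sup>2 + B / 4 * (l * y - x * y\<^sup>2) = B / 4 * (l * y - x * (x\<^sup>2 + y\<^sup>2))" for x y :: real
        by (simp add: algebra_simps power2_eq_square)
      then show ?thesis unfolding e3 .
    qed
    finally have e4: "B * (l * ?c - ?s) = 0" using e1 unfolding sc by simp
    have "B \<noteq> 0"
    proof
      assume B: "B = 0"
      then have "A = 0" using e1 False by simp
      then show False using nd[of "l / 2"] l B by (simp add: pf_def pf1_def)
    qed
    then have e5: "?s = l * ?c" using e4 by simp
    then have c: "?c \<noteq> 0" using False by auto
    then have tan: "tan l = l" using e5 by (simp add: tan_def)
    have "pi < l"
    proof (rule ccontr)
      assume "\<not> pi < l"
      moreover have "l \<noteq> pi" using False by auto
      ultimately have lp: "l < pi" by simp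
      let ?h = "\<lambda>t. sin t - t * cos t"
      have "?h 0 < ?h l"
      proof (rule DERIV_pos_imp_increasing_open[OF l(1)])
        fix x assume x: "0 < x" "x < l"
        have "(?h has_real_derivative x * sin x) (at x)" by (auto intro!: derivative_eq_intros)
        moreover have "0 < x * sin x" using x lp by (intro mult_pos_pos sin_gt_zero) auto
        ultimately show "\<exists>y. (?h has_real_derivative y) (at x) \<and> 0 < y" by blast
      qed (intro continuous_intros)
      then show False using e5 by simp
    qed
    moreover have "l < 2 * pi" using l False by (cases "l = 2 * pi") auto
    ultimately have "l = t1" using tan t1_ex1 theI'[OF t1_ex1] unfolding t1_def by blast
    moreover have "B = - 2 * A / l"
    proof -
      have "?c * (2 * A) = ?c * (- B * l)" using e3 unfolding e5 by (simp add: algebra_simps)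
      then have "2 * A = - B * l" using mult_cancel_left[of ?c "2 * A" "- B * l"] c by blast
      then show ?thesis using l by (simp add: field_simps)
    qed
    ultimately show ?thesis by simp
  qed
qed

lemma t1_bounds: "pi < t1" "t1 < 2 * pi"
  using theI'[OF t1_ex1] unfolding t1_def by blast+

context homogeneous_minimizer
begin

text \<open>If the value were below 1 in modulus, the first variation would be positive and a small
  negative \<epsilon> would lower the energy.\<close>

lemma shrink:
  assumes l: "0 < l" "l < 2 * pi" and z: "pf A B l = 0" "pf1 A B l = 0"
    and fin: "\<And>t. 0 \<le> t \<Longrightarrow> t \<le> l \<Longrightarrow> f (a + t) = pf A B t"
    and gin: "AE x in lborel. x \<in> {a<..<a + l} \<longrightarrow> g x = A + B * (x - a) \<and> f x \<noteq> 0"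
  shows "1 \<le> (A + B * l)\<^sup>2"
proof (rule ccontr)
  let ?\<Phi> = "\<lambda>\<epsilon>. integral (cbox (-2, 0) (-1, l)) (Rf A B \<epsilon>)"
  assume "\<not> ?thesis"
  then have D: "0 < c1 * (l * (1 - (A + B * l)\<^sup>2))" using c1_pos l by (intro mult_pos_pos) auto
  from DERIV_pos_inc_left[OF first_variation[OF l(1) z] D]
  obtain \<delta> where \<delta>: "\<delta> > 0" "\<And>h. 0 < h \<Longrightarrow> h < \<delta> \<Longrightarrow> ?\<Phi> (0 - h) < ?\<Phi> 0" by blast
  \<comment> \<open>Less than \<delta> for the strict decrease, at most 1 / 4 to keep the dilation
    factor positive.\<close>
  define h where "h = min (\<delta> / 2) (1 / 4)"
  have h: "0 < h" "h < \<delta>" "h \<le> 1 / 4" using \<delta>(1) by (auto simp: h_def)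
  have "?\<Phi> 0 \<le> ?\<Phi> (- h)"
  \<comment> \<open>The cut lies in the middle of the complementary gap. With d = 0 nothing beyond
    the arc is touched, as the dilation factor is at least 1.\<close>
  proof (rule arc_variation[OF l(1) z, of "a - (2 * pi - l) / 2" a 0])
    show "l \<le> (l + 0) * qf (- h) s" for s using l h eta_bounds(1)[of s] by (simp add: qf_def)
  qed (use l h fin gin in \<open>auto simp: field_simps\<close>)
  then show False using \<delta>(2)[OF h(1,2)] by simp
qed

text \<open>If the value exceeded 1 in modulus, the first variation would be negative and a small
  positive \<epsilon> would lower the energy. The arc then grows into angles where \<open>f\<close>
  and \<open>g\<close> vanish.\<close>

lemma stretch:
  assumes l: "0 < l" "0 < d" "l + d < 2 * pi" and z: "pf A B l = 0" "pf1 A B l = 0"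
    and fin: "\<And>t. 0 \<le> t \<Longrightarrow> t \<le> l \<Longrightarrow> f (a + t) = pf A B t"
    and gin: "AE x in lborel. x \<in> {a<..<a + l} \<longrightarrow> g x = A + B * (x - a) \<and> f x \<noteq> 0"
    and out: "AE x in lborel. x \<in> {a + l<..<a + l + d} \<longrightarrow> f x = 0 \<and> g x = 0"
  shows "(A + B * l)\<^sup>2 \<le> 1"
proof (rule ccontr)
  let ?\<Phi> = "\<lambda>\<epsilon>. integral (cbox (-2, 0) (-1, l)) (Rf A B \<epsilon>)"
  assume "\<not> ?thesis"
  then have D: "c1 * (l * (1 - (A + B * l)\<^sup>2)) < 0" using c1_pos l by (intro mult_pos_neg) auto
  from DERIV_neg_dec_right[OF first_variation[OF l(1) z] D]
  obtain \<delta> where \<delta>: "\<delta> > 0" "\<And>h. 0 < h \<Longrightarrow> h < \<delta> \<Longrightarrow> ?\<Phi> (0 + h) < ?\<Phi> 0" by blast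
  \<comment> \<open>The last bound means (l + d) (1 - h) >= l, so the stretched arc ends before a +
    l + d.\<close>
  define h where "h = min (min (\<delta> / 2) (1 / 4)) (d / (l + d))"
  have h: "h < \<delta>" "h \<le> 1 / 4" "h \<le> d / (l + d)" using \<delta>(1) unfolding h_def by linarith+
  have h0: "0 < h" using \<delta>(1) l by (simp add: h_def)
  have "?\<Phi> 0 \<le> ?\<Phi> h"
  proof (rule arc_variation[OF l(1) z, of "a - (2 * pi - l - d) / 2" a d])
    fix s
    have "(l + d) * (h * eta s) \<le> (l + d) * (h * 1)" using l h0 eta_bounds[of s] by (intro mult_left_mono) auto
    also have "\<dots> \<le> d" using h(3) l by (simp add: field_simps)
    finally show "l \<le> (l + d) * qf h s" by (simp add: qf_def algebra_simps)
  qed (use l h h0 fin gin out in \<open>auto simp: field_simps\<close>)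
  then show False using \<delta>(2)[OF h0 h(1)] by simp
qed

text \<open>The derivative of \<open>f\<close> is an integral of g - 4 F. Replacing the integrand by
  a continuous function that agrees with it almost everywhere makes the second derivative
  classical.\<close>

lemma f_second_derivative:
  assumes k: "continuous_on UNIV k" and gk: "AE x in lborel. x \<in> {a<..<b} \<longrightarrow> g x = k x" and y: "y \<in> {a..b}"
  shows "(deriv f has_real_derivative k y - 4 * f y) (at y within {a..b})"
proof -
  have ae: "AE x in lborel. x \<in> {a..b} \<longrightarrow> g x - 4 * F x = k x - 4 * f x"
    using gk f(5) AE_lborel_singleton[of a] AE_lborel_singleton[of b] by eventually_elim auto
  obtain N where N: "\<And>x. x \<in> space lborel - N \<Longrightarrow> x \<in> {a..b} \<longrightarrow> g x - 4 * F x = k x - 4 * f x" "N \<in> null_sets lborel"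
    using AE_E3[OF ae] by blast
  have neg: "negligible N" using N(2) by (simp add: negligible_iff_null_sets null_sets_completionI)
  have eq: "deriv f x = deriv f a + integral {a..x} (\<lambda>x. k x - 4 * f x)" if "x \<in> {a..b}" for x
  proof -
    have "integral {a..x} (\<lambda>t. g t - 4 * F t) = integral {a..x} (\<lambda>x. k x - 4 * f x)"
      using N(1) that by (intro integral_spike[OF neg]) auto
    then show ?thesis using f(4)[of a x] that by auto
  qed
  have c: "continuous_on {a..b} (\<lambda>x. k x - 4 * f x)"
    by (intro continuous_intros continuous_on_subset[OF k] continuous_on_subset[OF f(6)]) auto
  have "((\<lambda>x. deriv f a + integral {a..x} (\<lambda>x. k x - 4 * f x)) has_real_derivative 0 + (k y - 4 * f y)) (at y within {a..b})"
    by (intro DERIV_add DERIV_const integral_has_real_derivative[OF c y])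
  then show ?thesis using has_derivative_transform[OF y eq] by (simp add: has_field_derivative_def)
qed

text \<open>For the difference of two solutions of y'' + 4 y = k, the quantity (y')^2 + 4 y^2 is
  conserved, and it vanishes at a.\<close>

lemma ode_unique:
  assumes k: "continuous_on UNIV k" and gk: "AE x in lborel. x \<in> {a<..<b} \<longrightarrow> g x = k x"
    and p: "\<And>x. (p has_real_derivative p1 x) (at x)" "\<And>x. (p1 has_real_derivative k x - 4 * p x) (at x)"
    and init: "f a = p a" "deriv f a = p1 a" and x: "x \<in> {a..b}"
  shows "f x = p x \<and> deriv f x = p1 x"
proof -
  let ?E = "\<lambda>y. (deriv f y - p1 y) * (deriv f y - p1 y) + 4 * ((f y - p y) * (f y - p y))"
  have dE: "(?E has_real_derivative 0) (at y within {a..b})" if y: "y \<in> {a..b}" for y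
  proof -
    have d1: "((\<lambda>y. deriv f y - p1 y) has_real_derivative (k y - 4 * f y) - (k y - 4 * p y)) (at y within {a..b})"
      by (rule DERIV_diff[OF f_second_derivative[OF k gk y] has_field_derivative_at_within[OF p(2)]])
    have d2: "((\<lambda>y. f y - p y) has_real_derivative deriv f y - p1 y) (at y within {a..b})"
      by (rule has_field_derivative_at_within[OF DERIV_diff[OF f(1) p(1)]])
    show ?thesis
      using DERIV_add[OF DERIV_mult[OF d1 d1] DERIV_cmult[OF DERIV_mult[OF d2 d2], of 4]] by (simp add: algebra_simps)
  qed
  have "\<exists>c. \<forall>y\<in>{a..b}. ?E y = c"
    by (rule has_field_derivative_zero_constant[OF convex_real_interval(5) dE])
  then obtain c where c: "\<forall>y\<in>{a..b}. ?E y = c" ..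
  have "?E x = c" by (rule bspec[OF c x])
  moreover have "?E a = c" by (rule bspec[OF c]) (use x in simp)
  ultimately have "?E x = ?E a" by (rule trans[OF _ sym])
  moreover have "?E a = 0" using init by simp
  ultimately have "?E x = 0" by simp
  moreover have "v = 0 \<and> w = 0" if "v * v + 4 * (w * w) = 0" for v w :: real
    using that add_nonneg_eq_0_iff[of "v * v" "4 * (w * w)"] by simp
  ultimately have "deriv f x - p1 x = 0 \<and> f x - p x = 0" by blast
  then show ?thesis by simp
qed

text \<open>The angles at which the profile can be joined to zero in a C^1 way, hence the possible
  ends of arcs.\<close>

definition deg :: "real set" where "deg = {x. f x = 0 \<and> deriv f x = 0}"

lemma deg_shift: "x + 2 * pi * of_int n \<in> deg \<longleftrightarrow> x \<in> deg"
  unfolding deg_def using periodic_int[of f, OF f_periodic] periodic_int[of "deriv f", OF f'_periodic] by simp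

lemma closed_deg: "closed deg"
  unfolding deg_def by (intro closed_Collect_conj closed_Collect_eq f continuous_on_const)

text \<open>By periodicity two common zeros at distance 2 pi enclose \<open>x0\<close>. As
  \<open>deg\<close> is closed, there is a nearest one on each side, and these are at most 2 pi
  apart.\<close>

lemma component:
  assumes x0: "x0 \<notin> deg" and ne: "deg \<noteq> {}"
  obtains a b where "a < x0" "x0 < b" "b \<le> a + 2 * pi" "a \<in> deg" "b \<in> deg" "\<And>x. a < x \<Longrightarrow> x < b \<Longrightarrow> x \<notin> deg"
proof -
  obtain z where z: "z \<in> deg" using ne by blast
  define w where "w = z + 2 * pi * of_int \<lfloor>(x0 - z) / (2 * pi)\<rfloor>"
  have "w \<in> deg" unfolding w_def deg_shift by (rule z)
  then have w: "w \<in> deg" "w + 2 * pi \<in> deg" using deg_shift[of w 1] by simp_all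
  have wx: "w \<le> x0" "x0 < w + 2 * pi"
    using floor_divide_lower[of "2 * pi" "x0 - z"] floor_divide_upper[of "2 * pi" "x0 - z"] pi_gt_zero
    unfolding w_def by (simp_all add: algebra_simps)
  have cp: "compact (deg \<inter> {w..x0})" "compact (deg \<inter> {x0..w + 2 * pi})"
    by (intro closed_Int_compact closed_deg compact_Icc)+
  have cn: "deg \<inter> {w..x0} \<noteq> {}" "deg \<inter> {x0..w + 2 * pi} \<noteq> {}" using w wx by auto
  obtain a where a: "a \<in> deg \<inter> {w..x0}" "\<And>t. t \<in> deg \<inter> {w..x0} \<Longrightarrow> t \<le> a"
    using compact_attains_sup[OF cp(1) cn(1)] by blast
  obtain b where b: "b \<in> deg \<inter> {x0..w + 2 * pi}" "\<And>t. t \<in> deg \<inter> {x0..w + 2 * pi} \<Longrightarrow> b \<le> t"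
    using compact_attains_inf[OF cp(2) cn(2)] by blast
  have n: "x \<notin> deg" if "a < x" "x < b" for x
    using a(2)[of x] b(2)[of x] a(1) b(1) that by (cases "x \<le> x0") auto
  have "a \<noteq> x0" "b \<noteq> x0" using a(1) b(1) x0 by auto
  then show ?thesis using that[of a b] a(1) b(1) n by auto
qed

text \<open>At an accumulation point of zeros the derivative vanishes too, so zeros are finite in
  number on each compact part of the open interval, and countably many compact parts exhaust
  it.\<close>

lemma nonzero_AE:
  assumes nd: "\<And>x. a < x \<Longrightarrow> x < b \<Longrightarrow> x \<notin> deg"
  shows "AE x in lborel. x \<in> {a<..<b} \<longrightarrow> f x \<noteq> 0"
proof -
  have fin: "finite ({x. f x = 0} \<inter> {c..d})" if cd: "a < c" "d < b" for c d
  proof (rule ccontr)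
    assume "infinite ({x. f x = 0} \<inter> {c..d})"
    then obtain x where x: "x \<in> {c..d}" "x islimpt ({x. f x = 0} \<inter> {c..d})"
      using compact_Icc[of c d] unfolding compact_eq_Bolzano_Weierstrass by blast
    have "closed {x. f x = 0}" by (intro closed_Collect_eq f continuous_on_const)
    then have x0: "f x = 0" using islimpt_subset[OF x(2), of "{x. f x = 0}"] closed_limpt by blast
    have "deriv f x = 0"
    proof (rule ccontr)
      assume "deriv f x \<noteq> 0"
      moreover have "((\<lambda>y. (f y - f x) / (y - x)) \<longlongrightarrow> deriv f x) (at x)" using f(1)[of x] by (simp add: has_field_derivative_iff)
      ultimately have "\<forall>\<^sub>F y in at x. (f y - f x) / (y - x) \<noteq> 0" by (rule tendsto_imp_eventually_ne[rotated])
      then have "\<forall>\<^sub>F y in at x. y \<notin> {x. f x = 0} \<inter> {c..d}" by eventually_elim (use x0 in auto)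
      then show False using x(2) unfolding islimpt_iff_eventually by simp
    qed
    then show False using x0 nd[of x] x(1) cd by (auto simp: deg_def)
  qed
  have "AE x in lborel. \<forall>n. x \<notin> {x. f x = 0} \<inter> {a + inverse (real (Suc n))..b - inverse (real (Suc n))}"
    unfolding AE_all_countable
    by (intro allI AE_not_in finite_imp_null_set_lborel fin) simp_all
  then show ?thesis
  proof eventually_elim
    case (elim x)
    show ?case
    proof
      assume x: "x \<in> {a<..<b}"
      then obtain n where "inverse (real (Suc n)) < min (x - a) (b - x)" using reals_Archimedean[of "min (x - a) (b - x)"] by auto
      then have "x \<in> {a + inverse (real (Suc n))..b - inverse (real (Suc n))}" by auto
      then show "f x \<noteq> 0" using elim by blast
    qed
  qed
qed

text \<open>With zero data at the left end and an affine right-hand side, uniqueness identifies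
  \<open>f\<close> with \<open>pf A B\<close> on the whole arc; the data at the right end then feed
  \<open>arc_classify\<close>.\<close>

lemma arc:
  assumes ab: "a < b" "b \<le> a + 2 * pi" "a \<in> deg" "b \<in> deg" and nd: "\<And>x. a < x \<Longrightarrow> x < b \<Longrightarrow> x \<notin> deg"
  obtains A B where "pf A B (b - a) = 0" "pf1 A B (b - a) = 0" "\<And>t. 0 \<le> t \<Longrightarrow> t \<le> b - a \<Longrightarrow> f (a + t) = pf A B t"
    "AE x in lborel. x \<in> {a<..<b} \<longrightarrow> g x = A + B * (x - a) \<and> f x \<noteq> 0"
    "b - a = pi \<and> B = 0 \<or> b - a = t1 \<and> B = - 2 * A / (b - a)"
proof -
  have nz: "AE x in lborel. x \<in> {a<..<b} \<longrightarrow> f x \<noteq> 0" by (rule nonzero_AE) (rule nd)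
  obtain A0 B where AB: "AE x in lborel. x \<in> {a<..<b} \<longrightarrow> g x = A0 + B * x"
    using euler_lagrange[OF ab(1,2) nz] by blast
  define A where "A = A0 + B * a"
  define k where "k x = A + B * (x - a)" for x
  have gk: "AE x in lborel. x \<in> {a<..<b} \<longrightarrow> g x = k x"
    using AB by eventually_elim (auto simp: k_def A_def algebra_simps)
  have kc: "continuous_on UNIV k" unfolding k_def[abs_def] by (intro continuous_intros)
  have p: "((\<lambda>x. pf A B (x - a)) has_real_derivative pf1 A B (x - a)) (at x)"
    "((\<lambda>x. pf1 A B (x - a)) has_real_derivative k x - 4 * pf A B (x - a)) (at x)" for x
  proof -
    have "k x - 4 * pf A B (x - a) = pf2 A B (x - a)" using pf_ode[of A B "x - a"] by (simp add: k_def)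
    then show "((\<lambda>x. pf A B (x - a)) has_real_derivative pf1 A B (x - a)) (at x)"
      "((\<lambda>x. pf1 A B (x - a)) has_real_derivative k x - 4 * pf A B (x - a)) (at x)"
      using DERIV_shift[of "pf A B" _ x "- a"] DERIV_shift[of "pf1 A B" _ x "- a"] pf_deriv[of A B "x - a"] pf1_deriv[of A B "x - a"] by simp_all
  qed
  have sol: "f x = pf A B (x - a) \<and> deriv f x = pf1 A B (x - a)" if "x \<in> {a..b}" for x
    using ode_unique[OF kc gk p _ _ that] ab(3) by (simp add: deg_def)
  have z: "pf A B (b - a) = 0" "pf1 A B (b - a) = 0" using sol[of b] ab by (auto simp: deg_def)
  have "\<not> (pf A B t = 0 \<and> pf1 A B t = 0)" if "0 < t" "t < b - a" for t
    using sol[of "a + t"] nd[of "a + t"] that by (auto simp: deg_def)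
  then have "b - a = pi \<and> B = 0 \<or> b - a = t1 \<and> B = - 2 * A / (b - a)"
    using ab z by (intro arc_classify) auto
  moreover have "AE x in lborel. x \<in> {a<..<b} \<longrightarrow> g x = A + B * (x - a) \<and> f x \<noteq> 0"
    using gk nz by eventually_elim (auto simp: k_def)
  ultimately show ?thesis using that[of A B] z sol by auto
qed

text \<open>Where \<open>F\<close> vanishes almost everywhere, the weak equation pairs
  \<open>g\<close> to zero with every bump.\<close>

lemma g_zero:
  assumes bc: "b < c" "c \<le> b + 2 * pi" and z: "\<And>x. b < x \<Longrightarrow> x < c \<Longrightarrow> f x = 0"
  shows "AE x in lborel. x \<in> {b<..<c} \<longrightarrow> g x = 0"
proof (rule fundamental_lemma_real[OF g_loc_int])
  fix n d e assume de: "b < d" "d \<le> e" "e < c"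
  let ?z = "bump n d e"
  note b1 = bumps_deriv[OF bump_in_bumps, of n d e]
  note b2 = bumps_deriv[OF b1]
  have "(LINT x|lborel. g x * ?z x) = (LINT x|lborel. F x * (4 * ?z x + deriv (deriv ?z) x))"
    using F_weak[of b d e ?z] de bc bump_in_bumps by auto
  also have "\<dots> = 0"
  proof (rule integral_eq_zero_AE)
    show "AE x in lborel. F x * (4 * ?z x + deriv (deriv ?z) x) = 0"
      using f(5)
    proof eventually_elim
      case (elim x)
      show ?case
      proof (cases "x \<in> {d..e}")
        case True
        then show ?thesis using z[of x] de elim by auto
      next
        case False
        then show ?thesis using bumps_zero[OF bump_in_bumps False] bumps_zero[OF b2 False] by simp
      qed
    qed
  qed
  finally show "(LINT x|lborel. g x * ?z x) = 0" .
qed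

text \<open>Two windows that overlap on (pi, 2 pi) give the same affine function for
  \<open>g\<close> also beyond 2 pi. Comparison there with the translate by one period forces slope
  0, and \<open>f\<close> solves f'' + 4 f = A.\<close>

lemma profile_nondegenerate:
  assumes ne: "deg = {}"
  shows "\<exists>a b c. a\<^sup>2 \<noteq> b\<^sup>2 + c\<^sup>2 \<and> (\<forall>x. f x = a + b * cos (2 * x) + c * sin (2 * x))"
proof -
  have nz: "AE x in lborel. x \<in> {a<..<b} \<longrightarrow> f x \<noteq> 0" for a b by (rule nonzero_AE) (simp add: ne)
  obtain A B where AB: "AE x in lborel. x \<in> {0<..<2 * pi} \<longrightarrow> g x = A + B * x"
    using euler_lagrange[OF _ _ nz, of 0 "2 * pi"] by auto
  obtain A' B' where AB': "AE x in lborel. x \<in> {pi<..<3 * pi} \<longrightarrow> g x = A' + B' * x"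
    using euler_lagrange[OF _ _ nz, of pi "3 * pi"] by auto
  have pp: "pi < 2 * pi" "2 * pi < 3 * pi" using pi_gt_zero by linarith+
  have "AE x in lborel. x \<in> {pi<..<2 * pi} \<longrightarrow> A + B * x = A' + B' * x"
    using AB AB' by eventually_elim (use pp in auto)
  from affine_AE_eq[OF this pp(1)] have eq: "A = A'" "B = B'" by auto
  have "AE x in lborel. x + - 2 * pi \<in> {0<..<2 * pi} \<longrightarrow> g (x + - 2 * pi) = A + B * (x + - 2 * pi)"
    using AE_translate[OF AB, of "- 2 * pi"] .
  with AB' have "AE x in lborel. x \<in> {2 * pi<..<3 * pi} \<longrightarrow> A + B * x = (A - 2 * pi * B) + B * x"
  proof eventually_elim
    case (elim x)
    show ?case
    proof
      assume x: "x \<in> {2 * pi<..<3 * pi}"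
      then have "g x = A + B * x" using elim pp eq by auto
      moreover have "g (x + - 2 * pi) = A + B * (x + - 2 * pi)" using elim x pp by auto
      moreover have "g (x + - 2 * pi) = g x" using g_periodic[of "x + - 2 * pi"] by simp
      ultimately show "A + B * x = (A - 2 * pi * B) + B * x" by (simp add: algebra_simps)
    qed
  qed
  from affine_AE_eq[OF this pp(2)] have B: "B = 0" using pi_gt_zero by auto
  define a b c where "a = A / 4" and "b = f 0 - A / 4" and "c = deriv f 0 / 2"
  let ?p = "\<lambda>x. a + b * cos (2 * x) + c * sin (2 * x)" and ?p1 = "\<lambda>x. - 2 * b * sin (2 * x) + 2 * c * cos (2 * x)"
  have sol: "f x = ?p x \<and> deriv f x = ?p1 x" if "x \<in> {0..2 * pi}" for x
  proof (rule ode_unique[of "\<lambda>_. A" 0 "2 * pi" ?p ?p1])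
    show "AE x in lborel. x \<in> {0<..<2 * pi} \<longrightarrow> g x = A" using AB B by simp
    show "(?p has_real_derivative ?p1 x) (at x)" for x by (auto intro!: derivative_eq_intros)
    show "(?p1 has_real_derivative A - 4 * ?p x) (at x)" for x
      by (auto intro!: derivative_eq_intros simp: a_def algebra_simps)
  qed (use that in \<open>auto simp: a_def b_def c_def\<close>)
  have all: "f x = ?p x" for x
  proof -
    define n where "n = \<lfloor>x / (2 * pi)\<rfloor>"
    have r: "x + 2 * pi * of_int (- n) \<in> {0..2 * pi}"
      using floor_divide_lower[of "2 * pi" x] floor_divide_upper[of "2 * pi" x] pi_gt_zero unfolding n_def
      by (simp add: algebra_simps)
    have "?p (x + 2 * pi * of_int (- n)) = ?p x"
    proof (rule periodic_int)
      fix x :: real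
      have "2 * (x + 2 * pi) = 2 * x + 2 * pi + 2 * pi" by simp
      then show "?p (x + 2 * pi) = ?p x" by (simp only: sin_periodic cos_periodic)
    qed
    then show ?thesis using sol[OF r] periodic_int[of f, OF f_periodic, of x "- n"] by simp
  qed
  have d: "deriv f x = ?p1 x" for x
  proof -
    have "(?p has_real_derivative ?p1 x) (at x)" by (auto intro!: derivative_eq_intros)
    moreover have "f = ?p" using all by blast
    ultimately show ?thesis using DERIV_imp_deriv by metis
  qed
  have "a\<^sup>2 \<noteq> b\<^sup>2 + c\<^sup>2"
  proof
    assume e: "a\<^sup>2 = b\<^sup>2 + c\<^sup>2"
    have "\<exists>x. x \<in> deg"
    proof (cases "a = 0")
      case True
      then have "b = 0" "c = 0" using e by (simp_all add: sum_power2_eq_zero_iff)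
      then show ?thesis unfolding deg_def using True all[of 0] d[of 0] by auto
    next
      case False
      have "(- b / a)\<^sup>2 + (- c / a)\<^sup>2 = (b\<^sup>2 + c\<^sup>2) / a\<^sup>2" by (simp add: power_divide add_divide_distrib)
      then have "(- b / a)\<^sup>2 + (- c / a)\<^sup>2 = 1" unfolding e[symmetric] using False by simp
      \<comment> \<open>At the angle t / 2 the oscillating part equals -a and its derivative
        vanishes, so t / 2 would be a common zero.\<close>
      then obtain t where t: "- b / a = cos t" "- c / a = sin t" using sincos_total_2pi_le by blast
      then have t: "cos t = - b / a" "sin t = - c / a" by simp_all
      have "f (t / 2) = (a\<^sup>2 - (b\<^sup>2 + c\<^sup>2)) / a" unfolding all using False by (simp add: t power2_eq_square field_simps)
      moreover have "deriv f (t / 2) = 0" unfolding d by (simp add: t)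
      ultimately show ?thesis unfolding e deg_def by auto
    qed
    then show False using ne by blast
  qed
  then show ?thesis using all by blast
qed

lemma pf_right_angle: "pf A 0 t = A * ((sin t)\<^sup>2 / 2)"
  by (simp add: pf_def cos_double_sin)

lemma profile_degenerate:
  assumes ne: "deg \<noteq> {}" and x0: "f x0 \<noteq> 0"
  shows "\<exists>a. (\<exists>s\<in>{-1, 1}. \<forall>x\<in>{a..<a + 2 * pi}. f x = s * (if x \<le> a + pi then (sin (x - a))\<^sup>2 / 2 else 0)) \<or>
    (\<exists>s\<in>{-1, 1}. \<forall>x\<in>{a..<a + 2 * pi}. f x = s * (1 / 4 * (1 - cos (2 * (x - a)) - 2 / t1 * ((x - a) - sin (2 * (x - a)) / 2)) * indicator {0..t1} (x - a))) \<or>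
    (\<exists>l. \<bar>l\<bar> \<ge> 1 \<and> (\<forall>x\<in>{a..<a + 2 * pi}. f x = l * ((sin (x - a))\<^sup>2 / 2)))"
proof -
  have "x0 \<notin> deg" using x0 by (simp add: deg_def)
  then obtain a b where ab: "a < x0" "x0 < b" "b \<le> a + 2 * pi" "a \<in> deg" "b \<in> deg"
    and nd: "\<And>x. a < x \<Longrightarrow> x < b \<Longrightarrow> x \<notin> deg" using component[OF _ ne] by blast
  have a2: "a + 2 * pi \<in> deg" using ab(4) deg_shift[of a 1] by simp
  have "a < b" using ab by simp
  obtain A B where z: "pf A B (b - a) = 0" "pf1 A B (b - a) = 0"
    and fin: "\<And>t. 0 \<le> t \<Longrightarrow> t \<le> b - a \<Longrightarrow> f (a + t) = pf A B t"
    and gin: "AE x in lborel. x \<in> {a<..<b} \<longrightarrow> g x = A + B * (x - a) \<and> f x \<noteq> 0"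
    and cl: "b - a = pi \<and> B = 0 \<or> b - a = t1 \<and> B = - 2 * A / (b - a)"
    using arc[OF \<open>a < b\<close> ab(3,4,5) nd] by blast
  have len: "pi \<le> b - a" "b - a < 2 * pi" using cl t1_bounds pi_gt_zero by auto
  have fx: "f x = pf A B (x - a)" if "a \<le> x" "x \<le> b" for x using fin[of "x - a"] that by simp
  have ge: "1 \<le> (A + B * (b - a))\<^sup>2"
    using \<open>a < b\<close> len z fin gin by (intro shrink[of _ _ _ a]) auto
  show ?thesis
  proof (cases "\<forall>x. b < x \<longrightarrow> x < a + 2 * pi \<longrightarrow> f x = 0")
    case True
    \<comment> \<open>Half of the complementary gap, so that the stretched arc stays strictly
      shorter than the circle.\<close>
    define r where "r = (a + 2 * pi - b) / 2"
    have r: "0 < r" "(b - a) + r < 2 * pi" using len unfolding r_def by (simp_all add: field_simps)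
    have "AE x in lborel. x \<in> {b<..<a + 2 * pi} \<longrightarrow> g x = 0"
      using True len \<open>a < b\<close> by (intro g_zero) auto
    then have "AE x in lborel. x \<in> {a + (b - a)<..<a + (b - a) + r} \<longrightarrow> f x = 0 \<and> g x = 0"
      by eventually_elim (use True r in auto)
    then have "(A + B * (b - a))\<^sup>2 \<le> 1"
      using \<open>a < b\<close> r z fin gin by (intro stretch[of _ r _ _ a]) auto
    with ge have one: "A + B * (b - a) = 1 \<or> A + B * (b - a) = - 1" by (simp add: power2_eq_1_iff)
    have zero: "f x = 0" if "b < x" "x < a + 2 * pi" for x using True that by blast
    from cl show ?thesis
    proof
      assume c: "b - a = pi \<and> B = 0"
      then have "b = a + pi" by simp
      have "f x = A * (if x \<le> a + pi then (sin (x - a))\<^sup>2 / 2 else 0)" if "x \<in> {a..<a + 2 * pi}" for x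
        using that c fx[of x] zero[of x] pf_right_angle[of A "x - a"] \<open>b = a + pi\<close> by auto
      moreover have "A \<in> {-1, 1}" using one c by auto
      ultimately show ?thesis by blast
    next
      assume c: "b - a = t1 \<and> B = - 2 * A / (b - a)"
      then have b: "b = a + t1" and B: "B = - 2 * A / t1" and t: "t1 > 0" using t1_bounds pi_gt_zero by auto
      have "f x = - (- A) * (1 / 4 * (1 - cos (2 * (x - a)) - 2 / t1 * ((x - a) - sin (2 * (x - a)) / 2)) * indicator {0..t1} (x - a))"
        if x: "x \<in> {a..<a + 2 * pi}" for x
      proof (cases "x \<le> b")
        case True
        have "pf A B t = A * (1 / 4 * (1 - cos (2 * t) - 2 / t1 * (t - sin (2 * t) / 2)))" for t
          unfolding pf_def B using t by (simp add: field_simps)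
        then show ?thesis using fx[of x] x b True by (auto simp: indicator_def)
      next
        case False
        then show ?thesis using zero[of x] x b by (auto simp: indicator_def)
      qed
      then have "\<forall>x\<in>{a..<a + 2 * pi}. f x = A * (1 / 4 * (1 - cos (2 * (x - a)) - 2 / t1 * ((x - a) - sin (2 * (x - a)) / 2)) * indicator {0..t1} (x - a))"
        by simp
      \<comment> \<open>Hence A + B t1 = -A, and the condition on the end value says that A is 1 or
        -1.\<close>
      moreover have "B * (b - a) = - 2 * A" using t unfolding b B by simp
      then have "A \<in> {-1, 1}" using one by auto
      ultimately show ?thesis by blast
    qed
  next
    case False
    then obtain x1 where x1: "b < x1" "x1 < a + 2 * pi" "f x1 \<noteq> 0" by blast
    then have "x1 \<notin> deg" by (simp add: deg_def)
    then obtain a' b' where ab': "a' < x1" "x1 < b'" "b' \<le> a' + 2 * pi" "a' \<in> deg" "b' \<in> deg"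
      and nd': "\<And>x. a' < x \<Longrightarrow> x < b' \<Longrightarrow> x \<notin> deg" using component[OF _ ne] by blast
    \<comment> \<open>Both b and a + 2 pi are common zeros, so neither lies inside the second arc,
      which contains the point \<open>x1\<close> between them.\<close>
    have le: "b \<le> a'" "b' \<le> a + 2 * pi" using nd'[of b] nd'[of "a + 2 * pi"] ab(5) a2 x1 ab' by (force, force)
    have "a' < b'" using ab' by simp
    obtain A' B' where fin': "\<And>t. 0 \<le> t \<Longrightarrow> t \<le> b' - a' \<Longrightarrow> f (a' + t) = pf A' B' t"
      and gin': "AE x in lborel. x \<in> {a'<..<b'} \<longrightarrow> g x = A' + B' * (x - a') \<and> f x \<noteq> 0"
      and cl': "b' - a' = pi \<and> B' = 0 \<or> b' - a' = t1 \<and> B' = - 2 * A' / (b' - a')"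
      using arc[OF \<open>a' < b'\<close> ab'(3,4,5) nd'] by blast
    have len': "pi \<le> b' - a'" using cl' t1_bounds by auto
    \<comment> \<open>Two arcs of length at least pi inside an interval of length 2 pi must have
      length exactly pi and fill it.\<close>
    have e: "b = a + pi" "a' = a + pi" "b' = a + 2 * pi" using le len len' by linarith+
    have B0: "B = 0" "B' = 0" using cl cl' t1_bounds unfolding e by auto
    have pp: "a < a + pi" "a + pi < a + 2 * pi" using pi_gt_zero by linarith+
    have nz: "AE x in lborel. x \<in> {a<..<a + 2 * pi} \<longrightarrow> f x \<noteq> 0"
      using gin gin' AE_lborel_singleton[of "a + pi"] unfolding e by eventually_elim auto
    obtain C D where CD: "AE x in lborel. x \<in> {a<..<a + 2 * pi} \<longrightarrow> g x = C + D * x"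
      using euler_lagrange[OF _ _ nz] pp by auto
    \<comment> \<open>On the full circle \<open>g\<close> is one affine function; it is constant on
      the first half, hence on the second half with the same constant.\<close>
    have "AE x in lborel. x \<in> {a<..<a + pi} \<longrightarrow> A + 0 * x = C + D * x"
      using CD gin unfolding e B0 by eventually_elim (use pp in auto)
    from affine_AE_eq[OF this pp(1)] have 1: "A = C" "D = 0" by auto
    have "AE x in lborel. x \<in> {a + pi<..<a + 2 * pi} \<longrightarrow> A' + 0 * x = C + D * x"
      using CD gin' unfolding e B0 by eventually_elim (use pp in auto)
    from affine_AE_eq[OF this pp(2)] have AA: "A' = A" using 1 by auto
    have "f x = A * ((sin (x - a))\<^sup>2 / 2)" if x: "x \<in> {a..<a + 2 * pi}" for x
    proof (cases "x \<le> b")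
      case True
      then show ?thesis using fx[of x] x pf_right_angle[of A "x - a"] B0 by auto
    next
      case False
      have s: "sin (x - (a + pi)) = - sin (x - a)" using sin_periodic_pi[of "x - (a + pi)"] by (simp add: algebra_simps)
      show ?thesis using fin'[of "x - a'"] x False pf_right_angle[of A "x - (a + pi)"] unfolding e B0 AA by (simp add: s)
    qed
    moreover have "\<bar>A\<bar> \<ge> 1" using ge B0 by (simp add: abs_le_square_iff[of 1 A, simplified])
    ultimately show ?thesis by blast
  qed
qed

end

section \<open>From angular profiles to the four types\<close>

definition rotation :: "real \<Rightarrow> real^2^2" where
  "rotation a = vector [vector [cos a, sin a], vector [- sin a, cos a]]"

lemma rotation_nth: "(rotation a *v x) $ 1 = cos a * x $ 1 + sin a * x $ 2" "(rotation a *v x) $ 2 = cos a * x $ 2 - sin a * x $ 1"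
  by (simp_all add: rotation_def matrix_vector_mult_def sum_2)

lemma rotation_matrix_rotation: "rotation_matrix (rotation a)"
proof -
  have "orthogonal_matrix (rotation a)"
    unfolding orthogonal_matrix_def rotation_def matrix_matrix_mult_def transpose_def mat_def
    by (simp add: vec_eq_iff forall_2 sum_2 power2_eq_square[symmetric] mult.commute)
  moreover have "det (rotation a) = 1"
    by (simp add: det_2 rotation_def power2_eq_square[symmetric])
  ultimately show ?thesis by (simp add: rotation_matrix_def)
qed

lemma polar_coordinates:
  assumes "x \<noteq> 0"
  shows "x $ 1 = norm x * cos (ang a x)" "x $ 2 = norm x * sin (ang a x)"
proof -
  have "x = logpolar (chart a x)" using logpolar_chart[OF assms] by simp
  then have "x $ 1 = logpolar (chart a x) $ 1" "x $ 2 = logpolar (chart a x) $ 2" by simp_all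
  then show "x $ 1 = norm x * cos (ang a x)" "x $ 2 = norm x * sin (ang a x)"
    using assms by (simp_all add: chart_def)
qed

lemma rotation_polar:
  assumes "x \<noteq> 0"
  shows "(rotation a *v x) $ 1 = norm x * cos (ang a x - a)" "(rotation a *v x) $ 2 = norm x * sin (ang a x - a)"
  using polar_coordinates[OF assms, of a] unfolding rotation_nth cos_diff sin_diff
  by (simp_all only: distrib_left right_diff_distrib mult.assoc mult.left_commute mult.commute)

text \<open>The rotation is by -a: it carries the ray of direction a to the positive first axis, so
  that \<open>Arg2pi\<close> counts the angle from the start of the arc.\<close>

lemma rotation_angle: "Arg2pi (Complex ((rotation a *v x) $ 1) ((rotation a *v x) $ 2)) = ang a x - a"
proof -
  have "Complex ((rotation a *v x) $ 1) ((rotation a *v x) $ 2) = cis (- a) * Complex (x $ 1) (x $ 2)"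
    unfolding rotation_nth by (simp add: complex_eq_iff)
  then show ?thesis by (simp add: ang_def)
qed

lemma rotation_norm: "(norm (rotation a *v x))\<^sup>2 = (norm x)\<^sup>2"
proof -
  have n: "(norm y)\<^sup>2 = (y $ 1)\<^sup>2 + (y $ 2)\<^sup>2" for y :: "real^2"
    unfolding power2_norm_eq_inner by (simp add: inner_vec_def sum_2 power2_eq_square)
  have "(norm (rotation a *v x))\<^sup>2 = ((cos a)\<^sup>2 + (sin a)\<^sup>2) * ((x $ 1)\<^sup>2 + (x $ 2)\<^sup>2)"
    unfolding n rotation_nth by (simp only: power2_eq_square algebra_simps)
  then show ?thesis unfolding n by simp
qed

lemma u_I_polar:
  assumes "x \<noteq> 0"
  shows "u_I (rotation a *v x) = (norm x)\<^sup>2 * (if ang a x \<le> a + pi then (sin (ang a x - a))\<^sup>2 / 2 else 0)"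
proof (cases "ang a x \<le> a + pi")
  case True
  then have "0 \<le> sin (ang a x - a)" using ang_range(1)[of a x] by (intro sin_ge_zero) auto
  then have "max (norm x * sin (ang a x - a)) 0 = norm x * sin (ang a x - a)" by simp
  then show ?thesis unfolding u_I_def rotation_polar[OF assms] using True by (simp add: power_mult_distrib)
next
  case False
  then have "sin (ang a x - a) \<le> 0" using ang_range(2)[of a x] by (intro sin_le_zero) auto
  then have "norm x * sin (ang a x - a) \<le> 0" by (simp add: mult_nonneg_nonpos)
  then show ?thesis unfolding u_I_def rotation_polar[OF assms] using False by (simp add: max_absorb2)
qed

lemma u_II_polar:
  "u_II (rotation a *v x) = (norm x)\<^sup>2 * (1 / 4 * (1 - cos (2 * (ang a x - a)) - 2 / t1 * ((ang a x - a) - sin (2 * (ang a x - a)) / 2)) * indicator {0..t1} (ang a x - a))"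
  unfolding u_II_def Let_def rotation_angle rotation_norm by (simp only: times_divide_eq_right times_divide_eq_left mult.assoc mult_1 mult_1_right)

lemma u_III_polar: "x \<noteq> 0 \<Longrightarrow> u_III (rotation a *v x) = (norm x)\<^sup>2 * ((sin (ang a x - a))\<^sup>2 / 2)"
  unfolding u_III_def rotation_polar by (simp add: power_mult_distrib)

lemma quadratic_polar:
  assumes "x \<noteq> 0"
  shows "a * ((x $ 1)\<^sup>2 + (x $ 2)\<^sup>2) + b * ((x $ 1)\<^sup>2 - (x $ 2)\<^sup>2) + 2 * c * (x $ 1) * (x $ 2) =
    (norm x)\<^sup>2 * (a + b * cos (2 * ang \<alpha> x) + c * sin (2 * ang \<alpha> x))"
proof -
  have "a * ((r * p)\<^sup>2 + (r * q)\<^sup>2) + b * ((r * p)\<^sup>2 - (r * q)\<^sup>2) + 2 * c * (r * p) * (r * q) =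
    r\<^sup>2 * (a * (q\<^sup>2 + p\<^sup>2) + b * (p\<^sup>2 - q\<^sup>2) + c * (2 * q * p))" for r p q :: real
    by (simp add: power2_eq_square algebra_simps)
  then show ?thesis unfolding polar_coordinates[OF assms, of \<alpha>] cos_double sin_double by (simp add: power_mult_distrib)
qed

text \<open>Equality of \<open>F\<close> and \<open>f\<close> for almost every angle becomes
  equality almost everywhere in the disc by Fubini and the chart. The origin is excluded here
  because it has no polar coordinates.\<close>

lemma (in homogeneous_minimizer) u_profile:
  "AE x in lebesgue_on disc. x \<noteq> 0 \<and> u x = (norm x)\<^sup>2 * f (ang \<alpha> x)"
proof -
  have "AE p in lborel. p \<in> strip \<alpha> \<longrightarrow> F (snd p) = f (snd p)" using AE_snd[OF f(5)] by eventually_elim simp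
  then have "AE x in lborel. x \<in> disc \<longrightarrow> F (snd (chart \<alpha> x)) = f (snd (chart \<alpha> x))" by (rule AE_strip_imp_ball)
  then have "AE x in lborel. x \<noteq> 0 \<and> (x \<in> disc \<longrightarrow> F (ang \<alpha> x) = f (ang \<alpha> x))"
    using AE_lborel_singleton[of "0 :: real^2"] by eventually_elim (simp add: chart_def)
  then have "AE x in lebesgue. x \<noteq> 0 \<and> (x \<in> disc \<longrightarrow> F (ang \<alpha> x) = f (ang \<alpha> x))" by (rule AE_completion)
  then have "AE x in lebesgue. x \<in> disc \<longrightarrow> x \<noteq> 0 \<and> u x = (norm x)\<^sup>2 * f (ang \<alpha> x)"
    using u_polar[of \<alpha>] by eventually_elim auto
  then show ?thesis by (subst AE_restrict_space_iff) auto
qed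

theorem proposition25:
  fixes u :: "real^2 \<Rightarrow> real"
  assumes "u \<in> minimizers (ball 0 1)"
    and "\<not> (AE x in lebesgue_on (ball 0 1). u x = 0)"
    and "two_homogeneous u"
  shows "(\<exists>s\<in>{-1, 1}. \<exists>Q. rotation_matrix Q \<and>
            (AE x in lebesgue_on (ball 0 1). u x = s * u_I (Q *v x))) \<or>
         (\<exists>s\<in>{-1, 1}. \<exists>Q. rotation_matrix Q \<and>
            (AE x in lebesgue_on (ball 0 1). u x = s * u_II (Q *v x))) \<or>
         (\<exists>l. \<bar>l\<bar> \<ge> 1 \<and> (\<exists>Q. rotation_matrix Q \<and>
            (AE x in lebesgue_on (ball 0 1). u x = l * u_III (Q *v x)))) \<or>
         (\<exists>a b c. a\<^sup>2 \<noteq> b\<^sup>2 + c\<^sup>2 \<and>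
            (AE x in lebesgue_on (ball 0 1).
               u x = a * ((x $ 1)\<^sup>2 + (x $ 2)\<^sup>2) + b * ((x $ 1)\<^sup>2 - (x $ 2)\<^sup>2) + 2 * c * (x $ 1) * (x $ 2)))"
proof -
  interpret H: homogeneous_minimizer u by unfold_locales fact+
  have "\<exists>x. H.f x \<noteq> 0"
  proof (rule ccontr)
    assume "\<not> ?thesis"
    then have "AE x in lebesgue_on (ball 0 1). u x = 0" using H.u_profile[of 0] by (auto elim!: eventually_mono)
    then show False using assms(2) by contradiction
  qed
  then obtain x0 where x0: "H.f x0 \<noteq> 0" ..
  \<comment> \<open>With the cut at a, angles range over exactly the period on which the profile is
    described.\<close>
  have arg: "ang a x \<in> {a..<a + 2 * pi}" for a x using ang_range[of a x] by simp
  show ?thesis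
  proof (cases "H.deg = {}")
    case True
    then obtain a b c where abc: "a\<^sup>2 \<noteq> b\<^sup>2 + c\<^sup>2" "\<And>x. H.f x = a + b * cos (2 * x) + c * sin (2 * x)"
      using H.profile_nondegenerate by blast
    have "AE x in lebesgue_on (ball 0 1). u x = a * ((x $ 1)\<^sup>2 + (x $ 2)\<^sup>2) + b * ((x $ 1)\<^sup>2 - (x $ 2)\<^sup>2) + 2 * c * (x $ 1) * (x $ 2)"
      using H.u_profile[of 0]
    proof eventually_elim
      case (elim x)
      then show ?case using quadratic_polar[of x a b c 0] abc(2) by simp
    qed
    then show ?thesis using abc(1) by blast
  next
    case False
    note profile = H.profile_degenerate[OF False x0]
    obtain a where "(\<exists>s\<in>{-1, 1}. \<forall>x\<in>{a..<a + 2 * pi}. H.f x = s * (if x \<le> a + pi then (sin (x - a))\<^sup>2 / 2 else 0)) \<or>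
    (\<exists>s\<in>{-1, 1}. \<forall>x\<in>{a..<a + 2 * pi}. H.f x = s * (1 / 4 * (1 - cos (2 * (x - a)) - 2 / t1 * ((x - a) - sin (2 * (x - a)) / 2)) * indicator {0..t1} (x - a))) \<or>
    (\<exists>l. \<bar>l\<bar> \<ge> 1 \<and> (\<forall>x\<in>{a..<a + 2 * pi}. H.f x = l * ((sin (x - a))\<^sup>2 / 2)))"
      using profile by (elim exE)
    then show ?thesis
    proof (elim disjE bexE exE conjE)
      fix s :: real assume s: "s \<in> {-1, 1}" "\<forall>x\<in>{a..<a + 2 * pi}. H.f x = s * (if x \<le> a + pi then (sin (x - a))\<^sup>2 / 2 else 0)"
      have "AE x in lebesgue_on (ball 0 1). u x = s * u_I (rotation a *v x)"
        using H.u_profile[of a]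
      proof eventually_elim
        case (elim x)
        then show ?case using bspec[OF s(2) arg[of a x]] u_I_polar[of x a] by simp
      qed
      then show ?thesis using s(1) rotation_matrix_rotation by blast
    next
      fix s :: real assume s: "s \<in> {-1, 1}" "\<forall>x\<in>{a..<a + 2 * pi}. H.f x = s * (1 / 4 * (1 - cos (2 * (x - a)) - 2 / t1 * ((x - a) - sin (2 * (x - a)) / 2)) * indicator {0..t1} (x - a))"
      have "AE x in lebesgue_on (ball 0 1). u x = s * u_II (rotation a *v x)"
        using H.u_profile[of a]
      proof eventually_elim
        case (elim x)
        have "u x = (norm x)\<^sup>2 * H.f (ang a x)" using elim by blast
        then show ?case unfolding bspec[OF s(2) arg[of a x]] u_II_polar by (simp only: mult.left_commute)
      qed
      then show ?thesis using s(1) rotation_matrix_rotation by blast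
    next
      fix l :: real assume l: "\<bar>l\<bar> \<ge> 1" "\<forall>x\<in>{a..<a + 2 * pi}. H.f x = l * ((sin (x - a))\<^sup>2 / 2)"
      have "AE x in lebesgue_on (ball 0 1). u x = l * u_III (rotation a *v x)"
        using H.u_profile[of a]
      proof eventually_elim
        case (elim x)
        then have "x \<noteq> 0" "u x = (norm x)\<^sup>2 * H.f (ang a x)" by blast+
        then show ?case unfolding bspec[OF l(2) arg[of a x]] unfolding u_III_polar[OF \<open>x \<noteq> 0\<close>] by (simp only: mult.left_commute)
      qed
      then show ?thesis using l(1) rotation_matrix_rotation by blast
    qed
  qed
qed

end
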